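(* For all integers $r,a\ge 2$ and every sequence of $a$-arrangeable graphs $\mathcal{F}=\{F_1,F_2,\ldots\}$ with $|V(F_n)|=n$ and $\Delta(F_n)\le\sqrt{n}/\log(n)$ for all $n\in\mathbb{N}$, we have $\tau_r(\mathcal{F})<\infty$.
   Context: A graph is $a$-arrangeable if its vertices can be ordered so that for every vertex $v$ there are at most $a$ vertices to the left of $v$ that have a common neighbour with $v$ lying to the right of $v$. $\Delta(F)$ is the maximum degree. For a sequence of graphs $\mathcal{F}$ (with $F_i$ on $i$ vertices), an $\mathcal{F}$-tiling of a graph $G$ is a collection of vertex-disjoint subgraphs of $G$, each a copy of some graph in $\mathcal{F}$, whose vertex sets cover $V(G)$; in an edge-coloured graph it is monochromatic if each member is monochromatic. $\tau_r(\mathcal{F},n)$ is the minimum $t$ such that every $r$-edge-colouring of $K_n$ admits a monochromatic $\mathcal{F}$-tiling with at most $t$ members, and $\tau_r(\mathcal{F})=\sup_n\tau_r(\mathcal{F},n)$. *)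

theory Defs
  imports Complex_Main "HOL-Library.Extended_Nat" "Graph_Theory.Graph_Theory"
begin

text \<open>
  A finite simple graph is a \<^locale>\<open>pair_graph\<close>, i.e. a finite loopless symmetric digraph
  without parallel arcs; the undirected edge \<open>{u, v}\<close> is represented by the two arcs
  \<open>(u, v)\<close> and \<open>(v, u)\<close>.
\<close>

text \<open>In a symmetric digraph the out-degree is the undirected degree.\<close>

definition max_degree :: "'a pair_pre_digraph \<Rightarrow> nat" where
  "max_degree G = Max (out_degree (with_proj G) ` pverts G)"

text \<open>The list \<open>xs\<close> is the vertex ordering, from left to right.\<close>

definition arrangeable :: "nat \<Rightarrow> 'a pair_pre_digraph \<Rightarrow> bool" where
  "arrangeable a G \<longleftrightarrow>
    (\<exists>xs. distinct xs \<and> set xs = pverts G \<and>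
      (\<forall>i < length xs.
        card {j. j < i \<and> (\<exists>k. i < k \<and> k < length xs \<and>
                 (xs ! i, xs ! k) \<in> parcs G \<and> (xs ! j, xs ! k) \<in> parcs G)} \<le> a))"

text \<open>Colourings are functions on unordered pairs, so both arcs of an edge get the same colour.\<close>

definition edge_colouring :: "nat \<Rightarrow> 'a pair_pre_digraph \<Rightarrow> ('a set \<Rightarrow> nat) \<Rightarrow> bool" where
  "edge_colouring r G c \<longleftrightarrow> (\<forall>(u, v) \<in> parcs G. c {u, v} \<in> {1..r})"

definition monochromatic :: "('a set \<Rightarrow> nat) \<Rightarrow> 'a pair_pre_digraph \<Rightarrow> bool" where
  "monochromatic c H \<longleftrightarrow> (\<exists>k. \<forall>(u, v) \<in> parcs H. c {u, v} = k)"

text \<open>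
  A sequence of graphs \<open>F 1, F 2, \<dots>\<close> is indexed from 1; the value \<open>F 0\<close> is never used.
\<close>

definition tiling ::
  "(nat \<Rightarrow> 'a pair_pre_digraph) \<Rightarrow> 'b pair_pre_digraph \<Rightarrow> 'b pair_pre_digraph set \<Rightarrow> bool" where
  "tiling F G T \<longleftrightarrow>
    (\<forall>H \<in> T. subgraph (with_proj H) (with_proj G) \<and>
      (\<exists>i \<ge> 1. digraph_iso (with_proj (F i)) (with_proj H))) \<and>
    pairwise (\<lambda>H H'. disjnt (pverts H) (pverts H')) T \<and>
    (\<Union>H \<in> T. pverts H) = pverts G"

text \<open>
  The minimum is taken in \<^typ>\<open>enat\<close>, where the infimum of the empty set is \<open>\<infinity>\<close>.
\<close>

definition tiling_number_at :: "nat \<Rightarrow> (nat \<Rightarrow> 'a pair_pre_digraph) \<Rightarrow> nat \<Rightarrow> enat" where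
  "tiling_number_at r F n =
    Inf {enat t | t. \<forall>(G :: nat pair_pre_digraph) c.
      complete_digraph n (with_proj G) \<and> edge_colouring r G c \<longrightarrow>
      (\<exists>T. tiling F G T \<and> (\<forall>H \<in> T. monochromatic c H) \<and> finite T \<and> card T \<le> t)}"

definition tiling_number :: "nat \<Rightarrow> (nat \<Rightarrow> 'a pair_pre_digraph) \<Rightarrow> enat" where
  "tiling_number r F = (SUP n \<in> {1..}. tiling_number_at r F n)"

end

theory Submission
  imports Defs "HOL-Library.Ramsey"
begin

text \<open>
  The theorem rests on two facts about \<^emph>\<open>lower quasirandom\<close> host graphs, in which every linear-sized
  set \<open>C\<close> has only few vertices of relative degree below \<open>d\<close> into \<open>C\<close>.

  \<^emph>\<open>Spanning embedding.\<close> A lower quasirandom graph of linear minimum degree contains every spanning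
  \<open>a\<close>-arrangeable graph of maximum degree at most \<open>sqrt n / ln n\<close>. The few vertices of large degree
  are embedded first, in the arrangeable order, then the neighbours of an independent buffer of
  vertices of bounded degree, then everything else but the buffer; Hall's theorem places the buffer.
  A random choice at each step would keep all relevant quantities concentrated, since the degree
  condition makes the sum of squares of the step sizes of the martingales of smaller order than
  \<open>n^2 / ln n\<close>. Choosing instead a vertex that does not increase the corresponding exponential
  moment removes all probability.

  \<^emph>\<open>Covering.\<close> By induction on \<open>q\<close>, boundedly many tiles cover all vertices but a robust tile \<open>W\<close>,
  which stays a tile after deleting a small fraction, and a much smaller set \<open>R\<close> that sends few edges
  to \<open>W\<close> in some set of \<open>q\<close> colours. For the step, iterate the claim inside the leftover sets until
  many of the robust tiles come with the same set of \<open>q\<close> colours. Samples of these have few edges of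
  such colours between them, so an energy increment argument together with Ramsey's theorem finds a
  lower quasirandom set in a further colour; leftover vertices of large degree to it in that colour
  are absorbed. For \<open>q = r\<close> the set \<open>R\<close> is empty.
\<close>

section \<open>Hall's theorem and counting of random subsets\<close>

text \<open>An exponential moment controls only polynomially many quantities at once: with a step
  parameter \<open>\<mu>\<close> of order \<open>ln N / N\<close>, the budget
  \<open>\<mu> * \<epsilon> * N\<close> is a constant times \<open>ln N\<close>. Hall's condition,
  and the supply of free candidates before it, concern every large set \<open>B\<close> of host
  vertices, and there are exponentially many. Hence the quantities followed belong to lists of
  \<open>s\<close> host vertices: how many guest vertices have a candidate set missing the list. A
  guest vertex with few candidates in \<open>B\<close> is missed by an unusually large share of the
  lists over \<open>B\<close>, so averaging over these lists transfers the bound to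
  \<open>B\<close>. Arrangeability matters for the hubs: they have many neighbours, but these
  present only boundedly many distinct candidate sets. In the covering, the constants are such that
  a colour dense between two samples cannot belong to the colour set found before, so
  \<open>q\<close> really grows. Robustness pays for this: the samples are cut out of tiles that
  must remain tiles.\<close>

lemma Hall_marriage:
  assumes "finite I" "\<And>i. i \<in> I \<Longrightarrow> finite (A i)"
    and "\<And>J. J \<subseteq> I \<Longrightarrow> card J \<le> card (\<Union>(A ` J))"
  shows "\<exists>f. inj_on f I \<and> (\<forall>i\<in>I. f i \<in> A i)"
  using assms
proof (induction I arbitrary: A rule: finite_psubset_induct)
  case (psubset I)
  note finA = psubset.prems(1) and hall = psubset.prems(2)
  show ?case
  proof (cases "\<exists>J. J \<subset> I \<and> J \<noteq> {} \<and> card J = card (\<Union>(A ` J))")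
    case True
    then obtain J where J: "J \<subset> I" "J \<noteq> {}" "card J = card (\<Union>(A ` J))" by blast
    have finJ: "finite J" using J(1) psubset.hyps finite_subset by blast
    have "\<exists>f. inj_on f J \<and> (\<forall>i\<in>J. f i \<in> A i)"
      by (rule psubset.IH[OF J(1)]) (use finA hall J(1) in blast)+
    then obtain f where f: "inj_on f J" "\<forall>i\<in>J. f i \<in> A i" by blast
    \<comment> \<open>A tight \<open>J\<close> uses up exactly \<open>U\<close>. For
      \<open>L\<close> outside \<open>J\<close>, Hall's condition for \<open>L \<union> J\<close>
      minus the equality for \<open>J\<close> is Hall's condition for the sets
      \<open>A i - U\<close>.\<close>
    define U where "U = \<Union>(A ` J)"
    have finU: "finite U" unfolding U_def using finJ finA J(1) by blast
    have "\<exists>g. inj_on g (I - J) \<and> (\<forall>i\<in>I - J. g i \<in> A i - U)"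
    proof (rule psubset.IH)
      show "I - J \<subset> I" using J by blast
      show "finite (A i - U)" if "i \<in> I - J" for i using finA that by auto
      show "card L \<le> card (\<Union>i\<in>L. A i - U)" if L: "L \<subseteq> I - J" for L
      proof -
        have finL: "finite L" using L psubset.hyps finite_subset by blast
        have finAL: "finite (\<Union>(A ` L))" using finL finA L by blast
        have "card (L \<union> J) \<le> card (\<Union>(A ` (L \<union> J)))" using hall L J(1) by (meson Diff_subset Un_least psubsetE subset_trans)
        also have "\<Union>(A ` (L \<union> J)) = (\<Union>i\<in>L. A i - U) \<union> U" unfolding U_def by auto
        also have "card \<dots> \<le> card (\<Union>i\<in>L. A i - U) + card U" by (rule card_Un_le)
        finally have "card (L \<union> J) \<le> card (\<Union>i\<in>L. A i - U) + card U" .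
        moreover have "card (L \<union> J) = card L + card J"
          using L finL finJ by (intro card_Un_disjoint) auto
        ultimately show ?thesis using J(3) U_def by simp
      qed
    qed
    then obtain g where g: "inj_on g (I - J)" "\<forall>i\<in>I - J. g i \<in> A i - U" by blast
    define h where "h = (\<lambda>i. if i \<in> J then f i else g i)"
    have "inj_on h I"
    proof (rule inj_onI)
      fix x y assume xy: "x \<in> I" "y \<in> I" "h x = h y"
      have fU: "f i \<in> U" if "i \<in> J" for i using f(2) that U_def by blast
      have gU: "g i \<notin> U" if "i \<in> I - J" for i using g(2) that by blast
      show "x = y"
      proof (cases "x \<in> J"; cases "y \<in> J")
        assume "x \<in> J" "y \<in> J" then show ?thesis using xy f(1) by (auto simp: h_def dest: inj_onD)
      next
        assume "x \<in> J" "y \<notin> J" then show ?thesis using xy fU[of x] gU[of y] by (auto simp: h_def)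
      next
        assume "x \<notin> J" "y \<in> J" then show ?thesis using xy fU[of y] gU[of x] by (auto simp: h_def)
      next
        assume "x \<notin> J" "y \<notin> J" then show ?thesis using xy g(1) by (auto simp: h_def dest: inj_onD)
      qed
    qed
    moreover have "\<forall>i\<in>I. h i \<in> A i" using f(2) g(2) J(1) by (auto simp: h_def)
    ultimately show ?thesis by blast
  next
    case False
    show ?thesis
    proof (cases "I = {}")
      case True then show ?thesis by auto
    next
      case ne: False
      then obtain i where i: "i \<in> I" by blast
      have "card {i} \<le> card (\<Union>(A ` {i}))" using hall[of "{i}"] i by simp
      then have "A i \<noteq> {}" by auto
      then obtain a where a: "a \<in> A i" by blast
      \<comment> \<open>Without a tight proper subset, every nonempty proper \<open>L\<close> has an
        element to spare, so \<open>a\<close> can be spent on \<open>i\<close>.\<close>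
      have "\<exists>g. inj_on g (I - {i}) \<and> (\<forall>j\<in>I - {i}. g j \<in> A j - {a})"
      proof (rule psubset.IH)
        show "I - {i} \<subset> I" using i by blast
        show "finite (A j - {a})" if "j \<in> I - {i}" for j using finA that by auto
        show "card L \<le> card (\<Union>j\<in>L. A j - {a})" if L: "L \<subseteq> I - {i}" for L
        proof (cases "L = {}")
          case False
          have finL: "finite L" using L psubset.hyps finite_subset by blast
          have "L \<subset> I" using L i by blast
          then have "card L \<noteq> card (\<Union>(A ` L))" using \<open>\<nexists>J. _ J\<close> False by blast
          then have "card L < card (\<Union>(A ` L))" using hall[of L] \<open>L \<subset> I\<close> by (simp add: order_less_le psubset_imp_subset)
          moreover have "card (\<Union>(A ` L)) - 1 \<le> card (\<Union>(A ` L) - {a})" 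
            by (metis card_Diff_singleton_if diff_le_self order_refl)
          moreover have "(\<Union>j\<in>L. A j - {a}) = \<Union>(A ` L) - {a}" by auto
          ultimately show ?thesis by simp
        qed simp
      qed
      then obtain g where g: "inj_on g (I - {i})" "\<forall>j\<in>I - {i}. g j \<in> A j - {a}" by blast
      have "inj_on (g(i := a)) I"
        using g by (auto simp: inj_on_def)
      moreover have "\<forall>j\<in>I. (g(i := a)) j \<in> A j" using g a by auto
      ultimately show ?thesis by blast
    qed
  qed
qed

section \<open>Lower tail for a uniformly random subset\<close>

lemma sum_pow_card_Int:
  fixes y :: real
  assumes "finite V" "D \<subseteq> V"
  shows "(\<Sum>S\<in>Pow V. y ^ card (S \<inter> D)) = (1 + y) ^ card D * 2 ^ (card V - card D)"
  using assms
proof (induction V arbitrary: D rule: finite_induct)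
  case empty then show ?case by simp
next
  case (insert x V)
  have disj: "Pow V \<inter> insert x ` Pow V = {}" using insert.hyps by auto
  have inj: "inj_on (insert x) (Pow V)" using insert.hyps by (intro inj_onI) (auto simp: insert_eq_iff)
  have split: "(\<Sum>S\<in>Pow (insert x V). y ^ card (S \<inter> D)) =
      (\<Sum>S\<in>Pow V. y ^ card (S \<inter> D)) + (\<Sum>S\<in>Pow V. y ^ card (insert x S \<inter> D))"
    unfolding Pow_insert using disj insert.hyps inj by (subst sum.union_disjoint) (auto simp: sum.reindex)
  show ?case
  proof (cases "x \<in> D")
    case True
    define D' where "D' = D - {x}"
    have D': "D' \<subseteq> V" "D = insert x D'" "x \<notin> D'" using insert.prems True D'_def by auto
    have finD': "finite D'" using D' insert.hyps finite_subset by blast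
    have 1: "S \<inter> D = S \<inter> D'" if "S \<in> Pow V" for S using that D' insert.hyps by auto
    have 2: "card (insert x S \<inter> D) = Suc (card (S \<inter> D'))" if "S \<in> Pow V" for S
    proof -
      have "insert x S \<inter> D = insert x (S \<inter> D')" using D' by auto
      moreover have "finite (S \<inter> D')" "x \<notin> S \<inter> D'" using finD' D' by auto
      ultimately show ?thesis by simp
    qed
    have "(\<Sum>S\<in>Pow (insert x V). y ^ card (S \<inter> D)) = (1 + y) * (\<Sum>S\<in>Pow V. y ^ card (S \<inter> D'))"
    proof -
      have "(\<Sum>S\<in>Pow V. y ^ card (S \<inter> D)) = (\<Sum>S\<in>Pow V. y ^ card (S \<inter> D'))"
        by (rule sum.cong[OF refl]) (simp only: 1)
      moreover have "(\<Sum>S\<in>Pow V. y ^ card (insert x S \<inter> D)) = y * (\<Sum>S\<in>Pow V. y ^ card (S \<inter> D'))"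
        unfolding sum_distrib_left by (rule sum.cong[OF refl]) (simp only: 2 power_Suc)
      ultimately show ?thesis unfolding split by (simp add: algebra_simps)
    qed
    also have "\<dots> = (1 + y) ^ card D * 2 ^ (card (insert x V) - card D)"
      using insert.IH[OF D'(1)] D' finD' insert.hyps by simp
    finally show ?thesis .
  next
    case False
    then have D: "D \<subseteq> V" using insert.prems by auto
    have cle: "card D \<le> card V" using D insert.hyps card_mono by blast
    have "insert x S \<inter> D = S \<inter> D" for S using False by auto
    then have "(\<Sum>S\<in>Pow (insert x V). y ^ card (S \<inter> D)) = 2 * (\<Sum>S\<in>Pow V. y ^ card (S \<inter> D))"
      unfolding split by simp
    also have "\<dots> = (1 + y) ^ card D * 2 ^ (card (insert x V) - card D)"
      using insert.IH[OF D] insert.hyps cle by (simp add: Suc_diff_le)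
    finally show ?thesis .
  qed
qed

text \<open>Markov's inequality for \<open>(1 / 4) ^ card (S \<inter> D)\<close>: the share of bad
  \<open>S\<close> is at most \<open>(5 / 8) ^ card D * 4 ^ j\<close>. As
  \<open>4 \<le> (32 / 25) ^ 8\<close>, the factor \<open>4 ^ j\<close> is at most
  \<open>(32 / 25) ^ card D\<close>, and \<open>5 / 8 * 32 / 25 = 4 / 5\<close>.\<close>

lemma card_small_intersections:
  assumes "finite V" "D \<subseteq> V" "8 * j \<le> card D"
  shows "real (card {S \<in> Pow V. card (S \<inter> D) \<le> j}) \<le> 2 ^ card V * (4 / 5) ^ card D"
proof -
  let ?B = "{S \<in> Pow V. card (S \<inter> D) \<le> j}"
  have cD: "card D \<le> card V" using assms card_mono by blast
  have "real (card ?B) * (1/4) ^ j = (\<Sum>S\<in>?B. (1/4::real) ^ j)" by simp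
  also have "\<dots> \<le> (\<Sum>S\<in>?B. (1/4) ^ card (S \<inter> D))"
    by (intro sum_mono power_decreasing) auto
  also have "\<dots> \<le> (\<Sum>S\<in>Pow V. (1/4) ^ card (S \<inter> D))"
    using assms(1) by (intro sum_mono2) auto
  also have "\<dots> = (5/4) ^ card D * 2 ^ (card V - card D)"
    using sum_pow_card_Int[OF assms(1,2), of "1/4"] by simp
  also have "(2::real) ^ (card V - card D) = 2 ^ card V / 2 ^ card D"
    using cD by (simp add: power_diff)
  finally have "real (card ?B) * (1/4) ^ j \<le> (5/4) ^ card D * (2 ^ card V / 2 ^ card D)" .
  then have "real (card ?B) \<le> (5/4) ^ card D * (2 ^ card V / 2 ^ card D) * 4 ^ j"
    by (simp add: field_simps)
  also have "\<dots> = 2 ^ card V * ((5/8) ^ card D * 4 ^ j)"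
    by (simp add: power_divide field_simps flip: power_mult_distrib)
  also have "(5/8) ^ card D * 4 ^ j \<le> (4/5::real) ^ card D"
  proof -
    have "(4::real) ^ j \<le> ((32/25) ^ 8) ^ j" by (intro power_mono) (auto simp: field_simps)
    also have "\<dots> = (32/25) ^ (8 * j)" by (simp add: power_mult)
    also have "\<dots> \<le> (32/25) ^ card D" by (intro power_increasing assms) auto
    finally have "(5/8) ^ card D * (4::real) ^ j \<le> (5/8) ^ card D * (32/25) ^ card D"
      by (intro mult_left_mono) auto
    also have "\<dots> = (4/5) ^ card D" by (simp flip: power_mult_distrib)
    finally show ?thesis .
  qed
  finally show ?thesis by simp
qed

text \<open>Union bound over the events that \<open>S\<close> or its complement meets some
  \<open>D v\<close> in at most \<open>j\<close> points; complementation makes both kinds equally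
  frequent. It will split the host so that every neighbourhood is large on both sides.\<close>

lemma balanced_split:
  assumes "finite V" "\<And>v. v \<in> V \<Longrightarrow> D v \<subseteq> V" "\<And>v. v \<in> V \<Longrightarrow> card (D v) \<ge> 8 * j"
    and small: "2 * real (card V) * (4 / 5) ^ (8 * j) < 1"
  shows "\<exists>S\<subseteq>V. \<forall>v\<in>V. card (D v \<inter> S) > j \<and> card (D v - S) > j"
proof -
  define B1 where "B1 v = {S \<in> Pow V. card (S \<inter> D v) \<le> j}" for v
  define B2 where "B2 v = {S \<in> Pow V. card ((V - S) \<inter> D v) \<le> j}" for v
  have B1: "real (card (B1 v)) \<le> 2 ^ card V * (4 / 5) ^ (8 * j)" if "v \<in> V" for v
  proof -
    have "real (card (B1 v)) \<le> 2 ^ card V * (4 / 5) ^ card (D v)"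
      unfolding B1_def using card_small_intersections assms that by blast
    also have "\<dots> \<le> 2 ^ card V * (4 / 5) ^ (8 * j)"
      by (intro mult_left_mono power_decreasing) (use assms that in auto)
    finally show ?thesis .
  qed
  have B2eq: "card (B2 v) = card (B1 v)" if "v \<in> V" for v
  proof (rule bij_betw_same_card[of "\<lambda>S. V - S"])
    have "V - (V - S) = S" if "S \<subseteq> V" for S using that by auto
    then show "bij_betw (\<lambda>S. V - S) (B2 v) (B1 v)"
      by (intro bij_betw_byWitness[where f' = "\<lambda>S. V - S"]) (auto simp: B1_def B2_def)
  qed
  have "real (card (\<Union>v\<in>V. B1 v \<union> B2 v)) \<le> real (\<Sum>v\<in>V. card (B1 v \<union> B2 v))"
    using card_UN_le[OF assms(1)] by (simp only: of_nat_le_iff)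
  also have "\<dots> \<le> (\<Sum>v\<in>V. 2 * (2 ^ card V * (4 / 5) ^ (8 * j)))"
    unfolding of_nat_sum
  proof (intro sum_mono)
    fix v assume v: "v \<in> V"
    have "real (card (B1 v \<union> B2 v)) \<le> real (card (B1 v)) + real (card (B2 v))"
      using card_Un_le of_nat_mono by (metis of_nat_add)
    then show "real (card (B1 v \<union> B2 v)) \<le> 2 * (2 ^ card V * (4 / 5) ^ (8 * j))"
      using B1[OF v] B2eq[OF v] by simp
  qed
  also have "\<dots> = 2 ^ card V * (2 * real (card V) * (4 / 5) ^ (8 * j))" by simp
  also have "\<dots> < 2 ^ card V * 1" using small by (intro mult_strict_left_mono) auto
  finally have "real (card (\<Union>v\<in>V. B1 v \<union> B2 v)) < real (2 ^ card V)" by simp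
  then have "card (\<Union>v\<in>V. B1 v \<union> B2 v) < card (Pow V)"
    using card_Pow[OF assms(1)] by (simp only: of_nat_less_iff)
  moreover have "finite (\<Union>v\<in>V. B1 v \<union> B2 v)"
    using assms(1) by (auto simp: B1_def B2_def)
  ultimately have "\<not> Pow V \<subseteq> (\<Union>v\<in>V. B1 v \<union> B2 v)"
    by (meson card_mono linorder_not_le)
  then obtain S where S: "S \<subseteq> V" "\<forall>v\<in>V. S \<notin> B1 v \<and> S \<notin> B2 v" by blast
  have "card (D v \<inter> S) > j \<and> card (D v - S) > j" if v: "v \<in> V" for v
  proof -
    have "D v - S = (V - S) \<inter> D v" using assms(2)[OF v] by auto
    then show ?thesis using S v by (auto simp: B1_def B2_def Int_commute)
  qed
  then show ?thesis using S(1) by blast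
qed

section \<open>Upper tail for a random subset of fixed size\<close>

lemma binomial_ratio:
  assumes "D \<le> n"
  shows "(D choose k) * n ^ k \<le> (n choose k) * D ^ k"
proof (induction k)
  case 0 then show ?case by simp
next
  case (Suc k)
  have *: "Suc k * (m choose Suc k) = (m - k) * (m choose k)" for m
    by (metis binomial_absorb_comp binomial_absorption mult.commute)
  have le: "(D - k) * n \<le> (n - k) * D"
  proof (cases "k \<le> D")
    case True
    then have "real ((D - k) * n) = real D * n - k * n" "real ((n - k) * D) = real D * n - k * D"
      using assms by (simp_all add: of_nat_diff algebra_simps)
    moreover have "real k * D \<le> real k * n" using assms by (intro mult_left_mono) auto
    ultimately have "real ((D - k) * n) \<le> real ((n - k) * D)" by simp
    then show ?thesis by (simp only: of_nat_le_iff)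
  qed simp
  have "Suc k * ((D choose Suc k) * n ^ Suc k) = ((D - k) * n) * ((D choose k) * n ^ k)"
    unfolding mult.assoc[symmetric] * by simp
  also have "\<dots> \<le> ((n - k) * D) * ((n choose k) * D ^ k)"
    by (intro mult_le_mono le Suc)
  also have "\<dots> = Suc k * ((n choose Suc k) * D ^ Suc k)"
    unfolding mult.assoc[symmetric] * by simp
  finally show ?case by (simp only: mult_le_cancel1)
qed

text \<open>A bad \<open>S\<close> contains a \<open>k\<close>-subset \<open>L\<close> of
  \<open>D\<close>. Counting the pairs of \<open>L\<close> and \<open>S - L\<close>, and exchanging
  the order of choice so that \<open>L\<close> is picked inside \<open>S\<close> in at most
  \<open>2 ^ w\<close> ways, bounds the share of bad \<open>S\<close> by
  \<open>2 ^ w * (card D / card A) ^ k\<close>.\<close>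

lemma card_large_intersections:
  assumes "finite A" "D \<subseteq> A" "k \<le> w" "w \<le> card A"
  shows "card {S. S \<subseteq> A \<and> card S = w \<and> k \<le> card (S \<inter> D)} * card A ^ k
    \<le> (card A choose w) * 2 ^ w * card D ^ k"
proof -
  let ?n = "card A"
  let ?B = "{S. S \<subseteq> A \<and> card S = w \<and> k \<le> card (S \<inter> D)}"
  let ?P = "Sigma {L. L \<subseteq> D \<and> card L = k} (\<lambda>L. {M. M \<subseteq> A - L \<and> card M = w - k})"
  have finD: "finite D" using assms finite_subset by blast
  have "?B \<subseteq> (\<lambda>(L, M). L \<union> M) ` ?P"
  proof
    fix S assume S: "S \<in> ?B"
    then obtain L where L: "L \<subseteq> S \<inter> D" "card L = k" using obtain_subset_with_card_n[of k "S \<inter> D"] by blast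
    have finS: "finite S" using S assms(1) finite_subset by blast
    have "card (S - L) = w - k" using L S finS card_Diff_subset[of L S] finite_subset[of L S] by auto
    then have "(L, S - L) \<in> ?P" using L S by auto
    moreover have "S = L \<union> (S - L)" using L by auto
    ultimately show "S \<in> (\<lambda>(L, M). L \<union> M) ` ?P" by (metis (mono_tags, lifting) case_prod_conv image_eqI)
  qed
  moreover have finP: "finite ?P" using assms(1) finD by (intro finite_SigmaI) auto
  ultimately have "card ?B \<le> card ?P" by (meson card_image_le card_mono finite_imageI le_trans)
  also have "card ?P = (\<Sum>L | L \<subseteq> D \<and> card L = k. card {M. M \<subseteq> A - L \<and> card M = w - k})"
    using assms(1) finD by (subst card_SigmaI) auto
  also have "\<dots> = (\<Sum>L | L \<subseteq> D \<and> card L = k. (?n - k) choose (w - k))"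
  proof (rule sum.cong[OF refl])
    fix L assume L: "L \<in> {L. L \<subseteq> D \<and> card L = k}"
    then have "L \<subseteq> A" "finite L" using assms finD finite_subset by blast+
    then have "card (A - L) = ?n - k" using L card_Diff_subset by blast
    then show "card {M. M \<subseteq> A - L \<and> card M = w - k} = (?n - k) choose (w - k)"
      using n_subsets[of "A - L" "w - k"] assms(1) by simp
  qed
  also have "\<dots> = (card D choose k) * ((?n - k) choose (w - k))"
    using n_subsets[OF finD, of k] by simp
  finally have 1: "card ?B \<le> (card D choose k) * ((?n - k) choose (w - k))" .
  have "card ?B * ?n ^ k \<le> ((card D choose k) * ?n ^ k) * ((?n - k) choose (w - k))"
    using mult_le_mono1[OF 1, of "?n ^ k"] by (simp add: mult_ac)
  also have "\<dots> \<le> ((?n choose k) * card D ^ k) * ((?n - k) choose (w - k))"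
    using binomial_ratio[of "card D" ?n k] assms card_mono by (intro mult_le_mono1) blast
  also have "\<dots> = ((?n choose w) * (w choose k)) * card D ^ k"
    using choose_mult[OF assms(3,4)] by (simp add: mult_ac)
  also have "\<dots> \<le> ((?n choose w) * 2 ^ w) * card D ^ k"
    using binomial_le_pow2[of w k] by (intro mult_le_mono1 mult_le_mono2)
  finally show ?thesis .
qed

text \<open>Each \<open>u\<close> spoils at most a share \<open>2 ^ w * \<beta> ^ k\<close> of the
  \<open>w\<close>-subsets with \<open>k \<ge> \<gamma> * w\<close>, and the bound on
  \<open>\<beta>\<close> makes this at most \<open>1 / 4 ^ w\<close>, so fewer than
  \<open>4 ^ w\<close> many \<open>u\<close> leave a good subset. The exponential gain allows a
  sample of size \<open>w\<close> to be tested against a number of vertices linear in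
  \<open>w\<close>.\<close>

lemma sparse_sample:
  fixes \<beta> \<gamma> :: real
  assumes "finite A" "finite U" "w \<le> card A" "w > 0"
    and "\<And>u. u \<in> U \<Longrightarrow> D u \<subseteq> A" "\<And>u. u \<in> U \<Longrightarrow> card (D u) \<le> \<beta> * card A"
    and "0 < \<gamma>" "\<gamma> \<le> 1" "0 < \<beta>" "\<beta> \<le> (1 / 8) powr (1 / \<gamma>)"
    and "card U < 4 ^ w"
  shows "\<exists>S\<subseteq>A. card S = w \<and> (\<forall>u\<in>U. card (S \<inter> D u) \<le> \<gamma> * w)"
proof -
  define k where "k = nat \<lceil>\<gamma> * w\<rceil>"
  have k: "k \<le> w" "\<gamma> * w \<le> k"
  proof -
    have "\<gamma> * w \<le> w" using assms(7,8) by (simp add: mult_left_le_one_le)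
    then show "k \<le> w" unfolding k_def by (simp add: nat_le_iff ceiling_le_iff)
    show "\<gamma> * w \<le> k" unfolding k_def by (rule real_nat_ceiling_ge)
  qed
  define B where "B u = {S. S \<subseteq> A \<and> card S = w \<and> k \<le> card (S \<inter> D u)}" for u
  let ?n = "card A"
  have n0: "0 < ?n" using assms(3,4) by linarith
  have bk: "\<beta> ^ k \<le> (1 / 8) ^ w"
  proof -
    have b1: "\<beta> \<le> 1" using assms(7,10) powr_le1[of "1/\<gamma>" "1/8"] by simp
    have "\<beta> ^ k = \<beta> powr k" using assms(9) by (simp add: powr_realpow)
    also have "\<dots> \<le> \<beta> powr (\<gamma> * w)" using k b1 assms(9) by (intro powr_mono') auto
    also have "\<dots> \<le> ((1 / 8) powr (1 / \<gamma>)) powr (\<gamma> * w)" using assms(7,9,10) by (intro powr_mono2) auto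
    also have "\<dots> = (1 / 8) ^ w" using assms(7) by (simp add: powr_powr powr_realpow)
    finally show ?thesis .
  qed
  have Bu: "real (card (B u)) * 4 ^ w \<le> real (?n choose w)" if u: "u \<in> U" for u
  proof -
    have "real (card (B u)) * real ?n ^ k \<le> real (?n choose w) * 2 ^ w * real (card (D u)) ^ k"
      using card_large_intersections[OF assms(1) assms(5)[OF u] k(1) assms(3)]
      unfolding B_def by (metis (no_types, lifting) of_nat_le_iff of_nat_mult of_nat_numeral of_nat_power)
    also have "\<dots> \<le> real (?n choose w) * 2 ^ w * (\<beta> * ?n) ^ k"
      using assms(6)[OF u] by (intro mult_left_mono power_mono) auto
    also have "\<dots> = real (?n choose w) * 2 ^ w * \<beta> ^ k * real ?n ^ k" by (simp add: power_mult_distrib)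
    finally have "real (card (B u)) \<le> real (?n choose w) * 2 ^ w * \<beta> ^ k" using n0 by simp
    also have "\<dots> \<le> real (?n choose w) * 2 ^ w * (1 / 8) ^ w" using bk by (intro mult_left_mono) auto
    also have "\<dots> = real (?n choose w) / 4 ^ w" by (simp add: power_divide field_simps flip: power_mult_distrib)
    finally show ?thesis by (simp add: field_simps)
  qed
  have finAll: "finite {S. S \<subseteq> A \<and> card S = w}" using assms(1) by simp
  have pos: "0 < ?n choose w" using assms(3) by simp
  have "real (card (\<Union>u\<in>U. B u)) * 4 ^ w \<le> (\<Sum>u\<in>U. real (card (B u))) * 4 ^ w"
    using card_UN_le[OF assms(2), of B] by (intro mult_right_mono) (auto simp flip: of_nat_sum)
  also have "\<dots> \<le> (\<Sum>u\<in>U. real (?n choose w))"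
    unfolding sum_distrib_right by (intro sum_mono Bu)
  also have "\<dots> = card U * real (?n choose w)" by simp
  also have "\<dots> < 4 ^ w * real (?n choose w)"
  proof (rule mult_strict_right_mono)
    have "real (card U) < real (4 ^ w)" using assms(11) by (simp only: of_nat_less_iff)
    then show "real (card U) < 4 ^ w" by simp
  qed (use pos in simp)
  finally have "real (card (\<Union>u\<in>U. B u)) < real (?n choose w)" by simp
  then have "card (\<Union>u\<in>U. B u) < card {S. S \<subseteq> A \<and> card S = w}"
    using n_subsets[OF assms(1), of w] by simp
  moreover have "finite (\<Union>u\<in>U. B u)"
    using assms(1,2) by (auto simp: B_def)
  ultimately have "\<not> {S. S \<subseteq> A \<and> card S = w} \<subseteq> (\<Union>u\<in>U. B u)"
    by (meson card_mono linorder_not_le)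
  then obtain S where S: "S \<subseteq> A" "card S = w" "\<forall>u\<in>U. S \<notin> B u" by blast
  have "card (S \<inter> D u) \<le> \<gamma> * w" if "u \<in> U" for u
  proof -
    have "card (S \<inter> D u) < k" using S that by (auto simp: B_def)
    then have "int (card (S \<inter> D u)) < \<lceil>\<gamma> * w\<rceil>" by (simp add: k_def)
    then show ?thesis by (simp add: less_ceiling_iff)
  qed
  then show ?thesis using S by blast
qed

section \<open>Exponential potential and candidate sets\<close>

lemma exp_le_one_plus_square:
  fixes x :: real
  assumes "x \<le> 1"
  shows "exp x \<le> 1 + x + x\<^sup>2"
proof (cases "0 \<le> x")
  case True
  then show ?thesis using exp_bound[of x] assms by simp
next
  case False
  define y where "y = - x"
  have y: "y > 0" using False y_def by simp
  have "1 + y + y\<^sup>2 / 2 \<le> exp y" using exp_lower_Taylor_quadratic[of y] y by simp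
  then have "(1 - y + y\<^sup>2) * (1 + y + y\<^sup>2 / 2) \<le> (1 - y + y\<^sup>2) * exp y"
  proof (rule mult_left_mono)
    have "1 - y + y\<^sup>2 = (1 - y / 2)\<^sup>2 + 3 / 4 * y\<^sup>2" by (simp add: power2_eq_square field_simps)
    then show "0 \<le> 1 - y + y\<^sup>2" by simp
  qed
  moreover have "(1 - y + y\<^sup>2) * (1 + y + y\<^sup>2 / 2) = 1 + y\<^sup>2 / 2 + y ^ 3 / 2 + y ^ 4 / 2"
    by (simp add: field_simps power2_eq_square power3_eq_cube power4_eq_xxxx)
  moreover have "0 \<le> y\<^sup>2 / 2" "0 \<le> y ^ 3 / 2" "0 \<le> y ^ 4 / 2" using y by auto
  ultimately have "1 \<le> (1 - y + y\<^sup>2) * exp y" by linarith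
  then have "exp (- y) \<le> 1 - y + y\<^sup>2" by (simp add: exp_minus field_simps)
  then show ?thesis by (simp add: y_def)
qed

text \<open>One step of the derandomised Azuma--Hoeffding inequality: if every quantity has nonpositive
  mean drift over \<open>A\<close>, then some choice in \<open>A\<close> does not increase the exponential potential.\<close>

lemma exponential_potential_step:
  fixes \<Delta> :: "'j \<Rightarrow> 'p \<Rightarrow> real"
  assumes "finite A" "A \<noteq> {}" "0 < \<mu>" "\<mu> * M \<le> 1"
    and drift: "\<And>j. j \<in> J \<Longrightarrow> (\<Sum>p\<in>A. \<Delta> j p) \<le> 0"
    and bound: "\<And>j p. j \<in> J \<Longrightarrow> p \<in> A \<Longrightarrow> \<bar>\<Delta> j p\<bar> \<le> M"
    and wt: "\<And>j. j \<in> J \<Longrightarrow> 0 \<le> wt j"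
  shows "\<exists>p\<in>A. (\<Sum>j\<in>J. wt j * exp (\<mu> * \<Delta> j p - \<mu>\<^sup>2 * M\<^sup>2)) \<le> (\<Sum>j\<in>J. wt j)"
proof (rule ccontr)
  assume "\<not> ?thesis"
  then have "(\<Sum>p\<in>A. \<Sum>j\<in>J. wt j) < (\<Sum>p\<in>A. \<Sum>j\<in>J. wt j * exp (\<mu> * \<Delta> j p - \<mu>\<^sup>2 * M\<^sup>2))"
    by (intro sum_strict_mono[OF assms(1,2)]) (simp add: not_le)
  also have "\<dots> = (\<Sum>j\<in>J. wt j * (\<Sum>p\<in>A. exp (\<mu> * \<Delta> j p - \<mu>\<^sup>2 * M\<^sup>2)))"
    by (subst sum.swap) (simp add: sum_distrib_left)
  also have "\<dots> \<le> (\<Sum>j\<in>J. wt j * real (card A))"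
  proof (intro sum_mono mult_left_mono wt)
    fix j assume j: "j \<in> J"
    have e: "exp (\<mu> * \<Delta> j p) \<le> 1 + \<mu> * \<Delta> j p + \<mu>\<^sup>2 * M\<^sup>2" if p: "p \<in> A" for p
    proof -
      have b: "\<bar>\<Delta> j p\<bar> \<le> M" using bound j p by blast
      have "\<mu> * \<Delta> j p \<le> \<mu> * M" using b assms(3) by (intro mult_left_mono) auto
      then have "exp (\<mu> * \<Delta> j p) \<le> 1 + \<mu> * \<Delta> j p + (\<mu> * \<Delta> j p)\<^sup>2"
        using assms(4) by (intro exp_le_one_plus_square) linarith
      moreover have "(\<mu> * \<Delta> j p)\<^sup>2 \<le> \<mu>\<^sup>2 * M\<^sup>2"
        using b abs_le_square_iff[of "\<Delta> j p" M] by (auto simp: power_mult_distrib intro!: mult_left_mono)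
      ultimately show ?thesis by linarith
    qed
    have "(\<Sum>p\<in>A. exp (\<mu> * \<Delta> j p - \<mu>\<^sup>2 * M\<^sup>2)) = (\<Sum>p\<in>A. exp (\<mu> * \<Delta> j p)) * exp (- (\<mu>\<^sup>2 * M\<^sup>2))"
      by (simp add: sum_distrib_right exp_diff exp_minus divide_inverse)
    also have "\<dots> \<le> (\<Sum>p\<in>A. 1 + \<mu> * \<Delta> j p + \<mu>\<^sup>2 * M\<^sup>2) * exp (- (\<mu>\<^sup>2 * M\<^sup>2))"
      by (intro mult_right_mono sum_mono e) auto
    also have "(\<Sum>p\<in>A. 1 + \<mu> * \<Delta> j p + \<mu>\<^sup>2 * M\<^sup>2) = card A * (1 + \<mu>\<^sup>2 * M\<^sup>2) + \<mu> * (\<Sum>p\<in>A. \<Delta> j p)"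
      by (simp add: sum.distrib sum_distrib_left algebra_simps)
    also have "\<dots> * exp (- (\<mu>\<^sup>2 * M\<^sup>2)) \<le> (card A * exp (\<mu>\<^sup>2 * M\<^sup>2)) * exp (- (\<mu>\<^sup>2 * M\<^sup>2))"
    proof (rule mult_right_mono)
      have "\<mu> * (\<Sum>p\<in>A. \<Delta> j p) \<le> 0" using drift[OF j] assms(3) by (simp add: mult_nonneg_nonpos)
      moreover have "card A * (1 + \<mu>\<^sup>2 * M\<^sup>2) \<le> card A * exp (\<mu>\<^sup>2 * M\<^sup>2)"
        using exp_ge_add_one_self[of "\<mu>\<^sup>2 * M\<^sup>2"] by (intro mult_left_mono) auto
      ultimately show "card A * (1 + \<mu>\<^sup>2 * M\<^sup>2) + \<mu> * (\<Sum>p\<in>A. \<Delta> j p) \<le> card A * exp (\<mu>\<^sup>2 * M\<^sup>2)" by linarith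
    qed auto
    also have "\<dots> = card A" by (simp add: exp_minus)
    finally show "(\<Sum>p\<in>A. exp (\<mu> * \<Delta> j p - \<mu>\<^sup>2 * M\<^sup>2)) \<le> card A" .
  qed
  also have "\<dots> = (\<Sum>p\<in>A. \<Sum>j\<in>J. wt j)" by (simp add: sum_distrib_right mult.commute)
  finally show False by simp
qed

definition bounded_lists :: "nat \<Rightarrow> 'v set \<Rightarrow> 'v list set" where
  "bounded_lists s B = {xs. set xs \<subseteq> B \<and> length xs = s}"

lemma finite_bounded_lists: "finite B \<Longrightarrow> finite (bounded_lists s B)"
  unfolding bounded_lists_def by (rule finite_lists_length_eq)

lemma card_bounded_lists: "finite B \<Longrightarrow> card (bounded_lists s B) = card B ^ s"
  unfolding bounded_lists_def by (rule card_lists_length_eq)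

definition atypical :: "'v set \<Rightarrow> ('v \<Rightarrow> 'v set) \<Rightarrow> real \<Rightarrow> 'v set \<Rightarrow> 'v set" where
  "atypical V Nb d C = {p \<in> V. real (card (Nb p \<inter> C)) < d * real (card C)}"

text \<open>One \<open>\<delta>\<close> measures both which \<open>C\<close> count as large and how
  many atypical vertices are tolerated, so that passing to a large subset is paid for by enlarging a
  single parameter.\<close>

definition lower_quasirandom :: "'v set \<Rightarrow> ('v \<Rightarrow> 'v set) \<Rightarrow> real \<Rightarrow> real \<Rightarrow> bool" where
  "lower_quasirandom V Nb d \<delta> \<longleftrightarrow>
    (\<forall>C\<subseteq>V. \<delta> * real (card V) \<le> real (card C) \<longrightarrow> real (card (atypical V Nb d C)) \<le> \<delta> * real (card V))"

section \<open>Common neighbourhoods of random tuples in the host\<close>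

locale host_graph =
  fixes V :: "'v set" and Nb :: "'v \<Rightarrow> 'v set" and d \<delta> :: real
  assumes finV: "finite V" and V_ne: "V \<noteq> {}"
    and Nb_sub: "\<And>p. p \<in> V \<Longrightarrow> Nb p \<subseteq> V"
    and Nb_sym: "\<And>p q. p \<in> V \<Longrightarrow> q \<in> V \<Longrightarrow> q \<in> Nb p \<Longrightarrow> p \<in> Nb q"
    and quasirandom: "lower_quasirandom V Nb d \<delta>"
    and d_pos: "0 < d" and d_less: "d < 1" and \<delta>_pos: "0 < \<delta>"
begin

abbreviation N :: nat where "N \<equiv> card V"

lemma N_pos: "0 < N" using finV V_ne by (simp add: card_gt_0_iff)

lemma card_atypical: "C \<subseteq> V \<Longrightarrow> \<delta> * N \<le> card C \<Longrightarrow> card (atypical V Nb d C) \<le> \<delta> * N"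
  using quasirandom by (auto simp: lower_quasirandom_def)

lemma typicalD: "p \<in> V \<Longrightarrow> p \<notin> atypical V Nb d C \<Longrightarrow> d * card C \<le> card (C \<inter> Nb p)"
  by (auto simp: atypical_def Int_commute)

text \<open>\<open>miss j B\<close> is the proportion of \<open>j\<close>-tuples of vertices without a common neighbour in \<open>B\<close>.\<close>

primrec miss :: "nat \<Rightarrow> 'v set \<Rightarrow> real" where
  "miss 0 B = (if B = {} then 1 else 0)"
| "miss (Suc j) B = (\<Sum>p\<in>V. miss j (B \<inter> Nb p)) / N"

lemma miss_nonneg: "0 \<le> miss j B"
  by (induction j arbitrary: B) (auto intro!: sum_nonneg divide_nonneg_nonneg)

lemma miss_le_1: "miss j B \<le> 1"
proof (induction j arbitrary: B)
  case (Suc j)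
  have "(\<Sum>p\<in>V. miss j (B \<inter> Nb p)) \<le> (\<Sum>p\<in>V. 1)" by (intro sum_mono Suc)
  then show ?case using N_pos by simp
qed simp

lemma miss_empty: "miss j {} = 1"
  using N_pos by (induction j) auto

text \<open>Let \<open>j\<close> random host vertices cut down \<open>C\<close> one after the other.
  Each is atypical for the current \<open>B \<inter> C\<close> with probability at most
  \<open>\<delta>\<close> and otherwise keeps a factor \<open>d\<close> of it. If none is atypical,
  \<open>s\<close> random points of \<open>B\<close> miss the rest with probability at most
  \<open>(1 - \<theta> * d ^ j) ^ s\<close>. The density \<open>\<theta>\<close> is a variable
  because the induction replaces \<open>C\<close> by \<open>C \<inter> Nb p\<close> and
  \<open>\<theta>\<close> by \<open>\<theta> * d\<close>.\<close>

lemma miss_average: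
  fixes \<theta> :: real
  assumes "B \<subseteq> V" "0 \<le> \<theta>" "\<theta> \<le> 1" "\<theta> * card B \<le> card (B \<inter> C)" "\<delta> * N \<le> \<theta> * d ^ j * card B"
  shows "(\<Sum>xs\<in>bounded_lists s B. miss j (set xs \<inter> C)) \<le> (j * \<delta> + (1 - \<theta> * d ^ j) ^ s) * card B ^ s"
  using assms(2-)
proof (induction j arbitrary: C \<theta>)
  case 0
  have finB: "finite B" using assms(1) finV finite_subset by blast
  have "(\<Sum>xs\<in>bounded_lists s B. miss 0 (set xs \<inter> C)) = (\<Sum>xs\<in>bounded_lists s (B - C). 1)"
    using finB by (intro sum.mono_neutral_cong_right finite_bounded_lists) (auto simp: bounded_lists_def)
  also have "\<dots> = real (card (B - C)) ^ s" using finB by (simp add: card_bounded_lists)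
  also have "\<dots> \<le> ((1 - \<theta>) * card B) ^ s"
  proof (rule power_mono)
    have "card (B - C) = card B - card (B \<inter> C)" using finB by (simp add: card_Diff_subset_Int)
    moreover have "card (B \<inter> C) \<le> card B" using finB by (simp add: card_mono)
    ultimately show "real (card (B - C)) \<le> (1 - \<theta>) * card B" using 0 by (simp add: of_nat_diff algebra_simps)
  qed auto
  finally show ?case by (simp add: power_mult_distrib)
next
  case (Suc j)
  have finB: "finite B" using assms(1) finV finite_subset by blast
  let ?L = "bounded_lists s B"
  let ?A = "atypical V Nb d (B \<inter> C)"
  let ?t = "(1 - \<theta> * d ^ Suc j) ^ s"
  have t0: "0 \<le> ?t"
  proof -
    have "\<theta> * d ^ Suc j \<le> 1 * 1" using Suc.prems d_pos d_less by (intro mult_mono power_le_one) auto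
    then show ?thesis by simp
  qed
  have BC: "\<theta> * card B \<le> card (B \<inter> C)" by (rule Suc.prems(3))
  \<comment> \<open>The last premise concerns the density left after all steps, so quasirandomness
    applies at each of them.\<close>
  have "\<theta> * d ^ Suc j * card B \<le> \<theta> * card B"
    using Suc.prems d_pos d_less by (intro mult_right_mono mult_left_le power_le_one) auto
  then have cA: "card ?A \<le> \<delta> * N"
    using BC Suc.prems(4) assms(1) by (intro card_atypical) auto
  have fin: "finite ?L" using finB finite_bounded_lists by blast
  have each: "(\<Sum>xs\<in>?L. miss j (set xs \<inter> (C \<inter> Nb p))) \<le> (if p \<in> ?A then card B ^ s else (j * \<delta> + ?t) * card B ^ s)"
    if p: "p \<in> V" for p
  proof (cases "p \<in> ?A")
    case True
    have "(\<Sum>xs\<in>?L. miss j (set xs \<inter> (C \<inter> Nb p))) \<le> (\<Sum>xs\<in>?L. 1)" by (intro sum_mono miss_le_1)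
    then show ?thesis using True finB by (simp add: card_bounded_lists)
  next
    case False
    then have "d * card (B \<inter> C) \<le> card (B \<inter> C \<inter> Nb p)" using p by (intro typicalD) auto
    moreover have "d * (\<theta> * card B) \<le> d * card (B \<inter> C)" using BC d_pos by (intro mult_left_mono) auto
    ultimately have *: "(\<theta> * d) * card B \<le> card (B \<inter> (C \<inter> Nb p))" by (simp add: mult_ac Int_assoc)
    have "\<theta> * d \<le> 1 * 1" using Suc.prems d_pos d_less by (intro mult_mono) auto
    then have "(\<Sum>xs\<in>?L. miss j (set xs \<inter> (C \<inter> Nb p))) \<le> (j * \<delta> + (1 - \<theta> * d * d ^ j) ^ s) * card B ^ s"
      using Suc.prems d_pos * by (intro Suc.IH) (auto simp: mult_ac)
    then show ?thesis using False by (simp add: mult_ac)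
  qed
  have "(\<Sum>xs\<in>?L. miss (Suc j) (set xs \<inter> C)) = (\<Sum>p\<in>V. \<Sum>xs\<in>?L. miss j (set xs \<inter> (C \<inter> Nb p))) / N"
    by (subst sum.swap) (simp add: sum_divide_distrib Int_assoc)
  also have "\<dots> \<le> (\<Sum>p\<in>V. if p \<in> ?A then real (card B ^ s) else (j * \<delta> + ?t) * card B ^ s) / N"
    by (intro divide_right_mono sum_mono each) auto
  also have "(\<Sum>p\<in>V. if p \<in> ?A then real (card B ^ s) else (j * \<delta> + ?t) * card B ^ s)
      \<le> (\<Sum>p\<in>V. (if p \<in> ?A then real (card B ^ s) else 0) + (j * \<delta> + ?t) * card B ^ s)"
    using t0 \<delta>_pos by (intro sum_mono) auto
  also have "\<dots> = card ?A * real (card B ^ s) + N * ((j * \<delta> + ?t) * card B ^ s)"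
  proof -
    have "V \<inter> {x. x \<in> ?A} = ?A" by (auto simp: atypical_def)
    then show ?thesis using finV by (simp add: sum.distrib sum.If_cases)
  qed
  also have "\<dots> \<le> \<delta> * N * real (card B ^ s) + N * ((j * \<delta> + ?t) * card B ^ s)"
    using mult_right_mono[OF cA, of "real (card B ^ s)"] by simp
  also have "\<dots> / N = (Suc j * \<delta> + ?t) * card B ^ s" using N_pos by (simp add: field_simps)
  finally show ?case by (simp add: divide_right_mono)
qed

end

section \<open>Candidate sets and missed lists\<close>

locale guest_in_host = host_graph V Nb d \<delta>
  for V :: "'v set" and Nb d \<delta> +
  fixes nb :: "nat \<Rightarrow> nat set" and K :: "nat set" and D :: nat and c :: real
  assumes nb_sub: "\<And>x. x < N \<Longrightarrow> nb x \<subseteq> {..<N}"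
    and nb_sym: "\<And>x z. x < N \<Longrightarrow> z \<in> nb x \<Longrightarrow> x \<in> nb z"
    and nb_irrefl: "\<And>x. x \<notin> nb x"
    and K_sub: "K \<subseteq> {..<N}"
    and degree_le: "\<And>x. x < N \<Longrightarrow> x \<notin> K \<Longrightarrow> card (nb x) \<le> D"
    and c_pos: "0 < c" and c_less: "c < 1"
begin

text \<open>Occupied host vertices are kept: the set then changes only when a neighbour of
  \<open>x\<close> is embedded, and this locality bounds the steps of the weights below.\<close>

definition cand :: "nat set \<Rightarrow> (nat \<Rightarrow> 'v) \<Rightarrow> nat \<Rightarrow> 'v set" where
  "cand E \<phi> x = {p \<in> V. \<forall>z\<in>nb x \<inter> E. p \<in> Nb (\<phi> z)}"

lemma cand_sub: "cand E \<phi> x \<subseteq> V" by (auto simp: cand_def)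

lemma finite_cand: "finite (cand E \<phi> x)" by (rule finite_subset[OF cand_sub finV])

lemma finite_nb: "x < N \<Longrightarrow> finite (nb x)" by (rule finite_subset[OF nb_sub finite_lessThan])

lemma cand_update:
  assumes "z \<notin> E"
  shows "cand (insert z E) (\<phi>(z := p)) x = (if z \<in> nb x then cand E \<phi> x \<inter> Nb p else cand E \<phi> x)"
proof -
  have "w \<noteq> z" if "w \<in> nb x \<inter> E" for w using that assms by blast
  then show ?thesis by (auto simp: cand_def)
qed

lemma card_rem_insert:
  assumes "z \<in> nb x" "z \<notin> E" "x < N"
  shows "card (nb x - E) = Suc (card (nb x - insert z E))"
proof -
  have "nb x - E = insert z (nb x - insert z E)" using assms by auto
  then show ?thesis using finite_nb[OF assms(3)] by (metis Diff_iff card_insert_disjoint finite_Diff insertI1)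
qed

lemma card_done_insert:
  assumes "z \<in> nb x" "z \<notin> E" "x < N"
  shows "card (nb x \<inter> insert z E) = Suc (card (nb x \<inter> E))"
proof -
  have "nb x \<inter> insert z E = insert z (nb x \<inter> E)" using assms by auto
  then show ?thesis using finite_nb[OF assms(3)] assms by simp
qed

text \<open>The number of non-hubs whose final candidate set misses \<open>xs\<close>, estimated as if each remaining
  neighbour were placed uniformly; the factor \<open>1 / c\<close> per neighbour pays for choosing it from a subset
  of density \<open>c\<close> only, which makes the weight a supermartingale.\<close>

definition missed_weight :: "nat set \<Rightarrow> (nat \<Rightarrow> 'v) \<Rightarrow> 'v list \<Rightarrow> real" where
  "missed_weight E \<phi> xs = (\<Sum>x\<in>{..<N} - K. (1 / c) ^ card (nb x - E) * miss (card (nb x - E)) (set xs \<inter> cand E \<phi> x))"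

lemma missed_weight_diff:
  assumes "z < N" "z \<notin> E"
  shows "missed_weight (insert z E) (\<phi>(z := p)) xs - missed_weight E \<phi> xs =
    (\<Sum>x\<in>nb z - K. (1 / c) ^ card (nb x - insert z E) * miss (card (nb x - insert z E)) (set xs \<inter> cand E \<phi> x \<inter> Nb p)
      - (1 / c) ^ card (nb x - E) * miss (card (nb x - E)) (set xs \<inter> cand E \<phi> x))"
proof -
  have iff: "x \<in> nb z \<longleftrightarrow> z \<in> nb x" if "x < N" for x using nb_sym assms that by blast
  have eqE: "nb x - insert z E = nb x - E" if "z \<notin> nb x" for x using that by auto
  show ?thesis
    unfolding missed_weight_def sum_subtractf[symmetric] cand_update[OF assms(2)]
  proof (rule sum.mono_neutral_cong_right)
    show "nb z - K \<subseteq> {..<N} - K" using nb_sub[OF assms(1)] by blast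
  next
    show "\<forall>x\<in>{..<N} - K - (nb z - K). (1 / c) ^ card (nb x - insert z E) *
        miss (card (nb x - insert z E)) (set xs \<inter> (if z \<in> nb x then cand E \<phi> x \<inter> Nb p else cand E \<phi> x)) -
        (1 / c) ^ card (nb x - E) * miss (card (nb x - E)) (set xs \<inter> cand E \<phi> x) = 0"
    proof
      fix x assume "x \<in> {..<N} - K - (nb z - K)"
      then have "z \<notin> nb x" using iff[of x] by blast
      then show "(1 / c) ^ card (nb x - insert z E) *
        miss (card (nb x - insert z E)) (set xs \<inter> (if z \<in> nb x then cand E \<phi> x \<inter> Nb p else cand E \<phi> x)) -
        (1 / c) ^ card (nb x - E) * miss (card (nb x - E)) (set xs \<inter> cand E \<phi> x) = 0"
        using eqE[of x] by simp
    qed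
  next
    fix x assume "x \<in> nb z - K"
    then have "z \<in> nb x" using nb_sym[OF assms(1)] by blast
    then show "(1 / c) ^ card (nb x - insert z E) *
        miss (card (nb x - insert z E)) (set xs \<inter> (if z \<in> nb x then cand E \<phi> x \<inter> Nb p else cand E \<phi> x)) -
        (1 / c) ^ card (nb x - E) * miss (card (nb x - E)) (set xs \<inter> cand E \<phi> x) =
        (1 / c) ^ card (nb x - insert z E) * miss (card (nb x - insert z E)) (set xs \<inter> cand E \<phi> x \<inter> Nb p)
      - (1 / c) ^ card (nb x - E) * miss (card (nb x - E)) (set xs \<inter> cand E \<phi> x)"
      by (simp add: Int_assoc)
  qed simp
qed

text \<open>Over all of \<open>V\<close> the average of \<open>miss j\<close> after one more
  neighbour is \<open>miss (Suc j)\<close> by definition. Averaging over \<open>A\<close> instead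
  costs at most a factor \<open>N / card A \<le> 1 / c\<close>, and embedding \<open>z\<close>
  removes exactly one factor \<open>1 / c\<close> from each affected term.\<close>

lemma missed_weight_drift:
  assumes "z < N" "z \<notin> E" "A \<subseteq> V" "c * N \<le> card A"
  shows "(\<Sum>p\<in>A. missed_weight (insert z E) (\<phi>(z := p)) xs - missed_weight E \<phi> xs) \<le> 0"
proof -
  have "(\<Sum>p\<in>A. missed_weight (insert z E) (\<phi>(z := p)) xs - missed_weight E \<phi> xs) =
    (\<Sum>x\<in>nb z - K. \<Sum>p\<in>A. (1 / c) ^ card (nb x - insert z E) * miss (card (nb x - insert z E)) (set xs \<inter> cand E \<phi> x \<inter> Nb p)
      - (1 / c) ^ card (nb x - E) * miss (card (nb x - E)) (set xs \<inter> cand E \<phi> x))"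
    unfolding missed_weight_diff[OF assms(1,2)] by (rule sum.swap)
  also have "\<dots> \<le> 0"
  proof (rule sum_nonpos)
    fix x assume x: "x \<in> nb z - K"
    then have xN: "x < N" and zx: "z \<in> nb x" using nb_sub nb_sym assms(1) by blast+
    define j where "j = card (nb x - insert z E)"
    have j: "card (nb x - E) = Suc j" using card_rem_insert[OF zx assms(2) xN] j_def by simp
    let ?B = "set xs \<inter> cand E \<phi> x"
    have "(\<Sum>p\<in>A. miss j (?B \<inter> Nb p)) \<le> (\<Sum>p\<in>V. miss j (?B \<inter> Nb p))"
      using finV assms(3) by (intro sum_mono2) (auto simp: miss_nonneg)
    also have "\<dots> = N * miss (Suc j) ?B" using N_pos by simp
    also have "\<dots> \<le> card A / c * miss (Suc j) ?B"
      using assms(4) c_pos by (intro mult_right_mono miss_nonneg) (simp add: field_simps)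
    finally have "(1 / c) ^ j * (\<Sum>p\<in>A. miss j (?B \<inter> Nb p)) \<le> (1 / c) ^ j * (card A / c * miss (Suc j) ?B)"
      using c_pos by (intro mult_left_mono) auto
    then have "(\<Sum>p\<in>A. (1 / c) ^ j * miss j (?B \<inter> Nb p) - (1 / c) ^ Suc j * miss (Suc j) ?B) \<le> 0"
      by (simp only: sum_subtractf sum_distrib_left[symmetric] sum_constant) (simp add: mult_ac)
    then show "(\<Sum>p\<in>A. (1 / c) ^ card (nb x - insert z E) * miss (card (nb x - insert z E)) (?B \<inter> Nb p)
      - (1 / c) ^ card (nb x - E) * miss (card (nb x - E)) ?B) \<le> 0"
      unfolding j j_def[symmetric] .
  qed
  finally show ?thesis .
qed

text \<open>Only non-hubs are counted, and these have degree at most \<open>D\<close>; so each term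
  lies between 0 and \<open>(1 / c) ^ D\<close>, even if \<open>z\<close> itself is a hub.\<close>

lemma missed_weight_change:
  assumes "z < N" "z \<notin> E"
  shows "\<bar>missed_weight (insert z E) (\<phi>(z := p)) xs - missed_weight E \<phi> xs\<bar> \<le> (1 / c) ^ D * card (nb z - K)"
proof -
  have w: "0 \<le> (1 / c) ^ j * miss j B \<and> (1 / c) ^ j * miss j B \<le> (1 / c) ^ D" if "j \<le> D" for j B
  proof
    show "0 \<le> (1 / c) ^ j * miss j B" using c_pos miss_nonneg by simp
    have "(1 / c) ^ j * miss j B \<le> (1 / c) ^ j * 1" using c_pos miss_le_1 by (intro mult_left_mono) auto
    also have "\<dots> \<le> (1 / c) ^ D * 1" using c_pos c_less that by (intro mult_right_mono power_increasing) auto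
    finally show "(1 / c) ^ j * miss j B \<le> (1 / c) ^ D" by simp
  qed
  have "\<bar>missed_weight (insert z E) (\<phi>(z := p)) xs - missed_weight E \<phi> xs\<bar> \<le> (\<Sum>x\<in>nb z - K. (1 / c) ^ D)"
    unfolding missed_weight_diff[OF assms]
  proof (rule order_trans[OF sum_abs], rule sum_mono)
    fix x assume x: "x \<in> nb z - K"
    then have "x < N" "x \<notin> K" using nb_sub assms(1) by blast+
    then have "card (nb x) \<le> D" "finite (nb x)" using degree_le finite_nb by auto
    then have "card (nb x - E) \<le> D" "card (nb x - insert z E) \<le> D"
      by (meson Diff_subset card_mono le_trans)+
    then show "\<bar>(1 / c) ^ card (nb x - insert z E) * miss (card (nb x - insert z E)) (set xs \<inter> cand E \<phi> x \<inter> Nb p)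
      - (1 / c) ^ card (nb x - E) * miss (card (nb x - E)) (set xs \<inter> cand E \<phi> x)\<bar> \<le> (1 / c) ^ D"
      using w[of "card (nb x - insert z E)" "set xs \<inter> cand E \<phi> x \<inter> Nb p"]
        w[of "card (nb x - E)" "set xs \<inter> cand E \<phi> x"] by linarith
  qed
  then show ?thesis by (simp add: mult.commute)
qed

text \<open>If \<open>xs\<close> already misses the candidate set, then \<open>miss\<close> has the
  value 1, and the factors \<open>1 / c\<close> only enlarge the term.\<close>

lemma card_missed_le: "card {x \<in> {..<N} - K. set xs \<inter> cand E \<phi> x = {}} \<le> missed_weight E \<phi> xs"
proof -
  have "real (card {x \<in> {..<N} - K. set xs \<inter> cand E \<phi> x = {}}) = (\<Sum>x\<in>{x \<in> {..<N} - K. set xs \<inter> cand E \<phi> x = {}}. 1)" by simp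
  also have "\<dots> \<le> (\<Sum>x\<in>{x \<in> {..<N} - K. set xs \<inter> cand E \<phi> x = {}}. (1 / c) ^ card (nb x - E) * miss (card (nb x - E)) (set xs \<inter> cand E \<phi> x))"
    using c_pos c_less by (intro sum_mono) (auto simp: miss_empty)
  also have "\<dots> \<le> missed_weight E \<phi> xs"
    unfolding missed_weight_def using c_pos by (intro sum_mono2) (auto simp: miss_nonneg)
  finally show ?thesis .
qed

text \<open>Before the embedding all candidate sets equal \<open>V\<close>, so this is
  \<open>miss_average\<close> with \<open>\<theta> = 1\<close>; \<open>card (nb x) \<le> D\<close>
  makes the bound uniform over the non-hubs.\<close>

lemma missed_weight_start_average:
  assumes "B \<subseteq> V" "\<delta> * N \<le> d ^ D * card B"
  shows "(\<Sum>xs\<in>bounded_lists s B. missed_weight {} \<phi> xs) \<le> (1 / c) ^ D * (D * \<delta> + (1 - d ^ D) ^ s) * N * card B ^ s"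
proof -
  let ?L = "bounded_lists s B"
  have e: "(\<Sum>xs\<in>?L. (1 / c) ^ card (nb x - {}) * miss (card (nb x - {})) (set xs \<inter> cand {} \<phi> x))
      \<le> (1 / c) ^ D * ((D * \<delta> + (1 - d ^ D) ^ s) * card B ^ s)" if x: "x \<in> {..<N} - K" for x
  proof -
    define j where "j = card (nb x)"
    have j: "j \<le> D" using degree_le x j_def by auto
    have dj: "d ^ D \<le> d ^ j" "d ^ j \<le> 1" using d_pos d_less j by (auto intro: power_decreasing power_le_one)
    have "(\<Sum>xs\<in>?L. miss j (set xs \<inter> V)) \<le> (j * \<delta> + (1 - 1 * d ^ j) ^ s) * card B ^ s"
    proof (rule miss_average)
      show "1 * real (card B) \<le> real (card (B \<inter> V))" using assms(1) by (simp add: Int_absorb2)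
      have "d ^ D * card B \<le> d ^ j * card B" using dj by (intro mult_right_mono) auto
      then show "\<delta> * N \<le> 1 * d ^ j * card B" using assms(2) by simp
    qed (use assms in auto)
    also have "\<dots> \<le> (D * \<delta> + (1 - d ^ D) ^ s) * card B ^ s"
      using j dj \<delta>_pos by (intro mult_right_mono add_mono power_mono) auto
    finally have *: "(\<Sum>xs\<in>?L. miss j (set xs \<inter> V)) \<le> (D * \<delta> + (1 - d ^ D) ^ s) * card B ^ s" .
    have "cand {} \<phi> x = V" by (auto simp: cand_def)
    then have "(\<Sum>xs\<in>?L. (1 / c) ^ card (nb x - {}) * miss (card (nb x - {})) (set xs \<inter> cand {} \<phi> x))
      = (1 / c) ^ j * (\<Sum>xs\<in>?L. miss j (set xs \<inter> V))" by (simp add: j_def sum_distrib_left)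
    also have "\<dots> \<le> (1 / c) ^ D * ((D * \<delta> + (1 - d ^ D) ^ s) * card B ^ s)"
      using * c_pos c_less j by (intro mult_mono power_increasing sum_nonneg) (auto simp: miss_nonneg)
    finally show ?thesis .
  qed
  have "(\<Sum>xs\<in>?L. missed_weight {} \<phi> xs) =
     (\<Sum>x\<in>{..<N} - K. \<Sum>xs\<in>?L. (1 / c) ^ card (nb x - {}) * miss (card (nb x - {})) (set xs \<inter> cand {} \<phi> x))"
    unfolding missed_weight_def by (rule sum.swap)
  also have "\<dots> \<le> (\<Sum>x\<in>{..<N} - K. (1 / c) ^ D * ((D * \<delta> + (1 - d ^ D) ^ s) * card B ^ s))"
    by (intro sum_mono e)
  also have "\<dots> = card ({..<N} - K) * ((1 / c) ^ D * ((D * \<delta> + (1 - d ^ D) ^ s) * card B ^ s))" by simp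
  also have "\<dots> \<le> N * ((1 / c) ^ D * ((D * \<delta> + (1 - d ^ D) ^ s) * card B ^ s))"
  proof (rule mult_right_mono)
    show "real (card ({..<N} - K)) \<le> N" using card_mono[of "{..<N}" "{..<N} - K"] by simp
    have "d ^ D \<le> 1" using d_pos d_less by (intro power_le_one) auto
    then show "0 \<le> (1 / c) ^ D * ((D * \<delta> + (1 - d ^ D) ^ s) * card B ^ s)" using c_pos \<delta>_pos by simp
  qed
  finally show ?thesis by (simp add: mult_ac)
qed

text \<open>Sampling a list from \<open>B\<close> turns control over the polynomially many lists into
  control over all large sets \<open>B\<close>.\<close>

lemma few_sparse_candidates:
  fixes \<kappa> \<epsilon> :: real
  assumes "B \<subseteq> V" "\<delta> * N \<le> d ^ D * card B" "B \<noteq> {}" "0 \<le> \<kappa>" "\<kappa> < 1"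
    and bound: "\<And>xs. xs \<in> bounded_lists s V \<Longrightarrow> missed_weight E \<phi> xs \<le> missed_weight {} \<phi> xs + \<epsilon> * N"
  shows "card {x \<in> {..<N} - K. card (cand E \<phi> x \<inter> B) < \<kappa> * card B} * (1 - \<kappa>) ^ s
     \<le> (\<epsilon> + (1 / c) ^ D * (D * \<delta> + (1 - d ^ D) ^ s)) * N"
proof -
  let ?L = "bounded_lists s B"
  let ?X = "{x \<in> {..<N} - K. card (cand E \<phi> x \<inter> B) < \<kappa> * card B}"
  let ?b = "real (card B)"
  have finB: "finite B" using assms(1) finV finite_subset by blast
  have b0: "0 < ?b ^ s" using finB assms(3) by (simp add: card_gt_0_iff)
  have fin: "finite ?L" using finB finite_bounded_lists by blast
  have Lsub: "?L \<subseteq> bounded_lists s V" using assms(1) by (auto simp: bounded_lists_def)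
  \<comment> \<open>A vertex with too few candidates in \<open>B\<close> is missed by a share of at
    least \<open>(1 - \<kappa>) ^ s\<close> of the lists over \<open>B\<close>. The pairs of such a
    vertex and a list missing it are then counted in both orders.\<close>
  have low: "(1 - \<kappa>) ^ s * ?b ^ s \<le> card {xs \<in> ?L. set xs \<inter> cand E \<phi> x = {}}" if x: "x \<in> ?X" for x
  proof -
    let ?C = "cand E \<phi> x"
    have "(1 - \<kappa>) * ?b \<le> card (B - ?C)"
    proof -
      have "card (B - ?C) = card B - card (B \<inter> ?C)" using finB by (simp add: card_Diff_subset_Int)
      moreover have "card (B \<inter> ?C) \<le> card B" using finB by (simp add: card_mono)
      ultimately show ?thesis using x by (simp add: of_nat_diff algebra_simps Int_commute)
    qed
    then have "((1 - \<kappa>) * ?b) ^ s \<le> real (card (B - ?C)) ^ s" using assms(5) by (intro power_mono) auto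
    also have "\<dots> = card (bounded_lists s (B - ?C))" using finB by (simp add: card_bounded_lists)
    also have "bounded_lists s (B - ?C) = {xs \<in> ?L. set xs \<inter> ?C = {}}" by (auto simp: bounded_lists_def)
    finally show ?thesis by (simp add: power_mult_distrib)
  qed
  have "card ?X * ((1 - \<kappa>) ^ s * ?b ^ s) = (\<Sum>x\<in>?X. (1 - \<kappa>) ^ s * ?b ^ s)" by simp
  also have "\<dots> \<le> (\<Sum>x\<in>?X. real (card {xs \<in> ?L. set xs \<inter> cand E \<phi> x = {}}))"
    by (intro sum_mono low)
  also have "\<dots> = (\<Sum>x\<in>?X. \<Sum>xs\<in>?L. if set xs \<inter> cand E \<phi> x = {} then 1 else 0)"
    using fin by (simp add: sum.If_cases Collect_conj_eq Int_commute)
  also have "\<dots> = (\<Sum>xs\<in>?L. \<Sum>x\<in>?X. if set xs \<inter> cand E \<phi> x = {} then 1 else 0)" by (rule sum.swap)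
  also have "\<dots> \<le> (\<Sum>xs\<in>?L. missed_weight {} \<phi> xs + \<epsilon> * N)"
  proof (rule sum_mono)
    fix xs assume xs: "xs \<in> ?L"
    have "(\<Sum>x\<in>?X. if set xs \<inter> cand E \<phi> x = {} then 1 else 0::real) = card (?X \<inter> {x. set xs \<inter> cand E \<phi> x = {}})"
      by (simp add: sum.If_cases)
    also have "\<dots> \<le> card {x \<in> {..<N} - K. set xs \<inter> cand E \<phi> x = {}}"
      by (intro of_nat_mono card_mono) auto
    also have "\<dots> \<le> missed_weight E \<phi> xs" by (rule card_missed_le)
    also have "\<dots> \<le> missed_weight {} \<phi> xs + \<epsilon> * N" using bound xs Lsub by blast
    finally show "(\<Sum>x\<in>?X. if set xs \<inter> cand E \<phi> x = {} then 1 else 0) \<le> missed_weight {} \<phi> xs + \<epsilon> * N" .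
  qed
  also have "\<dots> = (\<Sum>xs\<in>?L. missed_weight {} \<phi> xs) + ?b ^ s * (\<epsilon> * N)"
    using finB by (simp add: sum.distrib card_bounded_lists)
  also have "\<dots> \<le> (1 / c) ^ D * (D * \<delta> + (1 - d ^ D) ^ s) * N * ?b ^ s + ?b ^ s * (\<epsilon> * N)"
    using missed_weight_start_average[OF assms(1,2), of \<phi> s] by simp
  finally have "card ?X * (1 - \<kappa>) ^ s * ?b ^ s \<le> ((\<epsilon> + (1 / c) ^ D * (D * \<delta> + (1 - d ^ D) ^ s)) * N) * ?b ^ s"
    by (simp add: algebra_simps)
  then show ?thesis using b0 by simp
qed

end

section \<open>Embedding the hubs and the neighbours of the buffer\<close>

lemma card_UN_le_mult:
  fixes b :: real
  assumes "finite X" "\<And>x. x \<in> X \<Longrightarrow> card (f x) \<le> b" "card X \<le> n" "0 \<le> b"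
  shows "card (\<Union>x\<in>X. f x) \<le> n * b"
proof -
  have "real (card (\<Union>x\<in>X. f x)) \<le> (\<Sum>x\<in>X. real (card (f x)))"
    using card_UN_le[OF assms(1), of f] by (simp flip: of_nat_sum)
  also have "\<dots> \<le> (\<Sum>x\<in>X. b)" by (intro sum_mono assms(2))
  also have "\<dots> = card X * b" by simp
  also have "\<dots> \<le> n * b" using assms(3,4) by (intro mult_right_mono) auto
  finally show ?thesis .
qed

lemma card_Diff_ge_real:
  assumes "finite Y"
  shows "real (card X) - real (card Y) \<le> real (card (X - Y))"
  using diff_card_le_card_Diff[OF assms, of X] by linarith

text \<open>Let \<open>m\<close> be the rightmost left neighbour of \<open>z\<close>. The other left
  neighbours lie left of \<open>m\<close> and share with \<open>m\<close> the neighbour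
  \<open>z\<close>, which is right of \<open>m\<close>; so there are at most \<open>a\<close> of
  them, and \<open>m\<close> is the extra one.\<close>

lemma left_degree_le:
  fixes nb :: "nat \<Rightarrow> nat set"
  assumes nb_sym: "\<And>x z. x < N \<Longrightarrow> z \<in> nb x \<Longrightarrow> x \<in> nb z"
    and arr: "\<And>z. z < N \<Longrightarrow> card {j. j < z \<and> (\<exists>k. z < k \<and> k < N \<and> k \<in> nb z \<and> k \<in> nb j)} \<le> a"
    and zN: "z < N"
  shows "card {u. u < z \<and> u \<in> nb z} \<le> a + 1"
proof (cases "{u. u < z \<and> u \<in> nb z} = {}")
  case True then show ?thesis by (simp only: card.empty)
next
  case False
  let ?L = "{u. u < z \<and> u \<in> nb z}"
  have fin: "finite ?L" by simp
  define m where "m = Max ?L"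
  have m: "m < z" "m \<in> nb z" using Max_in[OF fin False] m_def by auto
  have mN: "m < N" using m zN by simp
  have zm: "z \<in> nb m" using nb_sym[OF zN m(2)] .
  have "?L - {m} \<subseteq> {j. j < m \<and> (\<exists>k. m < k \<and> k < N \<and> k \<in> nb m \<and> k \<in> nb j)}"
  proof
    fix j assume j: "j \<in> ?L - {m}"
    then have "j \<le> m" using Max_ge[OF fin] m_def by auto
    then have "j < m" using j by auto
    moreover have "z \<in> nb j" using nb_sym[OF zN] j by auto
    ultimately show "j \<in> {j. j < m \<and> (\<exists>k. m < k \<and> k < N \<and> k \<in> nb m \<and> k \<in> nb j)}"
      using m zm zN by auto
  qed
  then have "card (?L - {m}) \<le> card {j. j < m \<and> (\<exists>k. m < k \<and> k < N \<and> k \<in> nb m \<and> k \<in> nb j)}"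
    by (rule card_mono[rotated]) simp
  then have "card (?L - {m}) \<le> a" using arr[OF mN] by linarith
  moreover have "card (?L - {m}) = card ?L - 1" using m by (intro card_Diff_singleton) auto
  ultimately show ?thesis by linarith
qed

text \<open>\<open>K\<close> is the set of hubs, \<open>I\<close> the buffer; hubs are embedded into \<open>V0\<close>, the neighbours of the
  buffer into its complement, so that neither phase can exhaust the candidates of the other.\<close>

locale first_phase = guest_in_host V Nb d \<delta> nb K D c
  for V :: "'v set" and Nb :: "'v \<Rightarrow> 'v set" and d \<delta> :: real and nb :: "nat \<Rightarrow> nat set"
    and K :: "nat set" and D :: nat and c :: real +
  fixes a :: nat and I :: "nat set" and V0 :: "'v set" and \<tau> c1 \<mu> :: real and s :: nat
  assumes arr: "\<And>z. z < N \<Longrightarrow> card {j. j < z \<and> (\<exists>k. z < k \<and> k < N \<and> k \<in> nb z \<and> k \<in> nb j)} \<le> a"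
    and I_sub: "I \<subseteq> {..<N} - K"
    and V0_sub: "V0 \<subseteq> V"
    and \<tau>_pos: "0 < \<tau>"
    and deg_V0: "\<And>v. v \<in> V \<Longrightarrow> \<tau> * N \<le> card (Nb v \<inter> V0)"
    and deg_V1: "\<And>v. v \<in> V \<Longrightarrow> \<tau> * N \<le> card (Nb v - V0)"
    and K_small: "card K \<le> d ^ (a + 1) * \<tau> / 4 * N"
    and NI_small: "card (\<Union>(nb ` I)) \<le> d ^ D * \<tau> / 4 * N"
    and aD: "a + 1 \<le> D"
    and \<delta>_small: "(2 ^ (a + 1) + a + 1 + 2 * D) * \<delta> \<le> d ^ D * \<tau> / 4"
    and c1_def: "c1 = d ^ D * \<tau> / 2"
    and c_le_c1: "c \<le> c1"
    and \<mu>_pos: "0 < \<mu>"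
begin

lemma dD: "0 < d ^ D" "d ^ D \<le> 1" using d_pos d_less by (auto intro: power_le_one)

lemma d_power_ge: "j \<le> D \<Longrightarrow> d ^ D \<le> d ^ j"
  using d_pos d_less by (intro power_decreasing) auto

lemma \<tau>_le: "\<tau> \<le> 1"
proof -
  obtain v where v: "v \<in> V" using V_ne by blast
  have "\<tau> * N \<le> card (Nb v \<inter> V0)" by (rule deg_V0[OF v])
  also have "\<dots> \<le> N" using V0_sub finV by (intro of_nat_mono card_mono) auto
  finally show ?thesis using N_pos by simp
qed

lemma c1_bounds: "0 < c1" "c1 \<le> 1 / 2"
proof -
  show "0 < c1" unfolding c1_def using mult_pos_pos[OF dD(1) \<tau>_pos] by simp
  have "d ^ D * \<tau> \<le> 1 * 1" using dD \<tau>_le \<tau>_pos by (intro mult_mono) auto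
  then show "c1 \<le> 1 / 2" using c1_def by simp
qed

lemma \<delta>_le: "\<delta> \<le> d ^ D * \<tau>" "D * \<delta> \<le> c1 / 2"
proof -
  have "1 * \<delta> \<le> (2 ^ (a + 1) + a + 1 + 2 * D) * \<delta>" using \<delta>_pos by (intro mult_right_mono) auto
  then show "\<delta> \<le> d ^ D * \<tau>" using \<delta>_small dD \<tau>_pos mult_pos_pos[OF dD(1) \<tau>_pos] by linarith
  have "(2 * D) * \<delta> \<le> (2 ^ (a + 1) + a + 1 + 2 * D) * \<delta>" using \<delta>_pos by (intro mult_right_mono) auto
  then show "D * \<delta> \<le> c1 / 2" using \<delta>_small c1_def mult_pos_pos[OF dD(1) \<tau>_pos] by linarith
qed

section \<open>Order and invariant of the first phase\<close>

definition side :: "nat \<Rightarrow> 'v set" where "side x = (if x \<in> K then V0 else V - V0)"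

lemma side_sub: "side x \<subseteq> V" using V0_sub by (auto simp: side_def)

lemma Nb_side: assumes "v \<in> V" shows "\<tau> * N \<le> card (Nb v \<inter> side x)"
proof (cases "x \<in> K")
  case True then show ?thesis using deg_V0[OF assms] by (simp add: side_def)
next
  case False
  have "Nb v \<inter> (V - V0) = Nb v - V0" using Nb_sub[OF assms] by auto
  then show ?thesis using False deg_V1[OF assms] by (simp add: side_def)
qed

lemma card_side: "\<tau> * N \<le> card (side x)"
proof -
  obtain v where v: "v \<in> V" using V_ne by blast
  have "card (Nb v \<inter> side x) \<le> card (side x)"
    using finite_subset[OF side_sub finV] by (intro card_mono) auto
  then show ?thesis using Nb_side[OF v, of x] by linarith
qed

text \<open>The embedding order of the first phase: hubs keep their arrangeable order, and all other
  vertices are shifted behind them.\<close>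

definition rk :: "nat \<Rightarrow> nat" where "rk x = (if x \<in> K then x else N + x)"

definition P :: "nat set" where "P = K \<union> \<Union>(nb ` I)"

definition seg :: "nat \<Rightarrow> nat set" where "seg t = {x \<in> P. rk x < t}"

lemma P_sub: "P \<subseteq> {..<N}"
proof -
  have "nb y \<subseteq> {..<N}" if "y \<in> I" for y using nb_sub I_sub that by blast
  then show ?thesis using K_sub unfolding P_def by blast
qed

lemma seg_sub: "seg t \<subseteq> {..<N}" using P_sub by (auto simp: seg_def)

lemma rk_eq: "rk x = rk z \<Longrightarrow> x < N \<Longrightarrow> z < N \<Longrightarrow> x = z"
  by (auto simp: rk_def split: if_splits)

lemma card_left_nb: "z < N \<Longrightarrow> card {u. u < z \<and> u \<in> nb z} \<le> a + 1"
  using left_degree_le[where nb = nb and N = N] nb_sym arr by simp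

text \<open>Whatever is embedded before a hub is a hub to its left, so the bound on left degrees
  limits its embedded neighbours although its degree is not bounded.\<close>

lemma card_nb_seg:
  assumes "x < N" "x \<notin> seg t" "x \<in> K \<Longrightarrow> x \<in> P"
  shows "card (nb x \<inter> seg t) \<le> (if x \<in> K then a + 1 else D)"
proof (cases "x \<in> K")
  case True
  then have "x \<in> P" using assms(3) by blast
  then have "t \<le> x" using assms(2) True by (auto simp: seg_def rk_def)
  then have "u < x" if "u \<in> seg t" for u using that assms(1) by (auto simp: seg_def rk_def split: if_splits)
  then have "nb x \<inter> seg t \<subseteq> {u. u < x \<and> u \<in> nb x}" by auto
  then have "card (nb x \<inter> seg t) \<le> card {u. u < x \<and> u \<in> nb x}" by (intro card_mono) auto
  then show ?thesis using card_left_nb[OF assms(1)] True by simp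
next
  case False
  have "card (nb x \<inter> seg t) \<le> card (nb x)" using finite_nb[OF assms(1)] by (intro card_mono) auto
  then show ?thesis using degree_le[OF assms(1) False] False by simp
qed

lemma card_nb_seg_D:
  assumes "x < N" "x \<notin> seg t" shows "card (nb x \<inter> seg t) \<le> D"
proof -
  have "x \<in> K \<Longrightarrow> x \<in> P" by (auto simp: P_def)
  from card_nb_seg[OF assms this] show ?thesis using aD by (auto split: if_splits)
qed

definition embedded :: "nat set \<Rightarrow> (nat \<Rightarrow> 'v) \<Rightarrow> bool" where
  "embedded E \<phi> \<longleftrightarrow> inj_on \<phi> E \<and> \<phi> ` E \<subseteq> V \<and> (\<forall>x\<in>E. \<forall>z\<in>nb x \<inter> E. \<phi> z \<in> Nb (\<phi> x))"

lemma embedded_insert: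
  assumes "embedded E \<phi>" "E \<subseteq> {..<N}" "z < N" "z \<notin> E" "p \<in> cand E \<phi> z" "p \<notin> \<phi> ` E"
  shows "embedded (insert z E) (\<phi>(z := p))"
  unfolding embedded_def
proof (intro conjI ballI)
  have e: "inj_on \<phi> E" "\<phi> ` E \<subseteq> V" "\<And>x w. x \<in> E \<Longrightarrow> w \<in> nb x \<inter> E \<Longrightarrow> \<phi> w \<in> Nb (\<phi> x)"
    using assms(1) by (auto simp: embedded_def)
  have pV: "p \<in> V" using assms(5) cand_sub by blast
  have upd: "(\<phi>(z := p)) w = \<phi> w" if "w \<in> E" for w using that assms(4) by auto
  show "inj_on (\<phi>(z := p)) (insert z E)"
    using e(1) assms(4,6) by (auto simp: inj_on_def)
  show "(\<phi>(z := p)) ` insert z E \<subseteq> V" using e(2) pV assms(4) by auto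
  fix x w assume x: "x \<in> insert z E" and w: "w \<in> nb x \<inter> insert z E"
  have pz: "p \<in> Nb (\<phi> u)" if "u \<in> nb z \<inter> E" for u using assms(5) that by (auto simp: cand_def)
  show "(\<phi>(z := p)) w \<in> Nb ((\<phi>(z := p)) x)"
  proof (cases "x = z")
    case True
    then have wE: "w \<in> nb z \<inter> E" using w nb_irrefl by auto
    then have "\<phi> w \<in> V" using e(2) by auto
    then have "\<phi> w \<in> Nb p" using Nb_sym[OF _ pV] pz[OF wE] by blast
    then show ?thesis using True upd wE by simp
  next
    case False
    then have xE: "x \<in> E" using x by blast
    then have xN: "x < N" using assms(2) by blast
    show ?thesis
    proof (cases "w = z")
      case True
      then have "x \<in> nb z \<inter> E" using w xE nb_sym[OF xN] by blast
      then show ?thesis using pz True upd[OF xE] by simp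
    next
      case False
      then have "w \<in> nb x \<inter> E" using w by blast
      then show ?thesis using e(3)[OF xE] upd[OF xE] upd[of w] by simp
    qed
  qed
qed

text \<open>The bound on candidates also covers vertices outside \<open>P\<close>, because the
  second phase starts from it. Counting within the own side keeps the candidates of non-hubs apart
  from the images of hubs.\<close>

definition inv1 :: "nat set \<Rightarrow> (nat \<Rightarrow> 'v) \<Rightarrow> bool" where
  "inv1 E \<phi> \<longleftrightarrow> embedded E \<phi> \<and> (\<forall>x\<in>E. \<phi> x \<in> side x) \<and>
    (\<forall>x\<in>{..<N} - E. d ^ card (nb x \<inter> E) * card (side x) \<le> card (cand E \<phi> x \<inter> side x))"

definition choices :: "nat set \<Rightarrow> (nat \<Rightarrow> 'v) \<Rightarrow> nat \<Rightarrow> 'v set" where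
  "choices E \<phi> z = cand E \<phi> z \<inter> side z - \<phi> ` E - (\<Union>x\<in>nb z - E. atypical V Nb d (cand E \<phi> x \<inter> side x))"

lemma choices_sub: "choices E \<phi> z \<subseteq> V" using cand_sub by (auto simp: choices_def)

lemma inv1_step:
  assumes "inv1 E \<phi>" "E \<subseteq> {..<N}" "z < N" "z \<notin> E" "p \<in> choices E \<phi> z"
  shows "inv1 (insert z E) (\<phi>(z := p))"
  unfolding inv1_def
proof (intro conjI ballI)
  have p: "p \<in> cand E \<phi> z" "p \<in> side z" "p \<notin> \<phi> ` E" "p \<in> V"
    "\<And>x. x \<in> nb z - E \<Longrightarrow> p \<notin> atypical V Nb d (cand E \<phi> x \<inter> side x)"
    using assms(5) cand_sub by (auto simp: choices_def)
  show "embedded (insert z E) (\<phi>(z := p))"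
    using assms p by (intro embedded_insert) (auto simp: inv1_def)
  show "(\<phi>(z := p)) x \<in> side x" if "x \<in> insert z E" for x
    using that assms(1) p(2) by (auto simp: inv1_def)
  fix x assume x: "x \<in> {..<N} - insert z E"
  then have old: "d ^ card (nb x \<inter> E) * card (side x) \<le> card (cand E \<phi> x \<inter> side x)"
    using assms(1) by (auto simp: inv1_def)
  show "d ^ card (nb x \<inter> insert z E) * card (side x) \<le> card (cand (insert z E) (\<phi>(z := p)) x \<inter> side x)"
  proof (cases "z \<in> nb x")
    case True
    then have xz: "x \<in> nb z - E" using x nb_sym[of x z] by auto
    have "d * (d ^ card (nb x \<inter> E) * card (side x)) \<le> d * card (cand E \<phi> x \<inter> side x)"
      using old d_pos by (intro mult_left_mono) auto
    also have "\<dots> \<le> card (cand E \<phi> x \<inter> side x \<inter> Nb p)" using typicalD[OF p(4) p(5)[OF xz]] .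
    also have "cand E \<phi> x \<inter> side x \<inter> Nb p = cand (insert z E) (\<phi>(z := p)) x \<inter> side x"
      unfolding cand_update[OF assms(4)] using True by auto
    finally show ?thesis using card_done_insert[OF True assms(4)] x by (simp add: mult_ac)
  next
    case False
    then have "nb x \<inter> insert z E = nb x \<inter> E" by auto
    then show ?thesis using old False unfolding cand_update[OF assms(4)] by simp
  qed
qed

text \<open>The essential use of arrangeability. A hub \<open>z\<close> may have many neighbours
  still to be embedded, but if such an \<open>x\<close> lies right of \<open>z\<close>, then
  \<open>nb x \<inter> E\<close> consists of vertices left of \<open>z\<close> that share with
  \<open>z\<close> the neighbour \<open>x\<close>; it is a subset of one fixed set of size at most
  \<open>a\<close>. With two sides this gives at most \<open>2 ^ (a + 1)\<close> candidate sets. At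
  most \<open>a + 1\<close> neighbours lie to the left, and a non-hub has at most \<open>D\<close>
  neighbours altogether.\<close>

lemma card_candidate_families:
  assumes "z \<in> P"
  shows "card ((\<lambda>x. cand (seg (rk z)) \<phi> x \<inter> side x) ` (nb z - seg (rk z))) \<le> 2 ^ (a + 1) + a + 1 + D"
proof -
  let ?E = "seg (rk z)"
  let ?S = "\<lambda>x. cand ?E \<phi> x \<inter> side x"
  have zN: "z < N" using assms P_sub by blast
  show ?thesis
  proof (cases "z \<in> K")
    case False
    have "card (?S ` (nb z - ?E)) \<le> card (nb z - ?E)" using finite_nb[OF zN] by (intro card_image_le) auto
    also have "\<dots> \<le> card (nb z)" using finite_nb[OF zN] by (intro card_mono) auto
    also have "\<dots> \<le> D" by (rule degree_le[OF zN False])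
    finally show ?thesis by simp
  next
    case True
    let ?L = "{u. u < z \<and> u \<in> nb z}"
    let ?A = "{j. j < z \<and> (\<exists>k. z < k \<and> k < N \<and> k \<in> nb z \<and> k \<in> nb j)}"
    define G where "G = (\<lambda>(L, b). {p \<in> V. \<forall>w\<in>L. p \<in> Nb (\<phi> w)} \<inter> (if b then V0 else V - V0))"
    have E: "u < z" if "u \<in> ?E" for u using that zN True by (auto simp: seg_def rk_def split: if_splits)
    have "?S ` (nb z - ?E) \<subseteq> ?S ` ?L \<union> G ` (Pow ?A \<times> UNIV)"
    proof
      fix T assume "T \<in> ?S ` (nb z - ?E)"
      then obtain x where x: "x \<in> nb z" "x \<notin> ?E" "T = ?S x" by blast
      have xN: "x < N" using x nb_sub[OF zN] by blast
      have "x \<noteq> z" using x nb_irrefl by blast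
      then consider "x < z" | "z < x" by linarith
      then show "T \<in> ?S ` ?L \<union> G ` (Pow ?A \<times> UNIV)"
      proof cases
        case 1 then show ?thesis using x by blast
      next
        case 2
        have "nb x \<inter> ?E \<subseteq> ?A"
        proof
          fix j assume j: "j \<in> nb x \<inter> ?E"
          then have "x \<in> nb j" using nb_sym[OF xN] by blast
          then show "j \<in> ?A" using j E 2 x xN by auto
        qed
        moreover have "T = G (nb x \<inter> ?E, x \<in> K)"
          unfolding x(3) G_def by (simp add: cand_def side_def)
        ultimately show ?thesis by blast
      qed
    qed
    moreover have finA: "finite ?A" by simp
    ultimately have "card (?S ` (nb z - ?E)) \<le> card (?S ` ?L \<union> G ` (Pow ?A \<times> UNIV))"
      by (intro card_mono) auto
    also have "\<dots> \<le> card (?S ` ?L) + card (G ` (Pow ?A \<times> UNIV))" by (rule card_Un_le)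
    also have "\<dots> \<le> card ?L + card (Pow ?A \<times> (UNIV :: bool set))"
      using finA by (intro add_mono card_image_le) auto
    also have "\<dots> = card ?L + 2 ^ card ?A * 2" using finA by (simp add: card_cartesian_product card_Pow)
    also have "\<dots> \<le> (a + 1) + 2 ^ a * 2"
      using card_left_nb[OF zN] arr[OF zN] by (intro add_mono mult_right_mono power_increasing) auto
    finally show ?thesis by simp
  qed
qed

text \<open>Quasirandomness is charged once for each distinct candidate set, not once for each
  neighbour.\<close>

lemma card_excluded:
  assumes "inv1 (seg (rk z)) \<phi>" "z \<in> P"
  shows "card (\<Union>x\<in>nb z - seg (rk z). atypical V Nb d (cand (seg (rk z)) \<phi> x \<inter> side x))
    \<le> (2 ^ (a + 1) + a + 1 + D) * (\<delta> * N)"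
proof -
  let ?E = "seg (rk z)"
  have zN: "z < N" using assms P_sub by blast
  let ?F = "(\<lambda>x. cand ?E \<phi> x \<inter> side x) ` (nb z - ?E)"
  have b: "card (atypical V Nb d T) \<le> \<delta> * N" if T: "T \<in> ?F" for T
  proof -
    obtain x where x: "x \<in> nb z" "x \<notin> ?E" "T = cand ?E \<phi> x \<inter> side x" using T by blast
    have xN: "x < N" using x nb_sub[OF zN] by blast
    have "d ^ card (nb x \<inter> ?E) * card (side x) \<le> card T" using assms(1) x xN by (auto simp: inv1_def)
    moreover have "d ^ D * (\<tau> * N) \<le> d ^ card (nb x \<inter> ?E) * card (side x)"
      using d_power_ge[OF card_nb_seg_D[OF xN x(2)]] card_side[of x] \<tau>_pos d_pos by (intro mult_mono) auto
    moreover have "\<delta> * N \<le> d ^ D * \<tau> * N" using \<delta>_le by (intro mult_right_mono) auto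
    ultimately have "\<delta> * N \<le> card T" by simp
    then show ?thesis using x cand_sub by (intro card_atypical) auto
  qed
  have "card (\<Union>T\<in>?F. atypical V Nb d T) \<le> real (2 ^ (a + 1) + a + 1 + D) * (\<delta> * N)"
  proof (rule card_UN_le_mult[OF _ b card_candidate_families[OF assms(2)]])
    show "finite ?F" using finite_nb[OF zN] by simp
  qed (use \<delta>_pos in auto)
  then show ?thesis by (simp add: UN_extend_simps algebra_simps)
qed

text \<open>Stated for a subset \<open>X\<close> of the candidates because it is applied to all of
  them and also to those inside \<open>Nb v\<close>. With \<open>j\<close> embedded neighbours, the
  occupied vertices cost at most a quarter of \<open>d ^ j * \<tau> * N\<close>, and the atypical
  ones together with the reserve \<open>D * \<delta> * N\<close> another quarter; \<open>c1\<close>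
  fits the remaining half. The reserve is spent in \<open>alive_step\<close>.\<close>

lemma choices_large:
  assumes "inv1 (seg (rk z)) \<phi>" "z \<in> P"
    and X: "X \<subseteq> cand (seg (rk z)) \<phi> z \<inter> side z" "d ^ card (nb z \<inter> seg (rk z)) * (\<tau> * N) \<le> card X"
  shows "c1 * N + D * \<delta> * N \<le> card (X \<inter> choices (seg (rk z)) \<phi> z)"
proof -
  let ?E = "seg (rk z)"
  let ?B = "\<Union>x\<in>nb z - ?E. atypical V Nb d (cand ?E \<phi> x \<inter> side x)"
  have zN: "z < N" using assms P_sub by blast
  have zE: "z \<notin> ?E" by (simp add: seg_def)
  have finX: "finite X" by (rule finite_subset[OF X(1)]) (simp add: finite_cand)
  have finE: "finite ?E" by (rule finite_subset[OF seg_sub finite_lessThan])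
  let ?j = "card (nb z \<inter> ?E)"
  have jD: "d ^ D \<le> d ^ ?j" using d_power_ge[OF card_nb_seg_D[OF zN zE]] .
  have used: "card (X \<inter> \<phi> ` ?E) \<le> d ^ ?j * \<tau> / 4 * N"
  proof (cases "z \<in> K")
    case True
    have "?E \<subseteq> K" using zN True by (auto simp: seg_def rk_def split: if_splits)
    then have "card ?E \<le> card K" by (rule card_mono[OF finite_subset[OF K_sub finite_lessThan]])
    then have "card (\<phi> ` ?E) \<le> card K" using card_image_le[OF finE, of \<phi>] by linarith
    moreover have "card (X \<inter> \<phi> ` ?E) \<le> card (\<phi> ` ?E)" using finE by (intro card_mono) auto
    moreover have "?j \<le> a + 1" using card_nb_seg[OF zN zE] assms(2) True by auto
    then have "d ^ (a + 1) \<le> d ^ ?j" using d_pos d_less by (intro power_decreasing) auto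
    then have "d ^ (a + 1) * \<tau> / 4 * N \<le> d ^ ?j * \<tau> / 4 * N"
      using \<tau>_pos by (intro mult_right_mono divide_right_mono) auto
    ultimately show ?thesis using K_small by linarith
  next
    case False
    have finNI: "finite (\<Union>(nb ` I))"
      by (rule finite_subset[OF _ finite_lessThan[of N]]) (use P_sub in \<open>auto simp: P_def\<close>)
    \<comment> \<open>\<open>X\<close> lies on the side of the non-hub \<open>z\<close>, where no
      hub has been placed.\<close>
    have "X \<inter> \<phi> ` ?E \<subseteq> \<phi> ` (?E - K)"
    proof
      fix q assume q: "q \<in> X \<inter> \<phi> ` ?E"
      then obtain x where x: "x \<in> ?E" "q = \<phi> x" by blast
      have "q \<in> side x" "q \<in> side z" using x q X(1) assms(1) by (auto simp: inv1_def)
      then have "x \<notin> K" using False by (auto simp: side_def)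
      then show "q \<in> \<phi> ` (?E - K)" using x by blast
    qed
    moreover have "?E - K \<subseteq> \<Union>(nb ` I)" by (auto simp: seg_def P_def)
    ultimately have "card (X \<inter> \<phi> ` ?E) \<le> card (\<phi> ` (?E - K))" "card (?E - K) \<le> card (\<Union>(nb ` I))"
      using finE finNI by (auto intro!: card_mono)
    then have "card (X \<inter> \<phi> ` ?E) \<le> card (\<Union>(nb ` I))"
      using card_image_le[of "?E - K" \<phi>] finE by simp
    moreover have "d ^ D * \<tau> / 4 * N \<le> d ^ ?j * \<tau> / 4 * N"
      using \<tau>_pos jD by (intro mult_right_mono divide_right_mono) auto
    ultimately show ?thesis using NI_small by linarith
  qed
  have finB: "finite ?B" by (rule finite_subset[OF _ finV]) (auto simp: atypical_def)
  have eq: "X \<inter> choices ?E \<phi> z = X - X \<inter> \<phi> ` ?E - ?B" using X(1) by (auto simp: choices_def)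
  have "card X - real (card (X \<inter> \<phi> ` ?E)) \<le> card (X - X \<inter> \<phi> ` ?E)"
    using finX by (intro card_Diff_ge_real) auto
  moreover have "card (X - X \<inter> \<phi> ` ?E) - real (card ?B) \<le> card (X - X \<inter> \<phi> ` ?E - ?B)"
    using finX finB by (intro card_Diff_ge_real) auto
  moreover have "card ?B \<le> (2 ^ (a + 1) + a + 1 + D) * (\<delta> * N)" by (rule card_excluded[OF assms(1,2)])
  ultimately have 1: "d ^ ?j * (\<tau> * N) - d ^ ?j * \<tau> / 4 * N - (2 ^ (a + 1) + a + 1 + D) * (\<delta> * N)
     \<le> card (X \<inter> choices ?E \<phi> z)"
    using used X(2) unfolding eq by linarith
  have 2: "(3 / 4) * d ^ D * \<tau> * N \<le> (3 / 4) * d ^ ?j * \<tau> * N"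
    using jD \<tau>_pos by (intro mult_right_mono mult_left_mono) auto
  have 3: "(2 ^ (a + 1) + a + 1 + 2 * D) * \<delta> * N \<le> d ^ D * \<tau> / 4 * N"
    using \<delta>_small by (intro mult_right_mono) auto
  have "c1 * N + D * \<delta> * N = (3 / 4) * d ^ D * \<tau> * N - d ^ D * \<tau> / 4 * N + D * \<delta> * N"
    by (simp add: c1_def algebra_simps)
  also have "\<dots> \<le> (3 / 4) * d ^ ?j * \<tau> * N - (2 ^ (a + 1) + a + 1 + D) * (\<delta> * N)"
    using 2 3 by (simp add: algebra_simps)
  also have "\<dots> = d ^ ?j * (\<tau> * N) - d ^ ?j * \<tau> / 4 * N - (2 ^ (a + 1) + a + 1 + D) * (\<delta> * N)"
    by (simp add: algebra_simps)
  finally show ?thesis using 1 by linarith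
qed

lemma card_choices:
  assumes "inv1 (seg (rk z)) \<phi>" "z \<in> P"
  shows "c1 * N + D * \<delta> * N \<le> card (choices (seg (rk z)) \<phi> z)"
proof -
  let ?E = "seg (rk z)"
  let ?X = "cand ?E \<phi> z \<inter> side z"
  have zN: "z < N" using assms P_sub by blast
  have "z \<notin> ?E" by (simp add: seg_def)
  then have "d ^ card (nb z \<inter> ?E) * card (side z) \<le> card ?X" using assms zN by (auto simp: inv1_def)
  moreover have "d ^ card (nb z \<inter> ?E) * (\<tau> * N) \<le> d ^ card (nb z \<inter> ?E) * card (side z)"
    using card_side d_pos by (intro mult_left_mono) auto
  ultimately have "c1 * N + D * \<delta> * N \<le> card (?X \<inter> choices ?E \<phi> z)"
    by (intro choices_large assms) auto
  moreover have "?X \<inter> choices ?E \<phi> z = choices ?E \<phi> z" by (auto simp: choices_def)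
  ultimately show ?thesis by simp
qed

text \<open>\<open>alive E \<phi> y v\<close> says that the neighbours of the buffer vertex \<open>y\<close> may still all be mapped into
  \<open>Nb v\<close>, which would make \<open>v\<close> a candidate for \<open>y\<close>. Only the vertices in \<open>Rel y\<close> can destroy this.\<close>

definition alive :: "nat set \<Rightarrow> (nat \<Rightarrow> 'v) \<Rightarrow> nat \<Rightarrow> 'v \<Rightarrow> bool" where
  "alive E \<phi> y v \<longleftrightarrow> (\<forall>x\<in>nb y. if x \<in> E then \<phi> x \<in> Nb v
     else d ^ card (nb x \<inter> E) * (\<tau> * N) \<le> card (cand E \<phi> x \<inter> Nb v \<inter> side x))"

definition Rel :: "nat \<Rightarrow> nat set" where
  "Rel y = {z \<in> P. z \<in> nb y \<or> (\<exists>x\<in>nb y. z \<in> nb x \<and> rk z < rk x)}"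

text \<open>By \<open>alive_step\<close>, embedding a vertex of \<open>Rel y\<close> keeps
  \<open>y\<close> alive for at least a share \<open>c1\<close> of the choices, so the powers of
  \<open>c1\<close> give the sum a nonnegative drift. Once \<open>P\<close> is embedded they have
  disappeared, and the sum counts buffer vertices for which \<open>v\<close> is a candidate.\<close>

definition alive_weight :: "nat set \<Rightarrow> (nat \<Rightarrow> 'v) \<Rightarrow> 'v \<Rightarrow> real" where
  "alive_weight E \<phi> v = (\<Sum>y\<in>I. if alive E \<phi> y v then c1 ^ card (Rel y - E) else 0)"

lemma finite_Rel: "finite (Rel y)"
  by (rule finite_subset[OF _ finite_lessThan[of N]]) (use P_sub in \<open>auto simp: Rel_def\<close>)

lemma finite_I: "finite I" by (rule finite_subset[OF I_sub]) auto

text \<open>If \<open>z\<close> is a neighbour of \<open>y\<close>, the choices inside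
  \<open>Nb v\<close> still number at least \<open>c1 * N\<close> after the atypical ones are
  removed, by the reserve in \<open>choices_large\<close>. Otherwise only atypical choices do harm,
  and they are at most half of all choices, while \<open>c1 \<le> 1 / 2\<close>.\<close>

lemma alive_step:
  assumes "inv1 (seg (rk z)) \<phi>" "z \<in> P" "y \<in> I" "v \<in> V" "alive (seg (rk z)) \<phi> y v"
  shows "c1 * card (choices (seg (rk z)) \<phi> z)
    \<le> card {p \<in> choices (seg (rk z)) \<phi> z. alive (insert z (seg (rk z))) (\<phi>(z := p)) y v}"
proof -
  let ?E = "seg (rk z)"
  let ?A = "choices ?E \<phi> z"
  let ?S = "\<lambda>x. cand ?E \<phi> x \<inter> Nb v \<inter> side x"
  let ?B = "\<Union>x\<in>nb y - ?E. atypical V Nb d (?S x)"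
  let ?G = "(if z \<in> nb y then ?A \<inter> Nb v else ?A) - ?B"
  have zN: "z < N" using assms P_sub by blast
  have zE: "z \<notin> ?E" by (simp add: seg_def)
  have yN: "y < N" "y \<notin> K" using assms(3) I_sub by auto
  have finA: "finite ?A" using choices_sub finV by (rule finite_subset)
  have finB: "finite ?B" by (rule finite_subset[OF _ finV]) (auto simp: atypical_def)
  have al: "d ^ card (nb x \<inter> ?E) * (\<tau> * N) \<le> card (?S x)" if "x \<in> nb y" "x \<notin> ?E" for x
    using assms(5) that by (auto simp: alive_def)
  have cB: "card ?B \<le> D * (\<delta> * N)"
  proof (rule card_UN_le_mult)
    show "finite (nb y - ?E)" using finite_nb[OF yN(1)] by simp
    have "card (nb y - ?E) \<le> card (nb y)" using finite_nb[OF yN(1)] by (intro card_mono) auto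
    then show "card (nb y - ?E) \<le> D" using degree_le[OF yN] by simp
    fix x assume x: "x \<in> nb y - ?E"
    then have xN: "x < N" using nb_sub[OF yN(1)] by blast
    have "d ^ D * (\<tau> * N) \<le> d ^ card (nb x \<inter> ?E) * (\<tau> * N)"
      using d_power_ge[OF card_nb_seg_D[OF xN]] x \<tau>_pos by (intro mult_right_mono) auto
    moreover have "\<delta> * N \<le> d ^ D * \<tau> * N" using \<delta>_le by (intro mult_right_mono) auto
    ultimately have "\<delta> * N \<le> card (?S x)" using al[of x] x by auto
    then show "card (atypical V Nb d (?S x)) \<le> \<delta> * N" using cand_sub by (intro card_atypical) auto
  qed (use \<delta>_pos in auto)
  have "?G \<subseteq> {p \<in> ?A. alive (insert z ?E) (\<phi>(z := p)) y v}"
  proof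
    fix p assume p: "p \<in> ?G"
    then have pA: "p \<in> ?A" and pV: "p \<in> V" using choices_sub by (auto split: if_splits)
    have "alive (insert z ?E) (\<phi>(z := p)) y v"
      unfolding alive_def
    proof
      fix x assume x: "x \<in> nb y"
      then have xN: "x < N" using nb_sub[OF yN(1)] by blast
      show "if x \<in> insert z ?E then (\<phi>(z := p)) x \<in> Nb v
         else d ^ card (nb x \<inter> insert z ?E) * (\<tau> * N) \<le> card (cand (insert z ?E) (\<phi>(z := p)) x \<inter> Nb v \<inter> side x)"
      proof (cases "x = z")
        case True then show ?thesis using p x by auto
      next
        case xz: False
        show ?thesis
        proof (cases "x \<in> ?E")
          case True then show ?thesis using assms(5) x xz by (auto simp: alive_def)
        next
          case False
          show ?thesis
          proof (cases "z \<in> nb x")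
            case True
            have "p \<notin> atypical V Nb d (?S x)" using p x False by auto
            then have t: "d * card (?S x) \<le> card (?S x \<inter> Nb p)" using typicalD[OF pV] by blast
            have "d * (d ^ card (nb x \<inter> ?E) * (\<tau> * N)) \<le> d * card (?S x)"
              using al[OF x False] d_pos by (intro mult_left_mono) auto
            moreover have "?S x \<inter> Nb p = cand (insert z ?E) (\<phi>(z := p)) x \<inter> Nb v \<inter> side x"
              unfolding cand_update[OF zE] using True by auto
            ultimately show ?thesis using t xz False card_done_insert[OF True zE xN] by (simp add: mult_ac)
          next
            case nz: False
            then have "nb x \<inter> insert z ?E = nb x \<inter> ?E" by auto
            then show ?thesis using xz False al[OF x False] nz unfolding cand_update[OF zE] by simp
          qed
        qed
      qed
    qed
    then show "p \<in> {p \<in> ?A. alive (insert z ?E) (\<phi>(z := p)) y v}" using pA by blast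
  qed
  then have le: "card ?G \<le> card {p \<in> ?A. alive (insert z ?E) (\<phi>(z := p)) y v}"
    using finA by (intro card_mono) auto
  have "c1 * card ?A \<le> card ?G"
  proof (cases "z \<in> nb y")
    case True
    have "c1 * N + D * \<delta> * N \<le> card (?S z \<inter> ?A)"
      using al[OF True zE] by (intro choices_large assms) auto
    also have "\<dots> \<le> card (?A \<inter> Nb v)" using finA by (intro of_nat_mono card_mono) auto
    finally have "c1 * N + D * \<delta> * N \<le> card (?A \<inter> Nb v)" .
    moreover have "card (?A \<inter> Nb v) - real (card ?B) \<le> card (?A \<inter> Nb v - ?B)"
      using finA finB by (intro card_Diff_ge_real) auto
    ultimately have "c1 * N \<le> card (?A \<inter> Nb v - ?B)" using cB by (simp add: mult_ac)
    moreover have "c1 * card ?A \<le> c1 * N"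
      using c1_bounds card_mono[OF finV choices_sub, of ?E \<phi> z] by (intro mult_left_mono) auto
    ultimately show ?thesis using True by simp
  next
    case False
    have "card ?A - real (card ?B) \<le> card (?A - ?B)" using finA finB by (intro card_Diff_ge_real) auto
    moreover have "c1 * N + D * \<delta> * N \<le> card ?A" by (rule card_choices[OF assms(1,2)])
    moreover have "D * \<delta> * N \<le> c1 / 2 * N" using \<delta>_le by (intro mult_right_mono) auto
    moreover have "0 \<le> D * \<delta> * N" using \<delta>_pos by simp
    moreover have "c1 * card ?A \<le> 1 / 2 * card ?A" using c1_bounds by (intro mult_right_mono) auto
    ultimately show ?thesis using False cB by (simp add: mult_ac)
  qed
  then show ?thesis using le by linarith
qed

text \<open>Outside \<open>Rel y\<close>, the vertex \<open>z\<close> is neither a neighbour of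
  \<open>y\<close> nor adjacent to a neighbour of \<open>y\<close> that is still to come, so it
  touches none of the conditions in \<open>alive\<close>.\<close>

lemma alive_irrelevant:
  assumes "z \<in> P" "y \<in> I" "z \<notin> Rel y"
  shows "alive (insert z (seg (rk z))) (\<phi>(z := p)) y v = alive (seg (rk z)) \<phi> y v"
  unfolding alive_def
proof (rule ball_cong[OF refl])
  let ?E = "seg (rk z)"
  fix x assume x: "x \<in> nb y"
  have zN: "z < N" using assms P_sub by blast
  have zE: "z \<notin> ?E" by (simp add: seg_def)
  have xP: "x \<in> P" using x assms(2) by (auto simp: P_def)
  then have xN: "x < N" using P_sub by blast
  have "x \<noteq> z" using assms(1,3) x by (auto simp: Rel_def)
  moreover have "z \<notin> nb x" if "x \<notin> ?E"
  proof
    assume zx: "z \<in> nb x"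
    have "rk z \<le> rk x" using that xP by (auto simp: seg_def)
    moreover have "rk z \<noteq> rk x" using rk_eq[OF _ zN xN] \<open>x \<noteq> z\<close> by blast
    ultimately show False using assms(1,3) zx x by (auto simp: Rel_def)
  qed
  moreover have "nb x \<inter> insert z ?E = nb x \<inter> ?E" if "z \<notin> nb x" using that by auto
  ultimately show "(if x \<in> insert z ?E then (\<phi>(z := p)) x \<in> Nb v
     else d ^ card (nb x \<inter> insert z ?E) * (\<tau> * N) \<le> card (cand (insert z ?E) (\<phi>(z := p)) x \<inter> Nb v \<inter> side x)) =
     (if x \<in> ?E then \<phi> x \<in> Nb v else d ^ card (nb x \<inter> ?E) * (\<tau> * N) \<le> card (cand ?E \<phi> x \<inter> Nb v \<inter> side x))"
    unfolding cand_update[OF zE] by auto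
qed

lemma alive_weight_diff:
  assumes "z \<in> P"
  shows "alive_weight (insert z (seg (rk z))) (\<phi>(z := p)) v - alive_weight (seg (rk z)) \<phi> v =
    (\<Sum>y\<in>{y \<in> I. z \<in> Rel y}. (if alive (insert z (seg (rk z))) (\<phi>(z := p)) y v then c1 ^ card (Rel y - insert z (seg (rk z))) else 0)
      - (if alive (seg (rk z)) \<phi> y v then c1 ^ card (Rel y - seg (rk z)) else 0))"
  unfolding alive_weight_def sum_subtractf[symmetric]
proof (rule sum.mono_neutral_cong_right[OF finite_I])
  show "\<forall>y\<in>I - {y \<in> I. z \<in> Rel y}. (if alive (insert z (seg (rk z))) (\<phi>(z := p)) y v then c1 ^ card (Rel y - insert z (seg (rk z))) else 0)
      - (if alive (seg (rk z)) \<phi> y v then c1 ^ card (Rel y - seg (rk z)) else 0) = 0"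
  proof
    fix y assume y: "y \<in> I - {y \<in> I. z \<in> Rel y}"
    then have "Rel y - insert z (seg (rk z)) = Rel y - seg (rk z)" by auto
    then show "(if alive (insert z (seg (rk z))) (\<phi>(z := p)) y v then c1 ^ card (Rel y - insert z (seg (rk z))) else 0)
      - (if alive (seg (rk z)) \<phi> y v then c1 ^ card (Rel y - seg (rk z)) else 0) = 0"
      using alive_irrelevant[OF assms, of y \<phi> p v] y by auto
  qed
qed auto

lemma alive_weight_drift:
  assumes "inv1 (seg (rk z)) \<phi>" "z \<in> P" "v \<in> V"
  shows "0 \<le> (\<Sum>p\<in>choices (seg (rk z)) \<phi> z.
    alive_weight (insert z (seg (rk z))) (\<phi>(z := p)) v - alive_weight (seg (rk z)) \<phi> v)"
proof -
  let ?E = "seg (rk z)"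
  let ?A = "choices ?E \<phi> z"
  let ?r = "\<lambda>y. card (Rel y - insert z ?E)"
  have finA: "finite ?A" using choices_sub finV by (rule finite_subset)
  have zE: "z \<notin> ?E" by (simp add: seg_def)
  have "0 \<le> (\<Sum>y\<in>{y \<in> I. z \<in> Rel y}. \<Sum>p\<in>?A. (if alive (insert z ?E) (\<phi>(z := p)) y v then c1 ^ ?r y else 0)
      - (if alive ?E \<phi> y v then c1 ^ card (Rel y - ?E) else 0))"
  proof (rule sum_nonneg)
    fix y assume y: "y \<in> {y \<in> I. z \<in> Rel y}"
    have "Rel y - ?E = insert z (Rel y - insert z ?E)" using y zE by auto
    then have r: "card (Rel y - ?E) = Suc (?r y)" using finite_Rel[of y] by (metis Diff_iff card_insert_disjoint finite_Diff insertI1)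
    have sum1: "(\<Sum>p\<in>?A. if alive (insert z ?E) (\<phi>(z := p)) y v then c1 ^ ?r y else 0) =
        card {p \<in> ?A. alive (insert z ?E) (\<phi>(z := p)) y v} * c1 ^ ?r y"
      using finA by (simp add: sum.If_cases Collect_conj_eq)
    show "0 \<le> (\<Sum>p\<in>?A. (if alive (insert z ?E) (\<phi>(z := p)) y v then c1 ^ ?r y else 0)
      - (if alive ?E \<phi> y v then c1 ^ card (Rel y - ?E) else 0))"
    proof (cases "alive ?E \<phi> y v")
      case True
      have "(c1 * card ?A) * c1 ^ ?r y \<le> card {p \<in> ?A. alive (insert z ?E) (\<phi>(z := p)) y v} * c1 ^ ?r y"
        using alive_step[OF assms(1,2) _ assms(3) True] y c1_bounds by (intro mult_right_mono) auto
      then show ?thesis unfolding sum_subtractf sum1 using True r by (simp add: mult_ac)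
    next
      case False
      then show ?thesis unfolding sum_subtractf sum1 using c1_bounds by simp
    qed
  qed
  also have "\<dots> = (\<Sum>p\<in>?A. \<Sum>y\<in>{y \<in> I. z \<in> Rel y}. (if alive (insert z ?E) (\<phi>(z := p)) y v then c1 ^ ?r y else 0)
      - (if alive ?E \<phi> y v then c1 ^ card (Rel y - ?E) else 0))" by (rule sum.swap)
  finally show ?thesis unfolding alive_weight_diff[OF assms(2)] .
qed

lemma alive_weight_change:
  assumes "z \<in> P"
  shows "\<bar>alive_weight (insert z (seg (rk z))) (\<phi>(z := p)) v - alive_weight (seg (rk z)) \<phi> v\<bar> \<le> card {y \<in> I. z \<in> Rel y}"
proof -
  have b: "0 \<le> (if Q then c1 ^ n else 0) \<and> (if Q then c1 ^ n else 0) \<le> 1" for Q n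
    using c1_bounds by (auto intro: power_le_one)
  have "\<bar>alive_weight (insert z (seg (rk z))) (\<phi>(z := p)) v - alive_weight (seg (rk z)) \<phi> v\<bar> \<le> (\<Sum>y\<in>{y \<in> I. z \<in> Rel y}. 1)"
    unfolding alive_weight_diff[OF assms]
  proof (rule order_trans[OF sum_abs], rule sum_mono)
    fix y
    show "\<bar>(if alive (insert z (seg (rk z))) (\<phi>(z := p)) y v then c1 ^ card (Rel y - insert z (seg (rk z))) else 0)
      - (if alive (seg (rk z)) \<phi> y v then c1 ^ card (Rel y - seg (rk z)) else 0)\<bar> \<le> 1"
      using b[of "alive (insert z (seg (rk z))) (\<phi>(z := p)) y v" "card (Rel y - insert z (seg (rk z)))"]
        b[of "alive (seg (rk z)) \<phi> y v" "card (Rel y - seg (rk z))"] by linarith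
  qed
  then show ?thesis by simp
qed

section \<open>The exponential potential and its step sizes\<close>

definition Mz :: "nat \<Rightarrow> real" where
  "Mz z = (1 / c) ^ D * card (nb z - K) + card {y \<in> I. z \<in> Rel y}"

text \<open>The minus sign lets one potential serve two purposes: missed weights must not grow much,
  survival weights must not drop much.\<close>

definition Q :: "nat set \<Rightarrow> (nat \<Rightarrow> 'v) \<Rightarrow> 'v list + 'v \<Rightarrow> real" where
  "Q E \<phi> j = (case j of Inl xs \<Rightarrow> missed_weight E \<phi> xs | Inr v \<Rightarrow> - alive_weight E \<phi> v)"

text \<open>Taking differences to the initial values starts the potential at \<open>card J\<close>;
  the subtracted squares are exactly what \<open>exponential_potential_step\<close> charges, so it
  need never grow.\<close>

definition Psi :: "('v list + 'v) set \<Rightarrow> nat set \<Rightarrow> (nat \<Rightarrow> 'v) \<Rightarrow> real" where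
  "Psi J E \<phi> = (\<Sum>j\<in>J. exp (\<mu> * (Q E \<phi> j - Q {} \<phi> j) - \<mu>\<^sup>2 * (\<Sum>z\<in>E. (Mz z)\<^sup>2)))"

text \<open>Every step changes the map, so the reference values in \<open>Psi\<close> have to be
  independent of it.\<close>

lemma Q_empty: "Q {} \<phi> j = Q {} \<phi>' j"
proof -
  have "cand {} \<phi> x = cand {} \<phi>' x" for x by (simp add: cand_def)
  then show ?thesis
    unfolding Q_def missed_weight_def alive_weight_def alive_def by (simp split: sum.split)
qed

lemma Psi_step:
  assumes "z < N" "z \<notin> E" "finite E" "A \<subseteq> V" "A \<noteq> {}" "\<mu> * Mz z \<le> 1"
    and "\<And>j. j \<in> J \<Longrightarrow> (\<Sum>p\<in>A. Q (insert z E) (\<phi>(z := p)) j - Q E \<phi> j) \<le> 0"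
    and "\<And>j p. j \<in> J \<Longrightarrow> p \<in> A \<Longrightarrow> \<bar>Q (insert z E) (\<phi>(z := p)) j - Q E \<phi> j\<bar> \<le> Mz z"
  shows "\<exists>p\<in>A. Psi J (insert z E) (\<phi>(z := p)) \<le> Psi J E \<phi>"
proof -
  let ?wt = "\<lambda>j. exp (\<mu> * (Q E \<phi> j - Q {} \<phi> j) - \<mu>\<^sup>2 * (\<Sum>z\<in>E. (Mz z)\<^sup>2))"
  let ?\<Delta> = "\<lambda>j p. Q (insert z E) (\<phi>(z := p)) j - Q E \<phi> j"
  have finA: "finite A" using assms(4) finV by (rule finite_subset)
  have "\<exists>p\<in>A. (\<Sum>j\<in>J. ?wt j * exp (\<mu> * ?\<Delta> j p - \<mu>\<^sup>2 * (Mz z)\<^sup>2)) \<le> (\<Sum>j\<in>J. ?wt j)"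
    by (rule exponential_potential_step[OF finA assms(5) \<mu>_pos assms(6)]) (use assms(7,8) in auto)
  moreover have "?wt j * exp (\<mu> * ?\<Delta> j p - \<mu>\<^sup>2 * (Mz z)\<^sup>2) =
     exp (\<mu> * (Q (insert z E) (\<phi>(z := p)) j - Q {} (\<phi>(z := p)) j) - \<mu>\<^sup>2 * (\<Sum>z\<in>insert z E. (Mz z)\<^sup>2))" for j p
    unfolding exp_add[symmetric] Q_empty[of "\<phi>(z := p)" j \<phi>] using assms(2,3) by (simp add: algebra_simps)
  ultimately show ?thesis unfolding Psi_def by simp
qed

lemma Mz_ge: "(1 / c) ^ D * card (nb z - K) \<le> Mz z" "card {y \<in> I. z \<in> Rel y} \<le> Mz z"
  using c_pos by (auto simp: Mz_def)

lemma first_phase_embedding: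
  assumes "\<And>z. z < N \<Longrightarrow> \<mu> * Mz z \<le> 1"
  defines "J \<equiv> Inl ` bounded_lists s V \<union> Inr ` V"
  shows "\<exists>\<phi>. inv1 P \<phi> \<and> Psi J P \<phi> \<le> card J"
proof -
  \<comment> \<open>\<open>t\<close> runs through ranks, not vertices: a rank belongs to at most one
    vertex of \<open>P\<close>, and all ranks are below \<open>2 * N\<close>.\<close>
  have "\<exists>\<phi>. inv1 (seg t) \<phi> \<and> Psi J (seg t) \<phi> \<le> card J" for t
  proof (induction t)
    case 0
    have e: "seg 0 = {}" by (simp add: seg_def)
    have "cand {} \<phi> x = V" for \<phi> x by (simp add: cand_def)
    then have "inv1 {} \<phi>" for \<phi> using side_sub by (auto simp: inv1_def embedded_def Int_absorb1)
    moreover have "Psi J {} \<phi> \<le> card J" for \<phi> by (simp add: Psi_def)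
    ultimately show ?case unfolding e by blast
  next
    case (Suc t)
    then obtain \<phi> where \<phi>: "inv1 (seg t) \<phi>" "Psi J (seg t) \<phi> \<le> card J" by blast
    show ?case
    proof (cases "\<exists>z\<in>P. rk z = t")
      case False
      then have "seg (Suc t) = seg t" by (auto simp: seg_def less_Suc_eq)
      then show ?thesis using \<phi> by auto
    next
      case True
      then obtain z where z: "z \<in> P" "rk z = t" by blast
      have zN: "z < N" using z P_sub by blast
      have zE: "z \<notin> seg t" using z by (simp add: seg_def)
      have ins: "seg (Suc t) = insert z (seg t)"
      proof
        show "seg (Suc t) \<subseteq> insert z (seg t)"
        proof
          fix x assume "x \<in> seg (Suc t)"
          then have x: "x \<in> P" "rk x < Suc t" by (auto simp: seg_def)
          show "x \<in> insert z (seg t)"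
          proof (cases "rk x = t")
            case True
            then have "x = z" using rk_eq[of x z] z x P_sub by auto
            then show ?thesis by simp
          next
            case False then show ?thesis using x by (simp add: seg_def)
          qed
        qed
        show "insert z (seg t) \<subseteq> seg (Suc t)" using z by (auto simp: seg_def)
      qed
      let ?A = "choices (seg t) \<phi> z"
      have cA: "c1 * N + D * \<delta> * N \<le> card ?A" using card_choices[of z \<phi>] z \<phi>(1) by simp
      have A0: "c * N \<le> card ?A"
      proof -
        have "c * N \<le> c1 * N" using c_le_c1 by (intro mult_right_mono) auto
        moreover have "0 \<le> D * \<delta> * N" using \<delta>_pos by simp
        ultimately show ?thesis using cA by linarith
      qed
      have "0 < c * N" using c_pos N_pos by simp
      then have Ane: "?A \<noteq> {}" using A0 by auto
      have finE: "finite (seg t)" by (rule finite_subset[OF seg_sub]) simp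
      have "\<exists>p\<in>?A. Psi J (insert z (seg t)) (\<phi>(z := p)) \<le> Psi J (seg t) \<phi>"
      proof (rule Psi_step[OF zN zE finE choices_sub Ane assms(1)[OF zN]])
        fix j assume j: "j \<in> J"
        show "(\<Sum>p\<in>?A. Q (insert z (seg t)) (\<phi>(z := p)) j - Q (seg t) \<phi> j) \<le> 0"
        proof (cases j)
          case (Inl xs)
          then show ?thesis using missed_weight_drift[OF zN zE choices_sub A0, of \<phi> xs] by (simp add: Q_def)
        next
          case (Inr v)
          then have "v \<in> V" using j J_def by auto
          then have "0 \<le> (\<Sum>p\<in>?A. alive_weight (insert z (seg t)) (\<phi>(z := p)) v - alive_weight (seg t) \<phi> v)"
            using alive_weight_drift[of z \<phi> v] z \<phi>(1) by simp
          then show ?thesis using Inr by (simp add: Q_def sum_subtractf sum_negf)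
        qed
        fix p assume p: "p \<in> ?A"
        show "\<bar>Q (insert z (seg t)) (\<phi>(z := p)) j - Q (seg t) \<phi> j\<bar> \<le> Mz z"
        proof (cases j)
          case (Inl xs)
          then show ?thesis using missed_weight_change[OF zN zE, of \<phi> p xs] Mz_ge(1)[of z] by (simp add: Q_def)
        next
          case (Inr v)
          then show ?thesis using alive_weight_change[OF z(1), of \<phi> p v] Mz_ge(2)[of z] z by (simp add: Q_def)
        qed
      qed
      then obtain p where p: "p \<in> ?A" "Psi J (insert z (seg t)) (\<phi>(z := p)) \<le> Psi J (seg t) \<phi>" by blast
      have "inv1 (insert z (seg t)) (\<phi>(z := p))"
        using inv1_step[OF \<phi>(1) seg_sub zN zE p(1)] .
      then show ?thesis unfolding ins using p(2) \<phi>(2) by (meson order_trans)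
    qed
  qed
  from this[of "2 * N"] show ?thesis
  proof -
    have "seg (2 * N) = P" using P_sub by (auto simp: seg_def rk_def)
    then show "\<exists>\<phi>. inv1 (seg (2 * N)) \<phi> \<and> Psi J (seg (2 * N)) \<phi> \<le> card J \<Longrightarrow> ?thesis" by simp
  qed
qed

lemma card_alive_ge:
  assumes "v \<in> V"
  shows "alive_weight P \<phi> v \<le> card {y \<in> I. v \<in> V \<and> (\<forall>x\<in>nb y. \<phi> x \<in> Nb v)}"
proof -
  have "alive_weight P \<phi> v \<le> (\<Sum>y\<in>I. if \<forall>x\<in>nb y. \<phi> x \<in> Nb v then 1 else 0)"
    unfolding alive_weight_def
  proof (rule sum_mono)
    fix y assume y: "y \<in> I"
    have "nb y \<subseteq> P" using y by (auto simp: P_def)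
    then have "alive P \<phi> y v \<Longrightarrow> \<forall>x\<in>nb y. \<phi> x \<in> Nb v" by (auto simp: alive_def)
    then show "(if alive P \<phi> y v then c1 ^ card (Rel y - P) else 0) \<le> (if \<forall>x\<in>nb y. \<phi> x \<in> Nb v then 1 else 0)"
      using c1_bounds by (auto intro: power_le_one)
  qed
  also have "\<dots> = card {y \<in> I. \<forall>x\<in>nb y. \<phi> x \<in> Nb v}"
    using finite_I by (simp add: sum.If_cases Collect_conj_eq)
  finally show ?thesis using assms by simp
qed

text \<open>The restriction \<open>rk z < rk x\<close> in \<open>Rel\<close> is decisive: a hub next
  to \<open>y\<close> may have large degree, but few of its neighbours precede it.\<close>

lemma card_Rel: assumes "y \<in> I" shows "card (Rel y) \<le> D + D * D"
proof -
  have yN: "y < N" "y \<notin> K" using assms I_sub by auto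
  let ?R = "\<lambda>x. {z \<in> P. z \<in> nb x \<and> rk z < rk x}"
  have sub: "Rel y \<subseteq> nb y \<union> (\<Union>x\<in>nb y. ?R x)" by (auto simp: Rel_def)
  have c: "card (?R x) \<le> D" if x: "x \<in> nb y" for x
  proof -
    have xN: "x < N" using x nb_sub[OF yN(1)] by blast
    have "?R x = nb x \<inter> seg (rk x)" by (auto simp: seg_def)
    then show ?thesis using card_nb_seg_D[OF xN, of "rk x"] by (simp add: seg_def)
  qed
  have fin: "finite (nb y \<union> (\<Union>x\<in>nb y. ?R x))"
    by (rule finite_subset[of _ "{..<N}"]) (use P_sub nb_sub[OF yN(1)] in auto)
  have "card (Rel y) \<le> card (nb y \<union> (\<Union>x\<in>nb y. ?R x))" using sub fin by (rule card_mono[rotated])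
  also have "\<dots> \<le> card (nb y) + card (\<Union>x\<in>nb y. ?R x)" by (rule card_Un_le)
  also have "card (\<Union>x\<in>nb y. ?R x) \<le> (\<Sum>x\<in>nb y. card (?R x))" by (rule card_UN_le[OF finite_nb[OF yN(1)]])
  also have "\<dots> \<le> (\<Sum>x\<in>nb y. D)" by (intro sum_mono c)
  also have "card (nb y) + (\<Sum>x\<in>nb y. D) \<le> D + D * D" using degree_le[OF yN] by (simp add: add_mono)
  finally show ?thesis by simp
qed

lemma alive_weight_start:
  assumes "v \<in> V" shows "c1 ^ (D + D * D) * card I \<le> alive_weight {} \<phi> v"
proof -
  have "cand {} \<phi> x \<inter> Nb v \<inter> side x = Nb v \<inter> side x" for x using side_sub by (auto simp: cand_def)
  then have al: "alive {} \<phi> y v" for y using Nb_side[OF assms] by (simp add: alive_def)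
  have "(\<Sum>y\<in>I. c1 ^ (D + D * D)) \<le> alive_weight {} \<phi> v"
    unfolding alive_weight_def using al card_Rel c1_bounds by (intro sum_mono) (simp add: power_decreasing)
  then show ?thesis by (simp add: mult.commute)
qed

lemma sum_Rel: "(\<Sum>z<N. card {y \<in> I. z \<in> Rel y}) \<le> (D + D * D) * N"
proof -
  have "(\<Sum>z<N. card {y \<in> I. z \<in> Rel y}) = (\<Sum>z<N. \<Sum>y\<in>I. if z \<in> Rel y then 1 else 0)"
    using finite_I by (simp add: sum.If_cases Collect_conj_eq)
  also have "\<dots> = (\<Sum>y\<in>I. \<Sum>z<N. if z \<in> Rel y then 1 else 0)" by (rule sum.swap)
  also have "\<dots> \<le> (\<Sum>y\<in>I. D + D * D)"
  proof (rule sum_mono)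
    fix y assume y: "y \<in> I"
    have "(\<Sum>z<N. if z \<in> Rel y then 1 else 0) = card ({..<N} \<inter> Rel y)" by (simp add: sum.If_cases)
    also have "\<dots> \<le> card (Rel y)" using finite_Rel by (intro card_mono) auto
    finally show "(\<Sum>z<N. if z \<in> Rel y then 1 else 0) \<le> D + D * D" using card_Rel[OF y] by simp
  qed
  also have "\<dots> = card I * (D + D * D)" by simp
  also have "\<dots> \<le> N * (D + D * D)"
  proof (rule mult_right_mono)
    have "card I \<le> card {..<N}" using I_sub by (intro card_mono) auto
    then show "card I \<le> N" by simp
  qed simp
  finally show ?thesis by (simp add: mult.commute)
qed

lemma sum_card_nb: "(\<Sum>z<N. card (nb z - K)) \<le> D * N"
proof -
  have "(\<Sum>z<N. card (nb z - K)) = (\<Sum>z<N. \<Sum>x\<in>{..<N} - K. if x \<in> nb z then 1 else 0)"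
  proof (rule sum.cong[OF refl])
    fix z assume "z \<in> {..<N}"
    then have "({..<N} - K) \<inter> nb z = nb z - K" using nb_sub[of z] by auto
    then show "card (nb z - K) = (\<Sum>x\<in>{..<N} - K. if x \<in> nb z then 1 else 0)" by (simp add: sum.If_cases)
  qed
  also have "\<dots> = (\<Sum>x\<in>{..<N} - K. \<Sum>z<N. if x \<in> nb z then 1 else 0)" by (rule sum.swap)
  also have "\<dots> \<le> (\<Sum>x\<in>{..<N} - K. D)"
  proof (rule sum_mono)
    fix x assume x: "x \<in> {..<N} - K"
    then have xN: "x < N" "x \<notin> K" by auto
    have "{..<N} \<inter> {z. x \<in> nb z} \<subseteq> nb x" using nb_sym by auto
    then have "card ({..<N} \<inter> {z. x \<in> nb z}) \<le> card (nb x)" using finite_nb[OF xN(1)] by (rule card_mono[rotated])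
    then show "(\<Sum>z<N. if x \<in> nb z then 1 else 0) \<le> D" using degree_le[OF xN] by (simp add: sum.If_cases)
  qed
  also have "\<dots> = card ({..<N} - K) * D" by simp
  also have "\<dots> \<le> N * D"
  proof (rule mult_right_mono)
    have "card ({..<N} - K) \<le> card {..<N}" by (intro card_mono) auto
    then show "card ({..<N} - K) \<le> N" by simp
  qed simp
  finally show ?thesis by (simp add: mult.commute)
qed

lemma sum_Mz: "(\<Sum>z<N. Mz z) \<le> ((1 / c) ^ D * D + D + D * D) * N"
proof -
  have "(\<Sum>z<N. Mz z) = (1 / c) ^ D * real (\<Sum>z<N. card (nb z - K)) + real (\<Sum>z<N. card {y \<in> I. z \<in> Rel y})"
    unfolding Mz_def by (simp add: sum.distrib sum_distrib_left)
  also have "\<dots> \<le> (1 / c) ^ D * real (D * N) + real ((D + D * D) * N)"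
    using c_pos of_nat_mono[OF sum_card_nb] of_nat_mono[OF sum_Rel]
    by (intro add_mono mult_left_mono) simp_all
  finally show ?thesis by (simp add: algebra_simps)
qed

text \<open>If \<open>z\<close> is in \<open>Rel y\<close>, then \<open>y\<close> is within distance
  two of \<open>z\<close>. Squaring this bound for every \<open>z\<close> would be far too much; the
  sum of the squares is later estimated as this maximum times \<open>sum_Mz\<close>, which is linear
  in \<open>N\<close>.\<close>

lemma Mz_le:
  fixes \<Delta> :: real
  assumes deg: "\<And>x. x < N \<Longrightarrow> card (nb x) \<le> \<Delta>" and "1 \<le> \<Delta>" "z < N"
  shows "Mz z \<le> ((1 / c) ^ D + 2) * \<Delta>\<^sup>2"
proof -
  have fin: "finite (nb z)" by (rule finite_nb[OF assms(3)])
  have \<Delta>2: "\<Delta> \<le> \<Delta>\<^sup>2" using assms(2) by (simp add: power2_eq_square)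
  have 1: "card (nb z - K) \<le> \<Delta>\<^sup>2"
  proof -
    have "card (nb z - K) \<le> card (nb z)" using fin by (intro card_mono) auto
    then show ?thesis using deg[OF assms(3)] \<Delta>2 by linarith
  qed
  have sub: "{y \<in> I. z \<in> Rel y} \<subseteq> nb z \<union> (\<Union>x\<in>nb z. nb x)"
  proof
    fix y assume y: "y \<in> {y \<in> I. z \<in> Rel y}"
    then have yN: "y < N" using I_sub by auto
    show "y \<in> nb z \<union> (\<Union>x\<in>nb z. nb x)"
    proof (cases "z \<in> nb y")
      case True then show ?thesis using nb_sym[OF yN] by blast
    next
      case False
      then obtain x where x: "x \<in> nb y" "z \<in> nb x" using y by (auto simp: Rel_def)
      then have "x < N" using nb_sub[OF yN] by blast
      then have "x \<in> nb z" "y \<in> nb x" using nb_sym x yN by blast+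
      then show ?thesis by blast
    qed
  qed
  have "card (\<Union>x\<in>nb z. nb x) \<le> card (nb z) * \<Delta>"
  proof (rule card_UN_le_mult[OF fin])
    fix x assume "x \<in> nb z" then show "card (nb x) \<le> \<Delta>" using nb_sub[OF assms(3)] deg by blast
  qed (use assms(2) in auto)
  also have "\<dots> \<le> \<Delta> * \<Delta>" using deg[OF assms(3)] assms(2) by (intro mult_right_mono) auto
  finally have 2: "card (\<Union>x\<in>nb z. nb x) \<le> \<Delta>\<^sup>2" by (simp add: power2_eq_square)
  have finU: "finite (\<Union>x\<in>nb z. nb x)" using fin nb_sub[OF assms(3)] finite_nb by blast
  have "card {y \<in> I. z \<in> Rel y} \<le> card (nb z \<union> (\<Union>x\<in>nb z. nb x))" using sub fin finU by (intro card_mono) auto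
  also have "\<dots> \<le> card (nb z) + card (\<Union>x\<in>nb z. nb x)" by (rule card_Un_le)
  finally have "real (card {y \<in> I. z \<in> Rel y}) \<le> 2 * \<Delta>\<^sup>2" using 2 deg[OF assms(3)] \<Delta>2 by linarith
  moreover have "(1 / c) ^ D * card (nb z - K) \<le> (1 / c) ^ D * \<Delta>\<^sup>2" using 1 c_pos by (intro mult_left_mono) auto
  ultimately show ?thesis unfolding Mz_def by (simp add: algebra_simps)
qed

end

section \<open>Embedding the remaining vertices\<close>

text \<open>Roles of the constants: \<open>\<mu>2\<close> says which host sets count as large,
  \<open>\<kappa>'\<close> which share of such a set a candidate set should contain,
  \<open>\<mu>1\<close> how many guest vertices may fail this; \<open>\<kappa>\<close> is the
  critical proportion of free candidates, and \<open>\<epsilon>\<close> the error allowed by the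
  potential.\<close>

locale second_phase = first_phase V Nb d \<delta> nb K D c a I V0 \<tau> c1 \<mu> s
  for V :: "'v set" and Nb :: "'v \<Rightarrow> 'v set" and d \<delta> :: real and nb :: "nat \<Rightarrow> nat set"
    and K :: "nat set" and D :: nat and c :: real
    and a :: nat and I :: "nat set" and V0 :: "'v set" and \<tau> c1 \<mu> :: real and s :: nat +
  fixes \<kappa> \<kappa>' \<mu>1 \<mu>2 \<epsilon> :: real
  assumes I_indep: "\<And>y. y \<in> I \<Longrightarrow> nb y \<inter> I = {}"
    and \<kappa>_pos: "0 < \<kappa>" and \<kappa>_le: "\<kappa> \<le> \<tau> / 2"
    and \<kappa>'_pos: "0 < \<kappa>'" and \<kappa>'_less: "\<kappa>' < 1"
    and \<mu>1_pos: "0 < \<mu>1" and \<mu>2_pos: "0 < \<mu>2"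
    and \<kappa>_\<mu>2: "\<kappa> \<le> \<kappa>' * \<mu>2"
    and \<mu>1_le: "\<mu>1 \<le> \<kappa> * d ^ D / 4"
    and D\<delta>_le: "(D + 1) * \<delta> \<le> \<kappa> * d ^ D / 4"
    and c_le: "c \<le> \<kappa> * d ^ D / 8"
    and N_large: "8 \<le> \<kappa> * d ^ D * N"
    and I_large: "(\<mu>1 + \<mu>2) * N \<le> card I"
    and \<delta>_\<mu>2: "\<delta> \<le> d ^ D * \<mu>2"
    and \<mu>1_ge: "\<epsilon> + (1 / c) ^ D * (D * \<delta> + (1 - d ^ D) ^ s) \<le> \<mu>1 * (1 - \<kappa>') ^ s"
    and alive_large: "(\<mu>1 + \<mu>2 + \<epsilon>) * N \<le> c1 ^ (D + D * D) * card I"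
    and step_small: "\<And>z. z < N \<Longrightarrow> \<mu> * Mz z \<le> 1"
    and potential_small: "ln (N ^ s + N) + \<mu>\<^sup>2 * (\<Sum>z<N. (Mz z)\<^sup>2) \<le> \<mu> * (\<epsilon> * N)"
begin

text \<open>Only the lists are followed through the second phase: all neighbours of the buffer are
  embedded by then, so the survival quantities are final.\<close>

definition JU :: "('v list + 'v) set" where "JU = Inl ` bounded_lists s V"

definition J :: "('v list + 'v) set" where "J = Inl ` bounded_lists s V \<union> Inr ` V"

lemma finite_J: "finite J" "finite JU"
  using finV finite_bounded_lists by (auto simp: J_def JU_def)

lemma card_J: "card J = N ^ s + N"
proof -
  have "card J = card (Inl ` bounded_lists s V :: ('v list + 'v) set) + card (Inr ` V :: ('v list + 'v) set)"
    unfolding J_def using finV finite_bounded_lists by (intro card_Un_disjoint) auto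
  then show ?thesis using finV by (simp add: card_image card_bounded_lists)
qed

text \<open>One exponential is at most the whole potential, which has not exceeded
  \<open>card J\<close>. By \<open>potential_small\<close>, the logarithm of \<open>card J\<close>
  and the charged squares fit into \<open>\<mu> * \<epsilon> * N\<close>.\<close>

lemma Q_bound:
  assumes "j \<in> J'" "finite J'" "Psi J' E \<phi> \<le> card J" "E \<subseteq> {..<N}"
  shows "Q E \<phi> j \<le> Q {} \<phi> j + \<epsilon> * N"
proof -
  let ?e = "\<lambda>j. \<mu> * (Q E \<phi> j - Q {} \<phi> j) - \<mu>\<^sup>2 * (\<Sum>z\<in>E. (Mz z)\<^sup>2)"
  have "exp (?e j) \<le> Psi J' E \<phi>" unfolding Psi_def using assms(1,2) by (intro member_le_sum) auto
  also have "\<dots> \<le> N ^ s + N" using assms(3) card_J by simp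
  finally have "ln (exp (?e j)) \<le> ln (N ^ s + N)" using N_pos by (subst ln_le_cancel_iff) (auto intro: add_nonneg_pos)
  then have "?e j \<le> ln (N ^ s + N)" by simp
  moreover have "(\<Sum>z\<in>E. (Mz z)\<^sup>2) \<le> (\<Sum>z<N. (Mz z)\<^sup>2)" using assms(4) by (intro sum_mono2) auto
  then have "\<mu>\<^sup>2 * (\<Sum>z\<in>E. (Mz z)\<^sup>2) \<le> \<mu>\<^sup>2 * (\<Sum>z<N. (Mz z)\<^sup>2)" by (intro mult_left_mono) auto
  ultimately have "\<mu> * (Q E \<phi> j - Q {} \<phi> j) \<le> \<mu> * (\<epsilon> * N)" using potential_small by linarith
  then have "Q E \<phi> j - Q {} \<phi> j \<le> \<epsilon> * N" using \<mu>_pos by simp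
  then show ?thesis by simp
qed

text \<open>Valid at any moment of the embedding and for a \<open>B\<close> that depends on it. It
  is used for the set of free vertices and for the part of it left unserved in Hall's
  condition.\<close>

lemma spread:
  assumes "Psi JU E \<phi> \<le> card J" "E \<subseteq> {..<N}" "B \<subseteq> V" "\<mu>2 * N \<le> card B"
  shows "card {x \<in> {..<N} - K. card (cand E \<phi> x \<inter> B) < \<kappa>' * card B} \<le> \<mu>1 * N"
proof -
  have "\<delta> * N \<le> d ^ D * \<mu>2 * N" using \<delta>_\<mu>2 by (intro mult_right_mono) auto
  also have "\<dots> \<le> d ^ D * card B" using assms(4) dD by (simp add: mult.assoc)
  finally have 1: "\<delta> * N \<le> d ^ D * card B" .
  have "0 < \<mu>2 * N" using \<mu>2_pos N_pos by simp
  then have 2: "B \<noteq> {}" using assms(4) by auto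
  have 3: "missed_weight E \<phi> xs \<le> missed_weight {} \<phi> xs + \<epsilon> * N" if "xs \<in> bounded_lists s V" for xs
    using Q_bound[of "Inl xs" JU E \<phi>] that assms(1,2) finite_J by (simp add: JU_def Q_def)
  have pos: "0 < (1 - \<kappa>') ^ s" using \<kappa>'_less by simp
  have "card {x \<in> {..<N} - K. card (cand E \<phi> x \<inter> B) < \<kappa>' * card B} * (1 - \<kappa>') ^ s
     \<le> (\<epsilon> + (1 / c) ^ D * (D * \<delta> + (1 - d ^ D) ^ s)) * N"
    using \<kappa>'_pos \<kappa>'_less by (intro few_sparse_candidates assms(3) 1 2 3) auto
  also have "\<dots> \<le> \<mu>1 * (1 - \<kappa>') ^ s * N" using \<mu>1_ge by (intro mult_right_mono) auto
  also have "\<dots> = \<mu>1 * N * (1 - \<kappa>') ^ s" by simp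
  finally show ?thesis using pos by simp
qed

definition free :: "nat set \<Rightarrow> (nat \<Rightarrow> 'v) \<Rightarrow> 'v set" where "free E \<phi> = V - \<phi> ` E"

text \<open>\<open>R\<close> collects the vertices whose set of free candidates has become critically small; they are
  embedded with priority, so that each of them loses at most \<open>card R\<close> further candidates.\<close>

definition inv2 :: "nat set \<Rightarrow> (nat \<Rightarrow> 'v) \<Rightarrow> nat set \<Rightarrow> bool" where
  "inv2 E \<phi> R \<longleftrightarrow> embedded E \<phi> \<and> P \<subseteq> E \<and> E \<subseteq> {..<N} \<and> Psi JU E \<phi> \<le> card J \<and>
    (\<forall>v\<in>V. (\<mu>1 + \<mu>2) * N \<le> card {y \<in> I. \<forall>x\<in>nb y. \<phi> x \<in> Nb v}) \<and>
    R \<subseteq> {..<N} - K \<and> E \<inter> I \<subseteq> R \<and> card R \<le> \<mu>1 * N \<and>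
    (\<forall>x\<in>R. card (cand E \<phi> x \<inter> free E \<phi>) < \<kappa> * N) \<and>
    (\<forall>x\<in>{..<N} - E - R. \<kappa> * d ^ card (nb x \<inter> E) * N \<le> card (cand E \<phi> x \<inter> free E \<phi>)) \<and>
    (\<forall>x\<in>R - E. \<kappa> * d ^ card (nb x \<inter> E) * N - card (R \<inter> E) - 1 \<le> card (cand E \<phi> x \<inter> free E \<phi>))"

lemma P_I_disjoint: "P \<inter> I = {}"
  using I_indep I_sub nb_sym by (fastforce simp: P_def)

lemma start_second_phase: "\<exists>\<phi>. inv2 P \<phi> {}"
proof -
  obtain \<phi> where \<phi>: "inv1 P \<phi>" "Psi J P \<phi> \<le> card J"
    using first_phase_embedding[OF step_small] unfolding J_def by blast
  have emb: "embedded P \<phi>" using \<phi>(1) by (simp add: inv1_def)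
  have "Psi JU P \<phi> \<le> Psi J P \<phi>"
    unfolding Psi_def using finite_J by (intro sum_mono2) (auto simp: J_def JU_def)
  then have 1: "Psi JU P \<phi> \<le> card J" using \<phi>(2) by linarith
  have 2: "(\<mu>1 + \<mu>2) * N \<le> card {y \<in> I. \<forall>x\<in>nb y. \<phi> x \<in> Nb v}" if v: "v \<in> V" for v
  proof -
    have "Q P \<phi> (Inr v) \<le> Q {} \<phi> (Inr v) + \<epsilon> * N"
      using v finite_J \<phi>(2) P_sub by (intro Q_bound[of _ J]) (auto simp: J_def)
    then have "alive_weight {} \<phi> v - \<epsilon> * N \<le> alive_weight P \<phi> v" by (simp add: Q_def)
    moreover have "(\<mu>1 + \<mu>2 + \<epsilon>) * N \<le> alive_weight {} \<phi> v"
      using alive_large alive_weight_start[OF v, of \<phi>] by linarith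
    moreover have "alive_weight P \<phi> v \<le> card {y \<in> I. \<forall>x\<in>nb y. \<phi> x \<in> Nb v}"
      using card_alive_ge[OF v, of \<phi>] v by simp
    ultimately show ?thesis by (simp add: algebra_simps)
  qed
  \<comment> \<open>Hubs occupy \<open>V0\<close> only, so on its own side a non-hub has lost
    nothing but the images of neighbours of the buffer.\<close>
  have 3: "\<kappa> * d ^ card (nb x \<inter> P) * N \<le> card (cand P \<phi> x \<inter> free P \<phi>)" if x: "x \<in> {..<N} - P" for x
  proof -
    have xK: "x \<notin> K" "x < N" using x by (auto simp: P_def)
    let ?j = "card (nb x \<inter> P)"
    let ?X = "cand P \<phi> x \<inter> side x"
    have finP: "finite P" by (rule finite_subset[OF P_sub]) simp
    have "?j \<le> card (nb x)" using finite_nb[OF xK(2)] by (intro card_mono) auto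
    then have jD: "d ^ D \<le> d ^ ?j" using degree_le[OF xK(2,1)] by (intro d_power_ge) simp
    have "d ^ ?j * (\<tau> * N) \<le> d ^ ?j * card (side x)" using card_side d_pos by (intro mult_left_mono) auto
    also have "\<dots> \<le> card ?X" using \<phi>(1) x by (auto simp: inv1_def)
    finally have X: "d ^ ?j * (\<tau> * N) \<le> card ?X" .
    have "card (\<phi> ` (P - K)) \<le> card (P - K)" using finP by (intro card_image_le) auto
    also have "\<dots> \<le> card (\<Union>(nb ` I))"
    proof (rule card_mono)
      show "finite (\<Union>(nb ` I))"
        by (rule finite_subset[OF _ finite_lessThan[of N]]) (use P_sub in \<open>auto simp: P_def\<close>)
    qed (auto simp: P_def)
    finally have "card (\<phi> ` (P - K)) \<le> d ^ D * \<tau> / 4 * N" using NI_small by linarith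
    also have "\<dots> \<le> d ^ ?j * \<tau> / 4 * N" using jD \<tau>_pos by (intro mult_right_mono divide_right_mono) auto
    finally have used: "card (\<phi> ` (P - K)) \<le> d ^ ?j * \<tau> / 4 * N" .
    have "?X - \<phi> ` (P - K) \<subseteq> cand P \<phi> x \<inter> free P \<phi>"
    proof
      fix q assume q: "q \<in> ?X - \<phi> ` (P - K)"
      have "q \<notin> \<phi> ` P"
      proof
        assume "q \<in> \<phi> ` P"
        then obtain u where u: "u \<in> P" "q = \<phi> u" by blast
        then have "u \<in> K" using q by blast
        moreover have "q \<in> side u" using u \<phi>(1) by (auto simp: inv1_def)
        ultimately show False using q xK by (auto simp: side_def)
      qed
      then show "q \<in> cand P \<phi> x \<inter> free P \<phi>" using q by (auto simp: free_def cand_def)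
    qed
    then have "card (?X - \<phi> ` (P - K)) \<le> card (cand P \<phi> x \<inter> free P \<phi>)"
      using finite_cand by (intro card_mono) auto
    moreover have "card ?X - real (card (\<phi> ` (P - K))) \<le> card (?X - \<phi> ` (P - K))"
      using finite_cand finP by (intro card_Diff_ge_real) auto
    moreover have "\<kappa> * d ^ ?j * N \<le> \<tau> / 2 * d ^ ?j * N" using \<kappa>_le d_pos by (intro mult_right_mono) auto
    moreover have "0 \<le> d ^ ?j * \<tau> * N" using d_pos \<tau>_pos by simp
    ultimately show ?thesis using X used by (simp add: mult_ac)
  qed
  have "inv2 P \<phi> {}"
    unfolding inv2_def using emb P_sub 1 2 3 P_I_disjoint \<mu>1_pos by auto
  then show ?thesis by blast
qed

text \<open>The bound on \<open>R\<close> needs no record of when its members entered: each of them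
  has fewer than \<open>\<kappa> * N\<close> free candidates now, because these only decrease, so
  \<open>spread\<close> for the current free set bounds all of them at once.\<close>

lemma second_phase_step:
  assumes "inv2 E \<phi> R" "z < N" "z \<notin> E" "z \<in> R \<or> R \<subseteq> E \<and> z \<notin> I"
  shows "\<exists>\<phi>' R'. inv2 (insert z E) \<phi>' R'"
proof -
  have emb: "embedded E \<phi>" and PE: "P \<subseteq> E" and EN: "E \<subseteq> {..<N}" and psi: "Psi JU E \<phi> \<le> card J"
    and hit: "\<And>v. v \<in> V \<Longrightarrow> (\<mu>1 + \<mu>2) * N \<le> card {y \<in> I. \<forall>x\<in>nb y. \<phi> x \<in> Nb v}"
    and RK: "R \<subseteq> {..<N} - K" and EI: "E \<inter> I \<subseteq> R" and cR: "card R \<le> \<mu>1 * N"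
    and low: "\<And>x. x \<in> R \<Longrightarrow> card (cand E \<phi> x \<inter> free E \<phi>) < \<kappa> * N"
    and notlow: "\<And>x. x \<in> {..<N} - E - R \<Longrightarrow> \<kappa> * d ^ card (nb x \<inter> E) * N \<le> card (cand E \<phi> x \<inter> free E \<phi>)"
    and queued: "\<And>x. x \<in> R - E \<Longrightarrow> \<kappa> * d ^ card (nb x \<inter> E) * N - card (R \<inter> E) - 1 \<le> card (cand E \<phi> x \<inter> free E \<phi>)"
    using assms(1) by (auto simp: inv2_def)
  have finE: "finite E" by (rule finite_subset[OF EN]) simp
  have finR: "finite R" by (rule finite_subset[OF RK]) simp
  have KE: "K \<subseteq> E" using PE by (auto simp: P_def)
  have zK: "z \<notin> K" using assms(3) KE by blast
  let ?S = "\<lambda>x. cand E \<phi> x \<inter> free E \<phi>"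
  have finS: "finite (?S x)" for x using finite_cand by auto
  have kN: "\<kappa> * d ^ D * N / 2 \<le> card (?S x)" if x: "x < N" "x \<notin> E" for x
  proof -
    have "card (nb x \<inter> E) \<le> card (nb x)" using finite_nb[OF x(1)] by (intro card_mono) auto
    then have "d ^ D \<le> d ^ card (nb x \<inter> E)" using degree_le[OF x(1)] x KE by (intro d_power_ge) fastforce
    then have 1: "\<kappa> * d ^ D * N \<le> \<kappa> * d ^ card (nb x \<inter> E) * N" using \<kappa>_pos by (intro mult_right_mono mult_left_mono) auto
    have "card (R \<inter> E) \<le> card R" using finR by (intro card_mono) auto
    then have 2: "card (R \<inter> E) \<le> \<kappa> * d ^ D * N / 4"
      using cR mult_right_mono[OF \<mu>1_le, of "real N"] by simp
    have 3: "0 \<le> \<kappa> * d ^ D * N" using \<kappa>_pos dD by simp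
    show ?thesis
    proof (cases "x \<in> R")
      case True
      then show ?thesis using queued[of x] x 1 2 N_large by auto
    next
      case False
      then show ?thesis using notlow[of x] x 1 3 by auto
    qed
  qed
  have S\<delta>: "\<delta> * N \<le> card (?S x)" if x: "x < N" "x \<notin> E" for x
  proof -
    have "1 * \<delta> \<le> (D + 1) * \<delta>" using \<delta>_pos by (intro mult_right_mono) auto
    then have "\<delta> \<le> \<kappa> * d ^ D / 4" using D\<delta>_le by simp
    then have "\<delta> * N \<le> \<kappa> * d ^ D / 4 * N" by (intro mult_right_mono) auto
    moreover have "0 \<le> \<kappa> * d ^ D * N" using \<kappa>_pos dD by simp
    ultimately show ?thesis using kN[OF x] by (simp add: field_simps)
  qed
  let ?B = "\<Union>x\<in>nb z - E. atypical V Nb d (?S x)"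
  define A where "A = ?S z - ?B"
  have AV: "A \<subseteq> V" using cand_sub by (auto simp: A_def)
  have cB: "card ?B \<le> D * (\<delta> * N)"
  proof (rule card_UN_le_mult)
    show "finite (nb z - E)" using finite_nb[OF assms(2)] by simp
    have "card (nb z - E) \<le> card (nb z)" using finite_nb[OF assms(2)] by (intro card_mono) auto
    then show "card (nb z - E) \<le> D" using degree_le[OF assms(2) zK] by simp
    fix x assume "x \<in> nb z - E"
    then have x: "x < N" "x \<notin> E" using nb_sub[OF assms(2)] by auto
    show "card (atypical V Nb d (?S x)) \<le> \<delta> * N" using S\<delta>[OF x] cand_sub by (intro card_atypical) auto
  qed (use \<delta>_pos in auto)
  have finB: "finite ?B" by (rule finite_subset[OF _ finV]) (auto simp: atypical_def)
  have cA: "c * N \<le> card A"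
  proof -
    have "card (?S z) - real (card ?B) \<le> card A" unfolding A_def by (rule card_Diff_ge_real[OF finB])
    moreover have "D * \<delta> * N \<le> \<kappa> * d ^ D / 4 * N"
      using D\<delta>_le \<delta>_pos by (intro mult_right_mono) (auto simp: algebra_simps)
    moreover have "c * N \<le> \<kappa> * d ^ D / 8 * N" using c_le by (intro mult_right_mono) auto
    moreover have "0 \<le> \<kappa> * d ^ D * N" using \<kappa>_pos dD by simp
    ultimately show ?thesis using kN[OF assms(2,3)] cB by (simp add: mult_ac)
  qed
  have "0 < c * N" using c_pos N_pos by simp
  then have Ane: "A \<noteq> {}" using cA by auto
  have "\<exists>p\<in>A. Psi JU (insert z E) (\<phi>(z := p)) \<le> Psi JU E \<phi>"
  proof (rule Psi_step[OF assms(2,3) finE AV Ane step_small[OF assms(2)]])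
    fix j assume "j \<in> JU"
    then obtain xs where j: "j = Inl xs" by (auto simp: JU_def)
    show "(\<Sum>p\<in>A. Q (insert z E) (\<phi>(z := p)) j - Q E \<phi> j) \<le> 0"
      using missed_weight_drift[OF assms(2,3) AV cA, of \<phi> xs] by (simp add: Q_def j)
    fix p
    show "\<bar>Q (insert z E) (\<phi>(z := p)) j - Q E \<phi> j\<bar> \<le> Mz z"
      using missed_weight_change[OF assms(2,3), of \<phi> p xs] Mz_ge(1)[of z] by (simp add: Q_def j)
  qed
  then obtain p where p: "p \<in> A" "Psi JU (insert z E) (\<phi>(z := p)) \<le> Psi JU E \<phi>" by blast
  define E' where "E' = insert z E"
  define \<phi>' where "\<phi>' = \<phi>(z := p)"
  let ?S' = "\<lambda>x. cand E' \<phi>' x \<inter> free E' \<phi>'"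
  have pp: "p \<in> cand E \<phi> z" "p \<in> free E \<phi>" "p \<in> V" "\<And>x. x \<in> nb z - E \<Longrightarrow> p \<notin> atypical V Nb d (?S x)"
    using p(1) AV by (auto simp: A_def)
  have emb': "embedded E' \<phi>'"
    unfolding E'_def \<phi>'_def using emb EN assms(2,3) pp by (intro embedded_insert) (auto simp: free_def)
  have E'N: "E' \<subseteq> {..<N}" using EN assms(2) by (simp add: E'_def)
  have psi': "Psi JU E' \<phi>' \<le> card J" using p(2) psi unfolding E'_def \<phi>'_def by linarith
  have free': "free E' \<phi>' = free E \<phi> - {p}" using assms(3) by (auto simp: free_def E'_def \<phi>'_def)
  have cand': "cand E' \<phi>' x = (if z \<in> nb x then cand E \<phi> x \<inter> Nb p else cand E \<phi> x)" for x
    unfolding E'_def \<phi>'_def by (rule cand_update[OF assms(3)])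
  have S'sub: "?S' x \<subseteq> ?S x" for x unfolding free' cand' by auto
  have S'le: "card (?S' x) \<le> card (?S x)" for x using S'sub finS by (rule card_mono[rotated])
  have j': "d ^ card (nb x \<inter> E') \<le> d ^ card (nb x \<inter> E)" if "x < N" for x
    using d_pos d_less finite_nb[OF that] by (intro power_decreasing card_mono) (auto simp: E'_def)
  \<comment> \<open>Apart from a factor \<open>d\<close> when \<open>z\<close> is a neighbour, only
    \<open>p\<close> itself is lost, which is no longer free. Multiplying the earlier deficit
    \<open>u\<close> by \<open>d\<close> does not increase it.\<close>
  have loss: "t * d ^ card (nb x \<inter> E') * N - u - 1 \<le> card (?S' x)"
    if x: "x < N" "x \<notin> E'" and t: "t * d ^ card (nb x \<inter> E) * N - u \<le> card (?S x)" and u: "0 \<le> u" for x and t u :: real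
  proof (cases "z \<in> nb x")
    case True
    then have xz: "x \<in> nb z - E" using x nb_sym[OF x(1)] by (auto simp: E'_def)
    have eq: "?S' x = ?S x \<inter> Nb p - {p}" unfolding free' cand' using True by auto
    have "card (?S x \<inter> Nb p) - real (card {p}) \<le> card (?S' x)" unfolding eq using finS by (intro card_Diff_ge_real) auto
    moreover have "d * card (?S x) \<le> card (?S x \<inter> Nb p)" by (rule typicalD[OF pp(3) pp(4)[OF xz]])
    moreover have "d * (t * d ^ card (nb x \<inter> E) * N - u) \<le> d * card (?S x)" using t d_pos by (intro mult_left_mono) auto
    moreover have "card (nb x \<inter> E') = Suc (card (nb x \<inter> E))"
      unfolding E'_def by (rule card_done_insert[OF True assms(3) x(1)])
    moreover have "d * u \<le> u" using u d_less d_pos by (simp add: mult_left_le_one_le)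
    ultimately show ?thesis by (simp add: algebra_simps)
  next
    case False
    have eq: "?S' x = ?S x - {p}" unfolding free' cand' using False by auto
    have "card (?S x) - real (card {p}) \<le> card (?S' x)" unfolding eq using finS by (intro card_Diff_ge_real) auto
    moreover have "nb x \<inter> E' = nb x \<inter> E" using False by (auto simp: E'_def)
    ultimately show ?thesis using t by simp
  qed
  \<comment> \<open>A vertex enters in the very step in which it falls below its threshold, hence
    with a deficit of at most 1; this is the \<open>- 1\<close> in the invariant.\<close>
  define R' where "R' = R \<union> {x \<in> {..<N} - E'. card (?S' x) < \<kappa> * d ^ card (nb x \<inter> E') * N}"
  have KE': "K \<subseteq> E'" using KE by (auto simp: E'_def)
  have R'K: "R' \<subseteq> {..<N} - K" using RK KE' by (auto simp: R'_def)
  have finR': "finite R'" by (rule finite_subset[OF R'K]) simp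
  have R'E': "R' \<inter> E' = R \<inter> E'" by (auto simp: R'_def)
  have E'I: "E' \<inter> I \<subseteq> R" using EI assms(3,4) by (auto simp: E'_def)
  have low': "card (?S' x) < \<kappa> * N" if x: "x \<in> R'" for x
  proof (cases "x \<in> R")
    case True then show ?thesis using low[OF True] S'le[of x] by linarith
  next
    case False
    then have "card (?S' x) < \<kappa> * d ^ card (nb x \<inter> E') * N" using x by (auto simp: R'_def)
    also have "\<dots> \<le> \<kappa> * 1 * N" using \<kappa>_pos d_pos d_less by (intro mult_right_mono mult_left_mono power_le_one) auto
    finally show ?thesis by simp
  qed
  have freeV: "free E' \<phi>' \<subseteq> V" by (auto simp: free_def)
  \<comment> \<open>The buffer vertices outside \<open>R\<close> are still to be embedded, so
    equally many host vertices are free.\<close>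
  have cfree: "\<mu>2 * N \<le> card (free E' \<phi>')"
  proof -
    have "card (free E' \<phi>') = N - card (\<phi>' ` E')"
      unfolding free_def using emb' finite_subset[OF E'N] by (intro card_Diff_subset) (auto simp: embedded_def)
    also have "card (\<phi>' ` E') = card E'" using emb' by (intro card_image) (auto simp: embedded_def)
    also have "N - card E' = card ({..<N} - E')"
      using E'N finite_subset[OF E'N] by (simp add: card_Diff_subset)
    finally have "card (free E' \<phi>') = card ({..<N} - E')" .
    moreover have "card (I - R) \<le> card ({..<N} - E')" using I_sub E'I by (intro card_mono) auto
    moreover have "card I - real (card R) \<le> card (I - R)" by (rule card_Diff_ge_real[OF finR])
    moreover have "(\<mu>1 + \<mu>2) * N = \<mu>1 * N + \<mu>2 * N" by (simp add: algebra_simps)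
    ultimately show ?thesis using I_large cR by linarith
  qed
  have cR': "card R' \<le> \<mu>1 * N"
  proof -
    have "R' \<subseteq> {x \<in> {..<N} - K. card (cand E' \<phi>' x \<inter> free E' \<phi>') < \<kappa>' * card (free E' \<phi>')}"
    proof
      fix x assume x: "x \<in> R'"
      have "\<kappa> * N \<le> \<kappa>' * \<mu>2 * N" using \<kappa>_\<mu>2 by (intro mult_right_mono) auto
      also have "\<dots> \<le> \<kappa>' * card (free E' \<phi>')" using cfree \<kappa>'_pos by (simp add: mult.assoc)
      finally show "x \<in> {x \<in> {..<N} - K. card (cand E' \<phi>' x \<inter> free E' \<phi>') < \<kappa>' * card (free E' \<phi>')}"
        using x R'K low'[OF x] by auto
    qed
    then have "card R' \<le> card {x \<in> {..<N} - K. card (cand E' \<phi>' x \<inter> free E' \<phi>') < \<kappa>' * card (free E' \<phi>')}"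
      by (rule card_mono[rotated]) simp
    then show ?thesis using spread[OF psi' E'N freeV cfree] by linarith
  qed
  have hit': "(\<mu>1 + \<mu>2) * N \<le> card {y \<in> I. \<forall>x\<in>nb y. \<phi>' x \<in> Nb v}" if v: "v \<in> V" for v
  proof -
    have "\<phi>' x = \<phi> x" if "y \<in> I" "x \<in> nb y" for x y
    proof -
      have "x \<in> E" using PE that by (auto simp: P_def)
      then show ?thesis using assms(3) by (auto simp: \<phi>'_def)
    qed
    then have "{y \<in> I. \<forall>x\<in>nb y. \<phi>' x \<in> Nb v} = {y \<in> I. \<forall>x\<in>nb y. \<phi> x \<in> Nb v}" by auto
    then show ?thesis using hit[OF v] by simp
  qed
  have queued': "\<kappa> * d ^ card (nb x \<inter> E') * N - card (R' \<inter> E') - 1 \<le> card (?S' x)" if x: "x \<in> R' - E'" for x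
  proof (cases "x \<in> R")
    case True
    then have xN: "x < N" "x \<notin> E'" "x \<in> R - E" using x RK by (auto simp: E'_def)
    \<comment> \<open>While \<open>x\<close> is waiting, only members of \<open>R\<close> are
      embedded, so the loss of \<open>p\<close> is matched by the growth of
      \<open>R \<inter> E\<close>.\<close>
    then have "z \<in> R" using assms(4) by blast
    then have "R' \<inter> E' = insert z (R \<inter> E)" unfolding R'E' by (auto simp: E'_def)
    then have c: "card (R' \<inter> E') = Suc (card (R \<inter> E))" using finR assms(3) by simp
    have "\<kappa> * d ^ card (nb x \<inter> E') * N - (card (R \<inter> E) + 1) - 1 \<le> card (?S' x)"
      using queued[OF xN(3)] by (intro loss xN) auto
    then show ?thesis using c by simp
  next
    case False
    then have xN: "x < N" "x \<notin> E'" "x \<in> {..<N} - E - R" using x R'K by (auto simp: E'_def)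
    have "\<kappa> * d ^ card (nb x \<inter> E') * N - 0 - 1 \<le> card (?S' x)"
      using notlow[OF xN(3)] by (intro loss xN) auto
    then show ?thesis by simp
  qed
  have notlow': "\<kappa> * d ^ card (nb x \<inter> E') * N \<le> card (?S' x)" if "x \<in> {..<N} - E' - R'" for x
    using that by (auto simp: R'_def)
  have "inv2 E' \<phi>' R'"
    unfolding inv2_def
    using emb' PE E'N psi' hit' R'K E'I cR' low' notlow' queued'
    by (auto simp: E'_def R'_def)
  then show ?thesis unfolding E'_def by blast
qed

lemma second_phase_end:
  "\<exists>E \<phi> R. inv2 E \<phi> R \<and> R \<subseteq> E \<and> {..<N} - I \<subseteq> E"
proof -
  have "\<exists>E' \<phi>' R'. inv2 E' \<phi>' R' \<and> R' \<subseteq> E' \<and> {..<N} - I \<subseteq> E'" if "inv2 E \<phi> R" for E \<phi> R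
    using that
  proof (induction "card ({..<N} - E)" arbitrary: E \<phi> R rule: less_induct)
    case less
    show ?case
    proof (cases "R \<subseteq> E \<and> {..<N} - I \<subseteq> E")
      case True then show ?thesis using less.prems by blast
    next
      case False
      have RN: "R \<subseteq> {..<N}" using less.prems by (auto simp: inv2_def)
      obtain z where z: "z < N" "z \<notin> E" "z \<in> R \<or> R \<subseteq> E \<and> z \<notin> I"
        using False RN by auto
      obtain \<phi>' R' where "inv2 (insert z E) \<phi>' R'" using second_phase_step[OF less.prems z] by blast
      moreover have "card ({..<N} - insert z E) < card ({..<N} - E)"
        using z by (intro psubset_card_mono) auto
      ultimately show ?thesis using less.hyps by blast
    qed
  qed
  then show ?thesis using start_second_phase by blast
qed

text \<open>Hall's condition for the remaining buffer vertices \<open>Y\<close> has three ranges. A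
  small \<open>S\<close> is served by the candidates of one member. A larger \<open>S\<close> cannot
  leave \<open>\<mu>2 * N\<close> free vertices unserved, by \<open>spread\<close>. If some, but
  fewer, are unserved, each of them is a candidate for at least \<open>\<mu>2 * N\<close> vertices
  of \<open>Y\<close>, all outside \<open>S\<close>, so \<open>Y - S\<close> outweighs the unserved
  set.\<close>

theorem spanning_copy:
  "\<exists>\<psi>. bij_betw \<psi> {..<N} V \<and> (\<forall>x<N. \<forall>z\<in>nb x. \<psi> z \<in> Nb (\<psi> x))"
proof -
  obtain E \<phi> R where inv: "inv2 E \<phi> R" and RE: "R \<subseteq> E" and IE: "{..<N} - I \<subseteq> E"
    using second_phase_end by blast
  have emb: "embedded E \<phi>" and PE: "P \<subseteq> E" and EN: "E \<subseteq> {..<N}" and psi: "Psi JU E \<phi> \<le> card J"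
    and hit: "\<And>v. v \<in> V \<Longrightarrow> (\<mu>1 + \<mu>2) * N \<le> card {y \<in> I. \<forall>x\<in>nb y. \<phi> x \<in> Nb v}"
    and RK: "R \<subseteq> {..<N} - K" and EI: "E \<inter> I \<subseteq> R" and cR: "card R \<le> \<mu>1 * N"
    and notlow: "\<And>x. x \<in> {..<N} - E - R \<Longrightarrow> \<kappa> * d ^ card (nb x \<inter> E) * N \<le> card (cand E \<phi> x \<inter> free E \<phi>)"
    using inv by (auto simp: inv2_def)
  have finE: "finite E" by (rule finite_subset[OF EN]) simp
  have finR: "finite R" by (rule finite_subset[OF RK]) simp
  define Y where "Y = {..<N} - E"
  let ?F = "free E \<phi>"
  let ?A = "\<lambda>y. cand E \<phi> y \<inter> ?F"
  have finY: "finite Y" by (simp add: Y_def)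
  have YI: "Y \<subseteq> I" using IE by (auto simp: Y_def)
  have finF: "finite ?F" using finV by (simp add: free_def)
  have cF: "card ?F = card Y"
  proof -
    have "card ?F = N - card (\<phi> ` E)"
      unfolding free_def using emb finE by (intro card_Diff_subset) (auto simp: embedded_def)
    also have "card (\<phi> ` E) = card E" using emb by (intro card_image) (auto simp: embedded_def)
    finally show ?thesis unfolding Y_def using finE EN by (simp add: card_Diff_subset)
  qed
  have kN: "\<kappa> * d ^ D * N \<le> card (?A y)" if y: "y \<in> Y" for y
  proof -
    have yN: "y < N" "y \<notin> K" using y YI I_sub by auto
    have "card (nb y \<inter> E) \<le> card (nb y)" using finite_nb[OF yN(1)] by (intro card_mono) auto
    then have "d ^ D \<le> d ^ card (nb y \<inter> E)" using degree_le[OF yN] by (intro d_power_ge) simp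
    then have "\<kappa> * d ^ D * N \<le> \<kappa> * d ^ card (nb y \<inter> E) * N" using \<kappa>_pos by (intro mult_right_mono mult_left_mono) auto
    moreover have "y \<in> {..<N} - E - R" using y RE by (auto simp: Y_def)
    ultimately show ?thesis using notlow[of y] by linarith
  qed
  have hall: "card S \<le> card (\<Union>(?A ` S))" if S: "S \<subseteq> Y" for S
  proof (cases "S = {}")
    case True then show ?thesis by simp
  next
    case False
    then obtain y where y: "y \<in> S" by blast
    have finS: "finite S" using S finY by (rule finite_subset)
    let ?U = "\<Union>(?A ` S)"
    have finU: "finite ?U" by (rule finite_subset[OF _ finF]) auto
    have UF: "?U \<subseteq> ?F" by auto
    define X where "X = ?F - ?U"
    have cX: "card ?F = card ?U + card X"
      unfolding X_def using finU finF UF by (simp add: card_Diff_subset card_mono)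
    have SY: "card S \<le> card Y" using S finY by (rule card_mono[rotated])
    show ?thesis
    proof (cases "card S \<le> \<kappa> * d ^ D * N")
      case True
      have "card (?A y) \<le> card ?U" using y finU by (intro card_mono) auto
      then show ?thesis using True kN[of y] y S by auto
    next
      case big: False
      show ?thesis
      proof (cases "X = {}")
        case True then show ?thesis using SY cX cF by simp
      next
        case Xne: False
        have finX: "finite X" using finF by (simp add: X_def)
        have small: "card X < \<mu>2 * N"
        proof (rule ccontr)
          assume "\<not> card X < \<mu>2 * N"
          then have Xl: "\<mu>2 * N \<le> card X" by simp
          have XV: "X \<subseteq> V" by (auto simp: X_def free_def)
          have X0: "0 < card X" using Xne finX by (simp add: card_gt_0_iff)
          have "S \<subseteq> {x \<in> {..<N} - K. card (cand E \<phi> x \<inter> X) < \<kappa>' * card X}"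
          proof
            fix x assume x: "x \<in> S"
            then have "cand E \<phi> x \<inter> X = {}" by (auto simp: X_def)
            moreover have "x \<in> {..<N} - K" using x S YI I_sub by blast
            ultimately show "x \<in> {x \<in> {..<N} - K. card (cand E \<phi> x \<inter> X) < \<kappa>' * card X}"
              using X0 \<kappa>'_pos by simp
          qed
          then have "card S \<le> card {x \<in> {..<N} - K. card (cand E \<phi> x \<inter> X) < \<kappa>' * card X}"
            by (rule card_mono[rotated]) simp
          then have "card S \<le> \<mu>1 * N" using spread[OF psi EN XV Xl] by linarith
          moreover have "\<mu>1 * N \<le> \<kappa> * d ^ D / 4 * N" using \<mu>1_le by (intro mult_right_mono) auto
          moreover have "0 \<le> \<kappa> * d ^ D * N" using \<kappa>_pos dD by simp
          ultimately show False using big by simp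
        qed
        obtain v where v: "v \<in> X" using Xne by blast
        have vV: "v \<in> V" "v \<in> ?F" using v by (auto simp: X_def free_def)
        let ?T = "{y \<in> I. \<forall>x\<in>nb y. \<phi> x \<in> Nb v}"
        \<comment> \<open>Buffer vertices embedded early lie in \<open>R\<close>. The others in
          \<open>?T\<close> have the unserved vertex \<open>v\<close> as a candidate and therefore
          avoid \<open>S\<close>.\<close>
        have "?T \<subseteq> (Y - S) \<union> R"
        proof
          fix y assume y: "y \<in> ?T"
          show "y \<in> (Y - S) \<union> R"
          proof (cases "y \<in> E")
            case True then show ?thesis using y EI by auto
          next
            case False
            then have yY: "y \<in> Y" using y I_sub by (auto simp: Y_def)
            have "v \<in> cand E \<phi> y"
              unfolding cand_def
            proof (intro CollectI conjI ballI vV(1))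
              fix x assume x: "x \<in> nb y \<inter> E"
              have "\<phi> x \<in> V" using x emb by (auto simp: embedded_def)
              then show "v \<in> Nb (\<phi> x)" using Nb_sym[OF vV(1)] y x by blast
            qed
            then have "y \<notin> S" using v vV(2) by (auto simp: X_def)
            then show ?thesis using yY by blast
          qed
        qed
        then have "card ?T \<le> card ((Y - S) \<union> R)" using finY finR by (intro card_mono) auto
        also have "\<dots> \<le> card (Y - S) + card R" by (rule card_Un_le)
        finally have "(\<mu>1 + \<mu>2) * N \<le> card (Y - S) + \<mu>1 * N" using hit[OF vV(1)] cR by linarith
        then have "\<mu>2 * N \<le> card (Y - S)" by (simp add: algebra_simps)
        then have "card X < card (Y - S)" using small by linarith
        moreover have "card (Y - S) = card Y - card S" using finS S by (simp add: card_Diff_subset)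
        ultimately show ?thesis using cX cF by linarith
      qed
    qed
  qed
  have finA: "finite (?A y)" for y using finF by blast
  obtain f where f: "inj_on f Y" "\<And>y. y \<in> Y \<Longrightarrow> f y \<in> ?A y"
    using Hall_marriage[OF finY finA hall] by blast
  define \<psi> where "\<psi> x = (if x \<in> E then \<phi> x else f x)" for x
  have inj: "inj_on \<psi> {..<N}"
  proof (rule inj_onI)
    fix x y assume xy: "x \<in> {..<N}" "y \<in> {..<N}" "\<psi> x = \<psi> y"
    have fF: "f u \<notin> \<phi> ` E" if "u \<in> {..<N}" "u \<notin> E" for u using f(2)[of u] that by (auto simp: Y_def free_def)
    show "x = y"
    proof (cases "x \<in> E"; cases "y \<in> E")
      assume "x \<in> E" "y \<in> E" then show ?thesis using xy emb by (auto simp: \<psi>_def embedded_def dest: inj_onD)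
    next
      assume "x \<in> E" "y \<notin> E"
      then have "f y = \<phi> x" using xy by (simp add: \<psi>_def)
      then show ?thesis using fF[OF xy(2) \<open>y \<notin> E\<close>] \<open>x \<in> E\<close> by auto
    next
      assume "x \<notin> E" "y \<in> E"
      then have "f x = \<phi> y" using xy by (simp add: \<psi>_def)
      then show ?thesis using fF[OF xy(1) \<open>x \<notin> E\<close>] \<open>y \<in> E\<close> by auto
    next
      assume "x \<notin> E" "y \<notin> E"
      then show ?thesis using xy f(1) by (auto simp: \<psi>_def Y_def dest: inj_onD)
    qed
  qed
  have \<psi>V: "\<psi> x \<in> V" if "x < N" for x
  proof (cases "x \<in> E")
    case True then show ?thesis using emb by (auto simp: \<psi>_def embedded_def)
  next
    case False then show ?thesis using f(2)[of x] that by (auto simp: \<psi>_def Y_def free_def)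
  qed
  have img: "\<psi> ` {..<N} = V"
  proof (rule card_subset_eq[OF finV])
    show "\<psi> ` {..<N} \<subseteq> V" using \<psi>V by auto
    show "card (\<psi> ` {..<N}) = N" using inj by (simp add: card_image)
  qed
  \<comment> \<open>All neighbours of a buffer vertex lie in \<open>P\<close>, so no edge joins two
    vertices placed by Hall's theorem.\<close>
  have out: "\<psi> z \<in> Nb (\<psi> x) \<and> \<psi> x \<in> Nb (\<psi> z)" if x: "x < N" "x \<notin> E" and z: "z \<in> nb x" for x z
  proof -
    have xY: "x \<in> Y" using x by (simp add: Y_def)
    then have "x \<in> I" using YI by blast
    then have zE: "z \<in> E" using z PE by (auto simp: P_def)
    have "f x \<in> cand E \<phi> x" using f(2)[OF xY] by blast
    then have "f x \<in> Nb (\<phi> z)" using z zE by (auto simp: cand_def)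
    then have 1: "\<psi> x \<in> Nb (\<psi> z)" using x zE by (simp add: \<psi>_def)
    have "z < N" using zE EN by blast
    then show ?thesis using 1 Nb_sym[OF \<psi>V[OF \<open>z < N\<close>] \<psi>V[OF x(1)] 1] by blast
  qed
  have "\<psi> z \<in> Nb (\<psi> x)" if x: "x < N" and z: "z \<in> nb x" for x z
  proof (cases "x \<in> E")
    case False then show ?thesis using out[OF x _ z] by blast
  next
    case True
    have zN: "z < N" using nb_sub[OF x] z by blast
    show ?thesis
    proof (cases "z \<in> E")
      case True then show ?thesis using \<open>x \<in> E\<close> z emb by (auto simp: \<psi>_def embedded_def)
    next
      case False
      then show ?thesis using out[OF zN False nb_sym[OF x z]] by blast
    qed
  qed
  then show ?thesis using inj img by (auto simp: bij_betw_def)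
qed

end

section \<open>Spanning arrangeable subgraphs of quasirandom graphs\<close>

text \<open>Each edge contributes to the left degree of exactly one of its ends, so the degree sum
  is twice the sum of the left degrees.\<close>

lemma sum_degrees_le:
  fixes nb :: "nat \<Rightarrow> nat set"
  assumes nb_sub: "\<And>x. x < N \<Longrightarrow> nb x \<subseteq> {..<N}"
    and nb_sym: "\<And>x z. x < N \<Longrightarrow> z \<in> nb x \<Longrightarrow> x \<in> nb z"
    and nb_irrefl: "\<And>x. x \<notin> nb x"
    and left: "\<And>z. z < N \<Longrightarrow> card {u. u < z \<and> u \<in> nb z} \<le> l"
  shows "(\<Sum>x<N. card (nb x)) \<le> 2 * l * N"
proof -
  let ?l = "\<lambda>x u. if u < x \<and> u \<in> nb x then 1 else (0::nat)"
  have card_eq: "card {u. u < x \<and> u \<in> nb x} = (\<Sum>u<N. ?l x u)" if "x < N" for x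
  proof -
    have "{..<N} \<inter> {u. u < x \<and> u \<in> nb x} = {u. u < x \<and> u \<in> nb x}" using that by auto
    then show ?thesis by (simp add: sum.If_cases)
  qed
  have nb_eq: "card (nb x) = (\<Sum>u<N. ?l x u + ?l u x)" if x: "x < N" for x
  proof -
    have "?l x u + ?l u x = (if u \<in> nb x then 1 else 0)" if "u < N" for u
      using nb_sym[OF x, of u] nb_sym[OF that, of x] nb_irrefl[of x] by (cases u x rule: linorder_cases) auto
    then have "(\<Sum>u<N. ?l x u + ?l u x) = (\<Sum>u<N. if u \<in> nb x then 1 else 0)" by (intro sum.cong) auto
    also have "\<dots> = card ({..<N} \<inter> nb x)" by (simp add: sum.If_cases)
    also have "{..<N} \<inter> nb x = nb x" using nb_sub[OF x] by auto
    finally show ?thesis by simp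
  qed
  have "(\<Sum>x<N. card (nb x)) = (\<Sum>x<N. \<Sum>u<N. ?l x u) + (\<Sum>x<N. \<Sum>u<N. ?l u x)"
    by (simp add: nb_eq sum.distrib)
  also have "(\<Sum>x<N. \<Sum>u<N. ?l u x) = (\<Sum>u<N. \<Sum>x<N. ?l u x)" by (rule sum.swap)
  also have "(\<Sum>x<N. \<Sum>u<N. ?l x u) \<le> (\<Sum>x<N. l)"
    using left card_eq by (intro sum_mono) auto
  finally show ?thesis by (simp add: algebra_simps)
qed

text \<open>Greedy choice: \<open>k\<close> chosen vertices block at most \<open>k * (D + 1)\<close>
  vertices.\<close>

lemma independent_subset:
  fixes nb :: "nat \<Rightarrow> nat set"
  assumes "finite X" "\<And>x. x \<in> X \<Longrightarrow> finite (nb x) \<and> card (nb x) \<le> D"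
    and nb_sym: "\<And>x z. x \<in> X \<Longrightarrow> z \<in> nb x \<Longrightarrow> x \<in> nb z" and nb_irrefl: "\<And>x. x \<notin> nb x"
    and "k * (D + 1) \<le> card X"
  shows "\<exists>Y\<subseteq>X. card Y = k \<and> (\<forall>y\<in>Y. nb y \<inter> Y = {})"
  using assms(5)
proof (induction k)
  case 0 then show ?case by (intro exI[of _ "{}"]) auto
next
  case (Suc k)
  then obtain Y where Y: "Y \<subseteq> X" "card Y = k" "\<forall>y\<in>Y. nb y \<inter> Y = {}" by auto
  have finY: "finite Y" using Y(1) assms(1) by (rule finite_subset)
  let ?U = "Y \<union> (\<Union>y\<in>Y. nb y)"
  have "card ?U \<le> card Y + card (\<Union>y\<in>Y. nb y)" by (rule card_Un_le)
  also have "card (\<Union>y\<in>Y. nb y) \<le> (\<Sum>y\<in>Y. card (nb y))" by (rule card_UN_le[OF finY])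
  also have "\<dots> \<le> (\<Sum>y\<in>Y. D)" using assms(2) Y(1) by (intro sum_mono) auto
  also have "card Y + \<dots> = k * (D + 1)" using Y(2) by simp
  also have "\<dots> < card X" using Suc.prems by simp
  finally have "card ?U < card X" by simp
  moreover have "finite ?U" using finY assms(2) Y(1) by auto
  ultimately have "\<not> X \<subseteq> ?U" by (meson card_mono linorder_not_le)
  then obtain x where x: "x \<in> X" "x \<notin> ?U" by blast
  have "nb y \<inter> insert x Y = {}" if y: "y \<in> insert x Y" for y
  proof (cases "y = x")
    case True
    have "u \<notin> nb x" if u: "u \<in> Y" for u
    proof
      assume "u \<in> nb x"
      then have "x \<in> nb u" by (rule nb_sym[OF x(1)])
      then show False using x(2) u by blast
    qed
    then show ?thesis using True nb_irrefl[of x] by auto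
  next
    case False
    then have "y \<in> Y" using y by blast
    then show ?thesis using Y(3) x(2) by auto
  qed
  moreover have "card (insert x Y) = Suc k" using x(2) finY Y(2) by simp
  moreover have "insert x Y \<subseteq> X" using x(1) Y(1) by blast
  ultimately show ?case by blast
qed

lemma eventually_split_small:
  fixes d :: real
  assumes "0 < d"
  shows "\<exists>N0. \<forall>N\<ge>N0. 2 * real N * (4 / 5) ^ (8 * nat \<lfloor>d * real N / 8\<rfloor>) < 1"
proof -
  define y where "y = (4 / 5 :: real) ^ 8"
  have y: "0 < y" "y < 1" by (auto simp: y_def power_less_one_iff)
  have "(\<lambda>n. real n * y ^ n) \<longlonglongrightarrow> 0" using powser_times_n_limit_0[of y] y by simp
  moreover have "(\<lambda>n. y ^ n) \<longlonglongrightarrow> 0" using y by (intro LIMSEQ_power_zero) auto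
  ultimately have "(\<lambda>n. (16 / d) * (real n * y ^ n + y ^ n)) \<longlonglongrightarrow> (16 / d) * (0 + 0)"
    by (intro tendsto_mult tendsto_const tendsto_add)
  then have "eventually (\<lambda>n. (16 / d) * (real n * y ^ n + y ^ n) < 1) sequentially"
    by (intro order_tendstoD(2)[where y = 0]) auto
  then obtain n0 where n0: "\<And>n. n \<ge> n0 \<Longrightarrow> (16 / d) * (real n * y ^ n + y ^ n) < 1"
    by (auto simp: eventually_sequentially)
  show ?thesis
  proof (intro exI allI impI)
    fix N :: nat assume N: "N \<ge> nat \<lceil>8 * (real n0 + 1) / d\<rceil>"
    define j where "j = nat \<lfloor>d * real N / 8\<rfloor>"
    have "8 * (real n0 + 1) / d \<le> real N" using N by linarith
    then have "real n0 + 1 \<le> d * real N / 8" using assms by (simp add: field_simps)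
    then have jn: "n0 \<le> j" unfolding j_def by linarith
    have "d * real N / 8 < real j + 1" unfolding j_def by linarith
    then have "real N \<le> (8 / d) * (real j + 1)" using assms by (simp add: field_simps)
    then have "2 * real N * y ^ j \<le> 2 * ((8 / d) * (real j + 1)) * y ^ j" using y by (intro mult_right_mono mult_left_mono) auto
    also have "\<dots> = (16 / d) * (real j * y ^ j + y ^ j)" by (simp add: field_simps)
    also have "\<dots> < 1" by (rule n0[OF jn])
    finally show "2 * real N * (4 / 5) ^ (8 * nat \<lfloor>d * real N / 8\<rfloor>) < 1"
      by (simp add: y_def j_def power_mult)
  qed
qed

lemma eventually_ln_ge: "\<exists>N0. \<forall>N\<ge>N0. x \<le> ln (real N)"
proof -
  have "filterlim (\<lambda>N. ln (real N)) at_top sequentially"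
    by (rule filterlim_compose[OF ln_at_top filterlim_real_sequentially])
  then show ?thesis by (auto simp: filterlim_at_top eventually_sequentially)
qed

text \<open>Makes the degree bound of the theorem admissible in \<open>Mz_le\<close>, which asks for
  a bound of at least 1.\<close>

lemma eventually_sqrt_over_ln_ge_1: "\<exists>N0. \<forall>N\<ge>N0. 1 \<le> sqrt (real N) / ln (real N)"
proof (intro exI allI impI)
  fix N :: nat assume N: "N \<ge> 16"
  have "ln (sqrt (sqrt (real N))) \<le> sqrt (sqrt (real N)) - 1" using N by (intro ln_le_minus_one) auto
  moreover have "ln (sqrt (sqrt (real N))) = ln (real N) / 4" using N by (simp add: ln_sqrt)
  ultimately have "ln (real N) \<le> 4 * sqrt (sqrt (real N)) - 4" by simp
  moreover have "(sqrt (sqrt (real N)) - 2)\<^sup>2 = sqrt (real N) - 4 * sqrt (sqrt (real N)) + 4"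
    by (simp add: power2_diff)
  ultimately have "ln (real N) \<le> sqrt (real N)" using zero_le_power2[of "sqrt (sqrt (real N)) - 2"] by linarith
  moreover have "0 < ln (real N)" using N by simp
  ultimately show "1 \<le> sqrt (real N) / ln (real N)" by simp
qed

text \<open>The order of the constants is the delicate point: \<open>d\<close> and \<open>a\<close>
  determine \<open>\<tau>\<close>, \<open>D\<close>, the buffer density \<open>b\<close> and
  \<open>c1\<close>, then \<open>\<kappa>\<close>, \<open>\<mu>1\<close> and \<open>c\<close>. Only
  then comes the list length \<open>s\<close>, which depends on \<open>c\<close> and
  \<open>\<mu>1\<close>, and last \<open>\<epsilon>\<close>, \<open>\<delta>\<close> and
  \<open>\<mu>\<close>, which depend on \<open>s\<close>.\<close>

theorem spanning_embedding:
  fixes d :: real and a :: nat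
  assumes d: "0 < d" "d < 1"
  shows "\<exists>\<delta>>0. \<exists>N0. \<forall>(V :: 'v set) Nb nb.
    finite V \<and> N0 \<le> card V \<and> (\<forall>p\<in>V. Nb p \<subseteq> V) \<and> (\<forall>p\<in>V. \<forall>q\<in>V. q \<in> Nb p \<longrightarrow> p \<in> Nb q) \<and>
    lower_quasirandom V Nb d \<delta> \<and> (\<forall>p\<in>V. d * real (card V) \<le> real (card (Nb p))) \<and>
    (\<forall>x<card V. nb x \<subseteq> {..<card V}) \<and> (\<forall>x<card V. \<forall>z\<in>nb x. x \<in> nb z) \<and> (\<forall>x. x \<notin> nb x) \<and>
    (\<forall>z<card V. card {j. j < z \<and> (\<exists>k. z < k \<and> k < card V \<and> k \<in> nb z \<and> k \<in> nb j)} \<le> a) \<and>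
    (\<forall>x<card V. real (card (nb x)) \<le> sqrt (real (card V)) / ln (real (card V))) \<longrightarrow>
    (\<exists>\<psi>. bij_betw \<psi> {..<card V} V \<and> (\<forall>x<card V. \<forall>z\<in>nb x. \<psi> z \<in> Nb (\<psi> x)))"
proof -
  define \<tau> where "\<tau> = d / 8"
  have \<tau>: "0 < \<tau>" "\<tau> \<le> 1" using d by (auto simp: \<tau>_def)
  \<comment> \<open>The degree sum is at most \<open>2 * (a + 1) * N\<close>, so at most
    \<open>2 * (a + 1) * N / D\<close> vertices have degree above \<open>D\<close>;
    \<open>D0\<close> makes this small enough for \<open>K_small\<close>.\<close>
  obtain D0 :: nat where D0: "8 * (real a + 1) / (d ^ (a + 1) * \<tau>) \<le> real D0" using real_arch_simple by blast
  define D where "D = D0 + a + 1"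
  have D1: "1 \<le> D" "a + 1 \<le> D" by (auto simp: D_def)
  have Dbig: "2 * (real a + 1) \<le> d ^ (a + 1) * \<tau> / 4 * real D"
  proof -
    have "0 < d ^ (a + 1) * \<tau>" using d \<tau> by simp
    then have "8 * (real a + 1) \<le> d ^ (a + 1) * \<tau> * real D0" using D0 by (simp add: field_simps)
    also have "\<dots> \<le> d ^ (a + 1) * \<tau> * real D" using d \<tau> by (intro mult_left_mono) (auto simp: D_def)
    finally show ?thesis by simp
  qed
  have dD: "0 < d ^ D" "d ^ D < 1" using d D1 by (auto simp: power_less_one_iff)
  \<comment> \<open>A buffer of at most \<open>b * N\<close> vertices of degree at most
    \<open>D\<close> has at most \<open>d ^ D * \<tau> / 4 * N\<close> neighbours.\<close>
  define b where "b = d ^ D * \<tau> / (4 * D)"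
  have b: "0 < b" using dD \<tau> D1 by (simp add: b_def)
  define c1 where "c1 = d ^ D * \<tau> / 2"
  have c1: "0 < c1" "c1 \<le> 1 / 2"
  proof -
    show "0 < c1" using dD \<tau> by (simp add: c1_def)
    have "d ^ D * \<tau> \<le> 1 * 1" using dD \<tau> by (intro mult_mono) auto
    then show "c1 \<le> 1 / 2" by (simp add: c1_def)
  qed
  \<comment> \<open>The buffer will have at least \<open>b * N / 2\<close> vertices, so the initial
    survival weight is at least \<open>4 * z0 * N\<close>; \<open>\<mu>1\<close>,
    \<open>\<mu>2\<close> and \<open>\<epsilon>\<close> will each be at most
    \<open>z0\<close>.\<close>
  define z0 where "z0 = c1 ^ (D + D * D) * b / 8"
  have z0: "0 < z0" using c1 b by (simp add: z0_def)
  \<comment> \<open>Strictly below the typical density \<open>d ^ D\<close>: then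
    \<open>(1 - d ^ D) / (1 - \<kappa>')\<close> is less than 1, and a large \<open>s\<close> beats
    the factor \<open>(1 / c) ^ D\<close>.\<close>
  define \<kappa>' where "\<kappa>' = d ^ D / 2"
  have \<kappa>': "0 < \<kappa>'" "\<kappa>' < 1" using dD by (auto simp: \<kappa>'_def)
  define \<mu>2 where "\<mu>2 = z0"
  define \<kappa> where "\<kappa> = min (\<tau> / 2) (\<kappa>' * \<mu>2)"
  have \<kappa>: "0 < \<kappa>" "\<kappa> \<le> \<tau> / 2" "\<kappa> \<le> \<kappa>' * \<mu>2" using \<tau> \<kappa>' z0 by (auto simp: \<kappa>_def \<mu>2_def)
  define \<mu>1 where "\<mu>1 = min (\<kappa> * d ^ D / 4) z0"
  have \<mu>1: "0 < \<mu>1" "\<mu>1 \<le> \<kappa> * d ^ D / 4" "\<mu>1 \<le> z0" using \<kappa> dD z0 by (auto simp: \<mu>1_def)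
  define c where "c = min (\<kappa> * d ^ D / 8) c1"
  have c: "0 < c" "c \<le> \<kappa> * d ^ D / 8" "c \<le> c1" "c < 1" using \<kappa> dD c1 by (auto simp: c_def min_def)
  obtain s where s: "1 \<le> s" "(1 / c) ^ D * (1 - d ^ D) ^ s \<le> \<mu>1 / 4 * (1 - \<kappa>') ^ s"
  proof -
    define r where "r = (1 - d ^ D) / (1 - \<kappa>')"
    have r: "0 \<le> r" "r < 1" using dD by (auto simp: r_def \<kappa>'_def field_simps)
    have "0 < c ^ D * \<mu>1 / 4" using c \<mu>1 by simp
    then obtain n where n: "r ^ n < c ^ D * \<mu>1 / 4" using real_arch_pow_inv[of "c ^ D * \<mu>1 / 4" r] r by auto
    have "r ^ (n + 1) \<le> r ^ n" using r by (intro power_decreasing) auto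
    then have "r ^ (n + 1) \<le> c ^ D * \<mu>1 / 4" using n by linarith
    then have "(1 - d ^ D) ^ (n + 1) \<le> c ^ D * \<mu>1 / 4 * (1 - \<kappa>') ^ (n + 1)"
      using \<kappa>' by (simp add: r_def power_divide field_simps)
    then have "(1 / c) ^ D * (1 - d ^ D) ^ (n + 1) \<le> (1 / c) ^ D * (c ^ D * \<mu>1 / 4 * (1 - \<kappa>') ^ (n + 1))"
      using c by (intro mult_left_mono) auto
    also have "\<dots> = \<mu>1 / 4 * (1 - \<kappa>') ^ (n + 1)" using c by (simp add: power_divide)
    finally show ?thesis using that[of "n + 1"] by simp
  qed
  \<comment> \<open>\<open>4 * e\<close> is the right side of \<open>\<mu>1_ge\<close>; the terms
    with \<open>\<epsilon>\<close>, with \<open>\<delta>\<close> and with the power \<open>s\<close>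
    receive \<open>e\<close> each.\<close>
  define e where "e = \<mu>1 / 4 * (1 - \<kappa>') ^ s"
  have e: "0 < e" using \<mu>1 \<kappa>' by (simp add: e_def)
  define \<epsilon> where "\<epsilon> = min e z0"
  have \<epsilon>: "0 < \<epsilon>" "\<epsilon> \<le> e" "\<epsilon> \<le> z0" using e z0 by (auto simp: \<epsilon>_def)
  define n0 :: real where "n0 = 2 ^ (a + 1) + a + 1 + 2 * D"
  have n0: "0 < n0" unfolding n0_def of_nat_0_less_iff by simp
  define \<delta> where "\<delta> = min (min (d ^ D * \<tau> / 4 / n0) (\<kappa> * d ^ D / 4 / (D + 1))) (min (d ^ D * \<mu>2) (e * c ^ D / D))"
  have \<delta>pos: "0 < \<delta>" using dD \<tau> n0 \<kappa> z0 e c D1 by (auto simp: \<delta>_def \<mu>2_def)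
  have \<delta>1: "n0 * \<delta> \<le> d ^ D * \<tau> / 4"
  proof -
    have "\<delta> \<le> d ^ D * \<tau> / 4 / n0" by (simp add: \<delta>_def)
    then show ?thesis using n0 by (simp add: field_simps)
  qed
  have \<delta>2: "(real D + 1) * \<delta> \<le> \<kappa> * d ^ D / 4"
  proof -
    have "\<delta> \<le> \<kappa> * d ^ D / 4 / (D + 1)" by (simp add: \<delta>_def)
    then show ?thesis by (simp add: field_simps)
  qed
  have \<delta>3: "\<delta> \<le> d ^ D * \<mu>2" by (simp add: \<delta>_def)
  have \<delta>4: "(1 / c) ^ D * (D * \<delta>) \<le> e"
  proof -
    have "\<delta> \<le> e * c ^ D / D" by (simp add: \<delta>_def)
    then have "D * \<delta> \<le> e * c ^ D" using D1 by (simp add: field_simps)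
    then have "(1 / c) ^ D * (D * \<delta>) \<le> (1 / c) ^ D * (e * c ^ D)" using c by (intro mult_left_mono) auto
    also have "\<dots> = e" using c by (simp add: power_divide)
    finally show ?thesis .
  qed
  \<comment> \<open>With \<open>\<mu> = L * ln N / N\<close> the budget
    \<open>\<mu> * \<epsilon> * N\<close> becomes \<open>2 * (s + 1) * ln N\<close>: one half for
    \<open>ln (N ^ s + N)\<close>, the other for the squares.\<close>
  define L where "L = 2 * (real s + 1) / \<epsilon>"
  have L: "0 < L" using \<epsilon> by (simp add: L_def)
  define M0 where "M0 = (1 / c) ^ D + 2"
  define S0 where "S0 = (1 / c) ^ D * D + D + D * D"
  have M0: "0 < M0" using c by (simp add: M0_def add_nonneg_pos)
  have S0: "0 \<le> S0" using c by (simp add: S0_def)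
  obtain N1 where N1: "\<And>N. N \<ge> N1 \<Longrightarrow> 2 * real N * (4 / 5) ^ (8 * nat \<lfloor>d * real N / 8\<rfloor>) < 1"
    using eventually_split_small[OF d(1)] by blast
  obtain N2 :: nat where N2: "2 / b \<le> real N2" using real_arch_simple by blast
  obtain N3 :: nat where N3: "8 / (\<kappa> * d ^ D) \<le> real N3" using real_arch_simple by blast
  obtain N4 where N4: "\<And>N. N \<ge> N4 \<Longrightarrow> 1 \<le> sqrt (real N) / ln (real N)"
    using eventually_sqrt_over_ln_ge_1 by blast
  obtain N5 where N5: "\<And>N. N \<ge> N5 \<Longrightarrow> max 1 (max (L * M0) (L\<^sup>2 * M0 * S0 / (s + 1))) \<le> ln (real N)"
    using eventually_ln_ge by blast
  define N0 where "N0 = max (max N1 N2) (max (max N3 N4) (max N5 2))"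
  show ?thesis
  proof (intro exI[of _ \<delta>] conjI \<delta>pos exI[of _ N0] allI impI)
    fix V :: "'v set" and Nb :: "'v \<Rightarrow> 'v set" and nb :: "nat \<Rightarrow> nat set"
    assume asm: "finite V \<and> N0 \<le> card V \<and> (\<forall>p\<in>V. Nb p \<subseteq> V) \<and> (\<forall>p\<in>V. \<forall>q\<in>V. q \<in> Nb p \<longrightarrow> p \<in> Nb q) \<and>
      lower_quasirandom V Nb d \<delta> \<and> (\<forall>p\<in>V. d * real (card V) \<le> real (card (Nb p))) \<and>
      (\<forall>x<card V. nb x \<subseteq> {..<card V}) \<and> (\<forall>x<card V. \<forall>z\<in>nb x. x \<in> nb z) \<and> (\<forall>x. x \<notin> nb x) \<and>
      (\<forall>z<card V. card {j. j < z \<and> (\<exists>k. z < k \<and> k < card V \<and> k \<in> nb z \<and> k \<in> nb j)} \<le> a) \<and>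
      (\<forall>x<card V. real (card (nb x)) \<le> sqrt (real (card V)) / ln (real (card V)))"
    define N where "N = card V"
    have finV: "finite V" and NbV: "\<And>p. p \<in> V \<Longrightarrow> Nb p \<subseteq> V"
      and Nbsym: "\<And>p q. p \<in> V \<Longrightarrow> q \<in> V \<Longrightarrow> q \<in> Nb p \<Longrightarrow> p \<in> Nb q"
      and qr: "lower_quasirandom V Nb d \<delta>" and deg: "\<And>p. p \<in> V \<Longrightarrow> d * real N \<le> real (card (Nb p))"
      and nbV: "\<And>x. x < N \<Longrightarrow> nb x \<subseteq> {..<N}" and nbsym: "\<And>x z. x < N \<Longrightarrow> z \<in> nb x \<Longrightarrow> x \<in> nb z"
      and nbirr: "\<And>x. x \<notin> nb x"
      and arr: "\<And>z. z < N \<Longrightarrow> card {j. j < z \<and> (\<exists>k. z < k \<and> k < N \<and> k \<in> nb z \<and> k \<in> nb j)} \<le> a"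
      and \<Delta>: "\<And>x. x < N \<Longrightarrow> real (card (nb x)) \<le> sqrt (real N) / ln (real N)"
      and NN0: "N0 \<le> N"
      using asm unfolding N_def by auto
    have NN: "N1 \<le> N" "N2 \<le> N" "N3 \<le> N" "N4 \<le> N" "N5 \<le> N" "2 \<le> N" using NN0 by (auto simp: N0_def)
    have Vne: "V \<noteq> {}" using NN(6) N_def by auto
    have finnb: "finite (nb x)" if "x < N" for x by (rule finite_subset[OF nbV[OF that] finite_lessThan])
    obtain V0 where V0: "V0 \<subseteq> V" "\<And>v. v \<in> V \<Longrightarrow> card (Nb v \<inter> V0) > nat \<lfloor>d * real N / 8\<rfloor>"
      "\<And>v. v \<in> V \<Longrightarrow> card (Nb v - V0) > nat \<lfloor>d * real N / 8\<rfloor>"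
    proof -
      have "8 * nat \<lfloor>d * real N / 8\<rfloor> \<le> card (Nb v)" if "v \<in> V" for v
      proof -
        have "real (nat \<lfloor>d * real N / 8\<rfloor>) \<le> d * real N / 8" by (rule of_nat_floor) (use d in simp)
        then have "real (8 * nat \<lfloor>d * real N / 8\<rfloor>) \<le> real (card (Nb v))" using deg[OF that] by simp
        then show ?thesis by (simp only: of_nat_le_iff)
      qed
      then have "\<exists>S\<subseteq>V. \<forall>v\<in>V. card (Nb v \<inter> S) > nat \<lfloor>d * real N / 8\<rfloor> \<and> card (Nb v - S) > nat \<lfloor>d * real N / 8\<rfloor>"
        using N1[OF NN(1)] by (intro balanced_split finV NbV) (auto simp: N_def)
      then show ?thesis using that by blast
    qed
    have fl: "\<tau> * N \<le> real n" if "n > nat \<lfloor>d * real N / 8\<rfloor>" for n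
      using that unfolding \<tau>_def by linarith
    define K where "K = {x. x < N \<and> D < card (nb x)}"
    have KN: "K \<subseteq> {..<N}" by (auto simp: K_def)
    have cK: "real (card K) \<le> d ^ (a + 1) * \<tau> / 4 * N"
    proof -
      have left: "card {u. u < z \<and> u \<in> nb z} \<le> a + 1" if "z < N" for z
        using left_degree_le[where nb = nb and N = N, OF nbsym arr that] by simp
      have "card K * D = (\<Sum>x\<in>K. D)" by simp
      also have "\<dots> \<le> (\<Sum>x\<in>K. card (nb x))" by (intro sum_mono) (auto simp: K_def)
      also have "\<dots> \<le> (\<Sum>x<N. card (nb x))" using KN by (intro sum_mono2) auto
      also have "\<dots> \<le> 2 * (a + 1) * N" by (rule sum_degrees_le[OF nbV nbsym nbirr left])
      finally have "real (card K * D) \<le> real (2 * (a + 1) * N)" by (simp only: of_nat_le_iff)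
      then have "real (card K) * D \<le> 2 * (real a + 1) * N" by (simp add: algebra_simps)
      also have "\<dots> \<le> (d ^ (a + 1) * \<tau> / 4 * D) * N" using Dbig by (intro mult_right_mono) auto
      also have "\<dots> = (d ^ (a + 1) * \<tau> / 4 * N) * D" by simp
      finally show ?thesis using D1 by simp
    qed
    define k where "k = nat \<lfloor>b * N\<rfloor>"
    have k: "real k \<le> b * N" "b * N / 2 \<le> real k"
    proof -
      show "real k \<le> b * N" unfolding k_def by (rule of_nat_floor) (use b in simp)
      have "2 / b \<le> real N" using N2 NN(2) by (meson of_nat_le_iff order_trans)
      then have "2 \<le> b * N" using b by (simp add: field_simps)
      then show "b * N / 2 \<le> real k" unfolding k_def by linarith
    qed
    have "k * (D + 1) \<le> card ({..<N} - K)"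
    proof -
      have "d ^ (a + 1) * \<tau> \<le> 1 * 1" using d \<tau> by (intro mult_mono power_le_one) auto
      then have "d ^ (a + 1) * \<tau> / 4 * N \<le> 1 / 4 * N" by (intro mult_right_mono) auto
      then have K4: "card K \<le> N / 4" using cK by simp
      have "d ^ D * \<tau> \<le> 1 * 1" using dD \<tau> by (intro mult_mono) auto
      then have "b \<le> 1 / (4 * D)" unfolding b_def using D1 by (intro divide_right_mono) auto
      then have "b * N * (D + 1) \<le> 1 / (4 * D) * N * (D + 1)" by (intro mult_right_mono) auto
      also have "\<dots> = N / 4 * ((D + 1) / D)" using D1 by (simp add: field_simps)
      also have "\<dots> \<le> N / 4 * 2" using D1 by (intro mult_left_mono) (auto simp: field_simps)
      finally have "b * N * (D + 1) \<le> N / 2" by simp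
      moreover have "real k * (D + 1) \<le> b * N * (D + 1)" using k by (intro mult_right_mono) auto
      moreover have "real N - card K \<le> card ({..<N} - K)"
        using card_Diff_ge_real[of K "{..<N}"] finite_subset[OF KN] by simp
      ultimately have "real k * (D + 1) \<le> card ({..<N} - K)" using K4 by linarith
      then have "real (k * (D + 1)) \<le> real (card ({..<N} - K))" by (simp only: of_nat_mult)
      then show ?thesis by (simp only: of_nat_le_iff)
    qed
    then have "\<exists>Y\<subseteq>{..<N} - K. card Y = k \<and> (\<forall>y\<in>Y. nb y \<inter> Y = {})"
      using finnb nbsym nbirr by (intro independent_subset) (auto simp: K_def)
    then obtain I where I: "I \<subseteq> {..<N} - K" "card I = k" "\<And>y. y \<in> I \<Longrightarrow> nb y \<inter> I = {}" by blast
    have finI: "finite I" by (rule finite_subset[OF I(1)]) simp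
    have NI: "real (card (\<Union>(nb ` I))) \<le> d ^ D * \<tau> / 4 * N"
    proof -
      have "card (\<Union>(nb ` I)) \<le> (\<Sum>y\<in>I. card (nb y))" by (rule card_UN_le[OF finI])
      also have "\<dots> \<le> (\<Sum>y\<in>I. D)" using I(1) by (intro sum_mono) (auto simp: K_def)
      also have "\<dots> = k * D" using I(2) by simp
      finally have "real (card (\<Union>(nb ` I))) \<le> real (k * D)" by (simp only: of_nat_le_iff)
      also have "\<dots> \<le> b * N * D" using k by (simp add: mult_right_mono)
      also have "\<dots> = d ^ D * \<tau> / 4 * N" using D1 by (simp add: b_def)
      finally show ?thesis .
    qed
    have lnN: "1 \<le> ln (real N)" "L * M0 \<le> ln (real N)" "L\<^sup>2 * M0 * S0 / (s + 1) \<le> ln (real N)"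
      using N5[OF NN(5)] by auto
    define \<mu> where "\<mu> = L * ln (real N) / N"
    have \<mu>: "0 < \<mu>" using L lnN NN by (simp add: \<mu>_def)
    have FP: "first_phase V Nb d \<delta> nb K D c a I V0 \<tau> c1 \<mu>"
    proof (unfold_locales, fold N_def)
      show "finite V" "V \<noteq> {}" by fact+
      show "K \<subseteq> {..<N}" by (rule KN)
      show "card (nb x) \<le> D" if "x < N" "x \<notin> K" for x using that by (auto simp: K_def)
      show "I \<subseteq> {..<N} - K" by (rule I(1))
      show "V0 \<subseteq> V" by (rule V0(1))
      show "\<tau> * N \<le> card (Nb v \<inter> V0)" if "v \<in> V" for v using fl[OF V0(2)[OF that]] .
      show "\<tau> * N \<le> card (Nb v - V0)" if "v \<in> V" for v using fl[OF V0(3)[OF that]] .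
      show "(2 ^ (a + 1) + a + 1 + 2 * D) * \<delta> \<le> d ^ D * \<tau> / 4" using \<delta>1 by (simp add: n0_def)
      show "c1 = d ^ D * \<tau> / 2" by (rule c1_def)
    qed (fact NbV Nbsym qr d \<delta>pos nbV nbsym nbirr c arr \<tau>(1) cK NI D1 \<mu>)+
    interpret first_phase V Nb d \<delta> nb K D c a I V0 \<tau> c1 \<mu> s by (rule FP)
    let ?\<Delta> = "sqrt (real N) / ln (real N)"
    have \<Delta>1: "1 \<le> ?\<Delta>" by (rule N4[OF NN(4)])
    have \<Delta>2: "?\<Delta>\<^sup>2 = N / (ln (real N))\<^sup>2" by (simp add: power_divide)
    have Mle: "Mz z \<le> M0 * (N / (ln (real N))\<^sup>2)" if "z < N" for z
      using Mz_le[of ?\<Delta> z, folded N_def, OF \<Delta> \<Delta>1 that] unfolding M0_def \<Delta>2 .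
    have M0z: "0 \<le> Mz z" for z using c by (simp add: Mz_def)
    have step: "\<mu> * Mz z \<le> 1" if "z < N" for z
    proof -
      have "\<mu> * Mz z \<le> \<mu> * (M0 * (N / (ln (real N))\<^sup>2))" using Mle[OF that] \<mu> by (intro mult_left_mono) auto
      also have "\<dots> = L * M0 / ln (real N)" using NN lnN by (simp add: \<mu>_def power2_eq_square)
      also have "\<dots> \<le> 1" using lnN by simp
      finally show ?thesis .
    qed
    have pot: "ln (real (N ^ s + N)) + \<mu>\<^sup>2 * (\<Sum>z<N. (Mz z)\<^sup>2) \<le> \<mu> * (\<epsilon> * N)"
    proof -
      \<comment> \<open>Maximum times sum. The degree bound makes the maximum of order
        \<open>N / (ln N)\<^sup>2\<close>, and the sum is linear, so after multiplication by
        \<open>\<mu>\<^sup>2\<close> a constant remains.\<close>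
      have "(\<Sum>z<N. (Mz z)\<^sup>2) \<le> (\<Sum>z<N. M0 * (N / (ln (real N))\<^sup>2) * Mz z)"
      proof (rule sum_mono)
        fix z assume "z \<in> {..<N}"
        then have "Mz z * Mz z \<le> M0 * (N / (ln (real N))\<^sup>2) * Mz z" using Mle[of z] M0z[of z] by (intro mult_right_mono) auto
        then show "(Mz z)\<^sup>2 \<le> M0 * (N / (ln (real N))\<^sup>2) * Mz z" by (simp only: power2_eq_square)
      qed
      also have "\<dots> = M0 * (N / (ln (real N))\<^sup>2) * (\<Sum>z<N. Mz z)" by (simp add: sum_distrib_left)
      also have "\<dots> \<le> M0 * (N / (ln (real N))\<^sup>2) * (S0 * N)"
        using sum_Mz[folded N_def] M0 unfolding S0_def by (intro mult_left_mono) auto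
      finally have "\<mu>\<^sup>2 * (\<Sum>z<N. (Mz z)\<^sup>2) \<le> \<mu>\<^sup>2 * (M0 * (N / (ln (real N))\<^sup>2) * (S0 * N))"
        by (intro mult_left_mono) auto
      also have "\<dots> = L\<^sup>2 * M0 * S0" using NN lnN by (simp add: \<mu>_def power2_eq_square)
      also have "\<dots> \<le> (s + 1) * ln (real N)" using lnN(3) by (simp add: field_simps)
      finally have 1: "\<mu>\<^sup>2 * (\<Sum>z<N. (Mz z)\<^sup>2) \<le> (s + 1) * ln (real N)" .
      have "N ^ s + N \<le> N ^ s + N ^ s" using s(1) NN(6) self_le_power[of N s] by simp
      also have "\<dots> = 2 * N ^ s" by simp
      also have "\<dots> \<le> N * N ^ s" using NN(6) by (rule mult_le_mono1)
      finally have "real (N ^ s + N) \<le> real (N * N ^ s)" by (simp only: of_nat_le_iff)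
      then have "real (N ^ s + N) \<le> real N ^ (s + 1)" by simp
      then have "ln (real (N ^ s + N)) \<le> ln (real N ^ (s + 1))"
        using NN(6) by (subst ln_le_cancel_iff) (auto intro: add_nonneg_pos)
      also have "\<dots> = (s + 1) * ln (real N)" using NN(6) ln_realpow[of "real N" "s + 1"] by simp
      finally have 2: "ln (real (N ^ s + N)) \<le> (s + 1) * ln (real N)" .
      have "\<mu> * (\<epsilon> * N) = 2 * (s + 1) * ln (real N)"
        using NN(6) \<epsilon> by (simp add: \<mu>_def L_def)
      then show ?thesis using 1 2 by (simp add: algebra_simps)
    qed
    have SP: "second_phase V Nb d \<delta> nb K D c a I V0 \<tau> c1 \<mu> s \<kappa> \<kappa>' \<mu>1 \<mu>2 \<epsilon>"
    proof (unfold_locales, fold N_def)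
      show "0 < \<mu>2" using z0 by (simp add: \<mu>2_def)
      have c1le: "c1 ^ (D + D * D) \<le> 1" using c1 by (intro power_le_one) auto
      have I2: "c1 ^ (D + D * D) * (b * N / 2) \<le> c1 ^ (D + D * D) * card I"
        using k(2) I(2) c1 by (intro mult_left_mono) auto
      have eq: "c1 ^ (D + D * D) * (b * N / 2) = 4 * z0 * N" by (simp add: z0_def)
      have "c1 ^ (D + D * D) * card I \<le> 1 * real (card I)" using c1le by (intro mult_right_mono) auto
      then have z4: "4 * z0 * N \<le> card I" using I2 eq by linarith
      have "(\<mu>1 + \<mu>2) * N \<le> (2 * z0) * N" using \<mu>1 by (intro mult_right_mono) (auto simp: \<mu>2_def)
      moreover have "0 \<le> z0 * N" using z0 by simp
      ultimately show "(\<mu>1 + \<mu>2) * N \<le> card I" using z4 by linarith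
      have "(\<mu>1 + \<mu>2 + \<epsilon>) * N \<le> (3 * z0) * N" using \<mu>1 \<epsilon> by (intro mult_right_mono) (auto simp: \<mu>2_def)
      then show "(\<mu>1 + \<mu>2 + \<epsilon>) * N \<le> c1 ^ (D + D * D) * card I" using I2 eq z0 \<open>0 \<le> z0 * N\<close> by linarith
      have "8 / (\<kappa> * d ^ D) \<le> real N" using N3 NN(3) by (meson of_nat_le_iff order_trans)
      then show "8 \<le> \<kappa> * d ^ D * N" using \<kappa> dD by (simp add: field_simps)
      have "\<epsilon> + (1 / c) ^ D * (D * \<delta> + (1 - d ^ D) ^ s) \<le> e + (e + e)"
        using \<epsilon>(2) \<delta>4 s(2) unfolding distrib_left e_def by (intro add_mono) auto
      also have "\<dots> \<le> \<mu>1 * (1 - \<kappa>') ^ s" using e by (simp add: e_def)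
      finally show "\<epsilon> + (1 / c) ^ D * (D * \<delta> + (1 - d ^ D) ^ s) \<le> \<mu>1 * (1 - \<kappa>') ^ s" .
      show "(D + 1) * \<delta> \<le> \<kappa> * d ^ D / 4" using \<delta>2 by (simp add: add.commute)
      show "ln (N ^ s + N) + \<mu>\<^sup>2 * (\<Sum>z<N. (Mz z)\<^sup>2) \<le> \<mu> * (\<epsilon> * N)" using pot by simp
    qed (fact I(3) \<kappa> \<kappa>' \<mu>1 c \<delta>3 step)+
    then interpret second_phase V Nb d \<delta> nb K D c a I V0 \<tau> c1 \<mu> s \<kappa> \<kappa>' \<mu>1 \<mu>2 \<epsilon> .
    show "\<exists>\<psi>. bij_betw \<psi> {..<card V} V \<and> (\<forall>x<card V. \<forall>z\<in>nb x. \<psi> z \<in> Nb (\<psi> x))"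
      by (rule spanning_copy)
  qed
qed

section \<open>Quasirandom colour classes\<close>

text \<open>Removing an element of largest value does not raise the average. This will carry density
  from sets of one exact size to all larger sets.\<close>

lemma low_average_subset:
  fixes f :: "'a \<Rightarrow> real"
  assumes "finite X" "k \<le> card X"
  shows "\<exists>X'\<subseteq>X. card X' = k \<and> sum f X' * card X \<le> sum f X * k"
  using assms
proof (induction "card X - k" arbitrary: X)
  case 0
  then show ?case by (intro exI[of _ X]) auto
next
  case (Suc n)
  have Xne: "X \<noteq> {}" and kX: "k < card X" using Suc.hyps(2) by auto
  have "Max (f ` X) \<in> f ` X" using Xne Suc.prems(1) by (intro Max_in) auto
  then obtain x where x0: "x \<in> X" "Max (f ` X) = f x" by blast
  have x: "x \<in> X" "\<And>y. y \<in> X \<Longrightarrow> f y \<le> f x"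
    using x0 Suc.prems(1) Max_ge[of "f ` X"] by auto
  define X1 where "X1 = X - {x}"
  have fin1: "finite X1" and c1: "card X = Suc (card X1)"
    using Suc.prems(1) x(1) card_Suc_Diff1[of X x] by (auto simp: X1_def)
  have s1: "sum f X = sum f X1 + f x" using Suc.prems(1) x(1) by (simp add: X1_def sum.remove)
  have "sum f X1 \<le> card X1 * f x" using x by (intro sum_bounded_above) (auto simp: X1_def)
  then have avg: "sum f X1 * card X \<le> sum f X * card X1" unfolding s1 c1 by (simp add: algebra_simps)
  have "n = card X1 - k" "k \<le> card X1" using Suc.hyps(2) c1 kX by auto
  then obtain X' where X': "X' \<subseteq> X1" "card X' = k" "sum f X' * card X1 \<le> sum f X1 * k"
    using Suc.hyps(1)[OF _ fin1] by blast
  have "sum f X' * card X \<le> sum f X * k"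
  proof (cases "card X1 = 0")
    case True
    then have "k = 0" "X' = {}" using \<open>k \<le> card X1\<close> X' fin1 by auto
    then show ?thesis by simp
  next
    case False
    have "(sum f X' * card X) * card X1 = (sum f X' * card X1) * card X" by simp
    also have "\<dots> \<le> (sum f X1 * k) * card X" using X'(3) by (intro mult_right_mono) auto
    also have "\<dots> = (sum f X1 * card X) * k" by simp
    also have "\<dots> \<le> (sum f X * card X1) * k" using avg by (intro mult_right_mono) auto
    finally have "(sum f X' * card X) * card X1 \<le> (sum f X * k) * card X1" by (simp add: mult_ac)
    then show ?thesis using False by simp
  qed
  then show ?case using X' by (intro exI[of _ X']) (auto simp: X1_def)
qed

lemma equipartition:
  assumes "finite A" "card A = L * m"
  shows "\<exists>P. (\<forall>i<L. P i \<subseteq> A \<and> card (P i) = m) \<and> (\<forall>i<L. \<forall>j<L. i \<noteq> j \<longrightarrow> P i \<inter> P j = {}) \<and> (\<Union>i<L. P i) = A"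
  using assms
proof (induction L arbitrary: A)
  case 0
  then show ?case by auto
next
  case (Suc L)
  have "m \<le> card A" using Suc.prems by simp
  then obtain X where X: "X \<subseteq> A" "card X = m" using obtain_subset_with_card_n by metis
  have finX: "finite X" using X(1) Suc.prems(1) by (rule finite_subset)
  have "card (A - X) = L * m" using X Suc.prems finX by (simp add: card_Diff_subset)
  then obtain P where P0: "\<forall>i<L. P i \<subseteq> A - X \<and> card (P i) = m"
    "\<forall>i<L. \<forall>j<L. i \<noteq> j \<longrightarrow> P i \<inter> P j = {}" "(\<Union>i<L. P i) = A - X"
    using Suc.IH[of "A - X"] finite_Diff[OF Suc.prems(1), of X] by blast
  have P: "\<And>i. i < L \<Longrightarrow> P i \<subseteq> A - X \<and> card (P i) = m"
    "\<And>i j. i < L \<Longrightarrow> j < L \<Longrightarrow> i \<noteq> j \<Longrightarrow> P i \<inter> P j = {}" "(\<Union>i<L. P i) = A - X"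
    using P0 by auto
  define Q where "Q i = (if i = L then X else P i)" for i
  have "Q i \<subseteq> A \<and> card (Q i) = m" if "i < Suc L" for i using that X P(1)[of i] by (auto simp: Q_def less_Suc_eq)
  moreover have "Q i \<inter> Q j = {}" if "i < Suc L" "j < Suc L" "i \<noteq> j" for i j
    using that P(1)[of i] P(1)[of j] P(2)[of i j] by (auto simp: Q_def less_Suc_eq)
  moreover have "(\<Union>i<Suc L. Q i) = A"
  proof -
    have "(\<Union>i<L. Q i) = (\<Union>i<L. P i)" by (auto simp: Q_def)
    moreover have "(\<Union>i<Suc L. Q i) = Q L \<union> (\<Union>i<L. Q i)" by (auto simp: less_Suc_eq)
    ultimately show ?thesis using P(3) X(1) by (auto simp: Q_def)
  qed
  ultimately show ?case by blast
qed

lemma equipartition_containing: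
  assumes "finite A" "card A = L * m" "X \<subseteq> A" "card X = m" "0 < L"
  shows "\<exists>P. P 0 = X \<and> (\<forall>i<L. P i \<subseteq> A \<and> card (P i) = m) \<and> (\<forall>i<L. \<forall>j<L. i \<noteq> j \<longrightarrow> P i \<inter> P j = {}) \<and> (\<Union>i<L. P i) = A"
proof -
  obtain L' where L: "L = Suc L'" using assms(5) gr0_implies_Suc by blast
  have finX: "finite X" using assms(3,1) by (rule finite_subset)
  have "card (A - X) = L' * m" using assms finX L by (simp add: card_Diff_subset)
  then obtain P where P0: "\<forall>i<L'. P i \<subseteq> A - X \<and> card (P i) = m"
    "\<forall>i<L'. \<forall>j<L'. i \<noteq> j \<longrightarrow> P i \<inter> P j = {}" "(\<Union>i<L'. P i) = A - X"
    using equipartition[OF finite_Diff[OF assms(1)], of X L' m] by blast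
  have P: "\<And>i. i < L' \<Longrightarrow> P i \<subseteq> A - X \<and> card (P i) = m"
    "\<And>i j. i < L' \<Longrightarrow> j < L' \<Longrightarrow> i \<noteq> j \<Longrightarrow> P i \<inter> P j = {}" "(\<Union>i<L'. P i) = A - X"
    using P0 by auto
  define Q where "Q i = (case i of 0 \<Rightarrow> X | Suc j \<Rightarrow> P j)" for i
  have "Q i \<subseteq> A \<and> card (Q i) = m" if "i < L" for i
    using that assms P(1) L by (cases i) (auto simp: Q_def)
  moreover have "Q i \<inter> Q j = {}" if ij: "i < L" "j < L" "i \<noteq> j" for i j
  proof (cases i)
    case 0
    then obtain j' where "j = Suc j'" "j' < L'" using ij L by (cases j) auto
    then show ?thesis using P(1)[of j'] 0 by (auto simp: Q_def)
  next
    case (Suc i')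
    then have i': "i' < L'" using that L by simp
    show ?thesis
    proof (cases j)
      case 0 then show ?thesis using P(1)[OF i'] Suc by (auto simp: Q_def)
    next
      case (Suc j')
      then have "j' < L'" "i' \<noteq> j'" using that L \<open>i = Suc i'\<close> by auto
      then show ?thesis using P(2)[OF i'] Suc \<open>i = Suc i'\<close> by (simp add: Q_def)
    qed
  qed
  moreover have "(\<Union>i<L. Q i) = A"
  proof -
    have "(\<Union>i<L. Q i) = Q 0 \<union> (\<Union>i<L'. Q (Suc i))" unfolding L lessThan_Suc_eq_insert_0 by auto
    then show ?thesis using P(3) assms(3) by (auto simp: Q_def)
  qed
  ultimately show ?thesis by (intro exI[of _ Q]) (auto simp: Q_def)
qed

section \<open>Energy increment for a single pair\<close>

definition edges :: "('v \<Rightarrow> 'v \<Rightarrow> nat) \<Rightarrow> nat \<Rightarrow> 'v set \<Rightarrow> 'v set \<Rightarrow> real" where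
  "edges col c A B = (\<Sum>x\<in>A. \<Sum>y\<in>B. if col x y = c then 1 else 0)"

definition dens :: "('v \<Rightarrow> 'v \<Rightarrow> nat) \<Rightarrow> nat \<Rightarrow> 'v set \<Rightarrow> 'v set \<Rightarrow> real" where
  "dens col c A B = edges col c A B / (card A * card B)"

definition energy :: "('v \<Rightarrow> 'v \<Rightarrow> nat) \<Rightarrow> nat \<Rightarrow> 'v set \<Rightarrow> 'v set \<Rightarrow> real" where
  "energy col r A B = (\<Sum>c<r. (dens col c A B)\<^sup>2)"

lemma edges_nonneg: "0 \<le> edges col c A B"
  unfolding edges_def by (intro sum_nonneg) auto

lemma edges_le: "finite A \<Longrightarrow> finite B \<Longrightarrow> edges col c A B \<le> card A * card B"
proof -
  have "edges col c A B \<le> (\<Sum>x\<in>A. \<Sum>y\<in>B. 1)" unfolding edges_def by (intro sum_mono) auto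
  then show ?thesis by simp
qed

lemma edges_sym:
  assumes "\<And>x y. col x y = col y x"
  shows "edges col c A B = edges col c B A"
proof -
  have "edges col c A B = (\<Sum>y\<in>B. \<Sum>x\<in>A. if col x y = c then 1 else 0)" unfolding edges_def by (rule sum.swap)
  also have "\<dots> = edges col c B A" unfolding edges_def using assms by simp
  finally show ?thesis .
qed

lemma edges_UN:
  assumes "finite I" "finite J" "\<And>i. i \<in> I \<Longrightarrow> finite (P i)" "\<And>i. i \<in> J \<Longrightarrow> finite (R i)"
    and "\<And>i j. i \<in> I \<Longrightarrow> j \<in> I \<Longrightarrow> i \<noteq> j \<Longrightarrow> P i \<inter> P j = {}" "\<And>i j. i \<in> J \<Longrightarrow> j \<in> J \<Longrightarrow> i \<noteq> j \<Longrightarrow> R i \<inter> R j = {}"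
  shows "edges col c (\<Union>i\<in>I. P i) (\<Union>j\<in>J. R j) = (\<Sum>i\<in>I. \<Sum>j\<in>J. edges col c (P i) (R j))"
proof -
  have "edges col c (\<Union>i\<in>I. P i) (\<Union>j\<in>J. R j) = (\<Sum>i\<in>I. \<Sum>x\<in>P i. \<Sum>y\<in>(\<Union>j\<in>J. R j). if col x y = c then 1 else 0)"
    unfolding edges_def using assms by (intro sum.UNION_disjoint) auto
  also have "\<dots> = (\<Sum>i\<in>I. \<Sum>x\<in>P i. \<Sum>j\<in>J. \<Sum>y\<in>R j. if col x y = c then 1 else 0)"
  proof (intro sum.cong refl)
    fix x
    show "(\<Sum>y\<in>(\<Union>j\<in>J. R j). if col x y = c then 1 else 0) = (\<Sum>j\<in>J. \<Sum>y\<in>R j. if col x y = c then 1 else (0::real))"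
      using assms by (intro sum.UNION_disjoint) auto
  qed
  also have "\<dots> = (\<Sum>i\<in>I. \<Sum>j\<in>J. edges col c (P i) (R j))"
    unfolding edges_def by (intro sum.cong refl sum.swap)
  finally show ?thesis .
qed

lemma edges_mono: "finite A \<Longrightarrow> finite B \<Longrightarrow> A' \<subseteq> A \<Longrightarrow> B' \<subseteq> B \<Longrightarrow> edges col c A' B' \<le> edges col c A B"
proof -
  assume a: "finite A" "finite B" "A' \<subseteq> A" "B' \<subseteq> B"
  have "edges col c A' B' \<le> (\<Sum>x\<in>A'. \<Sum>y\<in>B. if col x y = c then 1 else 0)"
    unfolding edges_def using a by (intro sum_mono sum_mono2) auto
  also have "\<dots> \<le> edges col c A B"
    unfolding edges_def using a by (intro sum_mono2 sum_nonneg) auto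
  finally show ?thesis .
qed

lemma dens_nonneg: "0 \<le> dens col c A B"
  unfolding dens_def by (intro divide_nonneg_nonneg edges_nonneg) auto

lemma dens_le_1: "finite A \<Longrightarrow> finite B \<Longrightarrow> dens col c A B \<le> 1"
  using edges_le[of A B col c] by (cases "card A * card B = 0") (auto simp: dens_def divide_le_eq card_gt_0_iff)

lemma sum_edges:
  assumes "\<And>x y. col x y < r"
  shows "(\<Sum>c<r. edges col c A B) = card A * card B"
proof -
  have "(\<Sum>c<r. edges col c A B) = (\<Sum>x\<in>A. \<Sum>c<r. \<Sum>y\<in>B. if col x y = c then 1 else 0)"
    unfolding edges_def by (rule sum.swap)
  also have "\<dots> = (\<Sum>x\<in>A. \<Sum>y\<in>B. \<Sum>c<r. if col x y = c then 1 else 0)"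
    by (intro sum.cong refl sum.swap)
  also have "\<dots> = (\<Sum>x\<in>A. \<Sum>y\<in>B. 1)" using assms by (intro sum.cong refl) simp
  finally show ?thesis by simp
qed

lemma energy_le:
  assumes "finite A" "finite B" shows "energy col r A B \<le> r"
proof -
  have "energy col r A B \<le> (\<Sum>c<r. 1)" unfolding energy_def
    by (intro sum_mono power_le_one dens_nonneg dens_le_1 assms)
  then show ?thesis by simp
qed

text \<open>Only lower deviations on subsets of the exact proportion \<open>1 / L\<close> are
  tested; \<open>low_average_subset\<close> extends the resulting lower bound to larger
  subsets.\<close>

definition pair_regular :: "('v \<Rightarrow> 'v \<Rightarrow> nat) \<Rightarrow> nat \<Rightarrow> nat \<Rightarrow> real \<Rightarrow> 'v set \<Rightarrow> 'v set \<Rightarrow> bool" where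
  "pair_regular col r L \<epsilon> A B \<longleftrightarrow> (\<forall>c<r. \<forall>X\<subseteq>A. \<forall>Y\<subseteq>B. L * card X = card A \<and> L * card Y = card B \<longrightarrow>
     dens col c A B - \<epsilon> \<le> dens col c X Y)"

text \<open>Complete the irregular subsets to equipartitions into \<open>L\<close> parts. The mean
  of the squared densities exceeds the square of the mean density by the variance, and one of the
  \<open>L\<^sup>2\<close> cells contributes \<open>\<epsilon>\<^sup>2\<close> to it; so some cell
  gains \<open>\<epsilon>\<^sup>2 / L\<^sup>2\<close>. Continuing with this one pair, rather than
  refining a partition, costs only a factor \<open>L\<close> in size.\<close>

lemma energy_increment:
  assumes "finite A" "finite B" "card A = L * m" "card B = L * m" "0 < L" "0 < m" "0 < \<epsilon>"
    and "\<not> pair_regular col r L \<epsilon> A B"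
  shows "\<exists>A'\<subseteq>A. \<exists>B'\<subseteq>B. card A' = m \<and> card B' = m \<and> energy col r A B + \<epsilon>\<^sup>2 / (real L)\<^sup>2 \<le> energy col r A' B'"
proof -
  obtain c0 X Y where irr: "c0 < r" "X \<subseteq> A" "Y \<subseteq> B" "L * card X = card A" "L * card Y = card B"
    "dens col c0 X Y < dens col c0 A B - \<epsilon>"
    using assms(8) unfolding pair_regular_def by (auto simp: not_le)
  have cX: "card X = m" "card Y = m" using irr assms by auto
  obtain P where P: "P 0 = X" "\<And>i. i < L \<Longrightarrow> P i \<subseteq> A \<and> card (P i) = m"
    "\<And>i j. i < L \<Longrightarrow> j < L \<Longrightarrow> i \<noteq> j \<Longrightarrow> P i \<inter> P j = {}" "(\<Union>i<L. P i) = A"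
    using equipartition_containing[OF assms(1,3) irr(2) cX(1) assms(5)] by blast
  obtain R where R: "R 0 = Y" "\<And>i. i < L \<Longrightarrow> R i \<subseteq> B \<and> card (R i) = m"
    "\<And>i j. i < L \<Longrightarrow> j < L \<Longrightarrow> i \<noteq> j \<Longrightarrow> R i \<inter> R j = {}" "(\<Union>i<L. R i) = B"
    using equipartition_containing[OF assms(2,4) irr(3) cX(2) assms(5)] by blast
  have finP: "finite (P i)" if "i < L" for i using P(2)[OF that] assms(1) finite_subset by blast
  have finR: "finite (R i)" if "i < L" for i using R(2)[OF that] assms(2) finite_subset by blast
  define g where "g c i j = dens col c (P i) (R j)" for c i j
  have avg: "(\<Sum>i<L. \<Sum>j<L. g c i j) = L\<^sup>2 * dens col c A B" for c
  proof -
    have "edges col c A B = (\<Sum>i<L. \<Sum>j<L. edges col c (P i) (R j))"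
      using edges_UN[of "{..<L}" "{..<L}" P R col c] finP finR P(3,4) R(3,4) by auto
    also have "\<dots> = (\<Sum>i<L. \<Sum>j<L. g c i j * (m * m))"
      using P(2) R(2) assms(6) by (intro sum.cong refl) (auto simp: g_def dens_def)
    also have "\<dots> = (\<Sum>i<L. \<Sum>j<L. g c i j) * (m * m)" by (simp add: sum_distrib_right)
    finally show ?thesis unfolding dens_def using assms by (simp add: power2_eq_square field_simps)
  qed
  have var: "(\<Sum>i<L. \<Sum>j<L. (g c i j)\<^sup>2) = L\<^sup>2 * (dens col c A B)\<^sup>2 + (\<Sum>i<L. \<Sum>j<L. (g c i j - dens col c A B)\<^sup>2)" for c
  proof -
    let ?D = "dens col c A B"
    have "(\<Sum>i<L. \<Sum>j<L. (g c i j - ?D)\<^sup>2) = (\<Sum>i<L. \<Sum>j<L. (g c i j)\<^sup>2 - 2 * ?D * g c i j + ?D\<^sup>2)"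
      by (intro sum.cong refl) (simp add: power2_diff)
    also have "\<dots> = (\<Sum>i<L. \<Sum>j<L. (g c i j)\<^sup>2) - 2 * ?D * (\<Sum>i<L. \<Sum>j<L. g c i j) + L\<^sup>2 * ?D\<^sup>2"
      by (simp add: sum.distrib sum_subtractf sum_distrib_left power2_eq_square)
    finally show ?thesis unfolding avg by (simp add: power2_eq_square algebra_simps)
  qed
  have var0: "0 \<le> (\<Sum>i<L. \<Sum>j<L. (g c i j - dens col c A B)\<^sup>2)" for c by (intro sum_nonneg) auto
  have varc0: "\<epsilon>\<^sup>2 \<le> (\<Sum>i<L. \<Sum>j<L. (g c0 i j - dens col c0 A B)\<^sup>2)"
  proof -
    have "\<bar>\<epsilon>\<bar> \<le> \<bar>g c0 0 0 - dens col c0 A B\<bar>" using irr(6) assms(7) P(1) R(1) by (simp add: g_def)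
    then have "\<epsilon>\<^sup>2 \<le> (g c0 0 0 - dens col c0 A B)\<^sup>2" by (simp only: abs_le_square_iff)
    also have "\<dots> \<le> (\<Sum>j<L. (g c0 0 j - dens col c0 A B)\<^sup>2)"
      using assms(5) by (intro member_le_sum) auto
    also have "\<dots> \<le> (\<Sum>i<L. \<Sum>j<L. (g c0 i j - dens col c0 A B)\<^sup>2)"
      by (rule member_le_sum[of 0 "{..<L}" "\<lambda>i. \<Sum>j<L. (g c0 i j - dens col c0 A B)\<^sup>2"])
        (use assms(5) in \<open>auto intro: sum_nonneg\<close>)
    finally show ?thesis .
  qed
  have "L\<^sup>2 * energy col r A B + \<epsilon>\<^sup>2 \<le> (\<Sum>c<r. \<Sum>i<L. \<Sum>j<L. (g c i j)\<^sup>2)"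
  proof -
    note varc0
    also have "(\<Sum>i<L. \<Sum>j<L. (g c0 i j - dens col c0 A B)\<^sup>2) \<le> (\<Sum>c<r. \<Sum>i<L. \<Sum>j<L. (g c i j - dens col c A B)\<^sup>2)"
      by (rule member_le_sum[of c0 "{..<r}" "\<lambda>c. \<Sum>i<L. \<Sum>j<L. (g c i j - dens col c A B)\<^sup>2"])
        (use irr(1) var0 in auto)
    finally have "\<epsilon>\<^sup>2 \<le> (\<Sum>c<r. \<Sum>i<L. \<Sum>j<L. (g c i j - dens col c A B)\<^sup>2)" .
    then show ?thesis by (simp add: var energy_def sum.distrib sum_distrib_left)
  qed
  also have "\<dots> = (\<Sum>i<L. \<Sum>c<r. \<Sum>j<L. (g c i j)\<^sup>2)" by (rule sum.swap)
  also have "\<dots> = (\<Sum>i<L. \<Sum>j<L. \<Sum>c<r. (g c i j)\<^sup>2)" by (intro sum.cong refl sum.swap)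
  also have "\<dots> = (\<Sum>i<L. \<Sum>j<L. energy col r (P i) (R j))" by (simp add: energy_def g_def)
  finally have tot: "L\<^sup>2 * energy col r A B + \<epsilon>\<^sup>2 \<le> (\<Sum>i<L. \<Sum>j<L. energy col r (P i) (R j))" .
  have "\<exists>i<L. \<exists>j<L. energy col r A B + \<epsilon>\<^sup>2 / (real L)\<^sup>2 \<le> energy col r (P i) (R j)"
  proof (rule ccontr)
    assume "\<not> ?thesis"
    then have lt: "\<And>i j. i < L \<Longrightarrow> j < L \<Longrightarrow> energy col r (P i) (R j) < energy col r A B + \<epsilon>\<^sup>2 / (real L)\<^sup>2"
      by (auto simp: not_le)
    have ne: "{..<L} \<noteq> {}" using assms(5) by auto
    define t where "t = energy col r A B + \<epsilon>\<^sup>2 / (real L)\<^sup>2"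
    have "(\<Sum>j<L. energy col r (P i) (R j)) < (\<Sum>j<L. t)" if "i < L" for i
      by (rule sum_strict_mono[OF finite_lessThan ne]) (use lt that in \<open>auto simp: t_def\<close>)
    then have "(\<Sum>i<L. \<Sum>j<L. energy col r (P i) (R j)) < (\<Sum>i<L. \<Sum>j<L. t)"
      by (rule sum_strict_mono[OF finite_lessThan ne]) simp
    also have "\<dots> = (real L)\<^sup>2 * t" by (simp add: power2_eq_square)
    also have "\<dots> = L\<^sup>2 * energy col r A B + \<epsilon>\<^sup>2" using assms(5) by (simp add: t_def distrib_left)
    finally show False using tot by simp
  qed
  then obtain i j where ij: "i < L" "j < L" "energy col r A B + \<epsilon>\<^sup>2 / (real L)\<^sup>2 \<le> energy col r (P i) (R j)" by blast
  show ?thesis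
    using P(2)[OF ij(1)] R(2)[OF ij(2)] ij(3) by (intro exI[of _ "P i"] exI[of _ "R j"] conjI) simp_all
qed

lemma regular_pair_or_high_energy:
  assumes "finite A" "finite B" "card A = L ^ n * u" "card B = L ^ n * u" "0 < L" "0 < u" "0 < \<epsilon>"
  shows "(\<exists>A'\<subseteq>A. \<exists>B'\<subseteq>B. \<exists>m. card A' = L * m \<and> card B' = L * m \<and> u \<le> m \<and> pair_regular col r L \<epsilon> A' B') \<or>
    (\<exists>A'\<subseteq>A. \<exists>B'\<subseteq>B. energy col r A B + n * (\<epsilon>\<^sup>2 / (real L)\<^sup>2) \<le> energy col r A' B')"
  using assms(1-4)
proof (induction n arbitrary: A B)
  case 0
  then show ?case by auto
next
  case (Suc n)
  have m: "u \<le> L ^ n * u" "0 < L ^ n * u" using assms(5,6) by auto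
  have cA: "card A = L * (L ^ n * u)" "card B = L * (L ^ n * u)" using Suc.prems by auto
  show ?case
  proof (cases "pair_regular col r L \<epsilon> A B")
    case True
    then have "\<exists>m. card A = L * m \<and> card B = L * m \<and> u \<le> m \<and> pair_regular col r L \<epsilon> A B"
      using cA m(1) by (intro exI[of _ "L ^ n * u"]) simp
    then show ?thesis by blast
  next
    case False
    from energy_increment[OF Suc.prems(1,2) cA assms(5) m(2) assms(7) this]
    obtain A1 B1 where A1: "A1 \<subseteq> A" "B1 \<subseteq> B" "card A1 = L ^ n * u" "card B1 = L ^ n * u"
      "energy col r A B + \<epsilon>\<^sup>2 / (real L)\<^sup>2 \<le> energy col r A1 B1"
      by (elim exE conjE)
    have fin: "finite A1" "finite B1" using A1 Suc.prems finite_subset by blast+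
    from Suc.IH[OF fin A1(3,4)] show ?thesis
    proof
      assume "\<exists>A'\<subseteq>A1. \<exists>B'\<subseteq>B1. \<exists>m. card A' = L * m \<and> card B' = L * m \<and> u \<le> m \<and> pair_regular col r L \<epsilon> A' B'"
      then obtain A' B' where A': "A' \<subseteq> A1" "B' \<subseteq> B1"
        "\<exists>m. card A' = L * m \<and> card B' = L * m \<and> u \<le> m \<and> pair_regular col r L \<epsilon> A' B'" by blast
      have "A' \<subseteq> A" "B' \<subseteq> B" using A'(1,2) A1(1,2) by auto
      then show ?thesis using A'(3) by blast
    next
      assume "\<exists>A'\<subseteq>A1. \<exists>B'\<subseteq>B1. energy col r A1 B1 + n * (\<epsilon>\<^sup>2 / (real L)\<^sup>2) \<le> energy col r A' B'"
      then obtain A' B' where A': "A' \<subseteq> A1" "B' \<subseteq> B1" "energy col r A1 B1 + n * (\<epsilon>\<^sup>2 / (real L)\<^sup>2) \<le> energy col r A' B'" by blast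
      have "energy col r A B + Suc n * (\<epsilon>\<^sup>2 / (real L)\<^sup>2) = energy col r A B + \<epsilon>\<^sup>2 / (real L)\<^sup>2 + n * (\<epsilon>\<^sup>2 / (real L)\<^sup>2)"
        by (simp add: algebra_simps add_divide_distrib)
      also have "\<dots> \<le> energy col r A' B'" using A1(5) A'(3) by linarith
      finally have "energy col r A B + Suc n * (\<epsilon>\<^sup>2 / (real L)\<^sup>2) \<le> energy col r A' B'" .
      moreover have "A' \<subseteq> A" "B' \<subseteq> B" using A'(1,2) A1(1,2) by auto
      ultimately show ?thesis by blast
    qed
  qed
qed

section \<open>Families of pairwise dense sets\<close>

definition hereditarily_dense :: "('v \<Rightarrow> 'v \<Rightarrow> nat) \<Rightarrow> nat \<Rightarrow> real \<Rightarrow> real \<Rightarrow> 'v set \<Rightarrow> 'v set \<Rightarrow> bool" where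
  "hereditarily_dense col c \<rho> k A B \<longleftrightarrow> (\<forall>X\<subseteq>A. \<forall>Y\<subseteq>B. k \<le> card X \<longrightarrow> k \<le> card Y \<longrightarrow>
     \<rho> * (real (card X) * real (card Y)) \<le> edges col c X Y)"

text \<open>Some colour has density at least \<open>1 / r\<close>, hence at least
  \<open>1 / (2 * r)\<close> on subsets of exactly \<open>m\<close> vertices. Larger
  \<open>X\<close> and \<open>Y\<close> contain such subsets of no larger density, taken first in
  \<open>X\<close> for fixed \<open>Y\<close> and then in \<open>Y\<close>.\<close>

lemma pair_regular_imp_dense:
  assumes fin: "finite A" "finite B" and card: "card A = L * m" "card B = L * m" and pos: "0 < L" "0 < m" "0 < r"
    and colr: "\<And>x y. col x y < r" and reg: "pair_regular col r L (1 / (2 * real r)) A B" and k: "real m \<le> k"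
  shows "\<exists>c<r. hereditarily_dense col c (1 / (2 * real r)) k A B"
proof -
  have "\<exists>c<r. 1 / r \<le> dens col c A B"
  proof (rule ccontr)
    assume "\<not> ?thesis"
    then have "\<And>c. c < r \<Longrightarrow> dens col c A B < 1 / r" by (auto simp: not_le)
    then have "(\<Sum>c<r. dens col c A B) < (\<Sum>c<r. 1 / r)" using pos by (intro sum_strict_mono) auto
    moreover have "(\<Sum>c<r. dens col c A B) = 1"
      unfolding dens_def sum_divide_distrib[symmetric] sum_edges[OF colr] using card pos by simp
    ultimately show False using pos by simp
  qed
  then obtain c where c: "c < r" "1 / r \<le> dens col c A B" by blast
  have "1 / (2 * real r) * (real (card X) * real (card Y)) \<le> edges col c X Y"
    if X: "X \<subseteq> A" "Y \<subseteq> B" "k \<le> card X" "k \<le> card Y" for X Y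
  proof -
    have finX: "finite X" "finite Y" using X fin finite_subset by blast+
    have mX: "m \<le> card X" "m \<le> card Y" using X k by linarith+
    define fX where "fX x = (\<Sum>y\<in>Y. if col x y = c then 1 else (0::real))" for x
    obtain X' where X': "X' \<subseteq> X" "card X' = m" "sum fX X' * card X \<le> sum fX X * m"
      using low_average_subset[OF finX(1) mX(1), of fX] by blast
    have e1: "edges col c X' Y * card X \<le> edges col c X Y * m" using X'(3) unfolding edges_def fX_def .
    define fY where "fY y = (\<Sum>x\<in>X'. if col x y = c then 1 else (0::real))" for y
    obtain Y' where Y': "Y' \<subseteq> Y" "card Y' = m" "sum fY Y' * card Y \<le> sum fY Y * m"
      using low_average_subset[OF finX(2) mX(2), of fY] by blast
    have e2: "edges col c X' Y' * card Y \<le> edges col c X' Y * m"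
    proof -
      have "edges col c X' T = sum fY T" for T
        unfolding edges_def fY_def by (rule sum.swap)
      then show ?thesis using Y'(3) by simp
    qed
    have "dens col c A B - 1 / (2 * real r) \<le> dens col c X' Y'"
      using reg c(1) X' Y' X card unfolding pair_regular_def by auto
    then have "1 / (2 * real r) \<le> dens col c X' Y'" using c(2) pos by (simp add: field_simps)
    then have e3: "1 / (2 * real r) * (m * m) \<le> edges col c X' Y'"
      unfolding dens_def X'(2) Y'(2) using pos by (simp add: field_simps)
    have "(1 / (2 * real r) * (real (card X) * real (card Y))) * (real m * m) = (1 / (2 * real r) * (m * m)) * card Y * card X" by simp
    also have "\<dots> \<le> edges col c X' Y' * card Y * card X" using e3 by (intro mult_right_mono) auto
    also have "\<dots> \<le> edges col c X' Y * m * card X" using e2 by (intro mult_right_mono) auto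
    also have "\<dots> = edges col c X' Y * card X * m" by simp
    also have "\<dots> \<le> edges col c X Y * m * m" using e1 by (intro mult_right_mono) auto
    also have "\<dots> = edges col c X Y * (real m * m)" by simp
    finally have "(1 / (2 * real r) * (real (card X) * real (card Y))) * (real m * m) \<le> edges col c X Y * (real m * m)" .
    then show ?thesis by (rule mult_right_le_imp_le) (use pos(2) in simp)
  qed
  then have "hereditarily_dense col c (1 / (2 * real r)) k A B" unfolding hereditarily_dense_def by simp
  then show ?thesis using c(1) by blast
qed

text \<open>The energy never exceeds \<open>r\<close>, so for \<open>n > r / e\<close> the second
  alternative of \<open>regular_pair_or_high_energy\<close> is impossible.\<close>

lemma dense_pair:
  fixes r :: nat and \<epsilon> :: real
  assumes r: "0 < r" and \<epsilon>: "0 < \<epsilon>" "\<epsilon> < 1"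
  shows "\<exists>\<alpha>::real. 0 < \<alpha> \<and> (\<forall>(col :: 'v \<Rightarrow> 'v \<Rightarrow> nat) A B w. (\<forall>x y. col x y < r) \<and> finite A \<and> finite B \<and> card A = w \<and> card B = w \<and> 0 < w \<longrightarrow>
    (\<exists>A'\<subseteq>A. \<exists>B'\<subseteq>B. \<exists>w' c. c < r \<and> card A' = w' \<and> card B' = w' \<and> 0 < w' \<and> \<alpha> * w \<le> w' \<and>
       hereditarily_dense col c (1 / (2 * real r)) (\<epsilon> * w') A' B'))"
proof -
  obtain L :: nat where L: "1 / \<epsilon> \<le> real L" using real_arch_simple by blast
  have L1: "1 < real L" using L \<epsilon> by (meson less_divide_eq_1_pos order_less_le_trans)
  then have L0: "0 < L" by simp
  define e where "e = (1 / (2 * real r))\<^sup>2 / (real L)\<^sup>2"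
  have e: "0 < e" using r L0 by (simp add: e_def)
  obtain n :: nat where n: "real r < n * e" using reals_Archimedean3[OF e] by metis
  define \<alpha> where "\<alpha> = 1 / (2 * real (L ^ n))"
  have \<alpha>: "0 < \<alpha>" using L0 by (simp add: \<alpha>_def)
  show ?thesis
  proof (intro exI[of _ \<alpha>] conjI \<alpha> allI impI)
    fix col :: "'v \<Rightarrow> 'v \<Rightarrow> nat" and A B :: "'v set" and w :: nat
    assume asm: "(\<forall>x y. col x y < r) \<and> finite A \<and> finite B \<and> card A = w \<and> card B = w \<and> 0 < w"
    have colr: "\<And>x y. col x y < r" using asm by blast
    have fin: "finite A" "finite B" and cA: "card A = w" "card B = w" and w: "0 < w" using asm by blast+
    show "\<exists>A'\<subseteq>A. \<exists>B'\<subseteq>B. \<exists>w' c. c < r \<and> card A' = w' \<and> card B' = w' \<and> 0 < w' \<and> \<alpha> * w \<le> w' \<and>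
       hereditarily_dense col c (1 / (2 * real r)) (\<epsilon> * w') A' B'"
    proof (cases "w < L ^ n")
      \<comment> \<open>For sets of bounded size a single edge is enough: a positive threshold only
        admits nonempty subsets.\<close>
      case True
      have ne: "A \<noteq> {}" "B \<noteq> {}" using cA w by auto
      then obtain x y where xy: "x \<in> A" "y \<in> B" by blast
      have "\<alpha> * w \<le> \<alpha> * L ^ n" using True \<alpha> by (intro mult_left_mono) auto
      also have "\<dots> \<le> 1" using L0 by (simp add: \<alpha>_def)
      finally have "\<alpha> * w \<le> real 1" by simp
      moreover have "hereditarily_dense col (col x y) (1 / (2 * real r)) (\<epsilon> * real 1) {x} {y}"
        unfolding hereditarily_dense_def
      proof (intro allI impI)
        fix X Y assume X: "X \<subseteq> {x}" "Y \<subseteq> {y}" "\<epsilon> * real 1 \<le> card X" "\<epsilon> * real 1 \<le> card Y"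
        then have "X \<noteq> {}" "Y \<noteq> {}" using \<epsilon> by auto
        then have "X = {x}" "Y = {y}" using X by auto
        then show "1 / (2 * real r) * (real (card X) * real (card Y)) \<le> edges col (col x y) X Y"
          using r by (simp add: edges_def)
      qed
      ultimately show ?thesis using xy colr[of x y]
        by (intro exI[of _ "{x}"] conjI exI[of _ "{y}"] exI[of _ 1] exI[of _ "col x y"]) auto
    next
      case False
      define u where "u = w div L ^ n"
      have u: "0 < u" using False L0 by (simp add: u_def div_greater_zero_iff)
      have uw: "L ^ n * u \<le> w" by (simp add: u_def)
      obtain A0 where A0: "A0 \<subseteq> A" "card A0 = L ^ n * u" using obtain_subset_with_card_n[of "L ^ n * u" A] uw cA by metis
      obtain B0 where B0: "B0 \<subseteq> B" "card B0 = L ^ n * u" using obtain_subset_with_card_n[of "L ^ n * u" B] uw cA by metis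
      have fin0: "finite A0" "finite B0" using A0 B0 fin finite_subset by blast+
      have "0 < 1 / (2 * real r)" using r by simp
      from regular_pair_or_high_energy[OF fin0 A0(2) B0(2) L0 u this, of col r]
      have "\<exists>A'\<subseteq>A0. \<exists>B'\<subseteq>B0. \<exists>m. card A' = L * m \<and> card B' = L * m \<and> u \<le> m \<and> pair_regular col r L (1 / (2 * real r)) A' B'"
      proof
        assume "\<exists>A'\<subseteq>A0. \<exists>B'\<subseteq>B0. energy col r A0 B0 + n * ((1 / (2 * real r))\<^sup>2 / (real L)\<^sup>2) \<le> energy col r A' B'"
        then obtain A' B' where A': "A' \<subseteq> A0" "B' \<subseteq> B0" "energy col r A0 B0 + n * ((1 / (2 * real r))\<^sup>2 / (real L)\<^sup>2) \<le> energy col r A' B'" by blast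
        have "energy col r A' B' \<le> r" using A' fin0 by (intro energy_le) (auto intro: finite_subset)
        moreover have "0 \<le> energy col r A0 B0" unfolding energy_def by (intro sum_nonneg) auto
        ultimately show ?thesis using A'(3) n unfolding e_def by simp
      qed
      then obtain A' B' m where A': "A' \<subseteq> A0" "B' \<subseteq> B0" "card A' = L * m" "card B' = L * m" "u \<le> m"
        "pair_regular col r L (1 / (2 * real r)) A' B'" by blast
      have m0: "0 < m" using A'(5) u by simp
      have fin': "finite A'" "finite B'" using A' fin0 finite_subset by blast+
      have "1 * real m \<le> (\<epsilon> * L) * m" using L \<epsilon> by (intro mult_right_mono) (auto simp: field_simps)
      then have "real m \<le> \<epsilon> * real (L * m)" by (simp add: mult_ac)
      from pair_regular_imp_dense[OF fin' A'(3,4) L0 m0 r colr A'(6) this]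
      obtain c where c: "c < r" "hereditarily_dense col c (1 / (2 * real r)) (\<epsilon> * real (L * m)) A' B'" by blast
      have "w < L ^ n * (u + 1)" using L0 by (simp add: u_def dividend_less_times_div)
      also have "\<dots> \<le> L ^ n * (2 * u)" using u by simp
      finally have "real w \<le> real (L ^ n * (2 * u))" by (simp only: of_nat_le_iff)
      then have "\<alpha> * w \<le> u" using L0 by (simp add: \<alpha>_def field_simps)
      moreover have "1 * u \<le> L * m" using A'(5) L0 by (intro mult_le_mono) auto
      ultimately have "\<alpha> * w \<le> real (L * m)" by linarith
      then show ?thesis using A' A0 B0 c m0 L0
        by (intro exI[of _ A'] conjI exI[of _ B'] exI[of _ "L * m"] exI[of _ c]) auto
    qed
  qed
qed

lemma hereditarily_dense_subset:
  assumes "hereditarily_dense col c \<rho> k A B" "A' \<subseteq> A" "B' \<subseteq> B" "k \<le> k'"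
  shows "hereditarily_dense col c \<rho> k' A' B'"
  unfolding hereditarily_dense_def
proof (intro allI impI)
  fix X Y assume "X \<subseteq> A'" "Y \<subseteq> B'" "k' \<le> card X" "k' \<le> card Y"
  then have "X \<subseteq> A" "Y \<subseteq> B" "k \<le> card X" "k \<le> card Y" using assms by auto
  then show "\<rho> * (real (card X) * real (card Y)) \<le> edges col c X Y"
    using assms(1) unfolding hereditarily_dense_def by blast
qed

text \<open>The pairs are treated one after the other on nested subsets. Each is made dense already
  for the smaller threshold \<open>\<epsilon> * \<alpha>1\<close>, so that it stays dense when the
  remaining pairs shrink the sets by a factor \<open>\<alpha>1\<close>.\<close>

lemma dense_pairs_family:
  fixes r :: nat and \<epsilon> :: real and Prs :: "(nat \<times> nat) set"
  assumes r: "0 < r" and \<epsilon>: "0 < \<epsilon>" "\<epsilon> < 1" and "finite Prs"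
  shows "\<forall>(i, j)\<in>Prs. i \<noteq> j \<Longrightarrow> \<exists>\<alpha>::real. 0 < \<alpha> \<and> \<alpha> \<le> 1 \<and> (\<forall>(col :: 'v \<Rightarrow> 'v \<Rightarrow> nat) S w. (\<forall>x y. col x y < r) \<and> (\<forall>i. finite (S i) \<and> card (S i) = w) \<and> 0 < w \<longrightarrow>
    (\<exists>S' w' \<chi>. (\<forall>i. S' i \<subseteq> S i \<and> card (S' i) = w') \<and> 0 < w' \<and> \<alpha> * w \<le> w' \<and>
       (\<forall>(i, j)\<in>Prs. \<chi> i j < r \<and> hereditarily_dense col (\<chi> i j) (1 / (2 * real r)) (\<epsilon> * w') (S' i) (S' j))))"
  using assms(4)
proof (induction Prs rule: finite_induct)
  case empty
  show ?case
  proof (intro exI[of _ 1] conjI allI impI)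
    fix col :: "'v \<Rightarrow> 'v \<Rightarrow> nat" and S :: "nat \<Rightarrow> 'v set" and w :: nat
    assume "(\<forall>x y. col x y < r) \<and> (\<forall>i. finite (S i) \<and> card (S i) = w) \<and> 0 < w"
    then show "\<exists>S' w' \<chi>. (\<forall>i. S' i \<subseteq> S i \<and> card (S' i) = w') \<and> 0 < w' \<and> 1 * real w \<le> real w' \<and>
       (\<forall>(i, j)\<in>{}. \<chi> i j < r \<and> hereditarily_dense col (\<chi> i j) (1 / (2 * real r)) (\<epsilon> * w') (S' i) (S' j))"
      by (intro exI[of _ S] exI[of _ w]) simp
  qed simp_all
next
  case (insert pr Prs)
  obtain i0 j0 where pr: "pr = (i0, j0)" by (cases pr)
  have ij: "i0 \<noteq> j0" using insert.prems pr by auto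
  obtain \<alpha>1 :: real where \<alpha>1: "0 < \<alpha>1" "\<alpha>1 \<le> 1"
    and IH: "\<And>(col :: 'v \<Rightarrow> 'v \<Rightarrow> nat) S w. (\<forall>x y. col x y < r) \<and> (\<forall>i. finite (S i) \<and> card (S i) = w) \<and> 0 < w \<Longrightarrow>
    (\<exists>S' w' \<chi>. (\<forall>i. S' i \<subseteq> S i \<and> card (S' i) = w') \<and> 0 < w' \<and> \<alpha>1 * w \<le> w' \<and>
       (\<forall>(i, j)\<in>Prs. \<chi> i j < r \<and> hereditarily_dense col (\<chi> i j) (1 / (2 * real r)) (\<epsilon> * w') (S' i) (S' j)))"
    using insert.IH insert.prems by auto
  have \<epsilon>1: "0 < \<epsilon> * \<alpha>1" "\<epsilon> * \<alpha>1 < 1"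
  proof -
    show "0 < \<epsilon> * \<alpha>1" using \<epsilon> \<alpha>1 by simp
    have "\<epsilon> * \<alpha>1 \<le> \<epsilon> * 1" using \<epsilon> \<alpha>1 by (intro mult_left_mono) auto
    then show "\<epsilon> * \<alpha>1 < 1" using \<epsilon> by linarith
  qed
  obtain \<alpha>2 :: real where \<alpha>2: "0 < \<alpha>2"
    and pair: "\<And>(col :: 'v \<Rightarrow> 'v \<Rightarrow> nat) A B w. (\<forall>x y. col x y < r) \<and> finite A \<and> finite B \<and> card A = w \<and> card B = w \<and> 0 < w \<Longrightarrow>
    (\<exists>A'\<subseteq>A. \<exists>B'\<subseteq>B. \<exists>w' c. c < r \<and> card A' = w' \<and> card B' = w' \<and> 0 < w' \<and> \<alpha>2 * w \<le> w' \<and>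
       hereditarily_dense col c (1 / (2 * real r)) (\<epsilon> * \<alpha>1 * w') A' B')"
    using dense_pair[OF r \<epsilon>1] by blast
  define \<alpha> where "\<alpha> = min 1 (\<alpha>1 * \<alpha>2)"
  have \<alpha>: "0 < \<alpha>" "\<alpha> \<le> 1" using \<alpha>1 \<alpha>2 by (auto simp: \<alpha>_def)
  show ?case
  proof (intro exI[of _ \<alpha>] conjI \<alpha> allI impI)
    fix col :: "'v \<Rightarrow> 'v \<Rightarrow> nat" and S :: "nat \<Rightarrow> 'v set" and w
    assume asm: "(\<forall>x y. col x y < r) \<and> (\<forall>i. finite (S i) \<and> card (S i) = w) \<and> 0 < w"
    have "(\<forall>x y. col x y < r) \<and> finite (S i0) \<and> finite (S j0) \<and> card (S i0) = w \<and> card (S j0) = w \<and> 0 < w" using asm by auto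
    from pair[OF this] obtain A' B' w1 c where A': "A' \<subseteq> S i0" "B' \<subseteq> S j0" "c < r" "card A' = w1" "card B' = w1" "0 < w1" "\<alpha>2 * w \<le> w1"
       "hereditarily_dense col c (1 / (2 * real r)) (\<epsilon> * \<alpha>1 * w1) A' B'" by blast
    have "w1 \<le> w" using A'(1,4) asm by (metis card_mono)
    then have ex: "\<exists>T\<subseteq>S i. card T = w1" for i using asm obtain_subset_with_card_n[of w1 "S i"] by metis
    then obtain T where "\<forall>i. T i \<subseteq> S i \<and> card (T i) = w1" by metis
    then have T: "\<And>i. T i \<subseteq> S i" "\<And>i. card (T i) = w1" by auto
    define S1 where "S1 = T(i0 := A', j0 := B')"
    have S1: "S1 i0 = A'" "S1 j0 = B'" "\<And>i. S1 i \<subseteq> S i" "\<And>i. card (S1 i) = w1" using ij A' T by (auto simp: S1_def)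
    have fin1: "finite (S1 i)" for i using S1(3)[of i] asm finite_subset by blast
    have "(\<forall>x y. col x y < r) \<and> (\<forall>i. finite (S1 i) \<and> card (S1 i) = w1) \<and> 0 < w1" using asm fin1 S1(4) A'(6) by blast
    from IH[OF this] obtain S' w' \<chi> where S0: "\<forall>i. S' i \<subseteq> S1 i \<and> card (S' i) = w'" "0 < w'" "\<alpha>1 * w1 \<le> w'"
       "\<forall>(i, j)\<in>Prs. \<chi> i j < r \<and> hereditarily_dense col (\<chi> i j) (1 / (2 * real r)) (\<epsilon> * w') (S' i) (S' j)"
      by (elim exE conjE)
    have S': "\<And>i. S' i \<subseteq> S1 i" "\<And>i. card (S' i) = w'" "0 < w'" "\<alpha>1 * w1 \<le> w'"
       "\<And>i j. (i, j) \<in> Prs \<Longrightarrow> \<chi> i j < r \<and> hereditarily_dense col (\<chi> i j) (1 / (2 * real r)) (\<epsilon> * w') (S' i) (S' j)"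
      using S0 by auto
    define \<chi>' where "\<chi>' i j = (if (i, j) = (i0, j0) then c else \<chi> i j)" for i j
    have "\<alpha> * w \<le> \<alpha>1 * \<alpha>2 * w" by (intro mult_right_mono) (auto simp: \<alpha>_def)
    also have "\<dots> \<le> \<alpha>1 * w1" using A'(7) \<alpha>1 by (simp add: mult.assoc)
    finally have 1: "\<alpha> * w \<le> w'" using S'(4) by linarith
    have "\<epsilon> * \<alpha>1 * w1 \<le> \<epsilon> * w'" using S'(4) \<epsilon> by (simp add: mult.assoc)
    then have 2: "hereditarily_dense col c (1 / (2 * real r)) (\<epsilon> * w') (S' i0) (S' j0)"
      using hereditarily_dense_subset[OF A'(8)] S'(1)[of i0] S'(1)[of j0] S1(1,2) by auto
    have "\<forall>(i, j)\<in>insert pr Prs. \<chi>' i j < r \<and> hereditarily_dense col (\<chi>' i j) (1 / (2 * real r)) (\<epsilon> * w') (S' i) (S' j)"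
      using 2 A'(3) S'(5) pr by (auto simp: \<chi>'_def)
    moreover have "\<forall>i. S' i \<subseteq> S i \<and> card (S' i) = w'" using S'(1,2) S1(3) by (meson subset_trans)
    ultimately show "\<exists>S' w' \<chi>. (\<forall>i. S' i \<subseteq> S i \<and> card (S' i) = w') \<and> 0 < w' \<and> \<alpha> * w \<le> w' \<and>
       (\<forall>(i, j)\<in>insert pr Prs. \<chi> i j < r \<and> hereditarily_dense col (\<chi> i j) (1 / (2 * real r)) (\<epsilon> * w') (S' i) (S' j))"
      using 1 S'(3) by blast
  qed
qed

section \<open>A quasirandom set from pairwise dense sets\<close>

definition colour_nb :: "('v \<Rightarrow> 'v \<Rightarrow> nat) \<Rightarrow> nat \<Rightarrow> 'v set \<Rightarrow> 'v \<Rightarrow> 'v set" where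
  "colour_nb col c V p = {q \<in> V. q \<noteq> p \<and> col p q = c}"

lemma colour_nb_sub: "colour_nb col c V p \<subseteq> V" by (auto simp: colour_nb_def)

definition valid_colouring :: "nat \<Rightarrow> ('v \<Rightarrow> 'v \<Rightarrow> nat) \<Rightarrow> bool" where
  "valid_colouring r col \<longleftrightarrow> (\<forall>x y. col x y = col y x \<and> col x y < r)"

text \<open>For small \<open>X\<close> or \<open>Y\<close> the left side is not positive. The
  subtracted terms thus replace the size condition, and the bounds can be summed over all pairs of
  parts.\<close>

lemma hereditarily_dense_lower:
  assumes "hereditarily_dense col c \<rho> k A B" "X \<subseteq> A" "Y \<subseteq> B" "0 \<le> \<rho>" "0 \<le> k"
  shows "\<rho> * (real (card X) * real (card Y) - k * card Y - k * card X) \<le> edges col c X Y"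
proof (cases "k \<le> card X \<and> k \<le> card Y")
  case True
  then have "\<rho> * (real (card X) * real (card Y)) \<le> edges col c X Y"
    using assms(1-3) unfolding hereditarily_dense_def by blast
  moreover have "\<rho> * (real (card X) * real (card Y) - k * card Y - k * card X) \<le> \<rho> * (real (card X) * real (card Y))"
  proof (rule mult_left_mono[OF _ assms(4)])
    have "0 \<le> k * card Y" "0 \<le> k * card X" using assms(5) by auto
    then show "real (card X) * real (card Y) - k * card Y - k * card X \<le> real (card X) * real (card Y)" by linarith
  qed
  ultimately show ?thesis by linarith
next
  case False
  have "real (card X) * real (card Y) - k * card Y - k * card X \<le> 0"
  proof (cases "k \<le> card X")
    case True
    then have "card Y \<le> k" using False by simp
    then have "real (card X) * real (card Y) \<le> real (card X) * k" by (intro mult_left_mono) auto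
    moreover have "0 \<le> k * card Y" using assms(5) by simp
    ultimately show ?thesis by (simp add: mult_ac)
  next
    case False
    then have "real (card X) * real (card Y) \<le> k * real (card Y)" by (intro mult_right_mono) auto
    moreover have "0 \<le> k * card X" using assms(5) by simp
    ultimately show ?thesis by linarith
  qed
  then have "\<rho> * (real (card X) * real (card Y) - k * card Y - k * card X) \<le> 0"
    using assms(4) by (rule mult_nonneg_nonpos[rotated])
  then show ?thesis using edges_nonneg[of col c X Y] by linarith
qed

text \<open>If the atypical set \<open>?P\<close> for \<open>C\<close> were large, count the edges
  between \<open>?P\<close> and \<open>C\<close> that join different parts. Pairs within a part are
  at most an eighth of all, because \<open>k \<ge> 8 / \<delta>0\<close>, and the two
  \<open>\<epsilon>\<close> errors cost an eighth each. The remaining \<open>5 / 8\<close>, at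
  density \<open>1 / (2 * r)\<close>, exceed the \<open>1 / (4 * r)\<close> that atypicality
  allows.\<close>

lemma union_lower_quasirandom:
  fixes S :: "nat \<Rightarrow> 'v set" and \<epsilon> \<delta>0 :: real and r :: nat
  assumes H: "finite H" "card H = k" and S: "\<And>i. i \<in> H \<Longrightarrow> finite (S i) \<and> card (S i) = w" and w: "0 < w"
    and disj: "\<And>i j. i \<in> H \<Longrightarrow> j \<in> H \<Longrightarrow> i \<noteq> j \<Longrightarrow> S i \<inter> S j = {}"
    and dense: "\<And>i j. i \<in> H \<Longrightarrow> j \<in> H \<Longrightarrow> i \<noteq> j \<Longrightarrow> hereditarily_dense col B (1 / (2 * real r)) (\<epsilon> * w) (S i) (S j)"
    and r: "0 < r" and \<delta>0: "0 < \<delta>0" and \<epsilon>: "0 < \<epsilon>" "\<epsilon> \<le> \<delta>0 / 8" and k: "8 / \<delta>0 \<le> real k"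
  shows "lower_quasirandom (\<Union>i\<in>H. S i) (colour_nb col B (\<Union>i\<in>H. S i)) (1 / (4 * real r)) \<delta>0"
  unfolding lower_quasirandom_def
proof (intro allI impI)
  let ?W = "\<Union>i\<in>H. S i"
  let ?\<rho> = "1 / (2 * real r)"
  fix C assume CW: "C \<subseteq> ?W" and C: "\<delta>0 * real (card ?W) \<le> real (card C)"
  let ?P = "atypical ?W (colour_nb col B ?W) (1 / (4 * real r)) C"
  have finW: "finite ?W" using H S by auto
  have finC: "finite C" using CW finW by (rule finite_subset)
  have PW: "?P \<subseteq> ?W" by (auto simp: atypical_def)
  have finP: "finite ?P" using PW finW by (rule finite_subset)
  have cW: "card ?W = k * w"
    using H S disj by (subst card_UN_disjoint) auto
  have card_split: "real (card X) = (\<Sum>i\<in>H. real (card (X \<inter> S i)))" if "X \<subseteq> ?W" for X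
  proof -
    have "X = (\<Union>i\<in>H. X \<inter> S i)" using that by auto
    then have "card X = card (\<Union>i\<in>H. X \<inter> S i)" by simp
    also have "\<dots> = (\<Sum>i\<in>H. card (X \<inter> S i))" using H S disj by (intro card_UN_disjoint) auto
    finally show ?thesis by simp
  qed
  show "real (card ?P) \<le> \<delta>0 * real (card ?W)"
  proof (rule ccontr)
    assume "\<not> ?thesis"
    then have P: "\<delta>0 * real (card ?W) < real (card ?P)" by simp
    have k0: "0 < k" using k \<delta>0 by (metis divide_pos_pos of_nat_0 of_nat_0_less_iff order_less_le_trans zero_less_numeral)
    have n0: "0 < \<delta>0 * real (card ?W)" using \<delta>0 k0 w cW by simp
    have P0: "0 < real (card ?P)" and C0: "0 < real (card C)" using n0 P C by linarith+
    let ?p = "real (card ?P)"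
    let ?c = "real (card C)"
    have upper: "(\<Sum>p\<in>?P. real (card (colour_nb col B ?W p \<inter> C))) \<le> ?p * (?c / (4 * real r))"
    proof -
      have "(\<Sum>p\<in>?P. real (card (colour_nb col B ?W p \<inter> C))) \<le> (\<Sum>p\<in>?P. ?c / (4 * real r))"
        by (intro sum_mono) (auto simp: atypical_def)
      then show ?thesis by simp
    qed
    have inner: "?\<rho> * (real (card (?P \<inter> S j)) * (?c - card (C \<inter> S j)) - \<epsilon> * w * ?c - k * (\<epsilon> * w) * card (?P \<inter> S j))
      \<le> (\<Sum>p\<in>?P \<inter> S j. real (card (colour_nb col B ?W p \<inter> C)))" if j: "j \<in> H" for j
    proof -
      let ?pj = "real (card (?P \<inter> S j))"
      have cj: "(\<Sum>i\<in>H - {j}. real (card (C \<inter> S i))) = ?c - card (C \<inter> S j)"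
        using card_split[OF CW] H(1) j by (simp add: sum_diff1)
      have "?\<rho> * (?pj * (?c - card (C \<inter> S j)) - \<epsilon> * w * ?c - k * (\<epsilon> * w) * ?pj)
        \<le> ?\<rho> * (?pj * (?c - card (C \<inter> S j)) - \<epsilon> * w * (?c - card (C \<inter> S j)) - card (H - {j}) * (\<epsilon> * w * ?pj))"
      proof (rule mult_left_mono)
        have "\<epsilon> * w * (?c - card (C \<inter> S j)) \<le> \<epsilon> * w * ?c" using \<epsilon> by (intro mult_left_mono) auto
        moreover have "card (H - {j}) \<le> k" using H by (metis Diff_subset card_mono)
        then have "card (H - {j}) * (\<epsilon> * w * ?pj) \<le> k * (\<epsilon> * w * ?pj)" using \<epsilon> by (intro mult_right_mono) auto
        ultimately show "?pj * (?c - card (C \<inter> S j)) - \<epsilon> * w * ?c - k * (\<epsilon> * w) * ?pj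
          \<le> ?pj * (?c - card (C \<inter> S j)) - \<epsilon> * w * (?c - card (C \<inter> S j)) - card (H - {j}) * (\<epsilon> * w * ?pj)" by (simp add: mult_ac)
      qed (use r in simp)
      also have "\<dots> = (\<Sum>i\<in>H - {j}. ?\<rho> * (?pj * real (card (C \<inter> S i)) - \<epsilon> * w * card (C \<inter> S i) - \<epsilon> * w * ?pj))"
        unfolding cj[symmetric] by (simp only: sum_distrib_left sum_subtractf right_diff_distrib sum_constant)
          (simp add: mult_ac)
      also have "\<dots> \<le> (\<Sum>i\<in>H - {j}. edges col B (?P \<inter> S j) (C \<inter> S i))"
        using dense[OF j] r \<epsilon> by (intro sum_mono hereditarily_dense_lower) auto
      also have "\<dots> = (\<Sum>p\<in>?P \<inter> S j. \<Sum>i\<in>H - {j}. \<Sum>q\<in>C \<inter> S i. if col p q = B then 1 else 0)"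
        unfolding edges_def by (rule sum.swap)
      also have "\<dots> \<le> (\<Sum>p\<in>?P \<inter> S j. real (card (colour_nb col B ?W p \<inter> C)))"
      proof (rule sum_mono)
        fix p assume p: "p \<in> ?P \<inter> S j"
        have finS: "finite (C \<inter> S i)" for i using finC by auto
        have "(\<Sum>i\<in>H - {j}. \<Sum>q\<in>C \<inter> S i. if col p q = B then 1 else 0) = (\<Sum>q\<in>(\<Union>i\<in>H - {j}. C \<inter> S i). if col p q = B then 1 else (0::real))"
          using H(1) finS disj by (intro sum.UNION_disjoint[symmetric]) auto
        also have "\<dots> = card ((\<Union>i\<in>H - {j}. C \<inter> S i) \<inter> {q. col p q = B})"
          using finite_subset[OF _ finC] by (subst sum.If_cases) auto
        also have "\<dots> \<le> card (colour_nb col B ?W p \<inter> C)"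
        proof (intro of_nat_mono card_mono)
          show "finite (colour_nb col B ?W p \<inter> C)" using finC by auto
          show "(\<Union>i\<in>H - {j}. C \<inter> S i) \<inter> {q. col p q = B} \<subseteq> colour_nb col B ?W p \<inter> C"
          proof
            fix q assume "q \<in> (\<Union>i\<in>H - {j}. C \<inter> S i) \<inter> {q. col p q = B}"
            then obtain i where i: "i \<in> H" "i \<noteq> j" "q \<in> C" "q \<in> S i" "col p q = B" by blast
            have "q \<noteq> p" using disj[OF i(1) j i(2)] i(4) p by auto
            then show "q \<in> colour_nb col B ?W p \<inter> C" using i by (auto simp: colour_nb_def)
          qed
        qed
        finally show "(\<Sum>i\<in>H - {j}. \<Sum>q\<in>C \<inter> S i. if col p q = B then 1 else 0) \<le> real (card (colour_nb col B ?W p \<inter> C))" by simp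
      qed
      finally show ?thesis .
    qed
    have "?\<rho> * (?p * ?c - w * ?c - k * (\<epsilon> * w) * ?c - k * (\<epsilon> * w) * ?p)
      \<le> (\<Sum>j\<in>H. ?\<rho> * (real (card (?P \<inter> S j)) * (?c - card (C \<inter> S j)) - \<epsilon> * w * ?c - k * (\<epsilon> * w) * card (?P \<inter> S j)))"
    proof -
      have "(\<Sum>j\<in>H. real (card (?P \<inter> S j)) * (?c - card (C \<inter> S j)) - \<epsilon> * w * ?c - k * (\<epsilon> * w) * card (?P \<inter> S j))
        = ?p * ?c - (\<Sum>j\<in>H. real (card (?P \<inter> S j)) * card (C \<inter> S j)) - k * (\<epsilon> * w) * ?c - k * (\<epsilon> * w) * ?p"
      proof -
        have alg: "(\<Sum>j\<in>H. f j * (x - g j) - y - z * f j) = sum f H * x - (\<Sum>j\<in>H. f j * g j) - card H * y - z * sum f H"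
          for f g :: "nat \<Rightarrow> real" and x y z :: real
          by (simp add: right_diff_distrib sum_subtractf sum_distrib_left sum_distrib_right)
        show ?thesis
          using alg[where f = "\<lambda>j. real (card (?P \<inter> S j))" and g = "\<lambda>j. real (card (C \<inter> S j))" and x = ?c
              and y = "\<epsilon> * w * ?c" and z = "k * (\<epsilon> * w)"]
          unfolding card_split[OF PW, symmetric] H(2) by (simp add: mult.assoc)
      qed
      moreover have "(\<Sum>j\<in>H. real (card (?P \<inter> S j)) * card (C \<inter> S j)) \<le> (\<Sum>j\<in>H. real w * card (C \<inter> S j))"
      proof (intro sum_mono mult_right_mono)
        fix j assume "j \<in> H"
        then have "finite (S j)" "card (S j) = w" using S by auto
        then show "real (card (?P \<inter> S j)) \<le> real w" by (metis card_mono inf_le2 of_nat_le_iff)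
      qed auto
      moreover have "(\<Sum>j\<in>H. real w * card (C \<inter> S j)) = w * ?c" unfolding card_split[OF CW] by (simp add: sum_distrib_left)
      ultimately show ?thesis unfolding sum_distrib_left[symmetric] using r by (intro mult_left_mono) auto
    qed
    also have "\<dots> \<le> (\<Sum>j\<in>H. \<Sum>p\<in>?P \<inter> S j. real (card (colour_nb col B ?W p \<inter> C)))"
      by (intro sum_mono inner)
    also have "\<dots> = (\<Sum>p\<in>(\<Union>j\<in>H. ?P \<inter> S j). real (card (colour_nb col B ?W p \<inter> C)))"
      using H(1) finP disj by (intro sum.UNION_disjoint[symmetric]) auto
    also have "(\<Union>j\<in>H. ?P \<inter> S j) = ?P" using PW by auto
    finally have main: "?\<rho> * (?p * ?c - w * ?c - k * (\<epsilon> * w) * ?c - k * (\<epsilon> * w) * ?p) \<le> ?p * (?c / (4 * real r))"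
      using upper by linarith
    have kw: "real (card ?W) = real k * w" using cW by simp
    have w8: "w \<le> ?p / 8"
    proof -
      have "8 \<le> \<delta>0 * k" using k \<delta>0 by (simp add: field_simps)
      then have "8 * real w \<le> \<delta>0 * k * w" by (intro mult_right_mono) auto
      then show ?thesis using P kw by simp
    qed
    have "k * (\<epsilon> * w) = \<epsilon> * real (card ?W)" using kw by simp
    also have "\<dots> \<le> \<delta>0 / 8 * real (card ?W)" using \<epsilon> by (intro mult_right_mono) auto
    finally have e8: "k * (\<epsilon> * w) \<le> ?p / 8" "k * (\<epsilon> * w) \<le> ?c / 8" using P C by linarith+
    have "w * ?c \<le> ?p / 8 * ?c" using w8 by (intro mult_right_mono) auto
    moreover have "k * (\<epsilon> * w) * ?c \<le> ?p / 8 * ?c" using e8 by (intro mult_right_mono) auto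
    moreover have "k * (\<epsilon> * w) * ?p \<le> ?c / 8 * ?p" using e8 by (intro mult_right_mono) auto
    ultimately have "?p * ?c * (5 / 8) \<le> ?p * ?c - w * ?c - k * (\<epsilon> * w) * ?c - k * (\<epsilon> * w) * ?p"
      by (simp add: mult_ac)
    then have "?\<rho> * (?p * ?c * (5 / 8)) \<le> ?p * (?c / (4 * real r))"
      using main mult_left_mono[of _ _ ?\<rho>] r by (smt (verit) divide_nonneg_nonneg of_nat_0_le_iff)
    then have "?p * ?c * (5 / 8) \<le> ?p * ?c / 2" using r by (simp add: field_simps)
    moreover have "0 < ?p * ?c" using P0 C0 by simp
    ultimately show False by linarith
  qed
qed

text \<open>Deleting the vertices atypical for \<open>W\<close> itself creates minimum degree, at
  the price of at most half of \<open>W\<close> and a doubled \<open>\<delta>0\<close>.\<close>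

lemma trimmed_quasirandom:
  fixes \<delta>0 :: real
  assumes finW: "finite W" and qr: "lower_quasirandom W (colour_nb col B W) (1 / (4 * real r)) \<delta>0"
    and r: "0 < r" and \<delta>0: "0 < \<delta>0" "\<delta>0 \<le> 1 / (8 * real r)"
  shows "\<exists>W'\<subseteq>W. card W \<le> 2 * card W' \<and> lower_quasirandom W' (colour_nb col B W') (1 / (4 * real r)) (2 * \<delta>0) \<and>
    (\<forall>p\<in>W'. 1 / (8 * real r) * card W' \<le> card (colour_nb col B W' p))"
proof -
  let ?T = "atypical W (colour_nb col B W) (1 / (4 * real r)) W"
  define W' where "W' = W - ?T"
  have r1: "1 / (8 * real r) \<le> 1 / 8" using r by (simp add: field_simps)
  have "\<delta>0 * card W \<le> 1 * real (card W)" using \<delta>0 r1 by (intro mult_right_mono) auto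
  then have cT: "card ?T \<le> \<delta>0 * card W" using qr unfolding lower_quasirandom_def by simp
  have TW: "?T \<subseteq> W" by (auto simp: atypical_def)
  have finT: "finite ?T" using TW finW by (rule finite_subset)
  have cW': "real (card W') = card W - real (card ?T)"
    unfolding W'_def using finT TW finW by (simp add: card_Diff_subset card_mono of_nat_diff)
  have "\<delta>0 * card W \<le> 1 / 8 * card W" using \<delta>0 r1 by (intro mult_right_mono) auto
  then have half: "card W \<le> 2 * real (card W')" using cT cW' by linarith
  have W'W: "W' \<subseteq> W" by (auto simp: W'_def)
  have "lower_quasirandom W' (colour_nb col B W') (1 / (4 * real r)) (2 * \<delta>0)"
    unfolding lower_quasirandom_def
  proof (intro allI impI)
    fix C assume C: "C \<subseteq> W'" "2 * \<delta>0 * real (card W') \<le> real (card C)"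
    have "\<delta>0 * card W \<le> \<delta>0 * (2 * real (card W'))" using half \<delta>0 by (intro mult_left_mono) auto
    then have hl: "\<delta>0 * card W \<le> 2 * \<delta>0 * card W'" by simp
    then have "\<delta>0 * card W \<le> card C" using C(2) by linarith
    then have c: "card (atypical W (colour_nb col B W) (1 / (4 * real r)) C) \<le> \<delta>0 * card W"
      using qr C(1) W'W unfolding lower_quasirandom_def by auto
    have "colour_nb col B W' p \<inter> C = colour_nb col B W p \<inter> C" for p using C(1) W'W by (auto simp: colour_nb_def)
    then have "atypical W' (colour_nb col B W') (1 / (4 * real r)) C \<subseteq> atypical W (colour_nb col B W) (1 / (4 * real r)) C"
      using W'W by (auto simp: atypical_def)
    then have "card (atypical W' (colour_nb col B W') (1 / (4 * real r)) C) \<le> card (atypical W (colour_nb col B W) (1 / (4 * real r)) C)"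
      by (rule card_mono[rotated]) (use finW in \<open>auto simp: atypical_def\<close>)
    then show "real (card (atypical W' (colour_nb col B W') (1 / (4 * real r)) C)) \<le> 2 * \<delta>0 * real (card W')"
      using c hl by linarith
  qed
  moreover have "1 / (8 * real r) * card W' \<le> card (colour_nb col B W' p)" if p: "p \<in> W'" for p
  proof -
    have "p \<notin> ?T" "p \<in> W" using p by (auto simp: W'_def)
    then have "1 / (4 * real r) * card W \<le> card (colour_nb col B W p \<inter> W)" by (auto simp: atypical_def)
    then have "1 / (4 * real r) * card W \<le> card (colour_nb col B W p)" by (simp add: Int_absorb2[OF colour_nb_sub])
    moreover have "colour_nb col B W p - ?T \<subseteq> colour_nb col B W' p" by (auto simp: colour_nb_def W'_def)
    then have "card (colour_nb col B W p - ?T) \<le> card (colour_nb col B W' p)"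
      by (rule card_mono[rotated]) (use finW in \<open>auto simp: colour_nb_def W'_def\<close>)
    moreover have "real (card (colour_nb col B W p)) - real (card ?T) \<le> card (colour_nb col B W p - ?T)"
      using diff_card_le_card_Diff[OF finT, of "colour_nb col B W p"] by linarith
    moreover have "card ?T \<le> 1 / (8 * real r) * card W"
    proof -
      have "\<delta>0 * card W \<le> 1 / (8 * real r) * card W" using \<delta>0 by (intro mult_right_mono) auto
      then show ?thesis using cT by linarith
    qed
    moreover have "1 / (4 * real r) * card W = 1 / (8 * real r) * card W + 1 / (8 * real r) * card W" using r by (simp add: field_simps)
    moreover have "1 / (8 * real r) * card W' \<le> 1 / (8 * real r) * card W"
      using card_mono[OF finW W'W] by (intro mult_left_mono) auto
    ultimately show ?thesis by linarith
  qed
  ultimately show ?thesis using W'W half by (intro exI[of _ W']) auto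
qed

text \<open>Ramsey's theorem, applied to the colours in which the pairs are dense, gives
  \<open>k\<close> sets pairwise dense in one colour. The last conjunct records that this colour is
  frequent between two of the given sets; in the covering this will show that the colour is
  new.\<close>

lemma find_quasirandom:
  fixes r :: nat and \<delta>0 :: real
  assumes r: "0 < r" and \<delta>0: "0 < \<delta>0" "\<delta>0 \<le> 1 / (8 * real r)"
  shows "\<exists>q (c::real). 0 < q \<and> 0 < c \<and> c \<le> 1 \<and> (\<forall>(col :: 'v \<Rightarrow> 'v \<Rightarrow> nat) (S :: nat \<Rightarrow> 'v set) (w::nat).
     valid_colouring r col \<and> (\<forall>i<q. finite (S i) \<and> card (S i) = w) \<and> (\<forall>i<q. \<forall>j<q. i \<noteq> j \<longrightarrow> S i \<inter> S j = {}) \<and> 0 < w \<longrightarrow>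
     (\<exists>B W. B < r \<and> W \<subseteq> (\<Union>i<q. S i) \<and> c * real w \<le> real (card W) \<and>
        lower_quasirandom W (colour_nb col B W) (1 / (4 * real r)) (2 * \<delta>0) \<and>
        (\<forall>p\<in>W. 1 / (8 * real r) * real (card W) \<le> real (card (colour_nb col B W p))) \<and>
        (\<exists>i<q. \<exists>j<q. i \<noteq> j \<and> c * (real w * real w) \<le> edges col B (S i) (S j))))"
proof -
  have r8: "1 / (8 * real r) \<le> 1 / 8" using r by (simp add: field_simps)
  define \<epsilon> where "\<epsilon> = \<delta>0 / 8"
  have \<epsilon>: "0 < \<epsilon>" "\<epsilon> < 1" "\<epsilon> \<le> \<delta>0 / 8" using \<delta>0 r8 by (auto simp: \<epsilon>_def)
  obtain k0 :: nat where k0: "8 / \<delta>0 \<le> real k0" using real_arch_simple by blast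
  define k where "k = max k0 2"
  have k: "8 / \<delta>0 \<le> real k" "2 \<le> k" using k0 by (auto simp: k_def)
  obtain q :: nat where q: "partn_lst {..<q} (replicate r k) 2" using ramsey_full by blast
  have q0: "0 < q"
  proof (rule ccontr)
    assume "\<not> 0 < q"
    then have e: "{..<q} = {}" by simp
    have "(\<lambda>_. 0) \<in> nsets {..<q} 2 \<rightarrow> {..<r}" using r by auto
    then obtain i H where "i < length (replicate r k)" "H \<in> nsets {..<q} (replicate r k ! i)"
      by (rule partn_lstE[OF q]) simp_all
    then show False using e k(2) by (auto simp: nsets_def)
  qed
  define Prs where "Prs = {(i, j). i < j \<and> j < q}"
  have "Prs \<subseteq> {..<q} \<times> {..<q}" by (auto simp: Prs_def)
  then have finPrs: "finite Prs" by (rule finite_subset) simp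
  have ne: "\<forall>(i, j)\<in>Prs. i \<noteq> j" by (auto simp: Prs_def)
  obtain \<alpha> :: real where \<alpha>: "0 < \<alpha>" "\<alpha> \<le> 1"
    and fam: "\<And>(col :: 'v \<Rightarrow> 'v \<Rightarrow> nat) S w. (\<forall>x y. col x y < r) \<and> (\<forall>i. finite (S i) \<and> card (S i) = w) \<and> 0 < w \<Longrightarrow>
    (\<exists>S' w' \<chi>. (\<forall>i. S' i \<subseteq> S i \<and> card (S' i) = w') \<and> 0 < w' \<and> \<alpha> * w \<le> w' \<and>
       (\<forall>(i, j)\<in>Prs. \<chi> i j < r \<and> hereditarily_dense col (\<chi> i j) (1 / (2 * real r)) (\<epsilon> * w') (S' i) (S' j)))"
    using dense_pairs_family[OF r \<epsilon>(1,2) finPrs ne, where 'v = 'v] by (elim exE conjE) blast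
  \<comment> \<open>\<open>\<alpha>\<^sup>2 / (2 * r)\<close> is the edge density that remains
    visible in the original sets; as it is at most \<open>\<alpha>\<close>, one constant also bounds
    the size.\<close>
  define c where "c = \<alpha>\<^sup>2 / (2 * real r)"
  have c: "0 < c" "c \<le> \<alpha>" "c \<le> 1"
  proof -
    show "0 < c" using \<alpha> r by (simp add: c_def)
    have "\<alpha>\<^sup>2 \<le> \<alpha>" using \<alpha> by (simp add: power2_eq_square mult_left_le)
    moreover have "\<alpha>\<^sup>2 / (2 * real r) \<le> \<alpha>\<^sup>2 / 1" using r by (intro divide_left_mono) auto
    then have "c \<le> \<alpha>\<^sup>2" by (simp add: c_def)
    ultimately show "c \<le> \<alpha>" "c \<le> 1" using \<alpha> by linarith+
  qed
  show ?thesis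
  proof (rule exI[of _ q], rule exI[of _ c], intro conjI q0 c(1,3) allI impI)
    fix col :: "'v \<Rightarrow> 'v \<Rightarrow> nat" and S :: "nat \<Rightarrow> 'v set" and w :: nat
    assume asm: "valid_colouring r col \<and> (\<forall>i<q. finite (S i) \<and> card (S i) = w) \<and> (\<forall>i<q. \<forall>j<q. i \<noteq> j \<longrightarrow> S i \<inter> S j = {}) \<and> 0 < w"
    have col_sym: "\<And>x y. col x y = col y x" and colr: "\<And>x y. col x y < r"
      using asm unfolding valid_colouring_def by blast+
    have S: "\<And>i. i < q \<Longrightarrow> finite (S i) \<and> card (S i) = w" and w: "0 < w"
      and disj: "\<And>i j. i < q \<Longrightarrow> j < q \<Longrightarrow> i \<noteq> j \<Longrightarrow> S i \<inter> S j = {}" using asm by blast+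
    \<comment> \<open>\<open>dense_pairs_family\<close> expects a set for every index; from
      \<open>q\<close> on, \<open>S 0\<close> is a filler.\<close>
    define S0 where "S0 i = (if i < q then S i else S 0)" for i
    have "(\<forall>x y. col x y < r) \<and> (\<forall>i. finite (S0 i) \<and> card (S0 i) = w) \<and> 0 < w" using colr S q0 w by (simp add: S0_def)
    from fam[OF this] obtain S' w' \<chi> where S': "\<forall>i. S' i \<subseteq> S0 i \<and> card (S' i) = w'" "0 < w'" "\<alpha> * w \<le> w'"
      "\<forall>(i, j)\<in>Prs. \<chi> i j < r \<and> hereditarily_dense col (\<chi> i j) (1 / (2 * real r)) (\<epsilon> * w') (S' i) (S' j)"
      by (elim exE conjE)
    have S'S: "S' i \<subseteq> S i" if "i < q" for i
    proof -
      have "S' i \<subseteq> S0 i" using S'(1) by blast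
      then show ?thesis using that by (simp add: S0_def)
    qed
    have S'f: "finite (S' i) \<and> card (S' i) = w'" if "i < q" for i
      using S'S[OF that] S[OF that] S'(1) finite_subset by blast
    \<comment> \<open>\<open>\<chi>\<close> is controlled on increasing pairs only.\<close>
    define f where "f X = \<chi> (Min X) (Max X)" for X
    have fr: "f \<in> nsets {..<q} 2 \<rightarrow> {..<r}"
    proof
      fix X assume X: "X \<in> nsets {..<q} 2"
      then have fin: "finite X" "X \<subseteq> {..<q}" "card X = 2" by (auto simp: nsets_def)
      then obtain x y where xy: "X = {x, y}" "x \<noteq> y" by (auto simp: card_2_iff)
      then have "Min X < Max X" by (auto simp: min_def max_def)
      moreover have "Max X < q" using fin xy by auto
      ultimately have "(Min X, Max X) \<in> Prs" by (auto simp: Prs_def)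
      then show "f X \<in> {..<r}" using S'(4) by (auto simp: f_def)
    qed
    obtain B H where "B < length (replicate r k)" and BH2: "H \<in> nsets {..<q} (replicate r k ! B)" "f ` nsets H 2 \<subseteq> {B}"
      by (rule partn_lstE[OF q fr]) simp_all
    then have BH: "B < r" "H \<in> nsets {..<q} (replicate r k ! B)" "f ` nsets H 2 \<subseteq> {B}" by auto
    have Hq: "H \<subseteq> {..<q}" "finite H" "card H = k" using BH(1,2) by (auto simp: nsets_def)
    have d1: "hereditarily_dense col B (1 / (2 * real r)) (\<epsilon> * w') (S' i) (S' j)" if ij: "i \<in> H" "j \<in> H" "i < j" for i j
    proof -
      have "{i, j} \<in> nsets H 2" using ij by (auto simp: nsets_def)
      then have "f {i, j} = B" using BH(3) by blast
      then have "\<chi> i j = B" using ij(3) by (simp add: f_def)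
      moreover have "(i, j) \<in> Prs" using ij Hq(1) by (auto simp: Prs_def)
      ultimately show ?thesis using S'(4) by blast
    qed
    have dense: "hereditarily_dense col B (1 / (2 * real r)) (\<epsilon> * w') (S' i) (S' j)" if ij: "i \<in> H" "j \<in> H" "i \<noteq> j" for i j
    proof (cases "i < j")
      case True then show ?thesis using d1 ij by blast
    next
      case False
      then have "hereditarily_dense col B (1 / (2 * real r)) (\<epsilon> * w') (S' j) (S' i)" using d1[of j i] ij by simp
      note d = this[unfolded hereditarily_dense_def]
      show ?thesis
        unfolding hereditarily_dense_def
      proof (intro allI impI)
        fix X Y assume "X \<subseteq> S' i" "Y \<subseteq> S' j" "\<epsilon> * w' \<le> card X" "\<epsilon> * w' \<le> card Y"
        then have "1 / (2 * real r) * (real (card Y) * real (card X)) \<le> edges col B Y X" using d by blast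
        then show "1 / (2 * real r) * (real (card X) * real (card Y)) \<le> edges col B X Y"
          using edges_sym[of col B X Y, OF col_sym] by (simp add: mult.commute)
      qed
    qed
    let ?W = "\<Union>i\<in>H. S' i"
    have disj': "S' i \<inter> S' j = {}" if "i \<in> H" "j \<in> H" "i \<noteq> j" for i j
      using disj[of i j] S'S[of i] S'S[of j] that Hq(1) by blast
    have S'H: "finite (S' i) \<and> card (S' i) = w'" if "i \<in> H" for i using S'f that Hq(1) by blast
    have "lower_quasirandom ?W (colour_nb col B ?W) (1 / (4 * real r)) \<delta>0"
      by (rule union_lower_quasirandom[OF Hq(2,3) S'H S'(2) disj' dense r \<delta>0(1) \<epsilon>(1,3) k(1)])
    moreover have finW: "finite ?W" using Hq(2) S'H by blast
    ultimately obtain W where W: "W \<subseteq> ?W" "card ?W \<le> 2 * card W"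
      "lower_quasirandom W (colour_nb col B W) (1 / (4 * real r)) (2 * \<delta>0)"
      "\<forall>p\<in>W. 1 / (8 * real r) * card W \<le> card (colour_nb col B W p)"
      using trimmed_quasirandom[OF finW _ r \<delta>0] by blast
    have cW: "card ?W = k * w'" using Hq(2,3) S'H disj' by (subst card_UN_disjoint) auto
    have "2 * w' \<le> k * w'" using k(2) by (rule mult_le_mono1)
    then have "w' \<le> card W" using W(2) cW by linarith
    moreover have "c * w \<le> \<alpha> * w" using c(2) by (intro mult_right_mono) auto
    ultimately have cw: "c * w \<le> card W" using S'(3) by linarith
    have WS: "W \<subseteq> (\<Union>i<q. S i)"
    proof
      fix x assume "x \<in> W"
      then obtain i where i: "i \<in> H" "x \<in> S' i" using W(1) by blast
      then have "i < q" using Hq(1) by blast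
      then show "x \<in> (\<Union>i<q. S i)" using S'S[of i] i by blast
    qed
    have "\<exists>i\<in>H. \<exists>j\<in>H. i \<noteq> j"
    proof (rule ccontr)
      assume "\<not> ?thesis"
      then have "\<forall>x\<in>H. \<forall>y\<in>H. x = y" by blast
      then have "card H \<le> 1" using Hq(2) card_le_Suc0_iff_eq[of H] by simp
      then show False using Hq(3) k(2) by linarith
    qed
    then obtain i j where ij: "i \<in> H" "j \<in> H" "i \<noteq> j" by blast
    then have ijq: "i < q" "j < q" using Hq(1) by blast+
    have "\<epsilon> * w' \<le> 1 * real w'" using \<epsilon> by (intro mult_right_mono) auto
    then have "\<epsilon> * w' \<le> card (S' i)" "\<epsilon> * w' \<le> card (S' j)" using S'H ij by auto
    then have "1 / (2 * real r) * (real (card (S' i)) * real (card (S' j))) \<le> edges col B (S' i) (S' j)"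
      using dense[OF ij] unfolding hereditarily_dense_def by blast
    then have "1 / (2 * real r) * (real w' * real w') \<le> edges col B (S' i) (S' j)" using S'H ij by simp
    also have "\<dots> \<le> edges col B (S i) (S j)" using S ijq S'S by (intro edges_mono) auto
    finally have e: "1 / (2 * real r) * (real w' * real w') \<le> edges col B (S i) (S j)" .
    have "c * (real w * real w) = 1 / (2 * real r) * ((\<alpha> * w) * (\<alpha> * w))" by (simp add: c_def power2_eq_square)
    also have "\<dots> \<le> 1 / (2 * real r) * (real w' * real w')" using S'(3) \<alpha> by (intro mult_left_mono mult_mono) auto
    finally have "c * (real w * real w) \<le> edges col B (S i) (S j)" using e by linarith
    then have "\<exists>i<q. \<exists>j<q. i \<noteq> j \<and> c * (real w * real w) \<le> edges col B (S i) (S j)" using ijq ij(3) by blast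
    then show "\<exists>B W. B < r \<and> W \<subseteq> (\<Union>i<q. S i) \<and> c * real w \<le> real (card W) \<and>
        lower_quasirandom W (colour_nb col B W) (1 / (4 * real r)) (2 * \<delta>0) \<and>
        (\<forall>p\<in>W. 1 / (8 * real r) * real (card W) \<le> real (card (colour_nb col B W p))) \<and>
        (\<exists>i<q. \<exists>j<q. i \<noteq> j \<and> c * (real w * real w) \<le> edges col B (S i) (S j))"
      using BH(1) WS cw W(3,4) by (intro exI[of _ B] exI[of _ W]) simp
  qed
qed

section \<open>Robust tiles\<close>

lemma lower_quasirandom_mono:
  assumes "lower_quasirandom V Nb d \<delta>" "\<delta> \<le> \<delta>'"
  shows "lower_quasirandom V Nb d \<delta>'"
  unfolding lower_quasirandom_def
proof (intro allI impI)
  fix C assume C: "C \<subseteq> V" "\<delta>' * real (card V) \<le> real (card C)"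
  have le: "\<delta> * real (card V) \<le> \<delta>' * real (card V)" using assms(2) by (intro mult_right_mono) auto
  then have "\<delta> * real (card V) \<le> real (card C)" using C(2) by linarith
  then have "real (card (atypical V Nb d C)) \<le> \<delta> * real (card V)"
    using assms(1) C(1) unfolding lower_quasirandom_def by blast
  then show "real (card (atypical V Nb d C)) \<le> \<delta>' * real (card V)" using le by linarith
qed

text \<open>\<open>A\<close> is so small that its members may all be counted as atypical, and
  \<open>C \<inter> W\<close> is still at least half of \<open>C\<close>. What \<open>A\<close> must
  supply is degree into \<open>W\<close>; deleting \<open>X\<close> leaves half of the guaranteed
  \<open>dm * card W\<close>.\<close>

lemma quasirandom_absorb_delete:
  fixes dm \<delta> :: real
  assumes finW: "finite W" and finA: "finite A" and AW: "A \<inter> W = {}"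
    and qr: "lower_quasirandom W (colour_nb col B W) (1 / (4 * real r)) (\<delta> / 8)"
    and deg: "\<And>p. p \<in> W \<union> A \<Longrightarrow> dm * real (card W) \<le> real (card (colour_nb col B W p))"
    and A1: "real (card A) \<le> \<delta> / 8 * real (card W)" and A2: "card A \<le> card W"
    and X: "X \<subseteq> W \<union> A" "real (card X) \<le> dm / 4 * real (card (W \<union> A))"
    and dm: "0 < dm" "dm \<le> 1 / (8 * real r)" and r: "0 < r" and \<delta>: "0 < \<delta>"
  defines "Y \<equiv> (W \<union> A) - X"
  shows "lower_quasirandom Y (colour_nb col B Y) (dm / 4) \<delta>"
    and "\<And>p. p \<in> Y \<Longrightarrow> dm / 4 * real (card Y) \<le> real (card (colour_nb col B Y p))"
    and "real (card W) \<le> 2 * real (card Y)"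
proof -
  have r8: "1 / (8 * real r) \<le> 1 / 8" using r by (simp add: field_simps)
  have fin: "finite (W \<union> A)" using finW finA by simp
  have finX: "finite X" using X(1) fin by (rule finite_subset)
  have finY: "finite Y" using fin by (simp add: Y_def)
  have cWA: "real (card (W \<union> A)) = card W + real (card A)" using finW finA AW by (simp add: card_Un_disjoint Int_commute)
  have X2: "real (card X) \<le> dm / 2 * card W"
  proof -
    have "dm / 4 * real (card (W \<union> A)) \<le> dm / 4 * (2 * real (card W))"
      using A2 dm unfolding cWA by (intro mult_left_mono) auto
    then show ?thesis using X(2) by simp
  qed
  have YWA: "card Y \<le> 2 * real (card W)"
  proof -
    have "card Y \<le> card (W \<union> A)" using fin unfolding Y_def by (intro card_mono) auto
    then show ?thesis using cWA A2 by linarith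
  qed
  have "dm / 2 * card W \<le> 1 / 2 * card W" using dm r8 by (intro mult_right_mono) auto
  moreover have "real (card (W \<union> A)) - real (card X) \<le> card Y" unfolding Y_def by (rule card_Diff_ge_real[OF finX])
  ultimately show WY: "real (card W) \<le> 2 * real (card Y)" using X2 cWA by linarith
  show "dm / 4 * real (card Y) \<le> real (card (colour_nb col B Y p))" if p: "p \<in> Y" for p
  proof -
    have "colour_nb col B W p - X \<subseteq> colour_nb col B Y p" by (auto simp: colour_nb_def Y_def)
    then have "card (colour_nb col B W p - X) \<le> card (colour_nb col B Y p)"
      by (rule card_mono[rotated]) (use finY in \<open>auto simp: colour_nb_def\<close>)
    moreover have "real (card (colour_nb col B W p)) - real (card X) \<le> card (colour_nb col B W p - X)"
      by (rule card_Diff_ge_real[OF finX])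
    moreover have "dm * real (card W) \<le> real (card (colour_nb col B W p))" using p by (intro deg) (auto simp: Y_def)
    moreover have "dm / 4 * real (card Y) \<le> dm / 4 * (2 * real (card W))" using YWA dm by (intro mult_left_mono) auto
    ultimately show ?thesis using X2 by linarith
  qed
  show "lower_quasirandom Y (colour_nb col B Y) (dm / 4) \<delta>"
    unfolding lower_quasirandom_def
  proof (intro allI impI)
    fix C assume C: "C \<subseteq> Y" "\<delta> * real (card Y) \<le> real (card C)"
    have finC: "finite C" using C(1) finY by (rule finite_subset)
    define C1 where "C1 = C \<inter> W"
    have "C - A \<subseteq> C1" using C(1) by (auto simp: C1_def Y_def)
    then have "card (C - A) \<le> card C1" by (rule card_mono[rotated]) (use finC in \<open>simp add: C1_def\<close>)
    then have c1: "card C - real (card A) \<le> card C1" using card_Diff_ge_real[OF finA, of C] by linarith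
    have "\<delta> * real (card W) \<le> \<delta> * (2 * real (card Y))" using WY \<delta> by (intro mult_left_mono) auto
    then have dW: "\<delta> * real (card W) \<le> 2 * card C" using C(2) by linarith
    have c2: "real (card C) / 2 \<le> card C1" using c1 A1 dW by linarith
    have "\<delta> / 8 * real (card W) \<le> card C1" using c2 dW by linarith
    moreover have "C1 \<subseteq> W" by (simp add: C1_def)
    ultimately have at: "real (card (atypical W (colour_nb col B W) (1 / (4 * real r)) C1)) \<le> \<delta> / 8 * real (card W)"
      using qr unfolding lower_quasirandom_def by blast
    have "atypical Y (colour_nb col B Y) (dm / 4) C \<subseteq> atypical W (colour_nb col B W) (1 / (4 * real r)) C1 \<union> A"
    proof
      fix p assume p: "p \<in> atypical Y (colour_nb col B Y) (dm / 4) C"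
      show "p \<in> atypical W (colour_nb col B W) (1 / (4 * real r)) C1 \<union> A"
      proof (rule ccontr)
        assume np: "p \<notin> atypical W (colour_nb col B W) (1 / (4 * real r)) C1 \<union> A"
        then have "p \<in> W" using p by (auto simp: atypical_def Y_def)
        then have t: "1 / (4 * real r) * real (card C1) \<le> real (card (colour_nb col B W p \<inter> C1))" using np by (auto simp: atypical_def)
        have "colour_nb col B W p \<inter> C1 \<subseteq> colour_nb col B Y p \<inter> C" using C(1) by (auto simp: colour_nb_def C1_def)
        then have m: "card (colour_nb col B W p \<inter> C1) \<le> card (colour_nb col B Y p \<inter> C)"
          by (rule card_mono[rotated]) (use finC in simp)
        have "dm / 4 * real (card C) \<le> 1 / (8 * real r) * real (card C)" using dm by (intro mult_right_mono) auto
        also have "\<dots> = 1 / (4 * real r) * (real (card C) / 2)" by simp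
        also have "\<dots> \<le> 1 / (4 * real r) * real (card C1)" using c2 by (intro mult_left_mono) auto
        also note t
        finally have "dm / 4 * real (card C) \<le> real (card (colour_nb col B Y p \<inter> C))" using m by linarith
        then show False using p by (auto simp: atypical_def)
      qed
    qed
    then have "card (atypical Y (colour_nb col B Y) (dm / 4) C) \<le> card (atypical W (colour_nb col B W) (1 / (4 * real r)) C1 \<union> A)"
      by (rule card_mono[rotated]) (use finW finA in \<open>auto simp: atypical_def\<close>)
    also have "\<dots> \<le> card (atypical W (colour_nb col B W) (1 / (4 * real r)) C1) + card A" by (rule card_Un_le)
    finally have "real (card (atypical Y (colour_nb col B Y) (dm / 4) C)) \<le> \<delta> / 8 * real (card W) + \<delta> / 8 * real (card W)"
      using at A1 by linarith
    moreover have "\<delta> * real (card W) \<le> \<delta> * (2 * real (card Y))" using WY \<delta> by (intro mult_left_mono) auto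
    moreover have "0 \<le> \<delta> * real (card Y)" using \<delta> by simp
    ultimately show "real (card (atypical Y (colour_nb col B Y) (dm / 4) C)) \<le> \<delta> * real (card Y)" by linarith
  qed
qed

text \<open>Samples are drawn from the last index to the first. When the one for \<open>b\<close> is
  drawn, the later samples are fixed and, together with \<open>R\<close>, impose fewer than
  \<open>4 ^ w\<close> conditions, as \<open>sparse_sample\<close> requires.\<close>

lemma sparse_samples:
  fixes Wf :: "nat \<Rightarrow> 'v set" and \<beta> \<gamma> :: real
  assumes "finite J" "finite R"
    and Wf: "\<And>t. t \<in> J \<Longrightarrow> finite (Wf t) \<and> w \<le> card (Wf t)"
    and sparse: "\<And>t u. t \<in> J \<Longrightarrow> u \<in> R \<union> (\<Union>t'\<in>{t' \<in> J. t < t'}. Wf t') \<Longrightarrow> real (card {x \<in> Wf t. col u x \<in> C}) \<le> \<beta> * real (card (Wf t))"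
    and size: "card R + card J * w < 4 ^ w" and w: "0 < w"
    and \<gamma>: "0 < \<gamma>" "\<gamma> \<le> 1" and \<beta>: "0 < \<beta>" "\<beta> \<le> (1 / 8) powr (1 / \<gamma>)"
  shows "\<exists>S. \<forall>t\<in>J. S t \<subseteq> Wf t \<and> card (S t) = w \<and>
    (\<forall>u\<in>R \<union> (\<Union>t'\<in>{t' \<in> J. t < t'}. S t'). real (card {x \<in> S t. col u x \<in> C}) \<le> \<gamma> * real w)"
  using assms(1) Wf sparse size
proof (induction J rule: finite_linorder_min_induct)
  case empty
  then show ?case by simp
next
  case (insert b J)
  have sz: "card R + card J * w < 4 ^ w" "card (R) + card J * w \<le> card R + card (insert b J) * w"
    using insert.prems(3) insert.hyps by (auto simp: card_insert_if split: if_splits)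
  have bJ: "b \<notin> J" using insert.hyps(2) by blast
  have "\<exists>S. \<forall>t\<in>J. S t \<subseteq> Wf t \<and> card (S t) = w \<and>
    (\<forall>u\<in>R \<union> (\<Union>t'\<in>{t' \<in> J. t < t'}. S t'). real (card {x \<in> S t. col u x \<in> C}) \<le> \<gamma> * real w)"
  proof (rule insert.IH)
    show "finite (Wf t) \<and> w \<le> card (Wf t)" if "t \<in> J" for t using insert.prems(1) that by blast
    show "real (card {x \<in> Wf t. col u x \<in> C}) \<le> \<beta> * real (card (Wf t))"
      if "t \<in> J" "u \<in> R \<union> (\<Union>t'\<in>{t' \<in> J. t < t'}. Wf t')" for t u
      using insert.prems(2)[of t u] that by blast
    show "card R + card J * w < 4 ^ w" by (rule sz(1))
  qed
  then obtain S where S0: "\<forall>t\<in>J. S t \<subseteq> Wf t \<and> card (S t) = w \<and>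
    (\<forall>u\<in>R \<union> (\<Union>t'\<in>{t' \<in> J. t < t'}. S t'). real (card {x \<in> S t. col u x \<in> C}) \<le> \<gamma> * real w)" by (elim exE)
  note S = bspec[OF S0]
  let ?U = "R \<union> (\<Union>t\<in>J. S t)"
  have finS: "finite (S t)" if "t \<in> J" for t 
    by (rule finite_subset[of _ "Wf t"]) (use S[OF that] insert.prems(1)[of t] that in auto)
  have finU: "finite ?U" using assms(2) insert.hyps(1) finS by simp
  have "card ?U \<le> card R + card (\<Union>t\<in>J. S t)" by (rule card_Un_le)
  also have "card (\<Union>t\<in>J. S t) \<le> (\<Sum>t\<in>J. card (S t))" by (rule card_UN_le[OF insert.hyps(1)])
  also have "\<dots> = card J * w" using S by simp
  finally have cU: "card ?U < 4 ^ w" using sz(1) by linarith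
  have Wb: "finite (Wf b)" "w \<le> card (Wf b)" using insert.prems(1)[of b] by auto
  have D: "real (card {x \<in> Wf b. col u x \<in> C}) \<le> \<beta> * real (card (Wf b))" if u: "u \<in> ?U" for u
  proof (rule insert.prems(2))
    show "b \<in> insert b J" by simp
    have "(\<Union>t\<in>J. S t) \<subseteq> (\<Union>t'\<in>{t' \<in> insert b J. b < t'}. Wf t')"
    proof
      fix x assume "x \<in> (\<Union>t\<in>J. S t)"
      then obtain t where t: "t \<in> J" "x \<in> S t" by blast
      then have "x \<in> Wf t" "b < t" using S[of t] insert.hyps(2) by auto
      then show "x \<in> (\<Union>t'\<in>{t' \<in> insert b J. b < t'}. Wf t')" using t(1) by blast
    qed
    then show "u \<in> R \<union> (\<Union>t'\<in>{t' \<in> insert b J. b < t'}. Wf t')" using u by blast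
  qed
  have "\<exists>T\<subseteq>Wf b. card T = w \<and> (\<forall>u\<in>?U. card (T \<inter> {x \<in> Wf b. col u x \<in> C}) \<le> \<gamma> * w)"
    by (rule sparse_sample[OF Wb(1) finU Wb(2) w _ D \<gamma> \<beta> cU]) auto
  then obtain T where T: "T \<subseteq> Wf b" "card T = w" "\<forall>u\<in>?U. card (T \<inter> {x \<in> Wf b. col u x \<in> C}) \<le> \<gamma> * w" by (elim exE conjE)
  define S' where "S' = S(b := T)"
  have S'J: "S' t = S t" if "t \<in> J" for t using that bJ by (auto simp: S'_def)
  have "S' t \<subseteq> Wf t \<and> card (S' t) = w \<and>
    (\<forall>u\<in>R \<union> (\<Union>t'\<in>{t' \<in> insert b J. t < t'}. S' t'). real (card {x \<in> S' t. col u x \<in> C}) \<le> \<gamma> * real w)"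
    if t: "t \<in> insert b J" for t
  proof (cases "t = b")
    case True
    have "real (card {x \<in> T. col u x \<in> C}) \<le> \<gamma> * real w" if u: "u \<in> R \<union> (\<Union>t'\<in>{t' \<in> insert b J. b < t'}. S' t')" for u
    proof -
      have "u \<in> ?U" using u S'J by auto
      moreover have "T \<inter> {x \<in> Wf b. col u x \<in> C} = {x \<in> T. col u x \<in> C}" using T(1) by auto
      ultimately show ?thesis using bspec[OF T(3)] by metis
    qed
    then show ?thesis using True T(1,2) by (simp add: S'_def)
  next
    case False
    then have tJ: "t \<in> J" using t by blast
    have "b < t" using insert.hyps(2) tJ by blast
    then have "{t' \<in> insert b J. t < t'} = {t' \<in> J. t < t'}" by auto
    moreover have "(\<Union>t'\<in>{t' \<in> J. t < t'}. S' t') = (\<Union>t'\<in>{t' \<in> J. t < t'}. S t')" using S'J by auto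
    ultimately show ?thesis using S[OF tJ] S'J[OF tJ] by simp
  qed
  then show ?case by (intro exI[of _ S'] ballI)
qed

text \<open>Separates the covering from the guest graphs: of tiles it is only known that single
  vertices, and large sets that are quasirandom with linear minimum degree in one colour, are
  tiles.\<close>

locale tile_cover =
  fixes r :: nat and Tile :: "('v \<Rightarrow> 'v \<Rightarrow> nat) \<Rightarrow> 'v set \<Rightarrow> bool"
  assumes r_pos: "0 < r"
    and Tile_single: "\<And>col x. valid_colouring r col \<Longrightarrow> Tile col {x}"
    and Tile_quasirandom: "\<And>d::real. 0 < d \<Longrightarrow> d < 1 \<Longrightarrow> \<exists>\<delta>::real. 0 < \<delta> \<and> (\<exists>N0::nat. \<forall>col X B.
      valid_colouring r col \<and> B < r \<and> finite X \<and> N0 \<le> card X \<and> lower_quasirandom X (colour_nb col B X) d \<delta> \<and>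
      (\<forall>p\<in>X. d * real (card X) \<le> real (card (colour_nb col B X p))) \<longrightarrow> Tile col X)"
begin

definition tiled :: "('v \<Rightarrow> 'v \<Rightarrow> nat) \<Rightarrow> nat \<Rightarrow> 'v set \<Rightarrow> bool" where
  "tiled col n V \<longleftrightarrow> (\<exists>T. finite T \<and> card T \<le> n \<and> (\<forall>X\<in>T. Tile col X) \<and> pairwise disjnt T \<and> \<Union>T = V)"

definition robust :: "('v \<Rightarrow> 'v \<Rightarrow> nat) \<Rightarrow> real \<Rightarrow> 'v set \<Rightarrow> bool" where
  "robust col \<theta> W \<longleftrightarrow> (\<forall>X\<subseteq>W. real (card X) \<le> \<theta> * real (card W) \<longrightarrow> Tile col (W - X))"

lemma tiled_empty: "tiled col n {}"
  unfolding tiled_def by (intro exI[of _ "{}"]) auto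

lemma tiled_Tile: "Tile col X \<Longrightarrow> tiled col 1 X"
  unfolding tiled_def by (intro exI[of _ "{X}"]) (auto simp: pairwise_def)

lemma tiled_mono: assumes "tiled col n V" "n \<le> m" shows "tiled col m V"
proof -
  obtain T where T: "finite T" "card T \<le> n" "\<forall>X\<in>T. Tile col X" "pairwise disjnt T" "\<Union>T = V"
    using assms(1) unfolding tiled_def by blast
  have "card T \<le> m" using T(2) assms(2) by linarith
  then show ?thesis unfolding tiled_def using T(1,3,4,5) by blast
qed

lemma tiled_Un:
  assumes "tiled col n A" "tiled col m B" "A \<inter> B = {}"
  shows "tiled col (n + m) (A \<union> B)"
proof -
  obtain T1 where T1: "finite T1" "card T1 \<le> n" "\<forall>X\<in>T1. Tile col X" "pairwise disjnt T1" "\<Union>T1 = A"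
    using assms(1) unfolding tiled_def by blast
  obtain T2 where T2: "finite T2" "card T2 \<le> m" "\<forall>X\<in>T2. Tile col X" "pairwise disjnt T2" "\<Union>T2 = B"
    using assms(2) unfolding tiled_def by blast
  have cross: "disjnt X Y" if "X \<in> T1" "Y \<in> T2" for X Y
    using that T1(5) T2(5) assms(3) by (auto simp: disjnt_def)
  have "pairwise disjnt (T1 \<union> T2)"
    unfolding pairwise_def
  proof (intro ballI impI)
    fix X Y assume XY: "X \<in> T1 \<union> T2" "Y \<in> T1 \<union> T2" "X \<noteq> Y"
    then consider "X \<in> T1" "Y \<in> T1" | "X \<in> T1" "Y \<in> T2" | "X \<in> T2" "Y \<in> T1" | "X \<in> T2" "Y \<in> T2" by blast
    then show "disjnt X Y"
    proof cases
      case 1 then show ?thesis using T1(4) XY(3) by (simp add: pairwise_def)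
    next
      case 2 then show ?thesis by (rule cross)
    next
      case 3 then show ?thesis using cross[of Y X] by (simp add: disjnt_sym)
    next
      case 4 then show ?thesis using T2(4) XY(3) by (simp add: pairwise_def)
    qed
  qed
  moreover have "card (T1 \<union> T2) \<le> n + m" using card_Un_le[of T1 T2] T1(2) T2(2) by linarith
  ultimately show ?thesis
    unfolding tiled_def using T1 T2 by (intro exI[of _ "T1 \<union> T2"]) auto
qed

lemma tiled_singles:
  assumes "valid_colouring r col" "finite A" shows "tiled col (card A) A"
  using assms(2)
proof (induction A rule: finite_induct)
  case empty
  show ?case by (rule tiled_empty)
next
  case (insert x A)
  have "tiled col (1 + card A) ({x} \<union> A)"
    by (rule tiled_Un[OF tiled_Tile[OF Tile_single[OF assms(1)]] insert.IH]) (use insert.hyps in auto)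
  then show ?case using insert.hyps by simp
qed

lemma tiled_UN:
  assumes "finite I" "\<And>i. i \<in> I \<Longrightarrow> tiled col n (A i)" "\<And>i j. i \<in> I \<Longrightarrow> j \<in> I \<Longrightarrow> i \<noteq> j \<Longrightarrow> A i \<inter> A j = {}"
  shows "tiled col (card I * n) (\<Union>i\<in>I. A i)"
  using assms
proof (induction I rule: finite_induct)
  case empty
  show ?case using tiled_empty by simp
next
  case (insert i I)
  have "tiled col (n + card I * n) (A i \<union> (\<Union>j\<in>I. A j))"
  proof (rule tiled_Un)
    show "tiled col n (A i)" using insert.prems(1) by blast
    show "tiled col (card I * n) (\<Union>j\<in>I. A j)" using insert.IH insert.prems by blast
    have "A i \<inter> A j = {}" if "j \<in> I" for j using insert.prems(2)[of i j] insert.hyps(2) that by blast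
    then show "A i \<inter> (\<Union>j\<in>I. A j) = {}" by blast
  qed
  then show ?case using insert.hyps by simp
qed

lemma robust_Tile: assumes "robust col \<theta> W" "0 \<le> \<theta>" shows "Tile col W"
proof -
  have "real (card ({} :: 'v set)) \<le> \<theta> * real (card W)" using assms(2) by simp
  then have "Tile col (W - {})" using assms(1) unfolding robust_def by blast
  then show ?thesis by simp
qed

text \<open>The tile property is invoked with density \<open>dm / 4\<close> after absorption and
  deletion; \<open>2 * N0\<close> allows for what the deletion takes away.\<close>

lemma robust_absorb:
  fixes dm :: real
  assumes dm: "0 < dm" "dm \<le> 1 / (8 * real r)"
  shows "\<exists>\<delta>::real. 0 < \<delta> \<and> (\<exists>N0::nat. \<forall>col B W A. valid_colouring r col \<and> B < r \<and> finite W \<and> finite A \<and> A \<inter> W = {} \<and>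
    2 * N0 \<le> card W \<and> lower_quasirandom W (colour_nb col B W) (1 / (4 * real r)) (\<delta> / 8) \<and>
    (\<forall>p\<in>W \<union> A. dm * real (card W) \<le> real (card (colour_nb col B W p))) \<and>
    real (card A) \<le> \<delta> / 8 * real (card W) \<and> card A \<le> card W \<longrightarrow> robust col (dm / 4) (W \<union> A))"
proof -
  have r8: "1 / (8 * real r) \<le> 1 / 8" using r_pos by (simp add: field_simps)
  have "0 < dm / 4" "dm / 4 < 1" using dm r8 by auto
  from Tile_quasirandom[OF this] obtain \<delta> :: real and N0 :: nat where \<delta>: "0 < \<delta>" and T: "\<And>col X B.
      valid_colouring r col \<and> B < r \<and> finite X \<and> N0 \<le> card X \<and> lower_quasirandom X (colour_nb col B X) (dm / 4) \<delta> \<and>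
      (\<forall>p\<in>X. dm / 4 * real (card X) \<le> real (card (colour_nb col B X p))) \<Longrightarrow> Tile col X" by blast
  show ?thesis
  proof (rule exI[of _ \<delta>], intro conjI \<delta>, rule exI[of _ N0], intro allI impI)
    fix col :: "'v \<Rightarrow> 'v \<Rightarrow> nat" and B :: nat and W A :: "'v set"
    assume asm: "valid_colouring r col \<and> B < r \<and> finite W \<and> finite A \<and> A \<inter> W = {} \<and>
      2 * N0 \<le> card W \<and> lower_quasirandom W (colour_nb col B W) (1 / (4 * real r)) (\<delta> / 8) \<and>
      (\<forall>p\<in>W \<union> A. dm * real (card W) \<le> real (card (colour_nb col B W p))) \<and>
      real (card A) \<le> \<delta> / 8 * real (card W) \<and> card A \<le> card W"
    have a: "valid_colouring r col" "B < r" "finite W" "finite A" "A \<inter> W = {}" "2 * N0 \<le> card W"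
      "lower_quasirandom W (colour_nb col B W) (1 / (4 * real r)) (\<delta> / 8)"
      "\<And>p. p \<in> W \<union> A \<Longrightarrow> dm * real (card W) \<le> real (card (colour_nb col B W p))"
      "real (card A) \<le> \<delta> / 8 * real (card W)" "card A \<le> card W" using asm by blast+
    show "robust col (dm / 4) (W \<union> A)"
      unfolding robust_def
    proof (intro allI impI)
      fix X assume X: "X \<subseteq> W \<union> A" "real (card X) \<le> dm / 4 * real (card (W \<union> A))"
      note q = quasirandom_absorb_delete[OF a(3,4,5,7,8,9,10) X dm r_pos \<delta>]
      have "N0 \<le> card (W \<union> A - X)" using q(3) a(6) by linarith
      then show "Tile col (W \<union> A - X)" using a(1-4) q(1,2) by (intro T[of col B]) auto
    qed
  qed
qed

text \<open>A large \<open>V\<close> is cut into equal parts for \<open>find_quasirandom\<close>. In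
  a small one a single vertex suffices, which is robust because removing a proportion below 1
  removes nothing.\<close>

lemma robust_subset:
  "\<exists>(c2::real) (\<theta>::real). 0 < c2 \<and> c2 \<le> 1 \<and> 0 < \<theta> \<and> (\<forall>col V. valid_colouring r col \<and> finite V \<and> V \<noteq> {} \<longrightarrow>
    (\<exists>W\<subseteq>V. W \<noteq> {} \<and> c2 * real (card V) \<le> real (card W) \<and> robust col \<theta> W))"
proof -
  define dm where "dm = 1 / (8 * real r)"
  have dm: "0 < dm" "dm \<le> 1 / (8 * real r)" using r_pos by (auto simp: dm_def)
  have r8: "1 / (8 * real r) \<le> 1 / 8" using r_pos by (simp add: field_simps)
  obtain \<delta> :: real and N0 :: nat where \<delta>: "0 < \<delta>" and rob: "\<And>col B W A. valid_colouring r col \<and> B < r \<and> finite W \<and> finite A \<and> A \<inter> W = {} \<and>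
    2 * N0 \<le> card W \<and> lower_quasirandom W (colour_nb col B W) (1 / (4 * real r)) (\<delta> / 8) \<and>
    (\<forall>p\<in>W \<union> A. dm * real (card W) \<le> real (card (colour_nb col B W p))) \<and>
    real (card A) \<le> \<delta> / 8 * real (card W) \<and> card A \<le> card W \<Longrightarrow> robust col (dm / 4) (W \<union> A)"
    using robust_absorb[OF dm] by blast
  define \<delta>0 where "\<delta>0 = min (\<delta> / 16) (1 / (8 * real r))"
  have \<delta>0: "0 < \<delta>0" "\<delta>0 \<le> 1 / (8 * real r)" "2 * \<delta>0 \<le> \<delta> / 8" using \<delta> r_pos by (auto simp: \<delta>0_def)
  obtain q and c :: real where qc: "0 < q" "0 < c" "c \<le> 1" and find: "\<And>(col :: 'v \<Rightarrow> 'v \<Rightarrow> nat) (S :: nat \<Rightarrow> 'v set) (w::nat).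
     valid_colouring r col \<and> (\<forall>i<q. finite (S i) \<and> card (S i) = w) \<and> (\<forall>i<q. \<forall>j<q. i \<noteq> j \<longrightarrow> S i \<inter> S j = {}) \<and> 0 < w \<Longrightarrow>
     (\<exists>B W. B < r \<and> W \<subseteq> (\<Union>i<q. S i) \<and> c * real w \<le> real (card W) \<and>
        lower_quasirandom W (colour_nb col B W) (1 / (4 * real r)) (2 * \<delta>0) \<and>
        (\<forall>p\<in>W. 1 / (8 * real r) * real (card W) \<le> real (card (colour_nb col B W p))) \<and>
        (\<exists>i<q. \<exists>j<q. i \<noteq> j \<and> c * (real w * real w) \<le> edges col B (S i) (S j)))"
    using find_quasirandom[OF r_pos \<delta>0(1,2), where 'v = 'v] by (elim exE conjE) blast
  obtain w0 :: nat where w0: "(2 * real N0 + 1) / c \<le> real w0" using real_arch_simple by blast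
  define n1 where "n1 = q * (w0 + 1)"
  have n1: "0 < n1" using qc by (simp add: n1_def)
  \<comment> \<open>\<open>1 / n1\<close> serves a single vertex of a small \<open>V\<close>;
    \<open>c / (2 * q)\<close> serves parts of size \<open>w\<close> with
    \<open>card V \<le> 2 * q * w\<close>.\<close>
  define c2 where "c2 = min (1 / real n1) (c / (2 * real q))"
  have c2: "0 < c2" "c2 \<le> 1" using n1 qc by (auto simp: c2_def min_le_iff_disj)
  have \<theta>: "0 < dm / 4" using dm by simp
  show ?thesis
  proof (rule exI[of _ c2], rule exI[of _ "dm / 4"], intro conjI c2 \<theta> allI impI)
    fix col :: "'v \<Rightarrow> 'v \<Rightarrow> nat" and V :: "'v set"
    assume "valid_colouring r col \<and> finite V \<and> V \<noteq> {}"
    then have val: "valid_colouring r col" and finV: "finite V" and Vne: "V \<noteq> {}" by blast+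
    show "\<exists>W\<subseteq>V. W \<noteq> {} \<and> c2 * real (card V) \<le> real (card W) \<and> robust col (dm / 4) W"
    proof (cases "card V < n1")
      case True
      obtain x where x: "x \<in> V" using Vne by blast
      have "c2 * real (card V) \<le> 1 / real n1 * real n1" using True by (intro mult_mono) (auto simp: c2_def)
      then have "c2 * real (card V) \<le> real (card {x})" using n1 by simp
      moreover have "robust col (dm / 4) {x}"
        unfolding robust_def
      proof (intro allI impI)
        fix X assume X: "X \<subseteq> {x}" "real (card X) \<le> dm / 4 * real (card {x})"
        have "X = {}"
        proof (rule ccontr)
          assume "X \<noteq> {}"
          then have "X = {x}" using X(1) by blast
          then have "1 \<le> dm / 4" using X(2) by simp
          then show False using dm r8 by linarith
        qed
        then show "Tile col ({x} - X)" using Tile_single[OF val] by simp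
      qed
      ultimately show ?thesis using x by (intro exI[of _ "{x}"]) auto
    next
      case False
      define w where "w = card V div q"
      have wq: "q * w \<le> card V" by (simp add: w_def)
      have ww: "w0 + 1 \<le> w"
      proof -
        have "(w0 + 1) * q \<le> card V" using False by (simp add: n1_def mult.commute)
        then show ?thesis using qc(1) by (simp add: w_def less_eq_div_iff_mult_less_eq)
      qed
      obtain V' where V': "V' \<subseteq> V" "card V' = q * w" using obtain_subset_with_card_n[OF wq] by blast
      have finV': "finite V'" using V'(1) finV by (rule finite_subset)
      obtain S where S: "\<forall>i<q. S i \<subseteq> V' \<and> card (S i) = w" "\<forall>i<q. \<forall>j<q. i \<noteq> j \<longrightarrow> S i \<inter> S j = {}" "(\<Union>i<q. S i) = V'"
        using equipartition[OF finV' V'(2)] by blast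
      have "finite (S i) \<and> card (S i) = w" if "i < q" for i using S(1) that finite_subset[OF _ finV'] by blast
      then have "valid_colouring r col \<and> (\<forall>i<q. finite (S i) \<and> card (S i) = w) \<and> (\<forall>i<q. \<forall>j<q. i \<noteq> j \<longrightarrow> S i \<inter> S j = {}) \<and> 0 < w"
        using val S(2) ww by simp
      from find[OF this] obtain B W where W: "B < r" "W \<subseteq> V'" "c * real w \<le> real (card W)"
        "lower_quasirandom W (colour_nb col B W) (1 / (4 * real r)) (2 * \<delta>0)"
        "\<forall>p\<in>W. 1 / (8 * real r) * real (card W) \<le> real (card (colour_nb col B W p))"
        unfolding S(3) by blast
      have finW: "finite W" using W(2) finV' by (rule finite_subset)
      have "2 * real N0 + 1 \<le> c * real w0" using w0 qc by (simp add: field_simps)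
      also have "\<dots> \<le> c * real w" using ww qc by (intro mult_left_mono) auto
      finally have cW: "2 * real N0 + 1 \<le> real (card W)" using W(3) by linarith
      have "robust col (dm / 4) (W \<union> {})"
        by (rule rob[of col B]) (use val W(1,5) finW cW \<delta> lower_quasirandom_mono[OF W(4) \<delta>0(3)] in \<open>auto simp: dm_def\<close>)
      moreover have "c2 * real (card V) \<le> real (card W)"
      proof -
        have "card V < q * (w + 1)" using qc(1) by (simp add: w_def dividend_less_times_div)
        also have "\<dots> \<le> q * (2 * w)" using ww by simp
        finally have "real (card V) \<le> real (q * (2 * w))" by (simp only: of_nat_le_iff)
        then have "c2 * real (card V) \<le> c / (2 * real q) * real (q * (2 * w))" using qc c2 by (intro mult_mono) (auto simp: c2_def)
        also have "\<dots> = c * real w" using qc by simp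
        finally show ?thesis using W(3) by linarith
      qed
      moreover have "W \<noteq> {}" using cW by auto
      moreover have "W \<subseteq> V" using W(2) V'(1) by blast
      ultimately show ?thesis by auto
    qed
  qed
qed

end

section \<open>Covering by boundedly many tiles\<close>

lemma colour_class_pigeonhole:
  fixes T :: nat
  assumes "\<And>i. i < T \<Longrightarrow> f i \<subseteq> {..<r::nat}" "T = m * 2 ^ r" "0 < m"
  shows "\<exists>C J. J \<subseteq> {..<T} \<and> card J = m \<and> (\<forall>i\<in>J. f i = C)"
proof -
  have "\<exists>C. m \<le> card {i. i < T \<and> f i = C}"
  proof (rule ccontr)
    assume "\<not> ?thesis"
    then have lt: "card {i. i < T \<and> f i = C} < m" for C by (auto simp: not_le)
    have "{..<T} \<subseteq> (\<Union>C\<in>Pow {..<r}. {i. i < T \<and> f i = C})" using assms(1) by auto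
    then have "card {..<T} \<le> card (\<Union>C\<in>Pow {..<r}. {i. i < T \<and> f i = C})" by (rule card_mono[rotated]) simp
    also have "\<dots> \<le> (\<Sum>C\<in>Pow {..<r}. card {i. i < T \<and> f i = C})" by (rule card_UN_le) simp
    also have "\<dots> < (\<Sum>C\<in>Pow {..<r}. m)" using lt by (intro sum_strict_mono) auto
    also have "\<dots> = m * 2 ^ r" by (simp add: card_Pow mult.commute)
    finally show False using assms(2) by simp
  qed
  then obtain C where "m \<le> card {i. i < T \<and> f i = C}" by blast
  then obtain J where "J \<subseteq> {i. i < T \<and> f i = C}" "card J = m" by (rule obtain_subset_with_card_n)
  then show ?thesis by (intro exI[of _ C] exI[of _ J]) auto
qed

lemma linear_less_power4: "\<exists>w0. \<forall>w\<ge>w0. k * w < (4::nat) ^ w"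
proof (intro exI allI impI)
  fix w assume w: "w \<ge> k"
  have "k * w \<le> w * w" using w by simp
  also have "\<dots> < 2 ^ w * 2 ^ w" using less_exp[of w] by (intro mult_strict_mono) auto
  also have "\<dots> = 4 ^ w" by (simp flip: power_mult_distrib)
  finally show "k * w < 4 ^ w" .
qed

context tile_cover
begin

text \<open>The order of the quantifiers carries the induction: the sparsity \<open>\<beta>\<close>
  is prescribed and the robustness \<open>\<theta>\<close> may depend on it, but the leftover
  proportion \<open>\<eta>\<close> is prescribed after \<open>\<theta>\<close> is known; the number
  \<open>M\<close> of tiles comes last.\<close>

definition covering_claim :: "nat \<Rightarrow> bool" where
  "covering_claim q \<longleftrightarrow> (\<forall>\<beta>::real. 0 < \<beta> \<longrightarrow> (\<exists>\<theta>::real. 0 < \<theta> \<and> (\<forall>\<eta>::real. 0 < \<eta> \<longrightarrow> (\<exists>M. \<forall>col V.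
    valid_colouring r col \<and> finite V \<longrightarrow> (\<exists>Z W R C. V = Z \<union> W \<union> R \<and> Z \<inter> W = {} \<and> Z \<inter> R = {} \<and> W \<inter> R = {} \<and>
      tiled col M Z \<and> (W = {} \<or> robust col \<theta> W) \<and> real (card R) \<le> \<eta> * real (card W) \<and>
      C \<subseteq> {..<r} \<and> card C = q \<and> (\<forall>u\<in>R. real (card {x \<in> W. col u x \<in> C}) \<le> \<beta> * real (card W)))))))"

text \<open>Without colours the sparsity condition is empty. Reserve one robust \<open>W\<close> and
  remove robust sets from the rest until the leftover is below \<open>\<eta> * card W\<close>; each
  removal leaves at most a share \<open>1 - c2\<close>.\<close>

lemma covering_claim_0: "covering_claim 0"
proof -
  obtain c2 \<theta> :: real where c2: "0 < c2" "c2 \<le> 1" and \<theta>: "0 < \<theta>" and rs: "\<And>col V. valid_colouring r col \<and> finite V \<and> V \<noteq> {} \<Longrightarrow>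
    (\<exists>W\<subseteq>V. W \<noteq> {} \<and> c2 * real (card V) \<le> real (card W) \<and> robust col \<theta> W)"
    using robust_subset by (elim exE conjE) blast
  have greedy: "\<exists>Z R. V = Z \<union> R \<and> Z \<inter> R = {} \<and> tiled col t Z \<and> real (card R) \<le> (1 - c2) ^ t * real (card V)"
    if val: "valid_colouring r col" and "finite V" for col V t
    using that(2)
  proof (induction t)
    case 0
    show ?case by (intro exI[of _ "{}"] exI[of _ V]) (simp add: tiled_empty)
  next
    case (Suc t)
    then obtain Z R where ZR: "V = Z \<union> R" "Z \<inter> R = {}" "tiled col t Z" "real (card R) \<le> (1 - c2) ^ t * real (card V)" by blast
    show ?case
    proof (cases "R = {}")
      case True
      then show ?thesis using ZR c2 tiled_mono[OF ZR(3), of "Suc t"] by (intro exI[of _ Z] exI[of _ "{}"]) simp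
    next
      case False
      have finR: "finite R" using ZR(1) Suc.prems by simp
      have "valid_colouring r col \<and> finite R \<and> R \<noteq> {}" using val finR False by blast
      from rs[OF this] obtain W where W: "W \<subseteq> R" "c2 * real (card R) \<le> real (card W)" "robust col \<theta> W" by blast
      have finW: "finite W" using W(1) finR by (rule finite_subset)
      have "tiled col 1 W" using robust_Tile[OF W(3)] \<theta> by (intro tiled_Tile) simp
      then have "tiled col (t + 1) (Z \<union> W)" using ZR(2) W(1) by (intro tiled_Un ZR(3)) auto
      moreover have "real (card (R - W)) \<le> (1 - c2) ^ Suc t * real (card V)"
      proof -
        have "real (card (R - W)) = real (card R) - real (card W)"
          using finW W(1) card_mono[OF finR W(1)] by (simp add: card_Diff_subset of_nat_diff)
        also have "\<dots> \<le> (1 - c2) * real (card R)" using W(2) by (simp add: algebra_simps)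
        also have "\<dots> \<le> (1 - c2) * ((1 - c2) ^ t * real (card V))" using ZR(4) c2 by (intro mult_left_mono) auto
        finally show ?thesis by (simp add: mult.assoc)
      qed
      moreover have "V = (Z \<union> W) \<union> (R - W)" "(Z \<union> W) \<inter> (R - W) = {}" using ZR(1,2) W(1) by auto
      ultimately show ?thesis by (intro exI[of _ "Z \<union> W"] exI[of _ "R - W"]) simp
    qed
  qed
  show ?thesis
    unfolding covering_claim_def
  proof (intro allI impI, rule exI[of _ \<theta>], intro conjI \<theta> allI impI)
    fix \<beta> \<eta> :: real assume \<beta>: "0 < \<beta>" and \<eta>: "0 < \<eta>"
    obtain t where t: "(1 - c2) ^ t < \<eta> * c2" using real_arch_pow_inv[of "\<eta> * c2" "1 - c2"] \<eta> c2 by auto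
    show "\<exists>M. \<forall>col V. valid_colouring r col \<and> finite V \<longrightarrow> (\<exists>Z W R C. V = Z \<union> W \<union> R \<and> Z \<inter> W = {} \<and> Z \<inter> R = {} \<and> W \<inter> R = {} \<and>
      tiled col M Z \<and> (W = {} \<or> robust col \<theta> W) \<and> real (card R) \<le> \<eta> * real (card W) \<and>
      C \<subseteq> {..<r} \<and> card C = 0 \<and> (\<forall>u\<in>R. real (card {x \<in> W. col u x \<in> C}) \<le> \<beta> * real (card W)))"
    proof (rule exI[of _ t], intro allI impI)
      fix col :: "'v \<Rightarrow> 'v \<Rightarrow> nat" and V :: "'v set"
      assume "valid_colouring r col \<and> finite V"
      then have val: "valid_colouring r col" and finV: "finite V" by blast+
      show "\<exists>Z W R C. V = Z \<union> W \<union> R \<and> Z \<inter> W = {} \<and> Z \<inter> R = {} \<and> W \<inter> R = {} \<and>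
        tiled col t Z \<and> (W = {} \<or> robust col \<theta> W) \<and> real (card R) \<le> \<eta> * real (card W) \<and>
        C \<subseteq> {..<r} \<and> card C = 0 \<and> (\<forall>u\<in>R. real (card {x \<in> W. col u x \<in> C}) \<le> \<beta> * real (card W))"
      proof (cases "V = {}")
        case True
        then show ?thesis
          by (intro exI[of _ "{}"]) (simp add: tiled_empty)
      next
        case False
        then have "valid_colouring r col \<and> finite V \<and> V \<noteq> {}" using val finV by blast
        from rs[OF this] obtain W where W: "W \<subseteq> V" "c2 * real (card V) \<le> real (card W)" "robust col \<theta> W" by blast
        have finVW: "finite (V - W)" using finV by simp
        obtain Z R where ZR: "V - W = Z \<union> R" "Z \<inter> R = {}" "tiled col t Z" "real (card R) \<le> (1 - c2) ^ t * real (card (V - W))"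
          using greedy[OF val finVW, of t] by blast
        have "real (card R) \<le> \<eta> * real (card W)"
        proof -
          note ZR(4)
          also have "(1 - c2) ^ t * real (card (V - W)) \<le> (\<eta> * c2) * real (card V)"
            using t c2 \<eta> card_mono[OF finV, of "V - W"] by (intro mult_mono) auto
          also have "\<dots> = \<eta> * (c2 * real (card V))" by simp
          also have "\<dots> \<le> \<eta> * real (card W)" using W(2) \<eta> by (intro mult_left_mono) auto
          finally show ?thesis .
        qed
        moreover have "V = Z \<union> W \<union> R" "Z \<inter> W = {}" "W \<inter> R = {}" using ZR(1) W(1) by auto
        ultimately show ?thesis using ZR(2,3) W(3) \<beta> by (intro exI[of _ Z] exI[of _ W] exI[of _ R] exI[of _ "{}"]) simp
      qed
    qed
  qed
qed

text \<open>Every round works inside the previous leftover, so all that comes later is small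
  compared with \<open>Wf i\<close> and sparse towards it in the colours
  \<open>Cf i\<close>.\<close>

lemma iterate_covering:
  fixes \<beta> \<eta> \<theta> :: real
  assumes single: "\<And>V. finite V \<Longrightarrow> \<exists>Z W R C. V = Z \<union> W \<union> R \<and> Z \<inter> W = {} \<and> Z \<inter> R = {} \<and> W \<inter> R = {} \<and>
      tiled col M Z \<and> (W = {} \<or> robust col \<theta> W) \<and> real (card R) \<le> \<eta> * real (card W) \<and>
      C \<subseteq> {..<r} \<and> card C = q \<and> (\<forall>u\<in>R. real (card {x \<in> W. col u x \<in> C}) \<le> \<beta> * real (card W))"
    and finV: "finite V"
  shows "\<exists>Z Wf Cf R. V = Z \<union> (\<Union>i<t. Wf i) \<union> R \<and> Z \<inter> (\<Union>i<t. Wf i) = {} \<and> Z \<inter> R = {} \<and> (\<forall>i<t. Wf i \<inter> R = {}) \<and>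
      (\<forall>i<t. \<forall>j<t. i \<noteq> j \<longrightarrow> Wf i \<inter> Wf j = {}) \<and> tiled col (t * M) Z \<and>
      (\<forall>i<t. (Wf i = {} \<or> robust col \<theta> (Wf i)) \<and> Cf i \<subseteq> {..<r} \<and> card (Cf i) = q \<and>
         real (card ((\<Union>j\<in>{i<..<t}. Wf j) \<union> R)) \<le> \<eta> * real (card (Wf i)) \<and>
         (\<forall>u\<in>(\<Union>j\<in>{i<..<t}. Wf j) \<union> R. real (card {x \<in> Wf i. col u x \<in> Cf i}) \<le> \<beta> * real (card (Wf i))))"
proof (induction t)
  case 0
  show ?case by (rule exI[of _ "{}"], rule exI[of _ "\<lambda>_. {}"], rule exI[of _ "\<lambda>_. {}"], rule exI[of _ V]) (simp add: tiled_empty)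
next
  case (Suc t)
  then obtain Z Wf Cf R where V: "V = Z \<union> (\<Union>i<t. Wf i) \<union> R" and ZW: "Z \<inter> (\<Union>i<t. Wf i) = {}" and ZR: "Z \<inter> R = {}"
    and WR: "\<forall>i<t. Wf i \<inter> R = {}" and WW: "\<forall>i<t. \<forall>j<t. i \<noteq> j \<longrightarrow> Wf i \<inter> Wf j = {}" and tZ: "tiled col (t * M) Z"
    and props: "\<forall>i<t. (Wf i = {} \<or> robust col \<theta> (Wf i)) \<and> Cf i \<subseteq> {..<r} \<and> card (Cf i) = q \<and>
         real (card ((\<Union>j\<in>{i<..<t}. Wf j) \<union> R)) \<le> \<eta> * real (card (Wf i)) \<and>
         (\<forall>u\<in>(\<Union>j\<in>{i<..<t}. Wf j) \<union> R. real (card {x \<in> Wf i. col u x \<in> Cf i}) \<le> \<beta> * real (card (Wf i)))"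
    by (elim exE conjE)
  have finR: "finite R" using V finV by simp
  from single[OF finR] obtain Z' W' R' C' where S: "R = Z' \<union> W' \<union> R'" "Z' \<inter> W' = {}" "Z' \<inter> R' = {}" "W' \<inter> R' = {}"
      "tiled col M Z'" "W' = {} \<or> robust col \<theta> W'" "real (card R') \<le> \<eta> * real (card W')"
      "C' \<subseteq> {..<r}" "card C' = q" "\<forall>u\<in>R'. real (card {x \<in> W'. col u x \<in> C'}) \<le> \<beta> * real (card W')"
    by (elim exE conjE)
  define Wg where "Wg = Wf(t := W')"
  define Cg where "Cg = Cf(t := C')"
  have Wg: "Wg t = W'" "\<And>i. i < t \<Longrightarrow> Wg i = Wf i" by (auto simp: Wg_def)
  have UW: "(\<Union>i<Suc t. Wg i) = (\<Union>i<t. Wf i) \<union> W'" by (auto simp: Wg_def less_Suc_eq)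
  have later: "(\<Union>j\<in>{i<..<Suc t}. Wg j) \<union> R' \<subseteq> (\<Union>j\<in>{i<..<t}. Wf j) \<union> R" if "i < t" for i
  proof
    fix x assume "x \<in> (\<Union>j\<in>{i<..<Suc t}. Wg j) \<union> R'"
    then consider j where "i < j" "j < Suc t" "x \<in> Wg j" | "x \<in> R'" by auto
    then show "x \<in> (\<Union>j\<in>{i<..<t}. Wf j) \<union> R"
    proof cases
      case (1 j)
      show ?thesis
      proof (cases "j = t")
        case True then show ?thesis using 1 S(1) Wg(1) by auto
      next
        case False then show ?thesis using 1 Wg(2)[of j] by auto
      qed
    next
      case 2 then show ?thesis using S(1) by auto
    qed
  qed
  have 1: "V = (Z \<union> Z') \<union> (\<Union>i<Suc t. Wg i) \<union> R'" unfolding UW using V S(1) by auto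
  have 2: "(Z \<union> Z') \<inter> (\<Union>i<Suc t. Wg i) = {}" unfolding UW using ZW ZR WR S(1,2) by auto
  have 3: "(Z \<union> Z') \<inter> R' = {}" using ZR S(1,3) by auto
  have 4: "\<forall>i<Suc t. Wg i \<inter> R' = {}" using WR S(1,4) Wg by (auto simp: less_Suc_eq)
  have 5: "\<forall>i<Suc t. \<forall>j<Suc t. i \<noteq> j \<longrightarrow> Wg i \<inter> Wg j = {}"
  proof (intro allI impI)
    fix i j assume ij: "i < Suc t" "j < Suc t" "i \<noteq> j"
    have wr: "Wf l \<inter> W' = {}" if "l < t" for l using WR S(1) that by auto
    consider "i = t" "j < t" | "i < t" "j = t" | "i < t" "j < t" using ij by linarith
    then show "Wg i \<inter> Wg j = {}"
    proof cases
      case 1 then show ?thesis using wr[of j] Wg by auto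
    next
      case 2 then show ?thesis using wr[of i] Wg by auto
    next
      case 3 then show ?thesis using WW ij(3) Wg(2) by auto
    qed
  qed
  have "tiled col (t * M + M) (Z \<union> Z')" using ZR S(1) by (intro tiled_Un tZ S(5)) auto
  then have 6: "tiled col (Suc t * M) (Z \<union> Z')" by (simp add: add.commute)
  have 7: "\<forall>i<Suc t. (Wg i = {} \<or> robust col \<theta> (Wg i)) \<and> Cg i \<subseteq> {..<r} \<and> card (Cg i) = q \<and>
         real (card ((\<Union>j\<in>{i<..<Suc t}. Wg j) \<union> R')) \<le> \<eta> * real (card (Wg i)) \<and>
         (\<forall>u\<in>(\<Union>j\<in>{i<..<Suc t}. Wg j) \<union> R'. real (card {x \<in> Wg i. col u x \<in> Cg i}) \<le> \<beta> * real (card (Wg i)))"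
  proof (intro allI impI)
    fix i assume i: "i < Suc t"
    show "(Wg i = {} \<or> robust col \<theta> (Wg i)) \<and> Cg i \<subseteq> {..<r} \<and> card (Cg i) = q \<and>
         real (card ((\<Union>j\<in>{i<..<Suc t}. Wg j) \<union> R')) \<le> \<eta> * real (card (Wg i)) \<and>
         (\<forall>u\<in>(\<Union>j\<in>{i<..<Suc t}. Wg j) \<union> R'. real (card {x \<in> Wg i. col u x \<in> Cg i}) \<le> \<beta> * real (card (Wg i)))"
    proof (cases "i = t")
      case True
      then have "(\<Union>j\<in>{i<..<Suc t}. Wg j) \<union> R' = R'" by auto
      then show ?thesis using S(6-10) True Wg(1) by (simp add: Cg_def)
    next
      case False
      then have it: "i < t" using i by simp
      have fin: "finite ((\<Union>j\<in>{i<..<t}. Wf j) \<union> R)"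
        by (rule finite_subset[OF _ finV]) (use V in auto)
      have "card ((\<Union>j\<in>{i<..<Suc t}. Wg j) \<union> R') \<le> card ((\<Union>j\<in>{i<..<t}. Wf j) \<union> R)"
        using later[OF it] fin by (rule card_mono[rotated])
      moreover have p: "(Wf i = {} \<or> robust col \<theta> (Wf i))" "Cf i \<subseteq> {..<r}" "card (Cf i) = q"
         "real (card ((\<Union>j\<in>{i<..<t}. Wf j) \<union> R)) \<le> \<eta> * real (card (Wf i))"
         "\<forall>u\<in>(\<Union>j\<in>{i<..<t}. Wf j) \<union> R. real (card {x \<in> Wf i. col u x \<in> Cf i}) \<le> \<beta> * real (card (Wf i))"
        using props it by blast+
      ultimately have "real (card ((\<Union>j\<in>{i<..<Suc t}. Wg j) \<union> R')) \<le> \<eta> * real (card (Wf i))" by linarith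
      moreover have "Cg i = Cf i" using it by (simp add: Cg_def)
      moreover have "\<forall>u\<in>(\<Union>j\<in>{i<..<Suc t}. Wg j) \<union> R'. real (card {x \<in> Wf i. col u x \<in> Cf i}) \<le> \<beta> * real (card (Wf i))"
        using p(5) later[OF it] by blast
      ultimately show ?thesis using p(1-3) Wg(2)[OF it] by simp
    qed
  qed
  show ?case
    by (rule exI[of _ "Z \<union> Z'"], rule exI[of _ Wg], rule exI[of _ Cg], rule exI[of _ R'], intro conjI)
      (fact 1 2 3 4 5 6 7)+
qed

text \<open>The new \<open>W\<close> is assembled from samples that the robust tiles can spare.
  Their size is a fixed proportion of the smallest tile, and the leftover is a much smaller
  proportion of it; hence the leftover is also tiny compared with \<open>W\<close>, and its vertices
  that see much of \<open>W\<close> in the new colour can be absorbed.\<close>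

lemma covering_claim_Suc:
  assumes IH: "covering_claim q" and q: "q < r"
  shows "covering_claim (Suc q)"
  unfolding covering_claim_def
proof (intro allI impI)
  fix \<beta>' :: real assume \<beta>': "0 < \<beta>'"
  have r8: "1 / (8 * real r) \<le> 1 / 8" using r_pos by (simp add: field_simps)
  \<comment> \<open>The threshold between absorbed and remaining vertices: degree
    \<open>dm * card W\<close> must be enough for \<open>robust_absorb\<close>, and anything below
    it must be negligible against \<open>\<beta>'\<close>.\<close>
  define dm where "dm = min (\<beta>' / 8) (1 / (8 * real r))"
  have dm: "0 < dm" "dm \<le> 1 / (8 * real r)" "dm \<le> \<beta>' / 8" using \<beta>' r_pos by (auto simp: dm_def)
  obtain \<delta> :: real and N0 :: nat where \<delta>: "0 < \<delta>" and rob: "\<And>col B W A. valid_colouring r col \<and> B < r \<and> finite W \<and> finite A \<and> A \<inter> W = {} \<and>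
    2 * N0 \<le> card W \<and> lower_quasirandom W (colour_nb col B W) (1 / (4 * real r)) (\<delta> / 8) \<and>
    (\<forall>p\<in>W \<union> A. dm * real (card W) \<le> real (card (colour_nb col B W p))) \<and>
    real (card A) \<le> \<delta> / 8 * real (card W) \<and> card A \<le> card W \<Longrightarrow> robust col (dm / 4) (W \<union> A)"
    using robust_absorb[OF dm(1,2)] by blast
  define \<delta>0 where "\<delta>0 = min (\<delta> / 16) (1 / (8 * real r))"
  have \<delta>0: "0 < \<delta>0" "\<delta>0 \<le> 1 / (8 * real r)" "2 * \<delta>0 \<le> \<delta> / 8" using \<delta> r_pos by (auto simp: \<delta>0_def)
  obtain m and c :: real where mc: "0 < m" "0 < c" "c \<le> 1" and find: "\<And>(col :: 'v \<Rightarrow> 'v \<Rightarrow> nat) (S :: nat \<Rightarrow> 'v set) (w::nat).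
     valid_colouring r col \<and> (\<forall>i<m. finite (S i) \<and> card (S i) = w) \<and> (\<forall>i<m. \<forall>j<m. i \<noteq> j \<longrightarrow> S i \<inter> S j = {}) \<and> 0 < w \<Longrightarrow>
     (\<exists>B W. B < r \<and> W \<subseteq> (\<Union>i<m. S i) \<and> c * real w \<le> real (card W) \<and>
        lower_quasirandom W (colour_nb col B W) (1 / (4 * real r)) (2 * \<delta>0) \<and>
        (\<forall>p\<in>W. 1 / (8 * real r) * real (card W) \<le> real (card (colour_nb col B W p))) \<and>
        (\<exists>i<m. \<exists>j<m. i \<noteq> j \<and> c * (real w * real w) \<le> edges col B (S i) (S j)))"
    using find_quasirandom[OF r_pos \<delta>0(1,2), where 'v = 'v] by (elim exE conjE) blast
  \<comment> \<open>The bound \<open>c / 2\<close> excludes the new colour from \<open>C\<close>;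
    the bound \<open>\<beta>' * c / (4 * m)\<close> lets \<open>m\<close> samples together
    contribute at most \<open>\<beta>' / 4\<close> of \<open>W\<close>.\<close>
  define \<gamma> where "\<gamma> = min (c / 2) (\<beta>' * c / (4 * real m))"
  have \<gamma>: "0 < \<gamma>" "\<gamma> \<le> 1" "\<gamma> \<le> c / 2" "\<gamma> \<le> \<beta>' * c / (4 * real m)" using mc \<beta>' by (auto simp: \<gamma>_def)
  define \<beta> where "\<beta> = (1 / 8 :: real) powr (1 / \<gamma>)"
  have \<beta>: "0 < \<beta>" by (simp add: \<beta>_def)
  obtain \<theta> :: real where \<theta>: "0 < \<theta>" and IH\<theta>: "\<And>\<eta>::real. 0 < \<eta> \<Longrightarrow> (\<exists>M. \<forall>col V.
    valid_colouring r col \<and> finite V \<longrightarrow> (\<exists>Z W R C. V = Z \<union> W \<union> R \<and> Z \<inter> W = {} \<and> Z \<inter> R = {} \<and> W \<inter> R = {} \<and>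
      tiled col M Z \<and> (W = {} \<or> robust col \<theta> W) \<and> real (card R) \<le> \<eta> * real (card W) \<and>
      C \<subseteq> {..<r} \<and> card C = q \<and> (\<forall>u\<in>R. real (card {x \<in> W. col u x \<in> C}) \<le> \<beta> * real (card W))))"
    using IH[unfolded covering_claim_def, rule_format, OF \<beta>] by blast
  define \<theta>1 where "\<theta>1 = min \<theta> 1"
  have \<theta>1: "0 < \<theta>1" "\<theta>1 \<le> \<theta>" "\<theta>1 \<le> 1" using \<theta> by (auto simp: \<theta>1_def)
  define T where "T = m * 2 ^ r"
  have T0: "0 < T" using mc by (simp add: T_def)
  obtain w1 where w1: "\<And>w. w \<ge> w1 \<Longrightarrow> (m + 1) * w < (4::nat) ^ w" using linear_less_power4 by blast
  obtain w2 :: nat where w2: "2 * real N0 / c \<le> real w2" using real_arch_simple by blast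
  define ws where "ws = Suc (max w1 w2)"
  obtain m0 :: nat where m0: "(real ws + 1) / \<theta>1 \<le> real m0" using real_arch_simple by blast
  have \<theta>': "0 < dm / 4" using dm by simp
  show "\<exists>\<theta>::real. 0 < \<theta> \<and> (\<forall>\<eta>::real. 0 < \<eta> \<longrightarrow> (\<exists>M. \<forall>col V.
    valid_colouring r col \<and> finite V \<longrightarrow> (\<exists>Z W R C. V = Z \<union> W \<union> R \<and> Z \<inter> W = {} \<and> Z \<inter> R = {} \<and> W \<inter> R = {} \<and>
      tiled col M Z \<and> (W = {} \<or> robust col \<theta> W) \<and> real (card R) \<le> \<eta> * real (card W) \<and>
      C \<subseteq> {..<r} \<and> card C = Suc q \<and> (\<forall>u\<in>R. real (card {x \<in> W. col u x \<in> C}) \<le> \<beta>' * real (card W)))))"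
  proof (rule exI[of _ "dm / 4"], intro conjI \<theta>' allI impI)
    fix \<eta>' :: real assume \<eta>': "0 < \<eta>'"
    define \<eta>1 where "\<eta>1 = min (min \<eta>' (\<delta> / 8)) (min (\<beta>' / 8) 1)"
    have \<eta>1: "0 < \<eta>1" "\<eta>1 \<le> \<eta>'" "\<eta>1 \<le> \<delta> / 8" "\<eta>1 \<le> \<beta>' / 8" "\<eta>1 \<le> 1" using \<eta>' \<delta> \<beta>' by (auto simp: \<eta>1_def)
    \<comment> \<open>Samples have size about \<open>\<theta>1 * mm\<close> and \<open>W\<close> at
      least \<open>c\<close> times that, so this \<open>\<eta>\<close> bounds the leftover by
      \<open>\<eta>1 * card W\<close>; the factor 2 covers the rounding of \<open>w\<close>.\<close>
    define \<eta> where "\<eta> = \<eta>1 * c * \<theta>1 / 2"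
    have \<eta>: "0 < \<eta>" using \<eta>1 mc \<theta>1 by (simp add: \<eta>_def)
    have \<eta>le1: "\<eta> \<le> 1"
    proof -
      have "\<eta>1 * c * \<theta>1 \<le> 1 * 1 * 1" using \<eta>1 mc \<theta>1 by (intro mult_mono) auto
      then show ?thesis by (simp add: \<eta>_def)
    qed
    obtain M where M: "\<And>col V. valid_colouring r col \<and> finite V \<Longrightarrow> (\<exists>Z W R C. V = Z \<union> W \<union> R \<and> Z \<inter> W = {} \<and> Z \<inter> R = {} \<and> W \<inter> R = {} \<and>
      tiled col M Z \<and> (W = {} \<or> robust col \<theta> W) \<and> real (card R) \<le> \<eta> * real (card W) \<and>
      C \<subseteq> {..<r} \<and> card C = q \<and> (\<forall>u\<in>R. real (card {x \<in> W. col u x \<in> C}) \<le> \<beta> * real (card W)))"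
      using IH\<theta>[OF \<eta>] by (elim exE) blast
    define M' where "M' = T * M + T + m0"
    show "\<exists>M. \<forall>col V. valid_colouring r col \<and> finite V \<longrightarrow> (\<exists>Z W R C. V = Z \<union> W \<union> R \<and> Z \<inter> W = {} \<and> Z \<inter> R = {} \<and> W \<inter> R = {} \<and>
      tiled col M Z \<and> (W = {} \<or> robust col (dm / 4) W) \<and> real (card R) \<le> \<eta>' * real (card W) \<and>
      C \<subseteq> {..<r} \<and> card C = Suc q \<and> (\<forall>u\<in>R. real (card {x \<in> W. col u x \<in> C}) \<le> \<beta>' * real (card W)))"
    proof (rule exI[of _ M'], intro allI impI)
      fix col :: "'v \<Rightarrow> 'v \<Rightarrow> nat" and V :: "'v set"
      assume "valid_colouring r col \<and> finite V"
      then have val: "valid_colouring r col" and finV: "finite V" by blast+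
      have col_sym: "\<And>x y. col x y = col y x" using val unfolding valid_colouring_def by blast
      have single: "\<exists>Z W R C. V = Z \<union> W \<union> R \<and> Z \<inter> W = {} \<and> Z \<inter> R = {} \<and> W \<inter> R = {} \<and>
        tiled col M Z \<and> (W = {} \<or> robust col \<theta> W) \<and> real (card R) \<le> \<eta> * real (card W) \<and>
        C \<subseteq> {..<r} \<and> card C = q \<and> (\<forall>u\<in>R. real (card {x \<in> W. col u x \<in> C}) \<le> \<beta> * real (card W))" if "finite V" for V
        by (rule M) (simp add: val that)
      have "\<exists>Z Wf Cf R. V = Z \<union> (\<Union>i<T. Wf i) \<union> R \<and> Z \<inter> (\<Union>i<T. Wf i) = {} \<and> Z \<inter> R = {} \<and> (\<forall>i<T. Wf i \<inter> R = {}) \<and>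
        (\<forall>i<T. \<forall>j<T. i \<noteq> j \<longrightarrow> Wf i \<inter> Wf j = {}) \<and> tiled col (T * M) Z \<and>
        (\<forall>i<T. (Wf i = {} \<or> robust col \<theta> (Wf i)) \<and> Cf i \<subseteq> {..<r} \<and> card (Cf i) = q \<and>
         real (card ((\<Union>j\<in>{i<..<T}. Wf j) \<union> R)) \<le> \<eta> * real (card (Wf i)) \<and>
         (\<forall>u\<in>(\<Union>j\<in>{i<..<T}. Wf j) \<union> R. real (card {x \<in> Wf i. col u x \<in> Cf i}) \<le> \<beta> * real (card (Wf i))))"
        by (rule iterate_covering[OF _ finV]) (rule single)
      then obtain Z Wf Cf R where V: "V = Z \<union> (\<Union>i<T. Wf i) \<union> R" and ZW: "Z \<inter> (\<Union>i<T. Wf i) = {}" and ZR: "Z \<inter> R = {}"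
        and WR: "\<forall>i<T. Wf i \<inter> R = {}" and WW: "\<forall>i<T. \<forall>j<T. i \<noteq> j \<longrightarrow> Wf i \<inter> Wf j = {}" and tZ: "tiled col (T * M) Z"
        and props: "\<forall>i<T. (Wf i = {} \<or> robust col \<theta> (Wf i)) \<and> Cf i \<subseteq> {..<r} \<and> card (Cf i) = q \<and>
         real (card ((\<Union>j\<in>{i<..<T}. Wf j) \<union> R)) \<le> \<eta> * real (card (Wf i)) \<and>
         (\<forall>u\<in>(\<Union>j\<in>{i<..<T}. Wf j) \<union> R. real (card {x \<in> Wf i. col u x \<in> Cf i}) \<le> \<beta> * real (card (Wf i)))"
        by (elim exE conjE)
      have rb: "Wf i = {} \<or> robust col \<theta> (Wf i)" and Cfr: "Cf i \<subseteq> {..<r}" and Cfq: "card (Cf i) = q"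
        and later_card: "real (card ((\<Union>j\<in>{i<..<T}. Wf j) \<union> R)) \<le> \<eta> * real (card (Wf i))"
        and later_sparse: "\<And>u. u \<in> (\<Union>j\<in>{i<..<T}. Wf j) \<union> R \<Longrightarrow> real (card {x \<in> Wf i. col u x \<in> Cf i}) \<le> \<beta> * real (card (Wf i))"
        if "i < T" for i using props that by blast+
      have finR: "finite R" using V finV by simp
      have finWf: "finite (Wf i)" if "i < T" for i
        by (rule finite_subset[OF _ finV]) (use V that in auto)
      \<comment> \<open>Later tiles lie in the leftover of earlier ones and
        \<open>\<eta> \<le> 1\<close>, so the last tile is the smallest; it may be empty.\<close>
      define mm where "mm = card (Wf (T - 1))"
      have T1: "T - 1 < T" using T0 by simp
      have Rmm: "real (card R) \<le> \<eta> * real mm"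
      proof -
        have "{T - 1<..<T} = {}" by auto
        then show ?thesis using later_card[OF T1] by (simp add: mm_def)
      qed
      have mmW: "mm \<le> card (Wf i)" if i: "i < T" for i
      proof (cases "i = T - 1")
        case True then show ?thesis by (simp add: mm_def)
      next
        case False
        then have "T - 1 \<in> {i<..<T}" using i T1 by auto
        then have "Wf (T - 1) \<subseteq> (\<Union>j\<in>{i<..<T}. Wf j) \<union> R" by blast
        moreover have "finite ((\<Union>j\<in>{i<..<T}. Wf j) \<union> R)" using finR finWf by auto
        ultimately have "mm \<le> card ((\<Union>j\<in>{i<..<T}. Wf j) \<union> R)" unfolding mm_def by (rule card_mono[rotated])
        moreover have "\<eta> * real (card (Wf i)) \<le> 1 * real (card (Wf i))" using \<eta>le1 by (intro mult_right_mono) auto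
        ultimately have "real mm \<le> real (card (Wf i))" using later_card[OF i] by linarith
        then show ?thesis by simp
      qed
      show "\<exists>Z W R C. V = Z \<union> W \<union> R \<and> Z \<inter> W = {} \<and> Z \<inter> R = {} \<and> W \<inter> R = {} \<and>
        tiled col M' Z \<and> (W = {} \<or> robust col (dm / 4) W) \<and> real (card R) \<le> \<eta>' * real (card W) \<and>
        C \<subseteq> {..<r} \<and> card C = Suc q \<and> (\<forall>u\<in>R. real (card {x \<in> W. col u x \<in> C}) \<le> \<beta>' * real (card W))"
      proof (cases "mm < m0")
        \<comment> \<open>A bounded last tile means a bounded leftover, which single vertices cover.
          With \<open>W\<close> and \<open>R\<close> empty, any \<open>Suc q\<close> colours will
          do.\<close>
        case True
        have tW: "tiled col 1 (Wf i)" if "i \<in> {..<T}" for i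
        proof (cases "Wf i = {}")
          case True then show ?thesis by (simp add: tiled_empty)
        next
          case False
          then have "robust col \<theta> (Wf i)" using rb[of i] that by blast
          then show ?thesis using \<theta> by (intro tiled_Tile robust_Tile[of col \<theta>]) auto
        qed
        have "tiled col (card {..<T} * 1) (\<Union>i<T. Wf i)"
          by (rule tiled_UN[OF _ tW]) (use WW in auto)
        then have t1: "tiled col (T * M + T) (Z \<union> (\<Union>i<T. Wf i))" using ZW by (intro tiled_Un tZ) simp_all
        have "\<eta> * real mm \<le> 1 * real mm" using \<eta>le1 by (intro mult_right_mono) auto
        then have "card R \<le> m0" using Rmm True by linarith
        then have "tiled col m0 R" by (rule tiled_mono[OF tiled_singles[OF val finR]])
        then have "tiled col M' (Z \<union> (\<Union>i<T. Wf i) \<union> R)" 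
          unfolding M'_def by (rule tiled_Un[OF t1]) (use ZR WR in blast)
        then have tV: "tiled col M' V" using V by simp
        have "Suc q \<le> card {..<r}" using q by simp
        then obtain C where "C \<subseteq> {..<r}" "card C = Suc q" by (rule obtain_subset_with_card_n)
        then show ?thesis using tV by (intro exI[of _ V] exI[of _ "{}"] exI[of _ C]) simp
      next
        case False
        \<comment> \<open>Small enough that every \<open>Wf i\<close> survives the removal of
          \<open>w\<close> vertices.\<close>
        define w where "w = nat \<lfloor>\<theta>1 * real mm\<rfloor>"
        have tm: "real ws + 1 \<le> \<theta>1 * real mm"
        proof -
          have "real ws + 1 \<le> \<theta>1 * real m0" using m0 \<theta>1 by (simp add: field_simps)
          also have "\<dots> \<le> \<theta>1 * real mm" using False \<theta>1 by (intro mult_left_mono) auto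
          finally show ?thesis .
        qed
        have w: "real w \<le> \<theta>1 * real mm" "\<theta>1 * real mm \<le> 2 * real w" "ws \<le> w"
        proof -
          show "real w \<le> \<theta>1 * real mm" unfolding w_def by (rule of_nat_floor) (use \<theta>1 in simp)
          show "ws \<le> w" using tm unfolding w_def by linarith
          then have "1 \<le> real w" by (simp add: ws_def)
          moreover have "\<theta>1 * real mm < real w + 1" unfolding w_def by linarith
          ultimately show "\<theta>1 * real mm \<le> 2 * real w" by linarith
        qed
        have w0: "0 < w" "w1 \<le> w" "w2 \<le> w" using w(3) by (auto simp: ws_def)
        have wW: "w \<le> card (Wf i)" "real w \<le> \<theta> * real (card (Wf i))" if "i < T" for i
        proof -
          have mw: "real mm \<le> real (card (Wf i))" using mmW[OF that] by simp
          have "\<theta>1 * real mm \<le> 1 * real mm" using \<theta>1 by (intro mult_right_mono) auto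
          then have "real w \<le> real (card (Wf i))" using w(1) mw by linarith
          then show "w \<le> card (Wf i)" by simp
          have "\<theta>1 * real mm \<le> \<theta> * real (card (Wf i))" using \<theta>1 mw by (intro mult_mono) auto
          then show "real w \<le> \<theta> * real (card (Wf i))" using w(1) by linarith
        qed
        have Rw: "real (card R) \<le> \<eta>1 * (c * real w)"
        proof -
          have "\<eta> * real mm = \<eta>1 * c / 2 * (\<theta>1 * real mm)" by (simp add: \<eta>_def)
          also have "\<dots> \<le> \<eta>1 * c / 2 * (2 * real w)" using w(2) \<eta>1 mc by (intro mult_left_mono) auto
          finally show ?thesis using Rmm by simp
        qed
        have Rw1: "card R \<le> w"
        proof -
          have "\<eta>1 * (c * real w) \<le> 1 * (1 * real w)" using \<eta>1 mc by (intro mult_mono) auto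
          then show ?thesis using Rw by linarith
        qed
        obtain C J where J: "J \<subseteq> {..<T}" "card J = m" "\<forall>i\<in>J. Cf i = C"
          using colour_class_pigeonhole[of T Cf r m] Cfr T_def mc(1) by blast
        have finJ: "finite J" by (rule finite_subset[OF J(1)]) simp
        have JT: "i < T" if "i \<in> J" for i using J(1) that by blast
        have "\<exists>S. \<forall>t\<in>J. S t \<subseteq> Wf t \<and> card (S t) = w \<and>
          (\<forall>u\<in>R \<union> (\<Union>t'\<in>{t' \<in> J. t < t'}. S t'). real (card {x \<in> S t. col u x \<in> C}) \<le> \<gamma> * real w)"
        proof (rule sparse_samples[OF finJ finR])
          show "finite (Wf t) \<and> w \<le> card (Wf t)" if "t \<in> J" for t using finWf wW(1) JT[OF that] by blast
          show "real (card {x \<in> Wf t. col u x \<in> C}) \<le> \<beta> * real (card (Wf t))"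
            if t: "t \<in> J" and u: "u \<in> R \<union> (\<Union>t'\<in>{t' \<in> J. t < t'}. Wf t')" for t u
          proof -
            have "u \<in> (\<Union>j\<in>{t<..<T}. Wf j) \<union> R" using u JT by auto
            moreover have "Cf t = C" using J(3) t by blast
            ultimately show ?thesis using later_sparse[OF JT[OF t], of u] by simp
          qed
          have "card R + card J * w \<le> (m + 1) * w" using Rw1 J(2) by simp
          then show "card R + card J * w < 4 ^ w" using w1[OF w0(2)] by linarith
          show "0 < w" by (rule w0(1))
          show "\<beta> \<le> (1 / 8) powr (1 / \<gamma>)" by (simp add: \<beta>_def)
        qed (rule \<gamma> \<beta>)+
        then obtain S where S: "\<forall>t\<in>J. S t \<subseteq> Wf t \<and> card (S t) = w \<and>
          (\<forall>u\<in>R \<union> (\<Union>t'\<in>{t' \<in> J. t < t'}. S t'). real (card {x \<in> S t. col u x \<in> C}) \<le> \<gamma> * real w)" by (elim exE)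
        have SW: "S t \<subseteq> Wf t" and Sw: "card (S t) = w"
          and Ssp: "\<And>u. u \<in> R \<union> (\<Union>t'\<in>{t' \<in> J. t < t'}. S t') \<Longrightarrow> real (card {x \<in> S t. col u x \<in> C}) \<le> \<gamma> * real w"
          if "t \<in> J" for t using S that by blast+
        have finS: "finite (S t)" if "t \<in> J" for t by (rule finite_subset[OF SW[OF that] finWf[OF JT[OF that]]])
        obtain g where g: "bij_betw g {..<m} J" using ex_bij_betw_nat_finite[OF finJ] J(2) by (auto simp: atLeast0LessThan)
        have gJ: "g i \<in> J" if "i < m" for i using g that by (auto simp: bij_betw_def)
        have g_inj: "g i \<noteq> g j" if "i < m" "j < m" "i \<noteq> j" for i j using g that by (auto simp: bij_betw_def inj_on_def)
        define S' where "S' i = S (g i)" for i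
        have US: "(\<Union>i<m. S' i) = (\<Union>t\<in>J. S t)" using g by (auto simp: S'_def bij_betw_def)
        have "valid_colouring r col \<and> (\<forall>i<m. finite (S' i) \<and> card (S' i) = w) \<and> (\<forall>i<m. \<forall>j<m. i \<noteq> j \<longrightarrow> S' i \<inter> S' j = {}) \<and> 0 < w"
        proof (intro conjI val w0(1) allI impI)
          fix i assume i: "i < m"
          show "finite (S' i)" "card (S' i) = w" using finS Sw gJ[OF i] by (auto simp: S'_def)
          fix j assume j: "j < m" "i \<noteq> j"
          have "Wf (g i) \<inter> Wf (g j) = {}" using WW JT gJ i j g_inj[OF i j] by blast
          then show "S' i \<inter> S' j = {}" using SW gJ i j unfolding S'_def by blast
        qed
        from find[OF this] obtain B W where B: "B < r" and WS: "W \<subseteq> (\<Union>i<m. S' i)" and cW: "c * real w \<le> real (card W)"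
          and qr: "lower_quasirandom W (colour_nb col B W) (1 / (4 * real r)) (2 * \<delta>0)"
          and degW: "\<forall>p\<in>W. 1 / (8 * real r) * real (card W) \<le> real (card (colour_nb col B W p))"
          and cross: "\<exists>i<m. \<exists>j<m. i \<noteq> j \<and> c * (real w * real w) \<le> edges col B (S' i) (S' j)"
          by blast
        have finW: "finite W" by (rule finite_subset[OF WS]) (use finS gJ in \<open>auto simp: S'_def\<close>)
        have WJ: "W \<subseteq> (\<Union>t\<in>J. S t)" using WS US by simp
        \<comment> \<open>Seen from the later of two samples, the colours in \<open>C\<close> take
          at most \<open>\<gamma> * w * w\<close> of the pairs, while \<open>B\<close> takes at
          least \<open>c * w * w\<close> between some two samples.\<close>
        have BC: "B \<notin> C"
        proof
          assume BC: "B \<in> C"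
          have less: "edges col B (S t') (S t) \<le> \<gamma> * real w * real w" if t: "t \<in> J" "t' \<in> J" "t < t'" for t t'
          proof -
            have "edges col B (S t') (S t) \<le> (\<Sum>u\<in>S t'. \<gamma> * real w)"
              unfolding edges_def
            proof (rule sum_mono)
              fix u assume u: "u \<in> S t'"
              have "(\<Sum>x\<in>S t. if col u x = B then 1 else 0::real) = card (S t \<inter> {x. col u x = B})"
                using finS[OF t(1)] by (simp add: sum.If_cases)
              also have "\<dots> \<le> card {x \<in> S t. col u x \<in> C}"
                using finS[OF t(1)] BC by (intro of_nat_mono card_mono) auto
              also have "\<dots> \<le> \<gamma> * real w" using u t by (intro Ssp) auto
              finally show "(\<Sum>x\<in>S t. if col u x = B then 1 else 0) \<le> \<gamma> * real w" .
            qed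
            also have "\<dots> = \<gamma> * real w * real w" using Sw[OF t(2)] by simp
            finally show ?thesis .
          qed
          obtain i j where ij: "i < m" "j < m" "i \<noteq> j" "c * (real w * real w) \<le> edges col B (S' i) (S' j)" using cross by blast
          have "edges col B (S (g i)) (S (g j)) \<le> \<gamma> * real w * real w"
          proof (cases "g i < g j")
            case True
            then show ?thesis using less[of "g i" "g j"] gJ ij edges_sym[of col B "S (g i)" "S (g j)", OF col_sym] by simp
          next
            case False
            then have "g j < g i" using g_inj[OF ij(1-3)] by linarith
            then show ?thesis using less[of "g j" "g i"] gJ ij by simp
          qed
          then have "c * (real w * real w) \<le> \<gamma> * (real w * real w)" using ij(4) by (simp add: S'_def mult.assoc)
          moreover have "\<gamma> * (real w * real w) \<le> c / 2 * (real w * real w)" using \<gamma> by (intro mult_right_mono) auto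
          moreover have "0 < c * (real w * real w)" using mc w0 by simp
          ultimately show False by (simp add: field_simps)
        qed
        define A where "A = {u \<in> R. dm * real (card W) \<le> real (card (colour_nb col B W u))}"
        have AR: "A \<subseteq> R" by (auto simp: A_def)
        have finA: "finite A" using AR finR by (rule finite_subset)
        have WU: "W \<subseteq> (\<Union>i<T. Wf i)" using WJ SW JT by blast
        have WdR: "W \<inter> R = {}" using WU WR by blast
        have AW: "A \<inter> W = {}" using AR WdR by blast
        have RW: "real (card R) \<le> \<eta>1 * real (card W)"
        proof -
          have "\<eta>1 * (c * real w) \<le> \<eta>1 * real (card W)" using cW \<eta>1 by (intro mult_left_mono) auto
          then show ?thesis using Rw by linarith
        qed
        have cAR: "card A \<le> card R" using AR finR by (rule card_mono[rotated])
        have A1: "real (card A) \<le> \<eta>1 * real (card W)" using RW cAR by linarith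
        have "robust col (dm / 4) (W \<union> A)"
        proof (rule rob[of col B], intro conjI val B finW finA AW)
          have "2 * real N0 \<le> c * real w2" using w2 mc by (simp add: field_simps)
          also have "\<dots> \<le> c * real w" using w0(3) mc by (intro mult_left_mono) auto
          finally show "2 * N0 \<le> card W" using cW by linarith
          show "lower_quasirandom W (colour_nb col B W) (1 / (4 * real r)) (\<delta> / 8)"
            by (rule lower_quasirandom_mono[OF qr \<delta>0(3)])
          show "\<forall>p\<in>W \<union> A. dm * real (card W) \<le> real (card (colour_nb col B W p))"
          proof
            fix p assume p: "p \<in> W \<union> A"
            show "dm * real (card W) \<le> real (card (colour_nb col B W p))"
            proof (cases "p \<in> A")
              case True then show ?thesis by (simp add: A_def)
            next
              case False
              then have "1 / (8 * real r) * real (card W) \<le> real (card (colour_nb col B W p))" using p degW by blast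
              moreover have "dm * real (card W) \<le> 1 / (8 * real r) * real (card W)" using dm by (intro mult_right_mono) auto
              ultimately show ?thesis by linarith
            qed
          qed
          have "\<eta>1 * real (card W) \<le> \<delta> / 8 * real (card W)" using \<eta>1 by (intro mult_right_mono) auto
          then show "real (card A) \<le> \<delta> / 8 * real (card W)" using A1 by linarith
          have "\<eta>1 * real (card W) \<le> 1 * real (card W)" using \<eta>1 by (intro mult_right_mono) auto
          then show "card A \<le> card W" using A1 by linarith
        qed
        \<comment> \<open>\<open>W\<close> meets a tile only in its sample, thus in at most
          \<open>w\<close> vertices, which robustness permits.\<close>
        have tile_i: "tiled col 1 (Wf i - W)" if "i \<in> {..<T}" for i
        proof -
          have i: "i < T" using that by simp
          have "W \<inter> Wf i \<subseteq> (if i \<in> J then S i else {})"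
          proof
            fix x assume x: "x \<in> W \<inter> Wf i"
            then obtain t where t: "t \<in> J" "x \<in> S t" using WJ by blast
            then have "x \<in> Wf t" using SW by blast
            then have "t = i" using WW i JT[OF t(1)] x by blast
            then show "x \<in> (if i \<in> J then S i else {})" using t by simp
          qed
          moreover have "finite (if i \<in> J then S i else {})" using finS by simp
          ultimately have "card (W \<inter> Wf i) \<le> card (if i \<in> J then S i else {})" by (rule card_mono[rotated])
          also have "\<dots> \<le> w" using Sw by simp
          finally have "real (card (W \<inter> Wf i)) \<le> real w" by simp
          then have s: "real (card (W \<inter> Wf i)) \<le> \<theta> * real (card (Wf i))" using wW(2)[OF i] by linarith
          have "Wf i \<noteq> {}" using wW(1)[OF i] w0(1) by auto
          then have "robust col \<theta> (Wf i)" using rb[OF i] by blast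
          then have "Tile col (Wf i - W \<inter> Wf i)" using s unfolding robust_def by blast
          moreover have "Wf i - W \<inter> Wf i = Wf i - W" by blast
          ultimately show ?thesis by (intro tiled_Tile) simp
        qed
        have "tiled col (card {..<T} * 1) (\<Union>i<T. Wf i - W)"
          by (rule tiled_UN[OF _ tile_i]) (use WW in auto)
        then have "tiled col (T * M + T) (Z \<union> (\<Union>i<T. Wf i - W))" using ZW by (intro tiled_Un tZ) auto
        then have tZ': "tiled col M' (Z \<union> (\<Union>i<T. Wf i - W))" by (rule tiled_mono) (simp add: M'_def)
        define U where "U = (\<Union>i<T. Wf i)"
        have UR: "U \<inter> R = {}" using WR by (auto simp: U_def)
        have UW: "(\<Union>i<T. Wf i - W) = U - W" by (auto simp: U_def)
        have e1: "V = (Z \<union> (\<Union>i<T. Wf i - W)) \<union> (W \<union> A) \<union> (R - A)"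
          using V WU AR unfolding UW U_def[symmetric] by blast
        have e2: "(Z \<union> (\<Union>i<T. Wf i - W)) \<inter> (W \<union> A) = {}"
          using ZW WU ZR AR UR unfolding UW U_def[symmetric] by blast
        have e3: "(Z \<union> (\<Union>i<T. Wf i - W)) \<inter> (R - A) = {}"
          using ZR UR unfolding UW by blast
        have e4: "(W \<union> A) \<inter> (R - A) = {}" using WdR by blast
        have WWA: "real (card W) \<le> real (card (W \<union> A))" using finW finA by (intro of_nat_mono card_mono) auto
        have e5: "real (card (R - A)) \<le> \<eta>' * real (card (W \<union> A))"
        proof -
          have "card (R - A) \<le> card R" using finR by (intro card_mono) auto
          moreover have "\<eta>1 * real (card W) \<le> \<eta>' * real (card (W \<union> A))" using \<eta>1 WWA by (intro mult_mono) auto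
          ultimately show ?thesis using RW by linarith
        qed
        obtain i0 where i0: "i0 \<in> J" using J(2) mc(1) by fastforce
        have C: "C \<subseteq> {..<r}" "card C = q" using Cfr[OF JT[OF i0]] Cfq[OF JT[OF i0]] J(3) i0 by auto
        have finC: "finite C" by (rule finite_subset[OF C(1)]) simp
        have e6: "insert B C \<subseteq> {..<r}" "card (insert B C) = Suc q" using B C BC finC by auto
        \<comment> \<open>The three contributions: at most \<open>\<beta>' / 4\<close> from colours
          in \<open>C\<close>, by the samples; \<open>\<beta>' / 8\<close> from \<open>B\<close>, as
          \<open>u\<close> was not absorbed; \<open>\<beta>' / 8\<close> from \<open>A\<close>, by
          its size.\<close>
        have e7: "real (card {x \<in> W \<union> A. col u x \<in> insert B C}) \<le> \<beta>' * real (card (W \<union> A))" if u: "u \<in> R - A" for u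
        proof -
          have uW: "u \<notin> W" using u WdR by blast
          have sub: "{x \<in> W \<union> A. col u x \<in> insert B C} \<subseteq> (\<Union>t\<in>J. {x \<in> S t. col u x \<in> C}) \<union> colour_nb col B W u \<union> A"
          proof
            fix x assume x: "x \<in> {x \<in> W \<union> A. col u x \<in> insert B C}"
            show "x \<in> (\<Union>t\<in>J. {x \<in> S t. col u x \<in> C}) \<union> colour_nb col B W u \<union> A"
            proof (cases "x \<in> A")
              case False
              then have xW: "x \<in> W" using x by blast
              show ?thesis
              proof (cases "col u x = B")
                case True then show ?thesis using xW uW by (auto simp: colour_nb_def)
              next
                case False
                then have "col u x \<in> C" using x by blast
                then show ?thesis using xW WJ by blast
              qed
            qed simp
          qed
          have f1: "finite (\<Union>t\<in>J. {x \<in> S t. col u x \<in> C})" using finJ finS by auto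
          have f2: "finite (colour_nb col B W u)" by (rule finite_subset[OF colour_nb_sub finW])
          have "card {x \<in> W \<union> A. col u x \<in> insert B C} \<le> card ((\<Union>t\<in>J. {x \<in> S t. col u x \<in> C}) \<union> colour_nb col B W u \<union> A)"
            using sub f1 f2 finA by (intro card_mono) auto
          also have "\<dots> \<le> card (\<Union>t\<in>J. {x \<in> S t. col u x \<in> C}) + card (colour_nb col B W u) + card A"
            using card_Un_le[of "(\<Union>t\<in>J. {x \<in> S t. col u x \<in> C}) \<union> colour_nb col B W u" A]
              card_Un_le[of "\<Union>t\<in>J. {x \<in> S t. col u x \<in> C}" "colour_nb col B W u"] by linarith
          finally have tot: "real (card {x \<in> W \<union> A. col u x \<in> insert B C}) \<le>
            real (card (\<Union>t\<in>J. {x \<in> S t. col u x \<in> C})) + real (card (colour_nb col B W u)) + real (card A)" by linarith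
          have "real (card (\<Union>t\<in>J. {x \<in> S t. col u x \<in> C})) \<le> real (\<Sum>t\<in>J. card {x \<in> S t. col u x \<in> C})"
            by (intro of_nat_mono card_UN_le finJ)
          also have "\<dots> \<le> (\<Sum>t\<in>J. \<gamma> * real w)" unfolding of_nat_sum using u by (intro sum_mono Ssp) auto
          also have "\<dots> = real m * \<gamma> * real w" using J(2) by simp
          also have "\<dots> \<le> real m * (\<beta>' * c / (4 * real m)) * real w" using \<gamma> by (intro mult_right_mono mult_left_mono) auto
          also have "\<dots> = \<beta>' / 4 * (c * real w)" using mc by simp
          also have "\<dots> \<le> \<beta>' / 4 * real (card W)" using cW \<beta>' by (intro mult_left_mono) auto
          finally have t1: "real (card (\<Union>t\<in>J. {x \<in> S t. col u x \<in> C})) \<le> \<beta>' / 4 * real (card W)" .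
          have "real (card (colour_nb col B W u)) < dm * real (card W)" using u by (auto simp: A_def)
          moreover have "dm * real (card W) \<le> \<beta>' / 8 * real (card W)" using dm by (intro mult_right_mono) auto
          moreover have "\<eta>1 * real (card W) \<le> \<beta>' / 8 * real (card W)" using \<eta>1 by (intro mult_right_mono) auto
          moreover have "0 \<le> \<beta>' * real (card W)" using \<beta>' by simp
          ultimately have "real (card {x \<in> W \<union> A. col u x \<in> insert B C}) \<le> \<beta>' * real (card W)" using tot t1 A1 by linarith
          also have "\<dots> \<le> \<beta>' * real (card (W \<union> A))" using WWA \<beta>' by (intro mult_left_mono) auto
          finally show ?thesis .
        qed
        show ?thesis
          by (rule exI[of _ "Z \<union> (\<Union>i<T. Wf i - W)"], rule exI[of _ "W \<union> A"], rule exI[of _ "R - A"], rule exI[of _ "insert B C"],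
              intro conjI e1 e2 e3 e4 e5 e6 tZ' ballI e7 disjI2) (fact | assumption)+
      qed
    qed
  qed
qed

text \<open>For \<open>q = r\<close> all colours are sparse, so a leftover vertex would see all of
  \<open>W\<close> and yet at most half of it. Then \<open>W\<close> is empty, and
  \<open>card R \<le> card W\<close> makes \<open>R\<close> empty too; this is why
  \<open>\<beta> = 1 / 2\<close> and \<open>\<eta> = 1\<close> are enough.\<close>

theorem bounded_tiling: "\<exists>M. \<forall>col V. valid_colouring r col \<and> finite V \<longrightarrow> tiled col M V"
proof -
  have claim: "covering_claim q" if "q \<le> r" for q
    using that
  proof (induction q)
    case 0 show ?case by (rule covering_claim_0)
  next
    case (Suc q) then show ?case using covering_claim_Suc[of q] by simp
  qed
  have "(0::real) < 1 / 2" by simp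
  from claim[OF order_refl, unfolded covering_claim_def, rule_format, OF this]
  obtain \<theta> :: real where \<theta>: "0 < \<theta>" and ex: "\<forall>\<eta>::real. 0 < \<eta> \<longrightarrow> (\<exists>M. \<forall>col V.
    valid_colouring r col \<and> finite V \<longrightarrow> (\<exists>Z W R C. V = Z \<union> W \<union> R \<and> Z \<inter> W = {} \<and> Z \<inter> R = {} \<and> W \<inter> R = {} \<and>
      tiled col M Z \<and> (W = {} \<or> robust col \<theta> W) \<and> real (card R) \<le> \<eta> * real (card W) \<and>
      C \<subseteq> {..<r} \<and> card C = r \<and> (\<forall>u\<in>R. real (card {x \<in> W. col u x \<in> C}) \<le> 1 / 2 * real (card W))))"
    by (elim exE conjE)
  have "(0::real) < 1" by simp
  from ex[rule_format, OF this] obtain M where M: "\<And>col V.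
    valid_colouring r col \<and> finite V \<Longrightarrow> (\<exists>Z W R C. V = Z \<union> W \<union> R \<and> Z \<inter> W = {} \<and> Z \<inter> R = {} \<and> W \<inter> R = {} \<and>
      tiled col M Z \<and> (W = {} \<or> robust col \<theta> W) \<and> real (card R) \<le> 1 * real (card W) \<and>
      C \<subseteq> {..<r} \<and> card C = r \<and> (\<forall>u\<in>R. real (card {x \<in> W. col u x \<in> C}) \<le> 1 / 2 * real (card W)))"
    by (elim exE) blast
  have "tiled col (M + 1) V" if val: "valid_colouring r col" and finV: "finite V" for col V
  proof -
    have "valid_colouring r col \<and> finite V" using val finV by blast
    from M[OF this] obtain Z W R C where P: "V = Z \<union> W \<union> R" "Z \<inter> W = {}" "tiled col M Z" "W = {} \<or> robust col \<theta> W"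
      "real (card R) \<le> 1 * real (card W)" "C \<subseteq> {..<r}" "card C = r" "\<forall>u\<in>R. real (card {x \<in> W. col u x \<in> C}) \<le> 1 / 2 * real (card W)"
      by (elim exE conjE)
    have C: "C = {..<r}" using P(6,7) by (intro card_subset_eq) auto
    have fin: "finite W" "finite R" using P(1) finV by auto
    have "R = {}"
    proof (rule ccontr)
      assume "R \<noteq> {}"
      then obtain u where u: "u \<in> R" by blast
      have "col u x < r" for x using val unfolding valid_colouring_def by blast
      then have "{x \<in> W. col u x \<in> C} = W" using C by auto
      then have "real (card W) \<le> 1 / 2 * real (card W)" using P(8) u by fastforce
      then have "card R = 0" using P(5) by linarith
      then show False using fin \<open>R \<noteq> {}\<close> by simp
    qed
    moreover have "tiled col 1 W"
    proof (cases "W = {}")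
      case True then show ?thesis by (simp only: tiled_empty)
    next
      case False
      then have "robust col \<theta> W" using P(4) by blast
      then show ?thesis using \<theta> by (intro tiled_Tile robust_Tile[of col \<theta>]) auto
    qed
    ultimately show ?thesis using tiled_Un[OF P(3) _ P(2), of 1] P(1) by simp
  qed
  then show ?thesis by blast
qed

end

section \<open>Monochromatic copies\<close>

text \<open>The guest is determined by the number of vertices, so a tile can be identified with its
  vertex set.\<close>

definition monochromatic_copy :: "(nat \<Rightarrow> 'a pair_pre_digraph) \<Rightarrow> ('v \<Rightarrow> 'v \<Rightarrow> nat) \<Rightarrow> 'v set \<Rightarrow> bool" where
  "monochromatic_copy F col X \<longleftrightarrow> finite X \<and> X \<noteq> {} \<and>
    (\<exists>\<psi> b. bij_betw \<psi> (pverts (F (card X))) X \<and> (\<forall>(u, v)\<in>parcs (F (card X)). col (\<psi> u) (\<psi> v) = b))"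

text \<open>Relabelling the guest by positions in its arrangeable order turns it into a graph on
  \<open>{..<n}\<close> whose natural order is the one required by
  \<open>spanning_embedding\<close>.\<close>

lemma monochromatic_copy_quasirandom:
  fixes F :: "nat \<Rightarrow> 'a pair_pre_digraph" and d :: real
  assumes graph: "\<And>n. n \<ge> 1 \<Longrightarrow> pair_graph (F n)"
    and arr: "\<And>n. n \<ge> 1 \<Longrightarrow> arrangeable a (F n)"
    and card: "\<And>n. n \<ge> 1 \<Longrightarrow> card (pverts (F n)) = n"
    and deg: "\<And>n. n \<ge> 1 \<Longrightarrow> real (max_degree (F n)) \<le> sqrt (real n) / ln (real n)"
    and d: "0 < d" "d < 1"
  shows "\<exists>\<delta>::real. 0 < \<delta> \<and> (\<exists>N0::nat. \<forall>col (X :: 'v set) b.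
      valid_colouring r col \<and> b < r \<and> finite X \<and> N0 \<le> card X \<and> lower_quasirandom X (colour_nb col b X) d \<delta> \<and>
      (\<forall>p\<in>X. d * real (card X) \<le> real (card (colour_nb col b X p))) \<longrightarrow> monochromatic_copy F col X)"
proof -
  from spanning_embedding[OF d, where a = a and 'v = 'v]
  obtain \<delta> :: real and N0 :: nat where \<delta>: "0 < \<delta>" and emb: "\<And>(V :: 'v set) Nb nb.
    finite V \<and> N0 \<le> card V \<and> (\<forall>p\<in>V. Nb p \<subseteq> V) \<and> (\<forall>p\<in>V. \<forall>q\<in>V. q \<in> Nb p \<longrightarrow> p \<in> Nb q) \<and>
    lower_quasirandom V Nb d \<delta> \<and> (\<forall>p\<in>V. d * real (card V) \<le> real (card (Nb p))) \<and>
    (\<forall>x<card V. nb x \<subseteq> {..<card V}) \<and> (\<forall>x<card V. \<forall>z\<in>nb x. x \<in> nb z) \<and> (\<forall>x. x \<notin> nb x) \<and>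
    (\<forall>z<card V. card {j. j < z \<and> (\<exists>k. z < k \<and> k < card V \<and> k \<in> nb z \<and> k \<in> nb j)} \<le> a) \<and>
    (\<forall>x<card V. real (card (nb x)) \<le> sqrt (real (card V)) / ln (real (card V))) \<Longrightarrow>
    (\<exists>\<psi>. bij_betw \<psi> {..<card V} V \<and> (\<forall>x<card V. \<forall>z\<in>nb x. \<psi> z \<in> Nb (\<psi> x)))"
    by (elim exE conjE) blast
  show ?thesis
  proof (rule exI[of _ \<delta>], intro conjI \<delta>, rule exI[of _ "max N0 1"], intro allI impI)
    fix col :: "'v \<Rightarrow> 'v \<Rightarrow> nat" and X :: "'v set" and b :: nat
    assume asm: "valid_colouring r col \<and> b < r \<and> finite X \<and> max N0 1 \<le> card X \<and> lower_quasirandom X (colour_nb col b X) d \<delta> \<and>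
      (\<forall>p\<in>X. d * real (card X) \<le> real (card (colour_nb col b X p)))"
    have col_sym: "\<And>x y. col x y = col y x" using asm unfolding valid_colouring_def by blast
    define n where "n = card X"
    have n: "n \<ge> 1" "N0 \<le> n" and finX: "finite X" using asm by (auto simp: n_def)
    interpret pair_graph "F n" by (rule graph[OF n(1)])
    obtain xs where xs: "distinct xs" "set xs = pverts (F n)"
      and xs_arr: "\<forall>i<length xs. card {j. j < i \<and> (\<exists>k. i < k \<and> k < length xs \<and>
                 (xs ! i, xs ! k) \<in> parcs (F n) \<and> (xs ! j, xs ! k) \<in> parcs (F n))} \<le> a"
      using arr[OF n(1)] unfolding arrangeable_def by blast
    have len: "length xs = n" using xs card[OF n(1)] distinct_card[OF xs(1)] by simp
    have bij: "bij_betw (\<lambda>i. xs ! i) {..<n} (pverts (F n))" using bij_betw_nth[OF xs(1)] len xs(2) by blast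
    define nb where "nb i = {k. i < n \<and> k < n \<and> (xs ! i, xs ! k) \<in> parcs (F n)}" for i
    have sym: "(v, u) \<in> parcs (F n)" if "(u, v) \<in> parcs (F n)" for u v
      using pair_sym_arcs that by (auto simp: symmetric_def dest: symD)
    have deg_nb: "real (card (nb i)) \<le> sqrt (real n) / ln (real n)" if i: "i < n" for i
    proof -
      have inV: "xs ! i \<in> pverts (F n)" using bij i by (auto simp: bij_betw_def)
      have inj: "inj_on (\<lambda>k. (xs ! i, xs ! k)) (nb i)"
        using xs(1) len by (auto simp: inj_on_def nb_def nth_eq_iff_index_eq)
      have fin: "finite (out_arcs (with_proj (F n)) (xs ! i))"
        by (rule finite_subset[OF _ pair_finite_arcs]) (auto simp: out_arcs_def)
      have "card (nb i) = card ((\<lambda>k. (xs ! i, xs ! k)) ` nb i)" using inj by (simp add: card_image)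
      also have "\<dots> \<le> out_degree (with_proj (F n)) (xs ! i)"
        unfolding out_degree_def using fin by (intro card_mono) (auto simp: out_arcs_def nb_def)
      also have "\<dots> \<le> max_degree (F n)"
        unfolding max_degree_def using inV pair_finite_verts by (intro Max_ge) auto
      finally show ?thesis using deg[OF n(1)] by linarith
    qed
    have arr_nb: "card {j. j < z \<and> (\<exists>k. z < k \<and> k < n \<and> k \<in> nb z \<and> k \<in> nb j)} \<le> a" if z: "z < n" for z
    proof -
      have "{j. j < z \<and> (\<exists>k. z < k \<and> k < n \<and> k \<in> nb z \<and> k \<in> nb j)} =
        {j. j < z \<and> (\<exists>k. z < k \<and> k < length xs \<and> (xs ! z, xs ! k) \<in> parcs (F n) \<and> (xs ! j, xs ! k) \<in> parcs (F n))}"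
        using z len by (auto simp: nb_def)
      then show ?thesis using xs_arr z len by simp
    qed
    have irrefl: "x \<notin> nb x" for x using pair_no_loops[of "(xs ! x, xs ! x)"] by (auto simp: nb_def)
    have "\<exists>\<psi>. bij_betw \<psi> {..<card X} X \<and> (\<forall>x<card X. \<forall>z\<in>nb x. \<psi> z \<in> colour_nb col b X (\<psi> x))"
    proof (rule emb, fold n_def, intro conjI finX n(2) allI impI ballI)
      show "colour_nb col b X p \<subseteq> X" for p by (rule colour_nb_sub)
      show "p \<in> colour_nb col b X q" if "p \<in> X" "q \<in> X" "q \<in> colour_nb col b X p" for p q
        using that col_sym[of p q] by (auto simp: colour_nb_def)
      show "lower_quasirandom X (colour_nb col b X) d \<delta>" using asm by blast
      show "d * real n \<le> real (card (colour_nb col b X p))" if "p \<in> X" for p using asm that by (auto simp: n_def)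
      show "nb x \<subseteq> {..<n}" for x by (auto simp: nb_def)
      show "x \<in> nb z" if "z \<in> nb x" for x z using that sym by (auto simp: nb_def)
    qed (use irrefl arr_nb deg_nb in auto)
    then obtain \<psi>0 where \<psi>0: "bij_betw \<psi>0 {..<n} X" "\<And>x z. x < n \<Longrightarrow> z \<in> nb x \<Longrightarrow> \<psi>0 z \<in> colour_nb col b X (\<psi>0 x)"
      unfolding n_def[symmetric] by blast
    define g where "g = inv_into {..<n} (\<lambda>i. xs ! i)"
    have g: "bij_betw g (pverts (F n)) {..<n}" unfolding g_def by (rule bij_betw_inv_into[OF bij])
    have gx: "xs ! (g u) = u" "g u < n" if "u \<in> pverts (F n)" for u
    proof -
      show "xs ! (g u) = u" unfolding g_def using bij that by (simp add: bij_betw_def f_inv_into_f)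
      show "g u < n" using g that by (auto simp: bij_betw_def)
    qed
    have "bij_betw (\<psi>0 \<circ> g) (pverts (F n)) X" by (rule bij_betw_trans[OF g \<psi>0(1)])
    moreover have "col ((\<psi>0 \<circ> g) u) ((\<psi>0 \<circ> g) v) = b" if uv: "(u, v) \<in> parcs (F n)" for u v
    proof -
      have "u \<in> pverts (F n)" "v \<in> pverts (F n)" using in_arcsD1[OF uv] in_arcsD2[OF uv] by auto
      then have "g v \<in> nb (g u)" "g u < n" using gx uv by (auto simp: nb_def)
      then show ?thesis using \<psi>0(2) by (auto simp: colour_nb_def)
    qed
    moreover have "X \<noteq> {}" using n(1) by (auto simp: n_def)
    ultimately show "monochromatic_copy F col X"
      unfolding monochromatic_copy_def n_def[symmetric] using finX by blast
  qed
qed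

lemma digraph_iso_image:
  assumes "pair_graph H" "inj_on \<psi> (pverts H)"
  shows "digraph_iso (with_proj H)
    (with_proj \<lparr>pverts = \<psi> ` pverts H, parcs = (\<lambda>(u, v). (\<psi> u, \<psi> v)) ` parcs H\<rparr>)"
proof -
  interpret pair_graph H by (rule assms(1))
  let ?f = "\<lparr>iso_verts = \<psi>, iso_arcs = (\<lambda>(u, v). (\<psi> u, \<psi> v)), iso_head = snd, iso_tail = fst\<rparr>"
  have "inj_on (\<lambda>(u, v). (\<psi> u, \<psi> v)) (parcs H)"
  proof (rule inj_onI)
    fix e e' assume e: "e \<in> parcs H" "e' \<in> parcs H" "(\<lambda>(u, v). (\<psi> u, \<psi> v)) e = (\<lambda>(u, v). (\<psi> u, \<psi> v)) e'"
    then have "\<psi> (fst e) = \<psi> (fst e')" "\<psi> (snd e) = \<psi> (snd e')" by (auto split: prod.splits)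
    then have "fst e = fst e'" "snd e = snd e'"
      using inj_onD[OF assms(2)] arc_fst_in_verts arc_snd_in_verts e(1,2) by blast+
    then show "e = e'" by (rule prod_eqI)
  qed
  moreover have "wf_digraph (with_proj H)"
    by (rule wf_digraph.intro) (simp_all add: arc_fst_in_verts arc_snd_in_verts)
  ultimately have "pre_digraph.digraph_isomorphism (with_proj H) ?f"
    unfolding pre_digraph.digraph_isomorphism_def using assms(2) by (auto split: prod.splits)
  moreover have "with_proj \<lparr>pverts = \<psi> ` pverts H, parcs = (\<lambda>(u, v). (\<psi> u, \<psi> v)) ` parcs H\<rparr> = app_iso ?f (with_proj H)"
    by (simp add: app_iso_def with_proj_def)
  ultimately show ?thesis unfolding digraph_iso_def by blast
qed

text \<open>The \<open>Suc\<close> translates between colours from \<open>{..<r}\<close> in the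
  covering and colours from \<open>{1..r}\<close> in the definition of an edge colouring.\<close>

lemma monochromatic_tile:
  fixes F :: "nat \<Rightarrow> 'a pair_pre_digraph" and G :: "'v pair_pre_digraph"
  assumes graph: "\<And>n. n \<ge> 1 \<Longrightarrow> pair_graph (F n)"
    and G: "complete_digraph n (with_proj G)" and XG: "X \<subseteq> pverts G"
    and copy: "monochromatic_copy F col X"
    and col: "\<And>x y. x \<in> pverts G \<Longrightarrow> y \<in> pverts G \<Longrightarrow> x \<noteq> y \<Longrightarrow> c {x, y} = Suc (col x y)"
  shows "\<exists>H. pverts H = X \<and> subgraph (with_proj H) (with_proj G) \<and>
    (\<exists>i\<ge>1. digraph_iso (with_proj (F i)) (with_proj H)) \<and> Defs.monochromatic c H"
proof -
  have parcsG: "parcs G = {(u, v). (u, v) \<in> pverts G \<times> pverts G \<and> u \<noteq> v}"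
    using G by (simp add: complete_digraph_pair_def)
  define m where "m = card X"
  obtain \<psi> b where \<psi>: "bij_betw \<psi> (pverts (F m)) X" "\<forall>(u, v)\<in>parcs (F m). col (\<psi> u) (\<psi> v) = b"
    and X: "finite X" "X \<noteq> {}"
    using copy unfolding monochromatic_copy_def m_def by blast
  have m1: "m \<ge> 1" using X by (simp add: m_def Suc_leI card_gt_0_iff)
  interpret pair_graph "F m" by (rule graph[OF m1])
  define H where "H = \<lparr>pverts = X, parcs = (\<lambda>(u, v). (\<psi> u, \<psi> v)) ` parcs (F m)\<rparr>"
  have inj: "inj_on \<psi> (pverts (F m))" and img: "\<psi> ` pverts (F m) = X" using \<psi>(1) by (auto simp: bij_betw_def)
  have arc: "\<psi> u \<in> X \<and> \<psi> v \<in> X \<and> \<psi> u \<noteq> \<psi> v" if uv: "(u, v) \<in> parcs (F m)" for u v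
  proof -
    have u: "u \<in> pverts (F m)" "v \<in> pverts (F m)" using in_arcsD1[OF uv] in_arcsD2[OF uv] by auto
    have "u \<noteq> v" using pair_no_loops[OF uv] by simp
    then show ?thesis using u img inj by (auto simp: inj_on_def)
  qed
  have HG: "parcs H \<subseteq> parcs G" unfolding parcsG H_def using arc XG by auto
  have "wf_digraph (with_proj G)"
    by (rule wf_digraph.intro) (auto simp: parcsG)
  moreover have "wf_digraph (with_proj H)"
    by (rule wf_digraph.intro) (use arc in \<open>auto simp: H_def\<close>)
  ultimately have sub: "subgraph (with_proj H) (with_proj G)"
    unfolding subgraph_def using XG HG by (simp add: compatible_def H_def)
  have iso: "digraph_iso (with_proj (F m)) (with_proj H)"
    using digraph_iso_image[OF graph[OF m1] inj] img by (simp add: H_def)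
  have "c {x, y} = Suc b" if xy: "(x, y) \<in> parcs H" for x y
  proof -
    obtain u v where uv: "(u, v) \<in> parcs (F m)" "x = \<psi> u" "y = \<psi> v" using xy by (auto simp: H_def)
    have "x \<in> pverts G" "y \<in> pverts G" "x \<noteq> y" using arc[OF uv(1)] uv XG by auto
    then have "c {x, y} = Suc (col x y)" by (rule col)
    then show ?thesis using \<psi>(2) uv by auto
  qed
  then have "Defs.monochromatic c H" unfolding Defs.monochromatic_def by blast
  then show ?thesis using sub iso m1 by (intro exI[of _ H]) (auto simp: H_def)
qed

theorem theorem5p3:
  fixes r a :: nat and F :: "nat \<Rightarrow> 'a pair_pre_digraph"
  assumes "r \<ge> 2" and "a \<ge> 2"
    and "\<And>n. n \<ge> 1 \<Longrightarrow> pair_graph (F n)"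
    and "\<And>n. n \<ge> 1 \<Longrightarrow> arrangeable a (F n)"
    and "\<And>n. n \<ge> 1 \<Longrightarrow> card (pverts (F n)) = n"
    and "\<And>n. n \<ge> 1 \<Longrightarrow> real (max_degree (F n)) \<le> sqrt (real n) / ln (real n)"
  shows "tiling_number r F < \<infinity>"
proof -
  have r0: "0 < r" using assms(1) by simp
  have tc: "tile_cover r (monochromatic_copy F :: (nat \<Rightarrow> nat \<Rightarrow> nat) \<Rightarrow> nat set \<Rightarrow> bool)"
  proof
    show "0 < r" by (rule r0)
    show "monochromatic_copy F col {x}" for col :: "nat \<Rightarrow> nat \<Rightarrow> nat" and x
    proof -
      interpret pair_graph "F 1" by (rule assms(3)) simp
      have "card (pverts (F 1)) = 1" using assms(5)[of 1] by simp
      then obtain u where u: "pverts (F 1) = {u}" by (auto simp: card_1_singleton_iff)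
      have "(v, w) \<notin> parcs (F 1)" for v w
      proof
        assume vw: "(v, w) \<in> parcs (F 1)"
        then have "v = u" "w = u" using in_arcsD1[OF vw] in_arcsD2[OF vw] u by auto
        then show False using pair_no_loops[OF vw] by simp
      qed
      then have "parcs (F 1) = {}" by auto
      then show ?thesis
        unfolding monochromatic_copy_def using u by (auto intro!: exI[of _ "\<lambda>_. x"] simp: bij_betw_def)
    qed
    show "\<exists>\<delta>::real. 0 < \<delta> \<and> (\<exists>N0::nat. \<forall>col (X :: nat set) B.
      valid_colouring r col \<and> B < r \<and> finite X \<and> N0 \<le> card X \<and> lower_quasirandom X (colour_nb col B X) d \<delta> \<and>
      (\<forall>p\<in>X. d * real (card X) \<le> real (card (colour_nb col B X p))) \<longrightarrow> monochromatic_copy F col X)"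
      if "0 < d" "d < 1" for d :: real
      by (rule monochromatic_copy_quasirandom[OF assms(3-6) that])
  qed
  obtain M where M: "\<And>col V. valid_colouring r col \<and> finite V \<Longrightarrow>
      tile_cover.tiled (monochromatic_copy F :: (nat \<Rightarrow> nat \<Rightarrow> nat) \<Rightarrow> nat set \<Rightarrow> bool) col M V"
    using tile_cover.bounded_tiling[OF tc] by (elim exE) blast
  have at: "tiling_number_at r F n \<le> enat M" for n
    unfolding tiling_number_at_def
  proof (rule Inf_lower, rule CollectI, intro exI[of _ M] conjI refl allI impI)
    fix G :: "nat pair_pre_digraph" and c
    assume "complete_digraph n (with_proj G) \<and> edge_colouring r G c"
    then have G: "complete_digraph n (with_proj G)" and c: "edge_colouring r G c" by blast+
    have finG: "finite (pverts G)" and parcsG: "parcs G = {(u, v). (u, v) \<in> pverts G \<times> pverts G \<and> u \<noteq> v}"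
      using G by (simp_all add: complete_digraph_pair_def)
    \<comment> \<open>\<open>valid_colouring\<close> constrains all pairs, while \<open>c\<close> is
      controlled on the edges of \<open>G\<close> only; 0 is the default where \<open>c\<close>
      leaves \<open>{1..r}\<close>.\<close>
    define col where "col x y = (if c {x, y} \<in> {1..r} then c {x, y} - 1 else 0)" for x y
    have "col x y = col y x" "col x y < r" for x y
      using r0 by (auto simp: col_def insert_commute)
    then have val: "valid_colouring r col" unfolding valid_colouring_def by blast
    have cc: "c {x, y} = Suc (col x y)" if "x \<in> pverts G" "y \<in> pverts G" "x \<noteq> y" for x y
    proof -
      have "(x, y) \<in> parcs G" using that by (simp add: parcsG)
      then have "c {x, y} \<in> {1..r}" using c unfolding edge_colouring_def by blast
      then show ?thesis by (auto simp: col_def)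
    qed
    obtain TT where TT: "finite TT" "card TT \<le> M" "\<forall>X\<in>TT. monochromatic_copy F col X" "pairwise disjnt TT" "\<Union>TT = pverts G"
      using M[of col "pverts G"] val finG unfolding tile_cover.tiled_def[OF tc] by blast
    have "\<forall>X\<in>TT. \<exists>H. pverts H = X \<and> subgraph (with_proj H) (with_proj G) \<and>
      (\<exists>i\<ge>1. digraph_iso (with_proj (F i)) (with_proj H)) \<and> Defs.monochromatic c H"
    proof
      fix X assume X: "X \<in> TT"
      have "X \<subseteq> pverts G" "monochromatic_copy F col X" using TT(3,5) X by blast+
      then show "\<exists>H. pverts H = X \<and> subgraph (with_proj H) (with_proj G) \<and>
        (\<exists>i\<ge>1. digraph_iso (with_proj (F i)) (with_proj H)) \<and> Defs.monochromatic c H"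
        by (intro monochromatic_tile[where F = F and c = c and col = col, OF _ G] assms(3) cc)
    qed
    then obtain h where h: "\<forall>X\<in>TT. pverts (h X) = X \<and> subgraph (with_proj (h X)) (with_proj G) \<and>
      (\<exists>i\<ge>1. digraph_iso (with_proj (F i)) (with_proj (h X))) \<and> Defs.monochromatic c (h X)"
      by (rule bchoice[THEN exE])
    have "pairwise (\<lambda>H H'. disjnt (pverts H) (pverts H')) (h ` TT)"
      unfolding pairwise_def
    proof (intro ballI impI)
      fix H H' assume H: "H \<in> h ` TT" "H' \<in> h ` TT" "H \<noteq> H'"
      then obtain X X' where X: "X \<in> TT" "X' \<in> TT" "H = h X" "H' = h X'" by blast
      then have "X \<noteq> X'" using H(3) by blast
      then show "disjnt (pverts H) (pverts H')" using TT(4) X h by (simp add: pairwise_def)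
    qed
    moreover have "(\<Union>H\<in>h ` TT. pverts H) = pverts G" using h TT(5) by auto
    ultimately have "tiling F G (h ` TT)" unfolding tiling_def using h by blast
    moreover have "\<forall>H\<in>h ` TT. Defs.monochromatic c H" using h by blast
    moreover have "finite (h ` TT)" "card (h ` TT) \<le> M" using TT(1,2) card_image_le[OF TT(1), of h] by auto
    ultimately show "\<exists>T. tiling F G T \<and> (\<forall>H\<in>T. Defs.monochromatic c H) \<and> finite T \<and> card T \<le> M" by blast
  qed
  have "tiling_number r F \<le> enat M" unfolding tiling_number_def by (rule SUP_least) (rule at)
  then show ?thesis by (rule order_le_less_trans) simp
qed

end
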